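(* Let $D$ be a period domain parameterizing weight $n$ polarized Hodge structures, with bracket-generating infinitesimal period relation, and let $(V,W_\bullet(N),F^\bullet)$ be a limiting mixed Hodge structure for $D$ that is sent to a point of the closed $G_{\mathbb R}$-orbit in $\check D$ under the reduced limit period mapping. Then $\mathrm{Gr}^{W_\bullet(N)}_*$ is rigid, in the sense that it does not admit a non-trivial variation of Hodge structure. Precisely: for every $k\ge0$, every variation of $Q_k$-polarized Hodge structures of weight $n+k$ over a connected, simply connected complex manifold, on the constant vector space $\mathrm{Gr}^{W_\bullet(N)}_{n+k,\mathrm{prim}}$, that has the Hodge structure induced by $F^\bullet$ as one of its members, is constant.
   Context: A polarized Hodge structure of weight $n$ is $(V,Q,F^\bullet)$ with $V$ a real vector space, $Q$ a nondegenerate $(-1)^n$-symmetric bilinear form, and $F^n\subset\dots\subset F^0=V_{\mathbb C}$ with $F^p\oplus\overline{F^{n-p+1}}=V_{\mathbb C}$, $Q(F^p,F^{n-p+1})=0$, and $Q(Cv,\bar v)>0$ for $v\neq0$, where $C=i^{p-q}$ on $V^{p,q}=F^p\cap\overline{F^q}$. The period domain $D$ consists of all $Q$-polarized Hodge structures of weight $n$ on $V$ with fixed Hodge numbers; it is viewed as an open orbit $G_{\mathbb R}/R$ ($G_{\mathbb R}$ the connected group with Lie algebra $\mathfrak g_{\mathbb R}=\mathrm{End}(V_{\mathbb R},Q)$, assumed semisimple, i.e. we work on a connected component) in its compact dual $\check D=G_{\mathbb C}/P$, the variety of $Q$-isotropic filtrations with the same dimensions. $\check D$ contains a unique closed $G_{\mathbb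 R}$-orbit. At $F^\bullet\in D$, let $\mathfrak g^{p,-p}=\{\xi\in\mathfrak g_{\mathbb C}:\xi(V^{r,s})\subset V^{r+p,s-p}\ \forall r,s\}$. The infinitesimal period relation is the homogeneous subbundle of $T\check D$ given by $\mathfrak g^{-1,1}$; it is bracket-generating if $\mathfrak g^{-1,1}$ generates the Lie algebra $\bigoplus_{p>0}\mathfrak g^{-p,p}$. A nilpotent orbit is a pair $(F^\bullet,N)$ with $F^\bullet\in\check D$, $N\in\mathfrak g_{\mathbb R}$ nilpotent, $e^{zN}F^\bullet\in D$ for $\mathrm{Im}(z)\gg0$, and $N(F^p)\subset F^{p-1}$. The associated limiting mixed Hodge structure is $(V,W_\bullet(N),F^\bullet)$, where $W_\bullet(N)$ is the monodromy weight filtration of $N$ on $V$ centered at $n$. All limiting mixed Hodge structures are of this form. It is sent to an orbit $\mathcal O$ under the reduced limit period mapping if $\lim_{\mathrm{Im}(z)\to\infty}e^{zN}F^\bullet\in\mathcal O$. For $k\ge0$, $\mathrm{Gr}^{W_\bullet(N)}_{n+k,\mathrm{prim}}=\ker\{N^{k+1}:\mathrm{Gr}^{W_\bullet(N)}_{n+k}\to\mathrm{Gr}^{W_\bullet(N)}_{n-k-2}\}$; $F^\bullet$ induces on it a Hodge structure of weight $n+k$ polarized by $Q_k(v,w)=\epsilon_kQ(v,N^kw)$ for a suitable sign $\epsilon_k=\pm1$. The full graded object $\mathrm{Gr}^{W_\bullet(N)}_*$, with $N$ a morphism of type $(-1,-1)$, is determined by these primitive parts via $\mathrm{Gr}_{n+k}=\bigoplus_{j\ge\max(0,-k)}N^j\mathrm{Gr}_{n+k+2j,\mathrm{prim}}$.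 A variation of polarized Hodge structure on a constant vector space $U$ over a complex manifold $S$ is a family $F_s^\bullet$ ($s\in S$) of polarized Hodge structures on $U$ (for a fixed polarization) that varies holomorphically in $s$ and satisfies $\partial F^p_s\subset F^{p-1}_s$. *)

theory Defs
  imports "HOL-Analysis.Analysis"
begin

section \<open>Complexification\<close>

text \<open>
  A finite-dimensional real vector space is a subspace \<open>U\<close> of some \<open>real ^ 'm\<close>; its
  complexification is the complex subspace of \<open>complex ^ 'm\<close> with real and imaginary part in \<open>U\<close>.
\<close>

definition re_vec :: "complex ^ 'n \<Rightarrow> real ^ 'n" where
  "re_vec v = (\<chi> i. Re (v $ i))"

definition im_vec :: "complex ^ 'n \<Rightarrow> real ^ 'n" where
  "im_vec v = (\<chi> i. Im (v $ i))"

definition cnj_vec :: "complex ^ 'n \<Rightarrow> complex ^ 'n" where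
  "cnj_vec v = (\<chi> i. cnj (v $ i))"

definition complexify :: "(real ^ 'n) set \<Rightarrow> (complex ^ 'n) set" where
  "complexify U = {v. re_vec v \<in> U \<and> im_vec v \<in> U}"

text \<open>The complex bilinear extension (not the Hermitian one).\<close>

definition complexify_form ::
  "(real ^ 'n \<Rightarrow> real ^ 'n \<Rightarrow> real) \<Rightarrow> complex ^ 'n \<Rightarrow> complex ^ 'n \<Rightarrow> complex" where
  "complexify_form Q v w =
     Complex (Q (re_vec v) (re_vec w) - Q (im_vec v) (im_vec w))
             (Q (re_vec v) (im_vec w) + Q (im_vec v) (re_vec w))"

definition complexify_map ::
  "(real ^ 'n \<Rightarrow> real ^ 'm) \<Rightarrow> complex ^ 'n \<Rightarrow> complex ^ 'm" where
  "complexify_map f v = (\<chi> i. Complex (f (re_vec v) $ i) (f (im_vec v) $ i))"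

definition complexify_matrix :: "real ^ 'n ^ 'n \<Rightarrow> complex ^ 'n ^ 'n" where
  "complexify_matrix A = map_matrix of_real A"


section \<open>Polarized Hodge structures\<close>

text \<open>
  Filtrations are indexed by all integers: below, \<open>F p\<close> is everything for \<open>p \<le> 0\<close> and is
  zero for \<open>p > n\<close>, the latter being forced by the direct sum condition for \<open>p \<le> 0\<close>.
\<close>

type_synonym 'n filtration = "int \<Rightarrow> (complex ^ 'n) set"

definition hodge_structure :: "nat \<Rightarrow> (real ^ 'n) set \<Rightarrow> 'n filtration \<Rightarrow> bool" where
  "hodge_structure n U F \<longleftrightarrow>
     subspace U \<and>
     (\<forall>p. vec.subspace (F p)) \<and> antimono F \<and> F 0 = complexify U \<and>
     (\<forall>p \<le> 0. F p = F 0) \<and>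
     (\<forall>p. {a + b | a b. a \<in> F p \<and> b \<in> cnj_vec ` F (int n - p + 1)} = complexify U) \<and>
     (\<forall>p. F p \<inter> cnj_vec ` F (int n - p + 1) = {0})"

text \<open>The summand \<open>V\<^sup>p\<^sup>,\<^sup>q\<close> with \<open>q = n - p\<close>.\<close>

definition hodge_space :: "nat \<Rightarrow> 'n filtration \<Rightarrow> int \<Rightarrow> (complex ^ 'n) set" where
  "hodge_space n F p = F p \<inter> cnj_vec ` F (int n - p)"

text \<open>
  As the spaces \<open>V\<^sup>p\<^sup>,\<^sup>q\<close> of a Hodge structure on \<open>U\<close> span its complexification, this determines
  \<open>C\<close> there; its values outside are irrelevant.
\<close>

definition weil_operator ::
  "nat \<Rightarrow> 'n filtration \<Rightarrow> (complex ^ 'n \<Rightarrow> complex ^ 'n) \<Rightarrow> bool" where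
  "weil_operator n F C \<longleftrightarrow>
     Vector_Spaces.linear (*s) (*s) C \<and>
     (\<forall>p. \<forall>v \<in> hodge_space n F p. C v = (\<i> powi (p - (int n - p))) *s v)"

definition polarized_hodge_structure ::
  "nat \<Rightarrow> (real ^ 'n) set \<Rightarrow> (real ^ 'n \<Rightarrow> real ^ 'n \<Rightarrow> real) \<Rightarrow> 'n filtration \<Rightarrow> bool" where
  "polarized_hodge_structure n U Q F \<longleftrightarrow>
     hodge_structure n U F \<and>
     bilinear Q \<and>
     (\<forall>v\<in>U. \<forall>w\<in>U. Q v w = (-1) ^ n * Q w v) \<and>
     (\<forall>v\<in>U. (\<forall>w\<in>U. Q v w = 0) \<longrightarrow> v = 0) \<and>
     (\<forall>p. \<forall>v \<in> F p. \<forall>w \<in> F (int n - p + 1). complexify_form Q v w = 0) \<and>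
     (\<exists>C. weil_operator n F C \<and>
        (\<forall>v \<in> complexify U. v \<noteq> 0 \<longrightarrow>
           complexify_form Q (C v) (cnj_vec v) \<in> \<real> \<and>
           Re (complexify_form Q (C v) (cnj_vec v)) > 0))"


section \<open>Groups and Lie algebras of a bilinear form\<close>

text \<open>
  The identity component of \<open>Aut(V,Q)\<close> is the connected group with Lie algebra
  \<open>End(V,Q)\<close>; likewise over the complex numbers.
\<close>

definition real_group :: "(real ^ 'n \<Rightarrow> real ^ 'n \<Rightarrow> real) \<Rightarrow> (real ^ 'n ^ 'n) set" where
  "real_group Q =
     connected_component_set {g. \<forall>v w. Q (g *v v) (g *v w) = Q v w} (mat 1)"

definition complex_group :: "(real ^ 'n \<Rightarrow> real ^ 'n \<Rightarrow> real) \<Rightarrow> (complex ^ 'n ^ 'n) set" where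
  "complex_group Q =
     connected_component_set
       {g. \<forall>v w. complexify_form Q (g *v v) (g *v w) = complexify_form Q v w} (mat 1)"

definition real_lie_algebra :: "(real ^ 'n \<Rightarrow> real ^ 'n \<Rightarrow> real) \<Rightarrow> (real ^ 'n ^ 'n) set" where
  "real_lie_algebra Q = {\<xi>. \<forall>v w. Q (\<xi> *v v) w + Q v (\<xi> *v w) = 0}"

definition complex_lie_algebra ::
  "(real ^ 'n \<Rightarrow> real ^ 'n \<Rightarrow> real) \<Rightarrow> (complex ^ 'n ^ 'n) set" where
  "complex_lie_algebra Q =
     {\<xi>. \<forall>v w. complexify_form Q (\<xi> *v v) w + complexify_form Q v (\<xi> *v w) = 0}"

definition lie_bracket :: "'a::ring_1 ^ 'n ^ 'n \<Rightarrow> 'a ^ 'n ^ 'n \<Rightarrow> 'a ^ 'n ^ 'n" where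
  "lie_bracket A B = A ** B - B ** A"

text \<open>Bourbaki's definition: zero is the only abelian ideal.\<close>

definition semisimple_lie_algebra :: "(real ^ 'n ^ 'n) set \<Rightarrow> bool" where
  "semisimple_lie_algebra L \<longleftrightarrow>
     (\<forall>I. subspace I \<and> I \<subseteq> L \<and>
          (\<forall>A\<in>L. \<forall>B\<in>I. lie_bracket A B \<in> I) \<and>
          (\<forall>A\<in>I. \<forall>B\<in>I. lie_bracket A B = 0) \<longrightarrow> I = {0})"

text \<open>Multiplication by \<open>mat c\<close> is scalar multiplication by \<open>c\<close>.\<close>

definition complex_matrix_subspace :: "(complex ^ 'n ^ 'n) set \<Rightarrow> bool" where
  "complex_matrix_subspace L \<longleftrightarrow>
     0 \<in> L \<and> (\<forall>A\<in>L. \<forall>B\<in>L. A + B \<in> L) \<and> (\<forall>c. \<forall>A\<in>L. mat c ** A \<in> L)"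

definition complex_lie_subalgebra :: "(complex ^ 'n ^ 'n) set \<Rightarrow> bool" where
  "complex_lie_subalgebra L \<longleftrightarrow>
     complex_matrix_subspace L \<and> (\<forall>A\<in>L. \<forall>B\<in>L. lie_bracket A B \<in> L)"

definition lie_algebra_hodge_space ::
  "nat \<Rightarrow> (real ^ 'n \<Rightarrow> real ^ 'n \<Rightarrow> real) \<Rightarrow> 'n filtration \<Rightarrow> int \<Rightarrow> (complex ^ 'n ^ 'n) set" where
  "lie_algebra_hodge_space n Q F p =
     {\<xi> \<in> complex_lie_algebra Q.
        \<forall>r. \<forall>v \<in> hodge_space n F r. \<xi> *v v \<in> hodge_space n F (r + p)}"

definition bracket_generating_at ::
  "nat \<Rightarrow> (real ^ 'n \<Rightarrow> real ^ 'n \<Rightarrow> real) \<Rightarrow> 'n filtration \<Rightarrow> bool" where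
  "bracket_generating_at n Q F \<longleftrightarrow>
     complex_lie_subalgebra hull lie_algebra_hodge_space n Q F (-1) =
     complex_matrix_subspace hull (\<Union>p\<in>{0<..}. lie_algebra_hodge_space n Q F (- p))"


section \<open>Period domain and compact dual\<close>

definition act :: "complex ^ 'n ^ 'n \<Rightarrow> 'n filtration \<Rightarrow> 'n filtration" where
  "act g F = (\<lambda>p. (*v) g ` F p)"

definition real_orbit :: "(real ^ 'n \<Rightarrow> real ^ 'n \<Rightarrow> real) \<Rightarrow> 'n filtration \<Rightarrow> 'n filtration set" where
  "real_orbit Q F = (\<lambda>g. act (complexify_matrix g) F) ` real_group Q"

definition complex_orbit ::
  "(real ^ 'n \<Rightarrow> real ^ 'n \<Rightarrow> real) \<Rightarrow> 'n filtration \<Rightarrow> 'n filtration set" where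
  "complex_orbit Q F = (\<lambda>g. act g F) ` complex_group Q"

definition polarized_hodge_structures_with_numbers ::
  "nat \<Rightarrow> (real ^ 'n \<Rightarrow> real ^ 'n \<Rightarrow> real) \<Rightarrow> (int \<Rightarrow> nat) \<Rightarrow> 'n filtration set" where
  "polarized_hodge_structures_with_numbers n Q h =
     {F. polarized_hodge_structure n UNIV Q F \<and> (\<forall>p. vec.dim (hodge_space n F p) = h p)}"

text \<open>
  The set of all \<open>Q\<close>-polarized Hodge structures with given Hodge numbers, and likewise the variety
  of \<open>Q\<close>-isotropic filtrations, can be disconnected when \<open>n\<close> is even.  The period domain with
  base point \<open>F\<^sub>0\<close> is the component of \<open>F\<^sub>0\<close>, that is, its orbit under the connected real group;
  its compact dual is the orbit under the connected complex group.
\<close>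

definition period_domain ::
  "nat \<Rightarrow> (real ^ 'n \<Rightarrow> real ^ 'n \<Rightarrow> real) \<Rightarrow> (int \<Rightarrow> nat) \<Rightarrow> 'n filtration \<Rightarrow> 'n filtration set
     \<Rightarrow> bool" where
  "period_domain n Q h F\<^sub>0 D \<longleftrightarrow>
     F\<^sub>0 \<in> polarized_hodge_structures_with_numbers n Q h \<and> D = real_orbit Q F\<^sub>0"

text \<open>The quotient topology of the complex group modulo the stabilizer of the base point.\<close>

definition compact_dual ::
  "(real ^ 'n \<Rightarrow> real ^ 'n \<Rightarrow> real) \<Rightarrow> 'n filtration \<Rightarrow> 'n filtration topology" where
  "compact_dual Q F\<^sub>0 =
     topology (\<lambda>T. T \<subseteq> complex_orbit Q F\<^sub>0 \<and>
                   openin (top_of_set (complex_group Q)) {g \<in> complex_group Q. act g F\<^sub>0 \<in> T})"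

lemma openin_compact_dual:
  "openin (compact_dual Q F\<^sub>0) T \<longleftrightarrow>
     T \<subseteq> complex_orbit Q F\<^sub>0 \<and>
     openin (top_of_set (complex_group Q)) {g \<in> complex_group Q. act g F\<^sub>0 \<in> T}"
proof -
  let ?G = "complex_group Q"
  let ?P = "\<lambda>T. T \<subseteq> complex_orbit Q F\<^sub>0 \<and>
                openin (top_of_set ?G) {g \<in> ?G. act g F\<^sub>0 \<in> T}"
  have "?P (S \<inter> T)" if "?P S" "?P T" for S T
  proof -
    have "{g \<in> ?G. act g F\<^sub>0 \<in> S \<inter> T} = {g \<in> ?G. act g F\<^sub>0 \<in> S} \<inter> {g \<in> ?G. act g F\<^sub>0 \<in> T}"
      by blast
    then show ?thesis
      using that by (metis (no_types, lifting) inf.coboundedI1 openin_Int)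
  qed
  moreover have "?P (\<Union>K)" if "\<forall>T\<in>K. ?P T" for K
  proof -
    have "{g \<in> ?G. act g F\<^sub>0 \<in> \<Union>K} = (\<Union>T\<in>K. {g \<in> ?G. act g F\<^sub>0 \<in> T})"
      by blast
    then show ?thesis
      using that by (metis (no_types, lifting) Sup_least openin_clauses(3) imageE)
  qed
  ultimately have "istopology ?P"
    unfolding istopology_def by blast
  then show ?thesis
    unfolding compact_dual_def by (simp add: topology_inverse')
qed

lemma topspace_compact_dual: "topspace (compact_dual Q F\<^sub>0) = complex_orbit Q F\<^sub>0"
proof -
  have "{g \<in> complex_group Q. act g F\<^sub>0 \<in> complex_orbit Q F\<^sub>0} = complex_group Q"
    by (auto simp: complex_orbit_def)
  then have "openin (compact_dual Q F\<^sub>0) (complex_orbit Q F\<^sub>0)"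
    by (simp add: openin_compact_dual)
  then show ?thesis
    by (meson openin_compact_dual openin_subset openin_topspace subset_antisym)
qed


section \<open>Nilpotent orbits and the reduced limit period mapping\<close>

definition matrix_pow :: "'a::semiring_1 ^ 'n ^ 'n \<Rightarrow> nat \<Rightarrow> 'a ^ 'n ^ 'n" where
  "matrix_pow A j = (((**) A) ^^ j) (mat 1)"

definition matrix_exp :: "complex ^ 'n ^ 'n \<Rightarrow> complex ^ 'n ^ 'n" where
  "matrix_exp A = (\<Sum>j. mat (1 / fact j) ** matrix_pow A j)"

text \<open>The filtration \<open>e\<^sup>z\<^sup>N F\<close>.\<close>

definition exp_translate :: "real ^ 'n ^ 'n \<Rightarrow> 'n filtration \<Rightarrow> complex \<Rightarrow> 'n filtration" where
  "exp_translate N F z = act (matrix_exp (mat z ** complexify_matrix N)) F"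

definition nilpotent_orbit ::
  "(real ^ 'n \<Rightarrow> real ^ 'n \<Rightarrow> real) \<Rightarrow> 'n filtration \<Rightarrow> 'n filtration set \<Rightarrow>
     'n filtration \<Rightarrow> real ^ 'n ^ 'n \<Rightarrow> bool" where
  "nilpotent_orbit Q F\<^sub>0 D F N \<longleftrightarrow>
     F \<in> topspace (compact_dual Q F\<^sub>0) \<and>
     N \<in> real_lie_algebra Q \<and> (\<exists>m. matrix_pow N m = 0) \<and>
     (\<exists>b. \<forall>z. Im z > b \<longrightarrow> exp_translate N F z \<in> D) \<and>
     (\<forall>p. \<forall>v \<in> F p. complexify_matrix N *v v \<in> F (p - 1))"

definition sent_to_orbit ::
  "(real ^ 'n \<Rightarrow> real ^ 'n \<Rightarrow> real) \<Rightarrow> 'n filtration \<Rightarrow>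
     'n filtration \<Rightarrow> real ^ 'n ^ 'n \<Rightarrow> 'n filtration set \<Rightarrow> bool" where
  "sent_to_orbit Q F\<^sub>0 F N \<O> \<longleftrightarrow>
     (\<exists>L\<in>\<O>. limitin (compact_dual Q F\<^sub>0) (exp_translate N F) L (filtercomap Im at_top))"

definition closed_real_orbit ::
  "(real ^ 'n \<Rightarrow> real ^ 'n \<Rightarrow> real) \<Rightarrow> 'n filtration \<Rightarrow> 'n filtration set \<Rightarrow> bool" where
  "closed_real_orbit Q F\<^sub>0 \<O> \<longleftrightarrow>
     (\<exists>E \<in> topspace (compact_dual Q F\<^sub>0). \<O> = real_orbit Q E) \<and>
     closedin (compact_dual Q F\<^sub>0) \<O>"


section \<open>Monodromy weight filtration and primitive parts\<close>

text \<open>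
  The last two clauses say that the \<open>k\<close>-th power of \<open>N\<close> induces an injective and a surjective map
  from the graded piece of weight \<open>n + k\<close> to that of weight \<open>n - k\<close>.
\<close>

definition monodromy_weight_filtration ::
  "real ^ 'n ^ 'n \<Rightarrow> int \<Rightarrow> (int \<Rightarrow> (real ^ 'n) set) \<Rightarrow> bool" where
  "monodromy_weight_filtration N n W \<longleftrightarrow>
     (\<forall>l. subspace (W l)) \<and> mono W \<and> (\<exists>l. W l = {0}) \<and> (\<exists>l. W l = UNIV) \<and>
     (\<forall>l. \<forall>v \<in> W l. N *v v \<in> W (l - 2)) \<and>
     (\<forall>k::nat. \<forall>v \<in> W (n + int k).
        matrix_pow N k *v v \<in> W (n - int k - 1) \<longrightarrow> v \<in> W (n + int k - 1)) \<and>
     (\<forall>k::nat. \<forall>w \<in> W (n - int k).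
        \<exists>v \<in> W (n + int k). w - matrix_pow N k *v v \<in> W (n - int k - 1))"

text \<open>
  The preimage in \<open>W (n + k)\<close> of the kernel of the map induced by the \<open>(k+1)\<close>-st power of \<open>N\<close>
  from \<open>W (n + k) / W (n + k - 1)\<close> to \<open>W (n - k - 2) / W (n - k - 3)\<close>.
\<close>

definition primitive_lifts ::
  "real ^ 'n ^ 'n \<Rightarrow> nat \<Rightarrow> (int \<Rightarrow> (real ^ 'n) set) \<Rightarrow> nat \<Rightarrow> (real ^ 'n) set" where
  "primitive_lifts N n W k =
     {v \<in> W (int n + int k). matrix_pow N (k + 1) *v v \<in> W (int n - int k - 3)}"

text \<open>
  \<open>U\<close> with \<open>\<pi>\<close> is a model of the primitive part of \<open>W (n + k) / W (n + k - 1)\<close>: \<open>\<pi>\<close> maps the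
  primitive lifts onto \<open>U\<close> with kernel \<open>W (n + k - 1)\<close>.  Only the restriction of \<open>\<pi>\<close> to the
  primitive lifts matters.
\<close>

definition primitive_quotient ::
  "real ^ 'n ^ 'n \<Rightarrow> nat \<Rightarrow> (int \<Rightarrow> (real ^ 'n) set) \<Rightarrow> nat \<Rightarrow>
     (real ^ 'm) set \<Rightarrow> (real ^ 'n \<Rightarrow> real ^ 'm) \<Rightarrow> bool" where
  "primitive_quotient N n W k U \<pi> \<longleftrightarrow>
     linear \<pi> \<and> \<pi> ` primitive_lifts N n W k = U \<and>
     (\<forall>v \<in> primitive_lifts N n W k. \<pi> v = 0 \<longleftrightarrow> v \<in> W (int n + int k - 1))"

definition induced_filtration ::
  "real ^ 'n ^ 'n \<Rightarrow> nat \<Rightarrow> (int \<Rightarrow> (real ^ 'n) set) \<Rightarrow> nat \<Rightarrow>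
     (real ^ 'n \<Rightarrow> real ^ 'm) \<Rightarrow> 'n filtration \<Rightarrow> 'm filtration" where
  "induced_filtration N n W k \<pi> F =
     (\<lambda>p. complexify_map \<pi> ` (F p \<inter> complexify (primitive_lifts N n W k)))"

text \<open>
  \<open>q\<close> is the form \<open>Q\<^sub>k\<close>, transported to the model \<open>U\<close>.  Only its values on \<open>U\<close> matter.
\<close>

definition primitive_form ::
  "(real ^ 'n \<Rightarrow> real ^ 'n \<Rightarrow> real) \<Rightarrow> real ^ 'n ^ 'n \<Rightarrow> nat \<Rightarrow> (int \<Rightarrow> (real ^ 'n) set) \<Rightarrow> nat \<Rightarrow>
     (real ^ 'n \<Rightarrow> real ^ 'm) \<Rightarrow> real \<Rightarrow> (real ^ 'm \<Rightarrow> real ^ 'm \<Rightarrow> real) \<Rightarrow> bool" where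
  "primitive_form Q N n W k \<pi> \<epsilon> q \<longleftrightarrow>
     bilinear q \<and>
     (\<forall>v \<in> primitive_lifts N n W k. \<forall>w \<in> primitive_lifts N n W k.
        q (\<pi> v) (\<pi> w) = \<epsilon> * Q v (matrix_pow N k *v w))"


section \<open>Complex manifolds and variations of Hodge structure\<close>

definition complex_differentiable_on ::
  "(complex ^ 'd \<Rightarrow> complex ^ 'm) \<Rightarrow> (complex ^ 'd) set \<Rightarrow> bool" where
  "complex_differentiable_on f T \<longleftrightarrow>
     (\<forall>x\<in>T. \<exists>f'. (f has_derivative f') (at x) \<and> (\<forall>c v. f' (c *s v) = c *s f' v))"

text \<open>A chart is its domain together with its coordinate map, which is arbitrary elsewhere.\<close>

type_synonym ('s, 'd) chart = "'s set \<times> ('s \<Rightarrow> complex ^ 'd)"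

definition complex_atlas ::
  "('s::{t2_space, second_countable_topology}, 'd::finite) chart set \<Rightarrow> bool" where
  "complex_atlas A \<longleftrightarrow>
     (\<Union>(T, \<phi>)\<in>A. T) = UNIV \<and>
     (\<forall>(T, \<phi>)\<in>A. open T \<and> open (\<phi> ` T) \<and> homeomorphism T (\<phi> ` T) \<phi> (inv_into T \<phi>)) \<and>
     (\<forall>(T, \<phi>)\<in>A. \<forall>(T', \<psi>)\<in>A.
        complex_differentiable_on (\<psi> \<circ> inv_into T \<phi>) (\<phi> ` (T \<inter> T')))"

definition holomorphic_map ::
  "('s::{t2_space, second_countable_topology}, 'd::finite) chart set \<Rightarrow>
     's set \<Rightarrow> ('s \<Rightarrow> complex ^ 'm) \<Rightarrow> bool" where
  "holomorphic_map A S f \<longleftrightarrow>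
     (\<forall>(T, \<phi>)\<in>A. complex_differentiable_on (f \<circ> inv_into T \<phi>) (\<phi> ` (S \<inter> T)))"

text \<open>The subspaces \<open>E s\<close> form a holomorphic subbundle: there are local holomorphic frames.\<close>

definition holomorphic_family ::
  "('s::{t2_space, second_countable_topology}, 'd::finite) chart set \<Rightarrow>
     ('s \<Rightarrow> (complex ^ 'm) set) \<Rightarrow> bool" where
  "holomorphic_family A E \<longleftrightarrow>
     (\<forall>s. \<exists>S (r::nat) e. open S \<and> s \<in> S \<and>
        (\<forall>i<r. holomorphic_map A S (e i)) \<and>
        (\<forall>t\<in>S. inj_on (\<lambda>i. e i t) {..<r} \<and>
               vec.independent ((\<lambda>i. e i t) ` {..<r}) \<and>
               vec.span ((\<lambda>i. e i t) ` {..<r}) = E t))"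

text \<open>Derivatives of local holomorphic sections of each \<open>F\<^sup>p\<close> lie in \<open>F\<^sup>p\<^sup>-\<^sup>1\<close>.\<close>

definition griffiths_transversal ::
  "('s::{t2_space, second_countable_topology}, 'd::finite) chart set \<Rightarrow>
     ('s \<Rightarrow> 'm::finite filtration) \<Rightarrow> bool" where
  "griffiths_transversal A \<Phi> \<longleftrightarrow>
     (\<forall>p S f. open S \<and> holomorphic_map A S f \<and> (\<forall>s\<in>S. f s \<in> \<Phi> s p) \<longrightarrow>
        (\<forall>(T, \<phi>)\<in>A. \<forall>s \<in> S \<inter> T. \<forall>f'.
           ((f \<circ> inv_into T \<phi>) has_derivative f') (at (\<phi> s)) \<longrightarrow>
           (\<forall>v. f' v \<in> \<Phi> s (p - 1))))"

definition polarized_VHS ::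
  "('s::{t2_space, second_countable_topology}, 'd::finite) chart set \<Rightarrow>
     nat \<Rightarrow> (real ^ 'm) set \<Rightarrow> (real ^ 'm \<Rightarrow> real ^ 'm \<Rightarrow> real) \<Rightarrow>
     ('s \<Rightarrow> 'm::finite filtration) \<Rightarrow> bool" where
  "polarized_VHS A w U q \<Phi> \<longleftrightarrow>
     (\<forall>s. polarized_hodge_structure w U q (\<Phi> s)) \<and>
     (\<forall>p. holomorphic_family A (\<lambda>s. \<Phi> s p)) \<and>
     griffiths_transversal A \<Phi>"

end

theory Submission
  imports Defs
begin

text \<open>
  Let \<open>L\<close> be the limit of \<open>e\<^sup>z\<^sup>N F\<close>, a point of the closed real orbit.

  The closed orbit has a rigidity property (\<open>closed_orbit_isotropic_vector\<close>): a real isotropic vector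
  \<open>y\<close> that lies in the sum of \<open>L c\<close> and its conjugate lies in \<open>L c\<close> already.  Otherwise, complete
  \<open>y\<close> to a hyperbolic pair \<open>x, y\<close> and let \<open>t\<close> act by the real torus element scaling \<open>x\<close> by \<open>t\<close> and
  \<open>y\<close> by \<open>1 / t\<close>.  As \<open>t\<close> grows, these elements move \<open>L\<close> towards a flag
  that contains more real vectors in one of its steps.  That flag is in the orbit since the orbit is closed,
  whereas the dimension of the real part of a step is constant along a real orbit.

  Elements of \<open>F\<close> have limits in \<open>L\<close>: if \<open>v \<in> F p\<close> is killed by the power \<open>k + 1\<close> of \<open>N\<close>, then the
  leading term \<open>N\<^sup>k v\<close> of \<open>e\<^sup>z\<^sup>N v\<close> is in \<open>L p\<close>, and \<open>v\<close> itself is in \<open>L (p - k)\<close>.  To apply this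
  to primitive classes, they have to be represented inside \<open>F p\<close> by vectors killed by the power \<open>k + 1\<close>
  of \<open>N\<close> exactly.  This is the strictness of the powers of \<open>N\<close> with respect to \<open>F\<close> (\<open>strictness\<close>,
  \<open>exact_lift\<close>), a weak form of Schmid's \<open>SL\<^sub>2\<close>-orbit theorem.  It is obtained from an inequality
  between the weights and the Hodge degrees of a basis adapted to both filtrations
  (\<open>weight_energy\<close>); the inequality comes from a monotone quantity along the orbit
  \<open>t \<mapsto> e\<^sup>i\<^sup>t\<^sup>N F\<close> (\<open>energy_inequality\<close>).

  Now let \<open>\<gamma>\<close> be in step \<open>c\<close> of the induced filtration on the primitive part, with exact lift
  \<open>v\<close>.  If the real vector \<open>N\<^sup>k v + conj (N\<^sup>k v)\<close> is isotropic, the closed orbit property puts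
  \<open>conj (N\<^sup>k v)\<close> into \<open>L c\<close>; pairing with \<open>L (n + 1 - c)\<close>, which contains the exact lifts of the
  step \<open>n + k + 1 - c\<close>, shows that the conjugate of \<open>\<gamma>\<close> is in step \<open>c\<close> too
  (\<open>isotropic_conjugate\<close>).  For \<open>k \<ge> 1\<close> and for odd \<open>n\<close> the isotropy is automatic, all steps are
  stable under conjugation, and there is only one Hodge number.  For \<open>k = 0\<close> and even \<open>n\<close>, two
  adjacent nonzero Hodge numbers would give real vectors on which the form has opposite signs, hence
  an isotropic combination, and the conclusion of \<open>isotropic_conjugate\<close> fails for it.  So no two
  consecutive Hodge numbers are nonzero (\<open>no_consecutive_hodge_numbers\<close>).

  Hodge numbers are constant in a variation, so each step \<open>F\<^sup>p\<close> of the variation equals \<open>F\<^sup>p\<^sup>-\<^sup>1\<close> or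
  \<open>F\<^sup>p\<^sup>+\<^sup>1\<close> everywhere, and Griffiths transversality says that derivatives of its sections stay in
  it.  A holomorphic family of subspaces with that property is locally constant
  (\<open>flat_holomorphic_family_constant\<close>).
\<close>

section \<open>Hermitian forms and orthogonalization\<close>

lemma vec_linearI:
  fixes f :: "('a::field) ^ 'n \<Rightarrow> 'a ^ 'm"
  assumes "\<And>u v. f (u + v) = f u + f v" "\<And>c u. f (c *s u) = c *s f u"
  shows "Vector_Spaces.linear (*s) (*s) f"
  unfolding Vector_Spaces.linear_iff by (intro conjI vec.vector_space_axioms) (use assms in auto)

definition hermitian_form :: "(complex ^ 'n \<Rightarrow> complex ^ 'n \<Rightarrow> complex) \<Rightarrow> bool" where
  "hermitian_form G \<longleftrightarrow>
     (\<forall>u v w. G (u + v) w = G u w + G v w) \<and> (\<forall>c u w. G (c *s u) w = c * G u w) \<and>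
     (\<forall>u w. G w u = cnj (G u w))"

lemma hermitian_formD:
  assumes "hermitian_form G"
  shows "G (u + v) w = G u w + G v w" "G (c *s u) w = c * G u w" "G w u = cnj (G u w)"
  using assms unfolding hermitian_form_def by blast+

lemma hermitian_form_right:
  assumes "hermitian_form G"
  shows "G w (u + v) = G w u + G w v" "G w (c *s u) = cnj c * G w u"
  using hermitian_formD(1,2)[OF assms] hermitian_formD(3)[OF assms] by (metis complex_cnj_add complex_cnj_mult)+

lemma hermitian_form_zero:
  assumes "hermitian_form G" shows "G 0 w = 0" "G w 0 = 0"
  using hermitian_formD(2)[OF assms, of 0 0 w] hermitian_form_right(2)[OF assms, of w 0 0] by auto

lemma hermitian_form_minus:
  assumes "hermitian_form G" shows "G (- u) w = - G u w" "G w (- u) = - G w u"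
  using hermitian_formD(2)[OF assms, of "-1" u w] hermitian_form_right(2)[OF assms, of w "-1" u]
  by (auto simp: vector_sneg_minus1[symmetric])

lemma hermitian_form_diff:
  assumes "hermitian_form G"
  shows "G (u - v) w = G u w - G v w" "G w (u - v) = G w u - G w v"
  using hermitian_formD(1)[OF assms, of u "-v" w] hermitian_form_right(1)[OF assms, of w u "-v"]
  by (auto simp: hermitian_form_minus[OF assms])

lemma hermitian_form_sum:
  assumes "hermitian_form G"
  shows "G (\<Sum>i\<in>I. x i) w = (\<Sum>i\<in>I. G (x i) w)" "G w (\<Sum>i\<in>I. x i) = (\<Sum>i\<in>I. G w (x i))"
  by (induction I rule: infinite_finite_induct; 
      simp add: hermitian_form_zero[OF assms] hermitian_formD(1)[OF assms] hermitian_form_right(1)[OF assms])+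

lemmas hermitian_form_simps =
  hermitian_formD(1,2) hermitian_form_right hermitian_form_zero hermitian_form_minus
  hermitian_form_diff hermitian_form_sum

lemma hermitian_form_real:
  assumes "hermitian_form G" shows "Im (G u u) = 0"
  using hermitian_formD(3)[OF assms, of u u] by (metis complex_cnj_cancel_iff complex_is_Real_iff Reals_cnj_iff)

lemma hermitian_form_sym_zero:
  assumes "hermitian_form G" "G u w = 0" shows "G w u = 0"
  by (subst hermitian_formD(3)[OF assms(1)]) (simp add: assms(2))

lemma hermitian_form_orth_span:
  assumes G: "hermitian_form G" and "\<And>v. v \<in> S \<Longrightarrow> G u v = 0" and "w \<in> vec.span S"
  shows "G u w = 0"
  using assms(3)
proof (induction rule: vec.span_induct_alt)
  case base show ?case by (rule hermitian_form_zero[OF G])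
next
  case (step c x y) then show ?case using assms(2) by (simp add: hermitian_form_simps[OF G])
qed

fun gram_schmidt ::
  "(complex ^ 'n \<Rightarrow> complex ^ 'n \<Rightarrow> complex) \<Rightarrow> (nat \<Rightarrow> complex ^ 'n) \<Rightarrow> nat \<Rightarrow> complex ^ 'n" where
  "gram_schmidt G f i =
     f i - (\<Sum>j<i. (G (f i) (gram_schmidt G f j) / G (gram_schmidt G f j) (gram_schmidt G f j))
                   *s gram_schmidt G f j)"

declare gram_schmidt.simps [simp del]

lemma span_image_lessThan_mono:
  fixes f :: "nat \<Rightarrow> complex ^ 'n"
  shows "i \<le> j \<Longrightarrow> vec.span (f ` {..<i}) \<subseteq> vec.span (f ` {..<j})"
  by (intro vec.span_mono image_mono) auto

lemma gram_schmidt_span: "vec.span (gram_schmidt G f ` {..<i}) = vec.span (f ` {..<i})"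
proof (induction i)
  case 0 then show ?case by simp
next
  case (Suc i)
  let ?g = "gram_schmidt G f"
  have "f i - ?g i \<in> vec.span (?g ` {..<i})"
    by (subst gram_schmidt.simps, simp, rule vec.span_sum, rule vec.span_scale, rule vec.span_base, simp)
  then have "vec.span (insert (f i) (?g ` {..<i})) = vec.span (insert (?g i) (?g ` {..<i}))"
    by (metis vec.eq_span_insert_eq)
  moreover have "vec.span (insert (f i) (?g ` {..<i})) = vec.span (insert (f i) (f ` {..<i}))"
    unfolding vec.span_insert Suc ..
  ultimately show ?case by (simp add: lessThan_Suc)
qed

lemma gram_schmidt_diff: "f i - gram_schmidt G f i \<in> vec.span (f ` {..<i})"
proof -
  have "f i - gram_schmidt G f i \<in> vec.span (gram_schmidt G f ` {..<i})"
    by (subst gram_schmidt.simps, simp, rule vec.span_sum, rule vec.span_scale, rule vec.span_base, simp)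
  then show ?thesis by (simp add: gram_schmidt_span)
qed

text \<open>
  The condition under which orthogonalization does not break down, for a form that may be
  indefinite.
\<close>

definition regular_along ::
  "(complex ^ 'n \<Rightarrow> complex ^ 'n \<Rightarrow> complex) \<Rightarrow> (nat \<Rightarrow> complex ^ 'n) \<Rightarrow> nat \<Rightarrow> bool" where
  "regular_along G f d \<longleftrightarrow>
     (\<forall>i<d. G (gram_schmidt G f i) (gram_schmidt G f i) \<noteq> 0)"

lemma gram_schmidt_orthogonal_earlier:
  assumes G: "hermitian_form G" and "\<And>j. j < i \<Longrightarrow> G (gram_schmidt G f j) (gram_schmidt G f j) \<noteq> 0"
  shows "j < i \<Longrightarrow> G (gram_schmidt G f i) (gram_schmidt G f j) = 0"
  using assms(2)
proof (induction i arbitrary: j rule: less_induct)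
  case (less i)
  let ?g = "gram_schmidt G f"
  have orth: "G (?g l) (?g j) = 0" if "l < i" "l \<noteq> j" for l
  proof (cases "j < l")
    case True
    have "\<And>j. j < l \<Longrightarrow> G (?g j) (?g j) \<noteq> 0"
      by (rule less.prems(2)) (use \<open>l < i\<close> in simp)
    then show ?thesis by (rule less.IH[OF \<open>l < i\<close> True])
  next
    case False
    then have "l < j" using that by simp
    have "\<And>l. l < j \<Longrightarrow> G (?g l) (?g l) \<noteq> 0"
      by (rule less.prems(2)) (use less.prems(1) in simp)
    then have "G (?g j) (?g l) = 0" by (rule less.IH[OF less.prems(1) \<open>l < j\<close>])
    then show ?thesis by (rule hermitian_form_sym_zero[OF G])
  qed
  have "G (?g i) (?g j) = G (f i) (?g j) - (\<Sum>l<i. G (f i) (?g l) / G (?g l) (?g l) * G (?g l) (?g j))"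
    by (subst gram_schmidt.simps, subst hermitian_form_diff(1)[OF G], subst hermitian_form_sum(1)[OF G],
       subst hermitian_formD(2)[OF G], rule refl)
  also have "(\<Sum>l<i. G (f i) (?g l) / G (?g l) (?g l) * G (?g l) (?g j)) =
      (\<Sum>l<i. if l = j then G (f i) (?g j) else 0)"
    using less.prems by (intro sum.cong refl) (simp add: orth)
  finally show ?case using less.prems(1) by simp
qed

lemma gram_schmidt_orthogonal:
  assumes G: "hermitian_form G" and "regular_along G f d" "i < d" "j < d" "i \<noteq> j"
  shows "G (gram_schmidt G f i) (gram_schmidt G f j) = 0"
proof (cases "j < i")
  case True
  then show ?thesis using assms gram_schmidt_orthogonal_earlier[OF G, of i f j]
    by (auto simp: regular_along_def)
next
  case False
  then have "G (gram_schmidt G f j) (gram_schmidt G f i) = 0"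
    using assms gram_schmidt_orthogonal_earlier[OF G, of j f i] by (auto simp: regular_along_def)
  then show ?thesis by (rule hermitian_form_sym_zero[OF G])
qed

lemma gram_schmidt_orthogonal_span:
  assumes G: "hermitian_form G" and "regular_along G f d" "i < d" "w \<in> vec.span (f ` {..<i})"
  shows "G (gram_schmidt G f i) w = 0"
proof (rule hermitian_form_orth_span[OF G])
  show "w \<in> vec.span (gram_schmidt G f ` {..<i})" using assms by (simp add: gram_schmidt_span)
qed (use assms gram_schmidt_orthogonal[OF G] in auto)

text \<open>
  Positivity on vectors orthogonal to the earlier ones suffices: by induction, the vector produced at
  each stage is such a vector.
\<close>

lemma regular_alongI:
  assumes G: "hermitian_form G"
    and "\<And>i u. i < d \<Longrightarrow> f i - u \<in> vec.span (f ` {..<i}) \<Longrightarrow>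
           (\<And>w. w \<in> vec.span (f ` {..<i}) \<Longrightarrow> G u w = 0) \<Longrightarrow> G u u \<noteq> 0"
  shows "regular_along G f d"
proof -
  have "i < d \<Longrightarrow> G (gram_schmidt G f i) (gram_schmidt G f i) \<noteq> 0" for i
  proof (induction i rule: less_induct)
    case (less i)
    then have "regular_along G f i" by (auto simp: regular_along_def)
    have "G (gram_schmidt G f i) w = 0" if "w \<in> vec.span (f ` {..<i})" for w
    proof (rule hermitian_form_orth_span[OF G])
      show "w \<in> vec.span (gram_schmidt G f ` {..<i})" using that by (simp add: gram_schmidt_span)
      show "G (gram_schmidt G f i) v = 0" if "v \<in> gram_schmidt G f ` {..<i}" for v
        using that gram_schmidt_orthogonal_earlier[OF G, of i f] less by auto
    qed
    then show ?case using assms(2)[OF less.prems gram_schmidt_diff] by blast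
  qed
  then show ?thesis by (auto simp: regular_along_def)
qed

definition orthogonal_frame ::
  "(complex ^ 'n \<Rightarrow> complex ^ 'n \<Rightarrow> complex) \<Rightarrow> (nat \<Rightarrow> complex ^ 'n) \<Rightarrow> nat \<Rightarrow> bool" where
  "orthogonal_frame G v d \<longleftrightarrow>
     hermitian_form G \<and> vec.span (v ` {..<d}) = UNIV \<and> (\<forall>i<d. G (v i) (v i) \<noteq> 0) \<and>
     (\<forall>i<d. \<forall>j<d. i \<noteq> j \<longrightarrow> G (v i) (v j) = 0)"

lemma orthogonal_frame_gram_schmidt:
  assumes "hermitian_form G" "regular_along G f d" "vec.span (f ` {..<d}) = UNIV"
  shows "orthogonal_frame G (gram_schmidt G f) d"
  using assms gram_schmidt_orthogonal[OF assms(1,2)]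
  by (auto simp: orthogonal_frame_def gram_schmidt_span regular_along_def)

lemma orthogonal_frame_expansion:
  assumes "orthogonal_frame G v d"
  shows "u = (\<Sum>i<d. (G u (v i) / G (v i) (v i)) *s v i)"
proof -
  have G: "hermitian_form G" using assms by (simp add: orthogonal_frame_def)
  have "u \<in> vec.span (v ` {..<d})" using assms by (simp add: orthogonal_frame_def)
  then show ?thesis
  proof (induction rule: vec.span_induct_alt)
    case base then show ?case by (simp add: hermitian_form_zero[OF G])
  next
    case (step c x y)
    then obtain j where j: "j < d" "x = v j" by auto
    have "(\<Sum>i<d. (G (c *s x + y) (v i) / G (v i) (v i)) *s v i) =
       (\<Sum>i<d. (if i = j then c *s v j else 0) + (G y (v i) / G (v i) (v i)) *s v i)"
      using assms j by (intro sum.cong)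
        (auto simp: hermitian_form_simps[OF G] orthogonal_frame_def add_divide_distrib vec.scale_left_distrib)
    also have "\<dots> = c *s x + y" using step j by (simp add: sum.distrib)
    finally show ?case by simp
  qed
qed

lemma orthogonal_frame_parseval:
  assumes "orthogonal_frame G v d" "hermitian_form G'"
  shows "G' u w = (\<Sum>i<d. G u (v i) / G (v i) (v i) * G' (v i) w)"
  by (subst orthogonal_frame_expansion[OF assms(1), of u])
     (simp add: hermitian_form_simps[OF assms(2)])

text \<open>
  The trace does not depend on the frame; the two frames may belong to different forms.  Below
  one frame follows the Hodge filtration and the other one a flag that the nilpotent
  endomorphism lowers, which shows that the trace of its square vanishes.
\<close>

lemma orthogonal_frame_trace:
  assumes v: "orthogonal_frame G v d" and e: "orthogonal_frame G' e d'"
    and L: "Vector_Spaces.linear (*s) (*s) (L :: complex ^ 'n \<Rightarrow> complex ^ 'n)"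
  shows "(\<Sum>i<d. G (L (v i)) (v i) / G (v i) (v i)) = (\<Sum>l<d'. G' (L (e l)) (e l) / G' (e l) (e l))"
proof -
  interpret L: Vector_Spaces.linear "(*s)" "(*s)" L by (rule L)
  have G: "hermitian_form G" "hermitian_form G'" using v e by (auto simp: orthogonal_frame_def)
  have "(\<Sum>i<d. G (L (v i)) (v i) / G (v i) (v i)) =
      (\<Sum>i<d. \<Sum>l<d'. G' (v i) (e l) / G' (e l) (e l) * G (L (e l)) (v i) / G (v i) (v i))"
    by (intro sum.cong refl, subst orthogonal_frame_expansion[OF e])
       (simp add: hermitian_form_simps[OF G(1)] L.sum L.scale sum_divide_distrib)
  also have "\<dots> = (\<Sum>l<d'. \<Sum>i<d. G (L (e l)) (v i) / G (v i) (v i) * G' (v i) (e l) / G' (e l) (e l))"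
    by (subst sum.swap) (simp add: ac_simps)
  also have "\<dots> = (\<Sum>l<d'. G' (L (e l)) (e l) / G' (e l) (e l))"
    by (intro sum.cong refl)
       (subst orthogonal_frame_parseval[OF v G(2)], simp add: sum_divide_distrib)
  finally show ?thesis .
qed

section \<open>Differentiable families of Hermitian forms\<close>

definition form_derivative ::
  "(real \<Rightarrow> complex ^ 'n \<Rightarrow> complex ^ 'n \<Rightarrow> complex) \<Rightarrow>
   (complex ^ 'n \<Rightarrow> complex ^ 'n \<Rightarrow> complex) \<Rightarrow> real \<Rightarrow> bool" where
  "form_derivative G G' y \<longleftrightarrow> (\<forall>u w. ((\<lambda>t. G t u w) has_vector_derivative G' u w) (at y))"

lemma has_vector_derivative_vec_nth:
  "(x has_vector_derivative x') F \<Longrightarrow> ((\<lambda>t. x t $ i :: complex) has_vector_derivative x' $ i) F"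
  by (rule bounded_linear.has_vector_derivative[OF bounded_linear_vec_nth])

lemma bounded_bilinear_scale: "bounded_bilinear (\<lambda>(c::complex) (w::complex ^ 'n). c *s w)"
proof -
  have "bilinear (\<lambda>(c::complex) (w::complex ^ 'n). c *s w)"
    by (auto simp: bilinear_def linear_iff vec_eq_iff algebra_simps)
  then show ?thesis by (simp add: bilinear_conv_bounded_bilinear)
qed

lemma has_vector_derivative_scale:
  fixes c :: "real \<Rightarrow> complex" and w :: "real \<Rightarrow> complex ^ 'n"
  assumes "(c has_vector_derivative c') (at y)" "(w has_vector_derivative w') (at y)"
  shows "((\<lambda>t. c t *s w t) has_vector_derivative (c y *s w' + c' *s w y)) (at y)"
  using bounded_bilinear.has_vector_derivative[OF bounded_bilinear_scale assms] by simp

lemma hermitian_form_coords: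
  assumes "hermitian_form G"
  shows "G u w = (\<Sum>a\<in>UNIV. \<Sum>b\<in>UNIV. u $ a * cnj (w $ b) * G (axis a 1) (axis b 1))"
proof -
  have e: "x = (\<Sum>a\<in>UNIV. (x $ a) *s axis a 1)" for x :: "complex ^ 'n"
    by (rule basis_expansion[symmetric])
  have "G u w = G (\<Sum>a\<in>UNIV. (u $ a) *s axis a 1) (\<Sum>b\<in>UNIV. (w $ b) *s axis b 1)"
    using e by metis
  also have "\<dots> = (\<Sum>a\<in>UNIV. \<Sum>b\<in>UNIV. u $ a * cnj (w $ b) * G (axis a 1) (axis b 1))"
    unfolding hermitian_form_sum(1)[OF assms]
    unfolding hermitian_form_sum(2)[OF assms]
    by (simp add: hermitian_formD(2)[OF assms] hermitian_form_right(2)[OF assms] sum_distrib_left ac_simps)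
  finally show ?thesis .
qed

lemma form_derivative_hermitian:
  assumes "\<And>t. hermitian_form (G t)" "form_derivative G G' y"
  shows "hermitian_form G'"
proof -
  have D: "((\<lambda>t. G t u w) has_vector_derivative G' u w) (at y)" for u w
    using assms(2) by (simp add: form_derivative_def)
  have "G' (u + v) w = G' u w + G' v w" for u v w
  proof (rule vector_derivative_unique_at[OF D])
    show "((\<lambda>t. G t (u + v) w) has_vector_derivative G' u w + G' v w) (at y)"
      unfolding hermitian_formD(1)[OF assms(1)] by (intro derivative_intros D)
  qed
  moreover have "G' (c *s u) w = c * G' u w" for c u w
  proof (rule vector_derivative_unique_at[OF D])
    show "((\<lambda>t. G t (c *s u) w) has_vector_derivative c * G' u w) (at y)"
      unfolding hermitian_formD(2)[OF assms(1)] by (intro derivative_intros D)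
  qed
  moreover have "G' w u = cnj (G' u w)" for u w
  proof (rule vector_derivative_unique_at[OF D])
    have "((\<lambda>t. cnj (G t u w)) has_vector_derivative cnj (G' u w)) (at y)"
      by (intro has_vector_derivative_cnj D)
    then show "((\<lambda>t. G t w u) has_vector_derivative cnj (G' u w)) (at y)"
      by (simp only: hermitian_formD(3)[OF assms(1), symmetric])
  qed
  ultimately show ?thesis unfolding hermitian_form_def by blast
qed

text \<open>
  In coordinates the form is a finite sum of products of differentiable functions, so the
  expansion in the standard basis reduces the claim to the scalar product rule.
\<close>

lemma form_derivative_product_rule:
  assumes "\<And>t. hermitian_form (G t)" "form_derivative G G' y"
    and u: "(u has_vector_derivative u') (at y)" and w: "(w has_vector_derivative w') (at y)"
  shows "((\<lambda>t. G t (u t) (w t)) has_vector_derivative (G' (u y) (w y) + G y u' (w y) + G y (u y) w')) (at y)"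
proof -
  have D: "((\<lambda>t. G t a b) has_vector_derivative G' a b) (at y)" for a b
    using assms(2) by (simp add: form_derivative_def)
  have G': "hermitian_form G'" by (rule form_derivative_hermitian[OF assms(1,2)])
  have ua: "((\<lambda>t. u t $ a) has_vector_derivative u' $ a) (at y)" for a
    by (rule has_vector_derivative_vec_nth[OF u])
  have wa: "((\<lambda>t. cnj (w t $ a)) has_vector_derivative cnj (w' $ a)) (at y)" for a
    by (intro has_vector_derivative_cnj has_vector_derivative_vec_nth[OF w])
  have D1: "((\<lambda>t. \<Sum>a\<in>UNIV. \<Sum>b\<in>UNIV. u t $ a * cnj (w t $ b) * G t (axis a 1) (axis b 1))
      has_vector_derivative (\<Sum>a\<in>UNIV. \<Sum>b\<in>UNIV. u y $ a * cnj (w y $ b) * G' (axis a 1) (axis b 1) +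
      (u y $ a * cnj (w' $ b) + u' $ a * cnj (w y $ b)) * G y (axis a 1) (axis b 1))) (at y)"
    by (intro has_vector_derivative_sum has_vector_derivative_mult ua wa D)
  have e1: "(\<Sum>a\<in>UNIV. \<Sum>b\<in>UNIV. u y $ a * cnj (w y $ b) * G' (axis a 1) (axis b 1) +
      (u y $ a * cnj (w' $ b) + u' $ a * cnj (w y $ b)) * G y (axis a 1) (axis b 1)) =
      G' (u y) (w y) + G y u' (w y) + G y (u y) w'"
    by (subst hermitian_form_coords[OF G'], subst hermitian_form_coords[OF assms(1)],
        subst hermitian_form_coords[OF assms(1)], unfold sum.distrib[symmetric], intro sum.cong refl)
       (simp add: algebra_simps)
  have e2: "(\<lambda>t. \<Sum>a\<in>UNIV. \<Sum>b\<in>UNIV. u t $ a * cnj (w t $ b) * G t (axis a 1) (axis b 1)) =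
      (\<lambda>t. G t (u t) (w t))"
    by (rule ext) (rule hermitian_form_coords[OF assms(1), symmetric])
  show ?thesis using D1 unfolding e1 e2 .
qed

text \<open>
  Each correction added during orthogonalization is a combination of earlier vectors, and so is its
  derivative.  The derivative is therefore determined by orthogonality, which is how it is computed later.
\<close>

lemma gram_schmidt_has_derivative:
  assumes G: "\<And>t. hermitian_form (G t)" and D: "form_derivative G G' y"
    and "regular_along (G y) f d" and "i < d"
  shows "\<exists>v'. ((\<lambda>t. gram_schmidt (G t) f i) has_vector_derivative v') (at y) \<and>
              v' \<in> vec.span (f ` {..<i})"
  using \<open>i < d\<close>
proof (induction i rule: less_induct)
  case (less i)
  let ?g = "\<lambda>j t. gram_schmidt (G t) f j"
  have "\<forall>j\<in>{..<i}. \<exists>v'. (?g j has_vector_derivative v') (at y) \<and> v' \<in> vec.span (f ` {..<j})"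
    using less.IH less.prems by simp
  then obtain v' where v'_all: "\<forall>j\<in>{..<i}. (?g j has_vector_derivative v' j) (at y) \<and>
      v' j \<in> vec.span (f ` {..<j})"
    unfolding bchoice_iff by blast
  then have v': "\<And>j. j < i \<Longrightarrow> (?g j has_vector_derivative v' j) (at y)"
      "\<And>j. j < i \<Longrightarrow> v' j \<in> vec.span (f ` {..<j})"
    by auto
  define c where "c j t = G t (f i) (?g j t) / G t (?g j t) (?g j t)" for j t
  have "\<exists>c'. (c j has_vector_derivative c') (at y)" if "j < i" for j
  proof -
    have "G y (?g j y) (?g j y) \<noteq> 0" using assms(3) less that by (auto simp: regular_along_def)
    moreover have "((\<lambda>t. G t (f i) (?g j t)) has_vector_derivative
        (G' (f i) (?g j y) + G y 0 (?g j y) + G y (f i) (v' j))) (at y)"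
      by (rule form_derivative_product_rule[OF G D _ v'(1)[OF that]]) simp
    moreover note form_derivative_product_rule[OF G D v'(1)[OF that] v'(1)[OF that]]
    ultimately have "(\<lambda>t. c j t) differentiable at y" unfolding c_def
      by (intro differentiable_divide) (auto intro: differentiableI_vector)
    then show ?thesis using vector_derivative_works by blast
  qed
  then have "\<forall>j\<in>{..<i}. \<exists>c'. (c j has_vector_derivative c') (at y)" by blast
  then obtain c' where c'_all: "\<forall>j\<in>{..<i}. (c j has_vector_derivative c' j) (at y)"
    unfolding bchoice_iff by blast
  then have c': "\<And>j. j < i \<Longrightarrow> (c j has_vector_derivative c' j) (at y)" by simp
  have "((\<lambda>t. f i - (\<Sum>j<i. c j t *s ?g j t)) has_vector_derivative
      (0 - (\<Sum>j<i. c j y *s v' j + c' j *s ?g j y))) (at y)"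
    by (intro has_vector_derivative_diff has_vector_derivative_sum has_vector_derivative_scale
        has_vector_derivative_const) (auto intro: c' v')
  then have "(?g i has_vector_derivative - (\<Sum>j<i. c j y *s v' j + c' j *s ?g j y)) (at y)"
    by (subst gram_schmidt.simps) (simp add: c_def)
  moreover have "- (\<Sum>j<i. c j y *s v' j + c' j *s ?g j y) \<in> vec.span (f ` {..<i})"
  proof (rule vec.span_neg, rule vec.span_sum)
    fix j assume j: "j \<in> {..<i}"
    have "v' j \<in> vec.span (f ` {..<i})"
      using v'(2)[of j] j span_image_lessThan_mono[of j i f] by auto
    moreover have "?g j y \<in> vec.span (f ` {..<i})"
      using j by (subst gram_schmidt_span[where G = "G y", symmetric]) (auto intro: vec.span_base)
    ultimately show "c j y *s v' j + c' j *s ?g j y \<in> vec.span (f ` {..<i})"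
      by (intro vec.span_add vec.span_scale)
  qed
  ultimately show ?case by blast
qed

section \<open>The flow of an orthogonal frame along a nilpotent orbit\<close>

lemma bounded_linear_matrix_vector: "bounded_linear (\<lambda>x :: complex ^ 'n. (A :: complex ^ 'n ^ 'm) *v x)"
proof -
  have "linear (\<lambda>x :: complex ^ 'n. A *v x)"
    by (rule linearI, rule matrix_vector_right_distrib)
       (simp add: matrix_vector_mult_def vec_eq_iff scaleR_sum_right)
  then show ?thesis by (simp add: linear_conv_bounded_linear)
qed

lemma has_vector_derivative_matrix_vector:
  "(x has_vector_derivative x') F \<Longrightarrow>
   ((\<lambda>t. (A :: complex ^ 'n ^ 'm) *v x t) has_vector_derivative A *v x') F"
  by (rule bounded_linear.has_vector_derivative[OF bounded_linear_matrix_vector])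

lemma has_vector_derivative_Re:
  "(g has_vector_derivative g') (at y) \<Longrightarrow> ((\<lambda>t. Re (g t)) has_real_derivative Re g') (at y)"
  by (simp add: has_real_derivative_iff_has_vector_derivative
      bounded_linear.has_vector_derivative[OF bounded_linear_Re])

lemma has_vector_derivative_Im:
  "(g has_vector_derivative g') (at y) \<Longrightarrow> ((\<lambda>t. Im (g t)) has_real_derivative Im g') (at y)"
  by (simp add: has_real_derivative_iff_has_vector_derivative
      bounded_linear.has_vector_derivative[OF bounded_linear_Im])

text \<open>
  \<open>K t\<close> is the pull-back of a fixed Hermitian form along \<open>e\<^sup>i\<^sup>t\<^sup>A\<close>, so moving the filtration is
  replaced by moving the form.  The frame \<open>f\<close> is adapted to the Hodge filtration, \<open>a i\<close> being
  the degree of \<open>f i\<close>; the assumption on \<open>A\<close> is transversality and the last one is the polarization.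
\<close>

locale hodge_flow =
  fixes K :: "real \<Rightarrow> complex ^ 'n \<Rightarrow> complex ^ 'n \<Rightarrow> complex"
    and A :: "complex ^ 'n ^ 'n"
    and f :: "nat \<Rightarrow> complex ^ 'n" and d :: nat and a :: "nat \<Rightarrow> int" and b :: real
  assumes K_herm: "hermitian_form (K t)"
    and K_skew: "K t (A *v u) w = - K t u (A *v w)"
    and K_deriv: "form_derivative K (\<lambda>u w. 2 * \<i> * K t (A *v u) w) t"
    and f_span: "vec.span (f ` {..<d}) = UNIV"
    and a_anti: "i \<le> j \<Longrightarrow> j < d \<Longrightarrow> a j \<le> a i"
    and A_shift: "i < d \<Longrightarrow> A *v f i \<in> vec.span (f ` {j. j < d \<and> a i - 1 \<le> a j})"
    and sign: "b < t \<Longrightarrow> i < d \<Longrightarrow> f i - u \<in> vec.span (f ` {..<i}) \<Longrightarrow>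
        (\<And>w. w \<in> vec.span (f ` {..<i}) \<Longrightarrow> K t u w = 0) \<Longrightarrow>
        0 < (if even (a i) then 1 else -1) * Re (K t u u)"
begin

text \<open>
  \<open>X\<close> is the matrix of \<open>A\<close> in the orthogonalized frame, up to norms.  The number \<open>m i j\<close> is the squared
  modulus of an entry in the normalized frame, with the sign of \<open>\<kappa> i * \<kappa> j\<close>; it is symmetric although
  the matrix is not.  \<open>\<phi> i\<close> turns out to be the logarithmic derivative of \<open>\<kappa> i\<close>.
\<close>

definition "v i t = gram_schmidt (K t) f i"
definition "\<kappa> i t = Re (K t (v i t) (v i t))"
definition "X j i t = K t (A *v v i t) (v j t)"
definition "m i j t = (cmod (X j i t))\<^sup>2 / (\<kappa> i t * \<kappa> j t)"
definition "\<phi> i t = - 2 * Im (X i i t) / \<kappa> i t"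

lemma K_real: "K t u u = of_real (Re (K t u u))"
  using hermitian_form_real[OF K_herm, of t u] by (simp add: complex_eq_iff)

lemma K_vv: "K t (v i t) (v i t) = of_real (\<kappa> i t)"
  unfolding \<kappa>_def by (rule K_real)

lemma regular: "b < t \<Longrightarrow> regular_along (K t) f d"
proof (rule regular_alongI[OF K_herm])
  fix i u assume *: "b < t" "i < d" "f i - u \<in> vec.span (f ` {..<i})"
    "\<And>w. w \<in> vec.span (f ` {..<i}) \<Longrightarrow> K t u w = 0"
  from sign[OF this] show "K t u u \<noteq> 0" by auto
qed

lemma frame: "b < t \<Longrightarrow> orthogonal_frame (K t) (\<lambda>i. v i t) d"
  using orthogonal_frame_gram_schmidt[OF K_herm regular f_span] by (simp add: v_def)

lemma kappa_sign: "b < t \<Longrightarrow> i < d \<Longrightarrow> 0 < (if even (a i) then 1 else -1) * \<kappa> i t"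
  unfolding \<kappa>_def
proof (rule sign)
  assume "b < t" "i < d"
  show "f i - v i t \<in> vec.span (f ` {..<i})" unfolding v_def by (rule gram_schmidt_diff)
  show "K t (v i t) w = 0" if "w \<in> vec.span (f ` {..<i})" for w
    unfolding v_def by (rule gram_schmidt_orthogonal_span[OF K_herm regular[OF \<open>b < t\<close>] \<open>i < d\<close> that])
qed

lemma kappa_nz: "b < t \<Longrightarrow> i < d \<Longrightarrow> \<kappa> i t \<noteq> 0"
  using kappa_sign[of t i] by auto

lemma v_orth: "b < t \<Longrightarrow> i < d \<Longrightarrow> j < d \<Longrightarrow> i \<noteq> j \<Longrightarrow> K t (v i t) (v j t) = 0"
  using frame[of t] by (auto simp: orthogonal_frame_def)

lemma v_orth_span: "b < t \<Longrightarrow> i < d \<Longrightarrow> w \<in> vec.span (f ` {..<i}) \<Longrightarrow> K t (v i t) w = 0"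
  unfolding v_def by (rule gram_schmidt_orthogonal_span[OF K_herm regular])

lemma v_in_span: "v i t \<in> vec.span (f ` {..i})"
proof -
  have "v i t = f i - (f i - v i t)" by simp
  moreover have "f i - v i t \<in> vec.span (f ` {..i})"
    using gram_schmidt_diff[of f i "K t"] span_image_lessThan_mono[of i "Suc i" f]
    unfolding v_def by (auto simp: lessThan_Suc_atMost)
  ultimately show ?thesis by (metis vec.span_diff vec.span_base atMost_iff image_eqI order_refl)
qed

lemma X_skew: "X i j t = - cnj (X j i t)"
  unfolding X_def K_skew[of t "v j t"]
  by (subst hermitian_formD(3)[OF K_herm]) simp

lemma Re_X_diag: "Re (X i i t) = 0"
  using arg_cong[OF X_skew[of i i t], of Re] by simp

lemma m_sym: "m i j t = m j i t"
  unfolding m_def using arg_cong[OF X_skew[of i j t], of cmod] by (simp add: mult.commute)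

text \<open>
  Transversality kills the entries that lower the degree by more than one.  Skewness carries this over
  to the entries that raise it, so only adjacent degrees remain.
\<close>

lemma X_zero:
  assumes "b < t" "i < d" "j < d" "a j < a i - 1"
  shows "X j i t = 0"
proof -
  let ?S = "vec.span (f ` {..<j})"
  have sub: "f ` {l. l < d \<and> a i - 1 \<le> a l} \<subseteq> f ` {..<j}"
  proof (rule image_mono, clarsimp)
    fix l assume "l < d" "a i - 1 \<le> a l"
    then show "l < j" using assms a_anti[of j l] by (metis linorder_not_le order.strict_trans1 order_less_irrefl)
  qed
  have "A *v u \<in> ?S" if "u \<in> vec.span (f ` {..i})" for u
    using that
  proof (induction rule: vec.span_induct_alt)
    case base then show ?case by (simp add: vec.span_zero)
  next
    case (step c x y)
    then obtain l where l: "l \<le> i" "x = f l" by auto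
    then have "a i \<le> a l" "l < d" using assms a_anti[of l i] by auto
    then have "f ` {j. j < d \<and> a l - 1 \<le> a j} \<subseteq> f ` {l. l < d \<and> a i - 1 \<le> a l}" by auto
    then have "A *v x \<in> ?S"
      using A_shift[OF \<open>l < d\<close>] sub l vec.span_mono by (metis (no_types, lifting) subsetD)
    then show ?case using step
      by (simp add: matrix_vector_right_distrib vec.scale vec.span_add vec.span_scale)
  qed
  then have "A *v v i t \<in> ?S" using v_in_span by blast
  then have "K t (v j t) (A *v v i t) = 0" by (rule v_orth_span[OF assms(1,3)])
  then show ?thesis unfolding X_def by (rule hermitian_form_sym_zero[OF K_herm])
qed

lemma X_zero':
  assumes "b < t" "i < d" "j < d" "1 < \<bar>a i - a j\<bar>"
  shows "X j i t = 0"
proof (cases "a j < a i - 1")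
  case True then show ?thesis by (rule X_zero[OF assms(1-3)])
next
  case False
  then have "X i j t = 0" using assms by (intro X_zero) auto
  then show ?thesis using X_skew[of j i t] by simp
qed

definition "v' t = (SOME v'. \<forall>i<d. ((v i) has_vector_derivative v' i) (at t) \<and>
              v' i \<in> vec.span (f ` {..<i}))"

lemma v_deriv:
  assumes "b < t" "i < d"
  shows "((v i) has_vector_derivative v' t i) (at t)" "v' t i \<in> vec.span (f ` {..<i})"
proof -
  have "\<forall>i\<in>{..<d}. \<exists>w. ((v i) has_vector_derivative w) (at t) \<and> w \<in> vec.span (f ` {..<i})"
    using gram_schmidt_has_derivative[OF K_herm K_deriv regular[OF assms(1)]]
    unfolding v_def by auto
  then have "\<exists>v'. \<forall>i<d. ((v i) has_vector_derivative v' i) (at t) \<and> v' i \<in> vec.span (f ` {..<i})"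
    unfolding bchoice_iff by auto
  from someI_ex[OF this] show "((v i) has_vector_derivative v' t i) (at t)" "v' t i \<in> vec.span (f ` {..<i})"
    using assms(2) unfolding v'_def by auto
qed

lemma K_v'_late: "b < t \<Longrightarrow> i < d \<Longrightarrow> j < d \<Longrightarrow> i \<le> j \<Longrightarrow> K t (v' t i) (v j t) = 0"
  using v_orth_span[of t j "v' t i"] v_deriv(2)[of t i] span_image_lessThan_mono[of i j f]
    hermitian_form_sym_zero[OF K_herm] by blast

text \<open>
  Differentiating the orthogonality relation of the vectors \<open>i\<close> and \<open>j\<close>: the derivative of the later
  vector pairs with the earlier one to the negative of the derivative of the form.
\<close>

lemma K_v'_early:
  assumes "b < t" "i < d" "j < i"
  shows "K t (v' t i) (v j t) = - 2 * \<i> * X j i t"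
proof -
  have j: "j < d" using assms by simp
  have "((\<lambda>s. K s (v i s) (v j s)) has_vector_derivative
     (2 * \<i> * K t (A *v v i t) (v j t) + K t (v' t i) (v j t) + K t (v i t) (v' t j))) (at t)"
    by (rule form_derivative_product_rule[OF K_herm K_deriv v_deriv(1)[OF assms(1,2)] v_deriv(1)[OF assms(1) j]])
  moreover have "((\<lambda>s. K s (v i s) (v j s)) has_vector_derivative 0) (at t)"
  proof (rule has_vector_derivative_transform_within_open[of "\<lambda>_. 0" _ _ "{b<..}"])
    show "0 = K s (v i s) (v j s)" if "s \<in> {b<..}" for s
      using v_orth[of s i j] that assms j by simp
  qed (use assms in auto)
  ultimately have "2 * \<i> * K t (A *v v i t) (v j t) + K t (v' t i) (v j t) + K t (v i t) (v' t j) = 0"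
    by (rule vector_derivative_unique_at)
  moreover have "K t (v i t) (v' t j) = 0"
    by (rule hermitian_form_sym_zero[OF K_herm]) (use K_v'_late[of t j i] assms j in auto)
  ultimately show ?thesis unfolding X_def by (simp add: add_eq_0_iff)
qed

lemma K_v'_expand:
  assumes "b < t" "i < d"
  shows "K t (v' t i) w = (\<Sum>j<i. - 2 * \<i> * X j i t / \<kappa> j t * K t (v j t) w)"
proof -
  have "K t (v' t i) w = (\<Sum>j<d. K t (v' t i) (v j t) / K t (v j t) (v j t) * K t (v j t) w)"
    by (rule orthogonal_frame_parseval[OF frame[OF assms(1)] K_herm])
  also have "\<dots> = (\<Sum>j<i. K t (v' t i) (v j t) / K t (v j t) (v j t) * K t (v j t) w)"
    using assms K_v'_late[OF assms(1,2)] by (intro sum.mono_neutral_right) auto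
  finally show ?thesis using K_v'_early[OF assms] by (simp add: K_vv)
qed

lemma kappa_deriv:
  assumes "b < t" "i < d"
  shows "(\<kappa> i has_real_derivative \<phi> i t * \<kappa> i t) (at t)"
proof -
  have "((\<lambda>s. K s (v i s) (v i s)) has_vector_derivative
     (2 * \<i> * K t (A *v v i t) (v i t) + K t (v' t i) (v i t) + K t (v i t) (v' t i))) (at t)"
    by (rule form_derivative_product_rule[OF K_herm K_deriv v_deriv(1)[OF assms(1,2)] v_deriv(1)[OF assms(1,2)]])
  moreover have "K t (v' t i) (v i t) = 0" using K_v'_late[of t i i] assms by simp
  moreover have "K t (v i t) (v' t i) = 0"
    by (rule hermitian_form_sym_zero[OF K_herm]) fact
  ultimately have "((\<lambda>s. K s (v i s) (v i s)) has_vector_derivative 2 * \<i> * X i i t) (at t)"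
    by (simp add: X_def)
  from has_vector_derivative_Re[OF this]
  have "(\<kappa> i has_real_derivative - 2 * Im (X i i t)) (at t)" by (simp add: \<kappa>_def[abs_def])
  then show ?thesis using kappa_nz[OF assms] by (simp add: \<phi>_def)
qed

lemma X_diag_deriv:
  assumes "b < t" "i < d"
  shows "((\<lambda>s. X i i s) has_vector_derivative
     of_real (4 * (\<Sum>j<i. (cmod (X j i t))\<^sup>2 / \<kappa> j t) - 2 * (\<Sum>j<d. (cmod (X j i t))\<^sup>2 / \<kappa> j t)) * \<i>) (at t)"
proof -
  let ?S1 = "\<Sum>j<d. (cmod (X j i t))\<^sup>2 / \<kappa> j t" and ?S2 = "\<Sum>j<i. (cmod (X j i t))\<^sup>2 / \<kappa> j t"
  have vA: "K t (v j t) (A *v w) = cnj (K t (A *v w) (v j t))" for j w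
    by (rule hermitian_formD(3)[OF K_herm])
  have 1: "K t (A *v v i t) (A *v v i t) = of_real ?S1"
    by (subst orthogonal_frame_parseval[OF frame[OF assms(1)] K_herm])
       (simp add: K_vv vA X_def[symmetric] complex_norm_square[symmetric])
  have 2: "K t (v' t i) (A *v v i t) = - 2 * \<i> * of_real ?S2"
    unfolding K_v'_expand[OF assms]
    by (simp add: vA X_def[symmetric] complex_norm_square[symmetric, unfolded of_real_power]
        sum_distrib_left mult_ac sum_negf)
  have "((\<lambda>s. K s (A *v v i s) (v i s)) has_vector_derivative
     (2 * \<i> * K t (A *v (A *v v i t)) (v i t) + K t (A *v v' t i) (v i t) + K t (A *v v i t) (v' t i))) (at t)"
    by (rule form_derivative_product_rule[OF K_herm K_deriv
          has_vector_derivative_matrix_vector[OF v_deriv(1)[OF assms(1,2)]] v_deriv(1)[OF assms(1,2)]])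
  moreover have "K t (A *v (A *v v i t)) (v i t) = - of_real ?S1" using 1 by (simp add: K_skew)
  moreover have "K t (A *v v' t i) (v i t) = 2 * \<i> * of_real ?S2" using 2 by (simp add: K_skew)
  moreover have "K t (A *v v i t) (v' t i) = 2 * \<i> * of_real ?S2"
    by (subst hermitian_formD(3)[OF K_herm]) (simp add: 2)
  ultimately show ?thesis by (simp add: X_def[symmetric] algebra_simps)
qed

text \<open>
  The equation satisfied by \<open>\<phi>\<close> is of Toda lattice type: entries above and below the diagonal contribute
  with opposite signs.
\<close>

lemma phi_deriv:
  assumes "b < t" "i < d"
  shows "(\<phi> i has_real_derivative 4 * (\<Sum>j<d. m i j t) - 8 * (\<Sum>j<i. m i j t) - 4 * m i i t) (at t)"
proof -
  note nz = kappa_nz[OF assms]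
  let ?S1 = "\<Sum>j<d. (cmod (X j i t))\<^sup>2 / \<kappa> j t" and ?S2 = "\<Sum>j<i. (cmod (X j i t))\<^sup>2 / \<kappa> j t"
  have D: "((\<lambda>s. Im (X i i s)) has_real_derivative (4 * ?S2 - 2 * ?S1)) (at t)"
    using has_vector_derivative_Im[OF X_diag_deriv[OF assms]] by simp
  have "((\<lambda>s. - 2 * Im (X i i s) / \<kappa> i s) has_real_derivative
     ((- 2 * (4 * ?S2 - 2 * ?S1)) * \<kappa> i t - (- 2 * Im (X i i t)) * (\<phi> i t * \<kappa> i t)) / (\<kappa> i t * \<kappa> i t)) (at t)"
    by (intro DERIV_divide DERIV_cmult D kappa_deriv assms nz)
  moreover have "(\<Sum>j<l. m i j t) = (\<Sum>j<l. (cmod (X j i t))\<^sup>2 / \<kappa> j t) / \<kappa> i t" for l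
    by (simp add: m_def sum_divide_distrib mult.commute)
  moreover have "m i i t = (Im (X i i t))\<^sup>2 / (\<kappa> i t * \<kappa> i t)"
    using Re_X_diag[of i t] by (simp add: m_def cmod_power2)
  moreover have "((- 2 * (4 * S2 - 2 * S1)) * \<kappa> i t - (- 2 * Im (X i i t)) * (\<phi> i t * \<kappa> i t)) / (\<kappa> i t * \<kappa> i t) =
      4 * (S1 / \<kappa> i t) - 8 * (S2 / \<kappa> i t) - 4 * ((Im (X i i t))\<^sup>2 / (\<kappa> i t * \<kappa> i t))" for S1 S2
    using nz by (simp add: \<phi>_def field_simps power2_eq_square)
  ultimately show ?thesis by (simp only: \<phi>_def[abs_def])
qed

text \<open>
  \<open>E\<close> is the logarithmic derivative of the product of the \<open>\<kappa> i\<close> with exponents \<open>a i\<close>, and \<open>\<nu>\<close>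
  is the squared Hilbert-Schmidt norm of \<open>A\<close> in the Hodge metric.
\<close>

definition "E t = (\<Sum>i<d. of_int (a i) * \<phi> i t)"
definition "\<nu> t = (\<Sum>i<d. \<Sum>j<d. \<bar>m i j t\<bar>)"

lemma m_sign:
  assumes "b < t" "i < d" "j < d"
  shows "m i j t = (if even (a i - a j) then \<bar>m i j t\<bar> else - \<bar>m i j t\<bar>)"
proof -
  have "0 < (if even (a i - a j) then 1 else -1) * (\<kappa> i t * \<kappa> j t)"
    using mult_pos_pos[OF kappa_sign[OF assms(1,2)] kappa_sign[OF assms(1,3)]] by (auto split: if_splits)
  then show ?thesis unfolding m_def
    by (auto simp: abs_if divide_less_0_iff not_less zero_le_divide_iff split: if_splits)
qed

text \<open>
  After symmetrization, an entry counts with the difference of the degrees of its indices.  Only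
  adjacent degrees occur, the order of the indices follows that of the degrees, and the sign of \<open>m\<close> is the
  parity of the difference, so each term becomes \<open>m - \<bar>m\<bar>\<close>.
\<close>

lemma E_deriv:
  assumes t: "b < t"
  shows "(E has_real_derivative ((\<Sum>i<d. \<Sum>j<d. m i j t) - \<nu> t)) (at t)"
proof -
  define \<epsilon> :: "nat \<Rightarrow> nat \<Rightarrow> real" where "\<epsilon> i j = (if i < j then 1 else if j < i then -1 else 0)" for i j
  have row: "4 * (\<Sum>j<d. m i j t) - 8 * (\<Sum>j<i. m i j t) - 4 * m i i t = 4 * (\<Sum>j<d. \<epsilon> i j * m i j t)"
    if "i < d" for i
  proof -
    have "(\<Sum>j<i. m i j t) = (\<Sum>j<d. (if j < i then m i j t else 0))"
      using that by (intro sum.mono_neutral_cong_left) auto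
    moreover have "m i i t = (\<Sum>j<d. (if j = i then m i j t else 0))" using that by simp
    moreover have "(\<Sum>j<d. \<epsilon> i j * m i j t) = (\<Sum>j<d. m i j t - 2 * (if j < i then m i j t else 0)
        - (if j = i then m i j t else 0))"
      by (intro sum.cong) (auto simp: \<epsilon>_def)
    ultimately show ?thesis by (simp add: sum_subtractf sum_distrib_left)
  qed
  have "(E has_real_derivative (\<Sum>i<d. of_int (a i) *
       (4 * (\<Sum>j<d. m i j t) - 8 * (\<Sum>j<i. m i j t) - 4 * m i i t))) (at t)"
    unfolding E_def[abs_def] by (intro DERIV_sum DERIV_cmult phi_deriv t) auto
  moreover have "(\<Sum>i<d. of_int (a i) * (4 * (\<Sum>j<d. m i j t) - 8 * (\<Sum>j<i. m i j t) - 4 * m i i t)) =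
      4 * (\<Sum>i<d. \<Sum>j<d. of_int (a i) * \<epsilon> i j * m i j t)"
  proof -
    have "(\<Sum>i<d. of_int (a i) * (4 * (\<Sum>j<d. m i j t) - 8 * (\<Sum>j<i. m i j t) - 4 * m i i t)) =
        (\<Sum>i<d. of_int (a i) * (4 * (\<Sum>j<d. \<epsilon> i j * m i j t)))"
      by (intro sum.cong refl) (simp only: row lessThan_iff)
    then show ?thesis by (simp add: sum_distrib_left mult_ac)
  qed
  moreover have "4 * (\<Sum>i<d. \<Sum>j<d. of_int (a i) * \<epsilon> i j * m i j t) =
      (\<Sum>i<d. \<Sum>j<d. 2 * (of_int (a i) - of_int (a j)) * \<epsilon> i j * m i j t)"
  proof -
    have "(\<Sum>i<d. \<Sum>j<d. of_int (a i) * \<epsilon> i j * m i j t) = (\<Sum>i<d. \<Sum>j<d. - of_int (a j) * \<epsilon> i j * m i j t)"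
      by (subst sum.swap) (intro sum.cong refl, simp add: \<epsilon>_def m_sym)
    moreover have "(\<Sum>i<d. \<Sum>j<d. 2 * (of_int (a i) - of_int (a j)) * \<epsilon> i j * m i j t) =
        2 * (\<Sum>i<d. \<Sum>j<d. of_int (a i) * \<epsilon> i j * m i j t) +
        2 * (\<Sum>i<d. \<Sum>j<d. - of_int (a j) * \<epsilon> i j * m i j t)"
      unfolding sum_distrib_left sum.distrib[symmetric]
      by (intro sum.cong refl) (simp only: algebra_simps, simp)
    ultimately show ?thesis by simp
  qed
  moreover have "2 * (of_int (a i) - of_int (a j)) * \<epsilon> i j * m i j t = m i j t - \<bar>m i j t\<bar>"
    if "i < d" "j < d" for i j
  proof -
    consider "1 < \<bar>a i - a j\<bar>" | "a i = a j" | "a i = a j + 1" | "a j = a i + 1" by linarith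
    then show ?thesis
    proof cases
      case 1
      then have "X j i t = 0" by (rule X_zero'[OF t that])
      then show ?thesis by (simp add: m_def)
    next
      case 2 then show ?thesis using m_sign[OF t that] by simp
    next
      case 3
      then have "i < j" using a_anti[of j i] that by (metis linorder_not_le zle_add1_eq_le order_less_irrefl)
      then show ?thesis using 3 m_sign[OF t that] by (simp add: \<epsilon>_def)
    next
      case 4
      then have "j < i" using a_anti[of i j] that by (metis linorder_not_le zle_add1_eq_le order_less_irrefl)
      then show ?thesis using 4 m_sign[OF t that] by (simp add: \<epsilon>_def)
    qed
  qed
  ultimately show ?thesis by (simp add: \<nu>_def sum_subtractf)
qed

end

section \<open>The Hodge metric of the flow\<close>

text \<open>
  A square array whose rows are orthonormal in one frame and whose columns are orthonormal in
  another one: the diagonal entries of a transformed matrix are bounded by its Frobenius norm.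
\<close>

lemma diagonal_entries_frobenius_bound:
  fixes T :: "nat \<Rightarrow> nat \<Rightarrow> complex" and x :: "nat \<Rightarrow> nat \<Rightarrow> complex"
  assumes row: "\<And>l. l < d' \<Longrightarrow> (\<Sum>i<d. (cmod (x l i))\<^sup>2) = 1"
    and col: "\<And>i j. i < d \<Longrightarrow> j < d \<Longrightarrow> (\<Sum>l<d'. x l i * cnj (x l j)) = (if i = j then 1 else 0)"
  shows "(\<Sum>l<d'. (Re (\<Sum>i<d. \<Sum>j<d. T i j * x l j * cnj (x l i)))\<^sup>2) \<le> (\<Sum>i<d. \<Sum>j<d. (cmod (T i j))\<^sup>2)"
proof -
  define Tx where "Tx l i = (\<Sum>j<d. T i j * x l j)" for l i
  have bound: "(Re (\<Sum>i<d. \<Sum>j<d. T i j * x l j * cnj (x l i)))\<^sup>2 \<le> (\<Sum>i<d. (cmod (Tx l i))\<^sup>2)"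
    if l: "l < d'" for l
  proof -
    have "\<bar>Re (\<Sum>i<d. \<Sum>j<d. T i j * x l j * cnj (x l i))\<bar> = \<bar>Re (\<Sum>i<d. Tx l i * cnj (x l i))\<bar>"
      by (simp add: Tx_def sum_distrib_right)
    also have "\<dots> \<le> cmod (\<Sum>i<d. Tx l i * cnj (x l i))" by (rule abs_Re_le_cmod)
    also have "\<dots> \<le> (\<Sum>i<d. \<bar>cmod (Tx l i)\<bar> * \<bar>cmod (x l i)\<bar>)"
      by (rule order_trans[OF norm_sum]) (simp add: norm_mult)
    also have "\<dots> \<le> L2_set (\<lambda>i. cmod (Tx l i)) {..<d} * L2_set (\<lambda>i. cmod (x l i)) {..<d}"
      by (rule L2_set_mult_ineq)
    also have "L2_set (\<lambda>i. cmod (x l i)) {..<d} = 1" unfolding L2_set_def using row[OF l] by simp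
    finally have "\<bar>Re (\<Sum>i<d. \<Sum>j<d. T i j * x l j * cnj (x l i))\<bar> \<le> \<bar>sqrt (\<Sum>i<d. (cmod (Tx l i))\<^sup>2)\<bar>"
      by (simp add: L2_set_def sum_nonneg)
    then have "(Re (\<Sum>i<d. \<Sum>j<d. T i j * x l j * cnj (x l i)))\<^sup>2 \<le> (sqrt (\<Sum>i<d. (cmod (Tx l i))\<^sup>2))\<^sup>2"
      by (rule abs_le_square_iff[THEN iffD1])
    then show ?thesis by (simp add: sum_nonneg)
  qed
  have "of_real (\<Sum>l<d'. \<Sum>i<d. (cmod (Tx l i))\<^sup>2) = (\<Sum>l<d'. \<Sum>i<d. Tx l i * cnj (Tx l i))"
    by (simp add: complex_norm_square[symmetric])
  also have "\<dots> = (\<Sum>i<d. \<Sum>l<d'. \<Sum>j<d. \<Sum>k<d. T i j * cnj (T i k) * (x l j * cnj (x l k)))"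
    by (subst sum.swap) (simp add: Tx_def sum_product mult_ac)
  also have "\<dots> = (\<Sum>i<d. \<Sum>j<d. \<Sum>k<d. T i j * cnj (T i k) * (\<Sum>l<d'. x l j * cnj (x l k)))"
    by (rule sum.cong[OF refl], subst sum.swap, rule sum.cong[OF refl], subst sum.swap)
       (simp add: sum_distrib_left)
  also have "\<dots> = (\<Sum>i<d. \<Sum>j<d. \<Sum>k<d. if j = k then T i j * cnj (T i k) else 0)"
    by (intro sum.cong refl) (simp add: col)
  also have "\<dots> = of_real (\<Sum>i<d. \<Sum>j<d. (cmod (T i j))\<^sup>2)"
    by (simp add: complex_norm_square[symmetric])
  finally have eq: "(\<Sum>l<d'. \<Sum>i<d. (cmod (Tx l i))\<^sup>2) = (\<Sum>i<d. \<Sum>j<d. (cmod (T i j))\<^sup>2)"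
    by (simp only: of_real_eq_iff)
  show ?thesis unfolding eq[symmetric] by (rule sum_mono, rule bound, simp)
qed

text \<open>
  The second flag, spanned by the initial parts of \<open>g\<close>, does not depend on \<open>t\<close> and is
  lowered by \<open>A\<close>.  Its distances in the moving Hodge metric measure the growth along the weight filtration.
\<close>

locale hodge_flow_flag = hodge_flow K A f d a b
  for K :: "real \<Rightarrow> complex ^ 'n \<Rightarrow> complex ^ 'n \<Rightarrow> complex"
    and A f d a b +
  fixes g :: "nat \<Rightarrow> complex ^ 'n" and d' :: nat
  assumes g_span: "vec.span (g ` {..<d'}) = UNIV"
    and g_indep: "l < d' \<Longrightarrow> g l \<notin> vec.span (g ` {..<l})"
    and g_lower: "l < d' \<Longrightarrow> A *v g l \<in> vec.span (g ` {..<l})"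
begin

text \<open>
  \<open>M\<close> is the Hodge metric: the form \<open>K\<close> made positive by changing its sign on the vectors of negative
  square.  \<open>du i\<close> is the derivative of the \<open>i\<close>-th coordinate of a constant vector.
\<close>

definition "M t u w = (\<Sum>i<d. K t u (v i t) * cnj (K t w (v i t)) / of_real \<bar>\<kappa> i t\<bar>)"
definition "du i t u = 2 * \<i> * K t (A *v u) (v i t) + K t u (v' t i)"
definition "M' t u w = (\<Sum>i<d. (du i t u * cnj (K t w (v i t)) + K t u (v i t) * cnj (du i t w)
     - of_real (\<phi> i t) * K t u (v i t) * cnj (K t w (v i t))) / of_real \<bar>\<kappa> i t\<bar>)"

lemma M_herm: "hermitian_form (M t)"
proof -
  have "M t w u = cnj (M t u w)" for u w by (simp add: M_def mult.commute)
  moreover have "M t (u + v) w = M t u w + M t v w" for u v w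
    by (simp add: M_def hermitian_formD(1)[OF K_herm] algebra_simps add_divide_distrib sum.distrib)
  moreover have "M t (c *s u) w = c * M t u w" for c u w
    by (simp add: M_def hermitian_formD(2)[OF K_herm] sum_distrib_left mult.assoc)
  ultimately show ?thesis unfolding hermitian_form_def by blast
qed

lemma M_Re: "Re (M t u u) = (\<Sum>i<d. (cmod (K t u (v i t)))\<^sup>2 / \<bar>\<kappa> i t\<bar>)"
proof -
  have "M t u u = of_real (\<Sum>i<d. (cmod (K t u (v i t)))\<^sup>2 / \<bar>\<kappa> i t\<bar>)"
    by (simp add: M_def complex_norm_square[symmetric, unfolded of_real_power])
  then show ?thesis by simp
qed

lemma M_pos:
  assumes t: "b < t" and u: "u \<noteq> 0"
  shows "0 < Re (M t u u)"
proof -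
  have "\<exists>i<d. K t u (v i t) \<noteq> 0"
  proof (rule ccontr)
    assume "\<not> ?thesis"
    then have "u = (\<Sum>i<d. 0)"
      by (subst orthogonal_frame_expansion[OF frame[OF t], of u]) (intro sum.cong, auto)
    then show False using u by simp
  qed
  then obtain i where "i < d" "K t u (v i t) \<noteq> 0" by blast
  then have "0 < (cmod (K t u (v i t)))\<^sup>2 / \<bar>\<kappa> i t\<bar>" using kappa_nz[OF t] by simp
  then show ?thesis unfolding M_Re using \<open>i < d\<close> by (intro sum_pos2[of _ i]) auto
qed

lemma abs_kappa_deriv:
  assumes "b < t" "i < d"
  shows "((\<lambda>s. \<bar>\<kappa> i s\<bar>) has_real_derivative \<phi> i t * \<bar>\<kappa> i t\<bar>) (at t)"
proof -
  let ?s = "(if even (a i) then 1 else -1) :: real"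
  have "((\<lambda>s. ?s * \<kappa> i s) has_real_derivative ?s * (\<phi> i t * \<kappa> i t)) (at t)"
    by (intro DERIV_cmult kappa_deriv assms)
  moreover have eq: "?s * \<kappa> i s = \<bar>\<kappa> i s\<bar>" if "b < s" for s
    using kappa_sign[OF that assms(2)] by (auto split: if_splits)
  ultimately have "((\<lambda>s. \<bar>\<kappa> i s\<bar>) has_real_derivative ?s * (\<phi> i t * \<kappa> i t)) (at t)"
    using assms(1) by (auto elim!: has_field_derivative_transform_within_open[of _ _ _ "{b<..}"])
  then show ?thesis using eq[OF assms(1)] by (simp add: mult.left_commute)
qed

lemma M_deriv:
  assumes t: "b < t"
  shows "form_derivative M (M' t) t"
  unfolding form_derivative_def
proof (intro allI)
  fix u w
  have D: "((\<lambda>s. K s u (v i s)) has_vector_derivative du i t u) (at t)" if "i < d" for i u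
    using form_derivative_product_rule[OF K_herm K_deriv _ v_deriv(1)[OF t that], of "\<lambda>_. u" 0]
    by (simp add: du_def hermitian_form_zero[OF K_herm])
  have "((\<lambda>s. K s u (v i s) * cnj (K s w (v i s)) / of_real \<bar>\<kappa> i s\<bar>) has_vector_derivative
     ((du i t u * cnj (K t w (v i t)) + K t u (v i t) * cnj (du i t w)
     - of_real (\<phi> i t) * K t u (v i t) * cnj (K t w (v i t))) / of_real \<bar>\<kappa> i t\<bar>)) (at t)" if i: "i < d" for i
  proof -
    note nz = kappa_nz[OF t i]
    have "((\<lambda>s. inverse \<bar>\<kappa> i s\<bar>) has_real_derivative - (inverse \<bar>\<kappa> i t\<bar> * (\<phi> i t * \<bar>\<kappa> i t\<bar>) * inverse \<bar>\<kappa> i t\<bar>)) (at t)"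
      using nz by (intro DERIV_inverse' abs_kappa_deriv t i) auto
    then have "((\<lambda>s. of_real (inverse \<bar>\<kappa> i s\<bar>) :: complex) has_vector_derivative
        of_real (- (inverse \<bar>\<kappa> i t\<bar> * (\<phi> i t * \<bar>\<kappa> i t\<bar>) * inverse \<bar>\<kappa> i t\<bar>))) (at t)"
      by (intro has_vector_derivative_of_real) (simp add: has_real_derivative_iff_has_vector_derivative)
    note quotient = has_vector_derivative_mult[OF has_vector_derivative_mult[OF D[OF i, of u] has_vector_derivative_cnj[OF D[OF i, of w]]] this]
    have alg: "x * y * - (inverse c * (p * c) * inverse c) + (x * y' + x' * y) * inverse c =
        (x' * y + x * y' - p * x * y) * inverse c" if "c \<noteq> 0" for x y x' y' p c :: complex
      using that by (simp add: field_simps)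
    have nz': "complex_of_real \<bar>\<kappa> i t\<bar> \<noteq> 0" using nz by simp
    show ?thesis
      unfolding divide_inverse of_real_inverse[symmetric]
      by (rule has_vector_derivative_eq_rhs[OF quotient])
         (simp only: of_real_minus of_real_mult of_real_inverse alg[OF nz'])
  qed
  then show "((\<lambda>t. M t u w) has_vector_derivative M' t u w) (at t)"
    unfolding M_def M'_def by (intro has_vector_derivative_sum) auto
qed

lemma M_regular: "b < t \<Longrightarrow> regular_along (M t) g d'"
proof (rule regular_alongI[OF M_herm])
  fix l u assume *: "b < t" "l < d'" "g l - u \<in> vec.span (g ` {..<l})"
  have "u \<noteq> 0" using * g_indep by auto
  then show "M t u u \<noteq> 0" using M_pos[OF *(1)] by fastforce
qed

text \<open>
  \<open>\<delta> l\<close> is the squared distance of \<open>g l\<close> to the span of the earlier vectors.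
\<close>

definition "e l t = gram_schmidt (M t) g l"
definition "\<delta> l t = Re (M t (e l t) (e l t))"

lemma M_frame: "b < t \<Longrightarrow> orthogonal_frame (M t) (\<lambda>l. e l t) d'"
  using orthogonal_frame_gram_schmidt[OF M_herm M_regular g_span] by (simp add: e_def)

lemma M_ee: "M t (e l t) (e l t) = of_real (\<delta> l t)"
  using hermitian_form_real[OF M_herm] by (simp add: \<delta>_def complex_eq_iff)

lemma delta_pos: "b < t \<Longrightarrow> l < d' \<Longrightarrow> 0 < \<delta> l t"
  unfolding \<delta>_def
proof (rule M_pos)
  assume "b < t" "l < d'"
  then have "M t (e l t) (e l t) \<noteq> 0" using M_frame[of t] by (auto simp: orthogonal_frame_def)
  then show "e l t \<noteq> 0" using hermitian_form_zero[OF M_herm] by metis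
qed

lemma e_orth_span: "b < t \<Longrightarrow> l < d' \<Longrightarrow> w \<in> vec.span (g ` {..<l}) \<Longrightarrow> M t (e l t) w = 0"
  unfolding e_def by (rule gram_schmidt_orthogonal_span[OF M_herm M_regular])

lemma A_lowers:
  assumes "l \<le> d'" "u \<in> vec.span (g ` {..<l})"
  shows "A *v u \<in> vec.span (g ` {..<l})"
  using assms(2)
proof (induction rule: vec.span_induct_alt)
  case base then show ?case by (simp add: vec.span_zero)
next
  case (step c x y)
  then obtain k where k: "k < l" "x = g k" by auto
  then have "A *v x \<in> vec.span (g ` {..<l})"
    using g_lower[of k] assms(1) span_image_lessThan_mono[of k l g] by auto
  then show ?case using step
    by (simp add: matrix_vector_right_distrib vec.scale vec.span_add vec.span_scale)
qed

lemma A_e: "l < d' \<Longrightarrow> A *v e l t \<in> vec.span (g ` {..<l})"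
proof -
  assume l: "l < d'"
  have "A *v e l t = A *v g l - A *v (g l - e l t)" by (simp add: matrix_vector_mult_diff_distrib)
  then show ?thesis
    using g_lower[OF l] A_lowers[of l "g l - e l t"] l gram_schmidt_diff[of g l "M t"]
    by (metis e_def less_imp_le vec.span_diff)
qed

text \<open>
  The sum is the trace of the square of \<open>A\<close>, up to sign.  Computed in a frame adapted to the flag that
  \<open>A\<close> lowers, the trace is zero.
\<close>

lemma trace_m_zero:
  assumes t: "b < t"
  shows "(\<Sum>i<d. \<Sum>j<d. m i j t) = 0"
proof -
  have vA: "K t (v j t) (A *v w) = cnj (K t (A *v w) (v j t))" for j w
    by (rule hermitian_formD(3)[OF K_herm])
  have L: "Vector_Spaces.linear (*s) (*s) (\<lambda>u. A *v (A *v u))"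
    using Vector_Spaces.linear_compose[OF matrix_vector_mul_linear_gen matrix_vector_mul_linear_gen, of A A]
    by (simp add: o_def)
  have "M t (A *v (A *v e l t)) (e l t) = 0" if "l < d'" for l
    by (rule hermitian_form_sym_zero[OF M_herm], rule e_orth_span[OF t that])
       (use A_lowers[of l] A_e[OF that] that in auto)
  then have "(\<Sum>i<d. K t (A *v (A *v v i t)) (v i t) / K t (v i t) (v i t)) = 0"
    by (subst orthogonal_frame_trace[OF frame[OF t] M_frame[OF t] L]) simp
  moreover have "K t (A *v (A *v v i t)) (v i t) / K t (v i t) (v i t) = - of_real (\<Sum>j<d. m i j t)"
    if "i < d" for i
  proof -
    have "K t (A *v (A *v v i t)) (v i t) = - K t (A *v v i t) (A *v v i t)" by (rule K_skew)
    also have "K t (A *v v i t) (A *v v i t) = of_real (\<Sum>j<d. (cmod (X j i t))\<^sup>2 / \<kappa> j t)"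
      by (subst orthogonal_frame_parseval[OF frame[OF t] K_herm])
         (simp add: K_vv vA X_def[symmetric] complex_norm_square[symmetric])
    finally show ?thesis by (simp add: K_vv m_def sum_divide_distrib mult.commute)
  qed
  ultimately have "complex_of_real (\<Sum>i<d. \<Sum>j<d. m i j t) = 0" by (simp add: sum_negf)
  then show ?thesis by (simp only: of_real_eq_0_iff)
qed

lemma E_deriv': "b < t \<Longrightarrow> (E has_real_derivative - \<nu> t) (at t)"
  using E_deriv[of t] trace_m_zero[of t] by simp

text \<open>
  The frame vector moves within the span of its predecessors, to which it is orthogonal, so only the
  derivative of the metric contributes.
\<close>

lemma delta_deriv:
  assumes "b < t" "l < d'"
  shows "(\<delta> l has_real_derivative Re (M' t (e l t) (e l t))) (at t)"
proof -
  obtain e' where e': "(e l has_vector_derivative e') (at t)" "e' \<in> vec.span (g ` {..<l})"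
    using gram_schmidt_has_derivative[OF M_herm M_deriv[OF assms(1)] M_regular[OF assms(1)] assms(2)]
    unfolding e_def[abs_def] by blast
  have z: "M t (e l t) e' = 0" "M t e' (e l t) = 0"
    using e_orth_span[OF assms e'(2)] hermitian_form_sym_zero[OF M_herm] by auto
  have "((\<lambda>s. M s (e l s) (e l s)) has_vector_derivative
      (M' t (e l t) (e l t) + M t e' (e l t) + M t (e l t) e')) (at t)"
    by (rule form_derivative_product_rule[OF M_herm M_deriv[OF assms(1)] e'(1) e'(1)])
  from has_vector_derivative_Re[OF this[unfolded z]]
  show ?thesis by (simp add: \<delta>_def[abs_def])
qed

end

section \<open>Estimates for the Hodge metric\<close>

context hodge_flow_flag begin

definition "Z i j t = cnj (X j i t) / of_real (\<kappa> j t)"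

lemma K_A_expand:
  assumes "b < t"
  shows "K t (A *v u) (v i t) = - (\<Sum>j<d. Z i j t * K t u (v j t))"
proof -
  have vA: "K t (v j t) (A *v w) = cnj (K t (A *v w) (v j t))" for j w
    by (rule hermitian_formD(3)[OF K_herm])
  have "K t u (A *v v i t) = (\<Sum>j<d. K t u (v j t) / K t (v j t) (v j t) * K t (v j t) (A *v v i t))"
    by (rule orthogonal_frame_parseval[OF frame[OF assms] K_herm])
  also have "\<dots> = (\<Sum>j<d. Z i j t * K t u (v j t))"
    by (simp add: vA X_def[symmetric] Z_def K_vv mult.commute)
  finally show ?thesis by (simp only: K_skew)
qed

text \<open>
  The frame vectors move so as to stay orthogonal.  Their motion cancels one triangular half of the
  matrix of \<open>A\<close> and leaves the other one.
\<close>

lemma du_expand: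
  assumes t: "b < t" "i < d"
  shows "du i t u = (\<Sum>j<d. (if j < i then 0 else - 2 * \<i>) * Z i j t * K t u (v j t))"
proof -
  have h: "cnj (K t w u) = K t u w" for w by (rule hermitian_formD(3)[OF K_herm, symmetric])
  have "K t u (v' t i) = cnj (K t (v' t i) u)" by (rule hermitian_formD(3)[OF K_herm])
  also have "\<dots> = (\<Sum>j<i. 2 * \<i> * Z i j t * cnj (K t (v j t) u))"
    unfolding K_v'_expand[OF t] by (simp add: Z_def)
  also have "\<dots> = (\<Sum>j<i. 2 * \<i> * Z i j t * K t u (v j t))"
    by (simp only: h)
  also have "\<dots> = (\<Sum>j<d. if j < i then 2 * \<i> * Z i j t * K t u (v j t) else 0)"
    using t by (intro sum.mono_neutral_cong_left) auto
  finally have "du i t u = (\<Sum>j<d. - 2 * \<i> * Z i j t * K t u (v j t) +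
      (if j < i then 2 * \<i> * Z i j t * K t u (v j t) else 0))"
    by (simp add: du_def K_A_expand[OF t(1)] sum.distrib sum_distrib_left sum_negf sum_subtractf mult.assoc)
  also have "\<dots> = (\<Sum>j<d. (if j < i then 0 else - 2 * \<i>) * Z i j t * K t u (v j t))"
    by (intro sum.cong) auto
  finally show ?thesis .
qed

definition "\<eta> i j = (if i < j then -1 else if j < i then 1 else 0 :: real)"

text \<open>
  The endomorphism lowers the flag, so \<open>M t (A u) u\<close> is zero for \<open>u = e l t\<close>.  Adding a multiple of this term
  replaces the triangular half of the matrix by an antisymmetric combination of both halves, in which
  the contributions of \<open>(i, j)\<close> and \<open>(j, i)\<close> cancel if the degrees have the same parity.
\<close>

lemma Re_M'_e:
  assumes t: "b < t" and l: "l < d'"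
  defines "u \<equiv> e l t"
  defines "Wm \<equiv> \<lambda>i j. Z i j t * K t u (v j t) * cnj (K t u (v i t)) / of_real \<bar>\<kappa> i t\<bar>"
  shows "Re (M' t u u) = (\<Sum>i<d. \<Sum>j<d. if even (a i - a j) then 0 else Re (2 * \<i> * \<eta> i j * Wm i j))"
proof -
  have MA: "M t (A *v u) u = - (\<Sum>i<d. \<Sum>j<d. Wm i j)"
    unfolding M_def K_A_expand[OF t] Wm_def
    by (simp add: sum_negf sum_distrib_right sum_divide_distrib)
  have "M t u (A *v u) = 0" unfolding u_def by (rule e_orth_span[OF t l A_e[OF l]])
  then have "M t (A *v u) u = 0" by (rule hermitian_form_sym_zero[OF M_herm])
  then have W0: "(\<Sum>i<d. \<Sum>j<d. Wm i j) = 0" using MA by simp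
  have row: "Re ((du i t u * cnj (K t u (v i t)) + K t u (v i t) * cnj (du i t u)
     - of_real (\<phi> i t) * K t u (v i t) * cnj (K t u (v i t))) / of_real \<bar>\<kappa> i t\<bar>) +
     Re (2 * \<i> * (\<Sum>j<d. Wm i j)) = (\<Sum>j<d. Re (2 * \<i> * \<eta> i j * Wm i j))" if i: "i < d" for i
  proof -
    let ?u = "K t u (v i t)"
    have 1: "Re ((du i t u * cnj ?u + ?u * cnj (du i t u)) / of_real \<bar>\<kappa> i t\<bar>) =
        Re (2 * (du i t u * cnj ?u / of_real \<bar>\<kappa> i t\<bar>))"
      by (simp add: Re_divide_of_real)
    have 2: "2 * (du i t u * cnj ?u / of_real \<bar>\<kappa> i t\<bar>) =
        (\<Sum>j<d. 2 * (if j < i then 0 else - 2 * \<i>) * Wm i j)"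
      unfolding du_expand[OF t i] Wm_def
      by (simp add: sum_distrib_right sum_distrib_left sum_divide_distrib mult.assoc)
    have "Z i i t = of_real (- Im (X i i t) / \<kappa> i t) * \<i>"
      using Re_X_diag[of i t] by (simp add: Z_def complex_eq_iff Re_divide_of_real Im_divide_of_real)
    then have 3: "Re (of_real (\<phi> i t) * ?u * cnj ?u / of_real \<bar>\<kappa> i t\<bar>) = Re (- 2 * \<i> * Wm i i)"
      by (simp add: Wm_def \<phi>_def Re_divide_of_real algebra_simps)
    have "(\<Sum>j<d. 2 * (if j < i then 0 else - 2 * \<i>) * Wm i j) + 2 * \<i> * (\<Sum>j<d. Wm i j) =
       (\<Sum>j<d. 2 * \<i> * \<eta> i j * Wm i j + (if j = i then - 2 * \<i> * Wm i i else 0))"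
      unfolding sum_distrib_left sum.distrib[symmetric]
      by (intro sum.cong) (auto simp: \<eta>_def)
    also have "\<dots> = (\<Sum>j<d. 2 * \<i> * \<eta> i j * Wm i j) - 2 * \<i> * Wm i i"
      using i by (simp add: sum.distrib)
    finally have "Re (\<Sum>j<d. 2 * (if j < i then 0 else - 2 * \<i>) * Wm i j) + Re (2 * \<i> * (\<Sum>j<d. Wm i j)) =
       Re (\<Sum>j<d. 2 * \<i> * \<eta> i j * Wm i j) + Re (- 2 * \<i> * Wm i i)"
      by (metis (no_types, lifting) plus_complex.sel(1) diff_conv_add_uminus mult_minus_left)
    then show ?thesis using 1 2 3 by (simp only: diff_divide_distrib minus_complex.sel Re_sum)
  qed
  have "Re (M' t u u) = Re (M' t u u) + Re (2 * \<i> * (\<Sum>i<d. \<Sum>j<d. Wm i j))" by (simp only: W0) simp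
  also have "\<dots> = (\<Sum>i<d. Re ((du i t u * cnj (K t u (v i t)) + K t u (v i t) * cnj (du i t u)
     - of_real (\<phi> i t) * K t u (v i t) * cnj (K t u (v i t))) / of_real \<bar>\<kappa> i t\<bar>) +
     Re (2 * \<i> * (\<Sum>j<d. Wm i j)))"
    unfolding M'_def by (simp only: Re_sum sum_distrib_left sum.distrib)
  also have "\<dots> = (\<Sum>i<d. \<Sum>j<d. Re (2 * \<i> * \<eta> i j * Wm i j))" by (intro sum.cong refl row) simp
  also have "\<dots> = (\<Sum>i<d. \<Sum>j<d. (if even (a i - a j) then 0 else Re (2 * \<i> * \<eta> i j * Wm i j)) +
      (if even (a i - a j) then Re (2 * \<i> * \<eta> i j * Wm i j) else 0))"
    by (intro sum.cong) auto
  finally have main: "Re (M' t u u) = (\<Sum>i<d. \<Sum>j<d. if even (a i - a j) then 0 else Re (2 * \<i> * \<eta> i j * Wm i j)) +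
      (\<Sum>i<d. \<Sum>j<d. if even (a i - a j) then Re (2 * \<i> * \<eta> i j * Wm i j) else 0)" (is "_ = _ + ?same")
    by (simp only: sum.distrib)
  have anti: "(if even (a i - a j) then Re (2 * \<i> * \<eta> i j * Wm i j) else 0) =
     - (if even (a j - a i) then Re (2 * \<i> * \<eta> j i * Wm j i) else 0)" if "i < d" "j < d" for i j
  proof (cases "even (a i - a j)")
    case True
    have ks: "\<kappa> i t * \<bar>\<kappa> j t\<bar> = \<kappa> j t * \<bar>\<kappa> i t\<bar>"
      using kappa_sign[OF t that(1)] kappa_sign[OF t that(2)] True by (auto split: if_splits)
    have nz: "\<kappa> i t \<noteq> 0" "\<kappa> j t \<noteq> 0" using kappa_nz[OF t] that by auto
    have "Wm j i = - cnj (Wm i j)"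
    proof -
      have "Z j i t = - X j i t / of_real (\<kappa> i t)" unfolding Z_def by (simp add: X_skew[of i j t])
      then have "Wm j i = - (X j i t * K t u (v i t) * cnj (K t u (v j t))) / of_real (\<kappa> i t * \<bar>\<kappa> j t\<bar>)"
        by (simp add: Wm_def)
      also have "\<dots> = - (X j i t * K t u (v i t) * cnj (K t u (v j t))) / of_real (\<kappa> j t * \<bar>\<kappa> i t\<bar>)"
        unfolding ks ..
      also have "\<dots> = - cnj (Wm i j)" by (simp add: Wm_def Z_def mult_ac)
      finally show ?thesis .
    qed
    then show ?thesis using True by (simp add: \<eta>_def)
  next
    case False then show ?thesis by simp
  qed
  have "?same = (\<Sum>i<d. \<Sum>j<d. - (if even (a j - a i) then Re (2 * \<i> * \<eta> j i * Wm j i) else 0))"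
    by (intro sum.cong refl anti) auto
  also have "\<dots> = - ?same" by (subst (2) sum.swap) (simp only: sum_negf)
  finally show ?thesis using main by simp
qed

lemma M_v:
  assumes "b < t" "j < d"
  shows "M t u (v j t) = K t u (v j t) * of_real (sgn (\<kappa> j t))"
proof -
  have "M t u (v j t) = (\<Sum>i<d. if i = j then K t u (v j t) * of_real (\<kappa> j t) / of_real \<bar>\<kappa> j t\<bar> else 0)"
    unfolding M_def using assms v_orth[OF assms(1) assms(2)] by (intro sum.cong) (auto simp: K_vv)
  then show ?thesis using assms kappa_nz[OF assms] by (simp add: sgn_div_norm divide_inverse mult.assoc)
qed

text \<open>
  The sum of all \<open>m\<close> is zero, and \<open>m\<close> is positive between equal degrees and negative between
  adjacent ones.  So both kinds contribute half of \<open>\<nu>\<close>.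
\<close>

lemma sum_adjacent_m:
  assumes t: "b < t"
  shows "(\<Sum>i<d. \<Sum>j<d. if even (a i - a j) then 0 else 4 * \<bar>m i j t\<bar>) = 2 * \<nu> t"
proof -
  have "(\<Sum>i<d. \<Sum>j<d. if even (a i - a j) then 0 else 4 * \<bar>m i j t\<bar>) =
      (\<Sum>i<d. \<Sum>j<d. 2 * \<bar>m i j t\<bar> - 2 * m i j t)"
    using m_sign[OF t] by (intro sum.cong refl) (smt (verit) lessThan_iff)
  also have "\<dots> = 2 * \<nu> t - 2 * (\<Sum>i<d. \<Sum>j<d. m i j t)"
    by (simp only: \<nu>_def sum_subtractf sum_distrib_left)
  finally show ?thesis by (simp add: trace_m_zero[OF t])
qed

text \<open>
  The logarithmic derivatives of the \<open>\<delta> l\<close> are the diagonal entries of one matrix in a unitary frame,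
  and its Frobenius norm is read off in the Hodge frame.
\<close>

lemma delta_log_deriv_square_sum:
  assumes t: "b < t"
  shows "(\<Sum>l<d'. (Re (M' t (e l t) (e l t)) / \<delta> l t)\<^sup>2) \<le> 2 * \<nu> t"
proof -
  define x where "x l i = K t (e l t) (v i t) / of_real (sqrt (\<bar>\<kappa> i t\<bar> * \<delta> l t))" for l i
  define Y where "Y i j = Z i j t * of_real (sqrt \<bar>\<kappa> j t\<bar> / sqrt \<bar>\<kappa> i t\<bar>)" for i j
  define T where "T i j = (if even (a i - a j) then 0 else 2 * \<i> * \<eta> i j * Y i j)" for i j
  note nz = kappa_nz[OF t] and dp = delta_pos[OF t]
  have row: "(\<Sum>i<d. (cmod (x l i))\<^sup>2) = 1" if l: "l < d'" for l
  proof -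
    have "(cmod (x l i))\<^sup>2 = (cmod (K t (e l t) (v i t)))\<^sup>2 / \<bar>\<kappa> i t\<bar> / \<delta> l t" for i
      using dp[OF l] by (simp add: x_def norm_divide power_divide)
    then have "(\<Sum>i<d. (cmod (x l i))\<^sup>2) = Re (M t (e l t) (e l t)) / \<delta> l t"
      by (simp add: M_Re sum_divide_distrib)
    then show ?thesis using dp[OF l] by (simp add: \<delta>_def)
  qed
  have col: "(\<Sum>l<d'. x l i * cnj (x l j)) = (if i = j then 1 else 0)" if ij: "i < d" "j < d" for i j
  proof -
    have "K t (v j t) (v i t) * of_real (sgn (\<kappa> i t)) = M t (v j t) (v i t)" by (rule M_v[OF t ij(1), symmetric])
    also have "\<dots> = (\<Sum>l<d'. M t (v j t) (e l t) / M t (e l t) (e l t) * M t (e l t) (v i t))"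
      by (rule orthogonal_frame_parseval[OF M_frame[OF t] M_herm])
    also have "\<dots> = (\<Sum>l<d'. cnj (M t (e l t) (v j t)) / \<delta> l t * M t (e l t) (v i t))"
      by (intro sum.cong refl) (subst hermitian_formD(3)[OF M_herm, of t "v j t"], simp only: M_ee)
    also have "\<dots> = (\<Sum>l<d'. x l i * cnj (x l j)) * of_real (sqrt \<bar>\<kappa> i t\<bar> * sqrt \<bar>\<kappa> j t\<bar> * sgn (\<kappa> i t) * sgn (\<kappa> j t))"
      unfolding sum_distrib_right
    proof (intro sum.cong refl)
      fix l assume "l \<in> {..<d'}"
      then have "0 < \<delta> l t" using dp by simp
      then have "complex_of_real (\<delta> l t) = of_real (sqrt (\<delta> l t)) * of_real (sqrt (\<delta> l t))"
        by (simp flip: of_real_mult)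
      then show "cnj (M t (e l t) (v j t)) / \<delta> l t * M t (e l t) (v i t) =
          x l i * cnj (x l j) * of_real (sqrt \<bar>\<kappa> i t\<bar> * sqrt \<bar>\<kappa> j t\<bar> * sgn (\<kappa> i t) * sgn (\<kappa> j t))"
        using nz[OF ij(1)] nz[OF ij(2)] \<open>0 < \<delta> l t\<close>
        by (simp add: M_v[OF t] ij x_def real_sqrt_mult field_simps)
    qed
    finally have eq: "K t (v j t) (v i t) * of_real (sgn (\<kappa> i t)) =
      (\<Sum>l<d'. x l i * cnj (x l j)) * of_real (sqrt \<bar>\<kappa> i t\<bar> * sqrt \<bar>\<kappa> j t\<bar> * sgn (\<kappa> i t) * sgn (\<kappa> j t))" .
    show ?thesis
    proof (cases "i = j")
      case True
      have "of_real (\<kappa> i t) * complex_of_real (sgn (\<kappa> i t)) = (\<Sum>l<d'. x l i * cnj (x l j)) * of_real \<bar>\<kappa> i t\<bar>"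
        using eq True nz[OF ij(1)] by (simp add: K_vv sgn_if split: if_splits)
      moreover have "of_real (\<kappa> i t) * complex_of_real (sgn (\<kappa> i t)) = of_real \<bar>\<kappa> i t\<bar>"
        by (simp add: sgn_if abs_if)
      ultimately show ?thesis using True nz[OF ij(1)] by simp
    next
      case False
      then show ?thesis using eq v_orth[OF t ij(2) ij(1)] nz[OF ij(1)] nz[OF ij(2)] by (auto simp: sgn_eq_0_iff)
    qed
  qed
  have key: "Re (M' t (e l t) (e l t)) / \<delta> l t = Re (\<Sum>i<d. \<Sum>j<d. T i j * x l j * cnj (x l i))"
    if l: "l < d'" for l
  proof -
    have "Re (M' t (e l t) (e l t)) / \<delta> l t = (\<Sum>i<d. \<Sum>j<d. (if even (a i - a j) then 0 else
       Re (2 * \<i> * \<eta> i j * (Z i j t * K t (e l t) (v j t) * cnj (K t (e l t) (v i t)) / of_real \<bar>\<kappa> i t\<bar>))) / \<delta> l t)"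
      unfolding Re_M'_e[OF t l] sum_divide_distrib ..
    also have "\<dots> = (\<Sum>i<d. \<Sum>j<d. Re (T i j * x l j * cnj (x l i)))"
    proof (intro sum.cong refl)
      fix i j assume ij: "i \<in> {..<d}" "j \<in> {..<d}"
      have d2: "complex_of_real (\<delta> l t) = of_real (sqrt (\<delta> l t)) * of_real (sqrt (\<delta> l t))"
        using dp[OF l] by (simp flip: of_real_mult)
      have k2: "complex_of_real \<bar>\<kappa> i t\<bar> = of_real (sqrt \<bar>\<kappa> i t\<bar>) * of_real (sqrt \<bar>\<kappa> i t\<bar>)"
        by (simp flip: of_real_mult)
      have "Y i j * x l j * cnj (x l i) =
         Z i j t * K t (e l t) (v j t) * cnj (K t (e l t) (v i t)) / of_real \<bar>\<kappa> i t\<bar> / of_real (\<delta> l t)"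
        unfolding d2 k2 using nz[of i] nz[of j] ij dp[OF l]
        by (simp add: Y_def x_def real_sqrt_mult field_simps)
      then have "T i j * x l j * cnj (x l i) = (if even (a i - a j) then 0 else
         2 * \<i> * \<eta> i j * (Z i j t * K t (e l t) (v j t) * cnj (K t (e l t) (v i t)) / of_real \<bar>\<kappa> i t\<bar>) / of_real (\<delta> l t))"
        by (simp add: T_def mult.assoc)
      then show "(if even (a i - a j) then 0 else
       Re (2 * \<i> * \<eta> i j * (Z i j t * K t (e l t) (v j t) * cnj (K t (e l t) (v i t)) / of_real \<bar>\<kappa> i t\<bar>))) / \<delta> l t =
        Re (T i j * x l j * cnj (x l i))"
        by (simp only: Re_divide_of_real if_distrib[of Re] zero_complex.sel split: if_split) auto
    qed
    finally show ?thesis by (simp only: Re_sum)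
  qed
  have "(\<Sum>l<d'. (Re (M' t (e l t) (e l t)) / \<delta> l t)\<^sup>2) =
      (\<Sum>l<d'. (Re (\<Sum>i<d. \<Sum>j<d. T i j * x l j * cnj (x l i)))\<^sup>2)"
    by (intro sum.cong refl) (simp only: key lessThan_iff)
  also have "\<dots> \<le> (\<Sum>i<d. \<Sum>j<d. (cmod (T i j))\<^sup>2)"
    by (rule diagonal_entries_frobenius_bound[OF row col])
  also have "\<dots> = (\<Sum>i<d. \<Sum>j<d. if even (a i - a j) then 0 else 4 * \<bar>m i j t\<bar>)"
  proof (intro sum.cong refl)
    fix i j assume ij: "i \<in> {..<d}" "j \<in> {..<d}"
    have "(cmod (Y i j))\<^sup>2 = \<bar>m i j t\<bar>"
      using nz[of i] nz[of j] ij
      by (simp add: Y_def Z_def m_def norm_mult norm_divide power_mult_distrib power_divide abs_mult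
          power2_eq_square field_simps)
    moreover have "i \<noteq> j" if "odd (a i - a j)" using that by auto
    ultimately show "(cmod (T i j))\<^sup>2 = (if even (a i - a j) then 0 else 4 * \<bar>m i j t\<bar>)"
      by (auto simp: T_def norm_mult power_mult_distrib \<eta>_def)
  qed
  also have "\<dots> = 2 * \<nu> t" by (rule sum_adjacent_m[OF t])
  finally show ?thesis .
qed

text \<open>
  The operator norm is at most the Hilbert-Schmidt norm.
\<close>

lemma M_A_bound:
  assumes t: "b < t"
  shows "Re (M t (A *v u) (A *v u)) \<le> \<nu> t * Re (M t u u)"
proof -
  note nz = kappa_nz[OF t]
  have "(cmod (K t (A *v u) (v i t)))\<^sup>2 / \<bar>\<kappa> i t\<bar> \<le> (\<Sum>j<d. \<bar>m i j t\<bar>) * Re (M t u u)" if i: "i < d" for i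
  proof -
    have "cmod (K t (A *v u) (v i t)) \<le> (\<Sum>j<d. cmod (Z i j t) * cmod (K t u (v j t)))"
      unfolding K_A_expand[OF t] norm_minus_cancel by (rule order_trans[OF norm_sum]) (simp add: norm_mult)
    also have "\<dots> = (\<Sum>j<d. \<bar>cmod (Z i j t) * sqrt \<bar>\<kappa> j t\<bar>\<bar> * \<bar>cmod (K t u (v j t)) / sqrt \<bar>\<kappa> j t\<bar>\<bar>)"
      using nz by (intro sum.cong) (auto simp: abs_mult)
    also have "\<dots> \<le> L2_set (\<lambda>j. cmod (Z i j t) * sqrt \<bar>\<kappa> j t\<bar>) {..<d} * L2_set (\<lambda>j. cmod (K t u (v j t)) / sqrt \<bar>\<kappa> j t\<bar>) {..<d}"
      by (rule L2_set_mult_ineq)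
    finally have "(cmod (K t (A *v u) (v i t)))\<^sup>2 \<le>
       (L2_set (\<lambda>j. cmod (Z i j t) * sqrt \<bar>\<kappa> j t\<bar>) {..<d} * L2_set (\<lambda>j. cmod (K t u (v j t)) / sqrt \<bar>\<kappa> j t\<bar>) {..<d})\<^sup>2"
      by (rule power_mono) simp
    also have "\<dots> = (\<Sum>j<d. (cmod (Z i j t))\<^sup>2 * \<bar>\<kappa> j t\<bar>) * Re (M t u u)"
      by (simp add: power_mult_distrib L2_set_def sum_nonneg M_Re power_divide)
    also have "(\<Sum>j<d. (cmod (Z i j t))\<^sup>2 * \<bar>\<kappa> j t\<bar>) = (\<Sum>j<d. \<bar>m i j t\<bar>) * \<bar>\<kappa> i t\<bar>"
      unfolding sum_distrib_right using nz i
      by (intro sum.cong refl) (simp add: Z_def m_def norm_divide power_divide abs_mult power2_eq_square field_simps)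
    finally show ?thesis using nz[OF i] by (simp add: divide_simps mult_ac)
  qed
  then have "(\<Sum>i<d. (cmod (K t (A *v u) (v i t)))\<^sup>2 / \<bar>\<kappa> i t\<bar>) \<le> (\<Sum>i<d. (\<Sum>j<d. \<bar>m i j t\<bar>) * Re (M t u u))"
    by (intro sum_mono) auto
  then show ?thesis by (simp add: M_Re[of t "A *v u"] \<nu>_def sum_distrib_right)
qed

lemma nu_nonneg: "0 \<le> \<nu> t" unfolding \<nu>_def by (intro sum_nonneg) auto

lemma M_A_power_bound:
  assumes t: "b < t"
  shows "Re (M t (((*v) A ^^ r) u) (((*v) A ^^ r) u)) \<le> \<nu> t ^ r * Re (M t u u)"
proof (induction r)
  case 0 then show ?case by simp
next
  case (Suc r)
  have "Re (M t (((*v) A ^^ Suc r) u) (((*v) A ^^ Suc r) u)) \<le> \<nu> t * Re (M t (((*v) A ^^ r) u) (((*v) A ^^ r) u))"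
    using M_A_bound[OF t] by simp
  also have "\<dots> \<le> \<nu> t * (\<nu> t ^ r * Re (M t u u))" by (intro mult_left_mono Suc nu_nonneg)
  finally show ?case by (simp add: mult.assoc)
qed

lemma delta_minimal:
  assumes t: "b < t" "l < d'" and u: "g l - u \<in> vec.span (g ` {..<l})"
  shows "\<delta> l t \<le> Re (M t u u)"
proof -
  define w where "w = u - e l t"
  have "w = (g l - e l t) - (g l - u)" by (simp add: w_def)
  then have w: "w \<in> vec.span (g ` {..<l})"
    using u gram_schmidt_diff[of g l "M t"] unfolding e_def by (metis vec.span_diff)
  have z: "M t (e l t) w = 0" "M t w (e l t) = 0"
    using e_orth_span[OF t w] hermitian_form_sym_zero[OF M_herm] by auto
  have "M t u u = M t (e l t + w) (e l t + w)" by (simp add: w_def)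
  also have "\<dots> = M t (e l t) (e l t) + M t w w" by (simp add: hermitian_form_simps[OF M_herm] z)
  finally have "Re (M t u u) = \<delta> l t + Re (M t w w)" by (simp add: \<delta>_def)
  moreover have "0 \<le> Re (M t w w)" unfolding M_Re by (intro sum_nonneg) auto
  ultimately show ?thesis by simp
qed

end

section \<open>The energy inequality\<close>

context hodge_flow_flag begin

definition "lnh t = (\<Sum>i<d. of_int (a i) * ln \<bar>\<kappa> i t\<bar>)"

lemma lnh_deriv:
  assumes t: "b < t" shows "(lnh has_real_derivative E t) (at t)"
proof -
  have "((\<lambda>s. ln \<bar>\<kappa> i s\<bar>) has_real_derivative \<phi> i t) (at t)" if "i < d" for i
    using DERIV_ln_divide[of "\<bar>\<kappa> i t\<bar>"] DERIV_chain2[OF DERIV_ln_divide abs_kappa_deriv[OF t that]] kappa_nz[OF t that]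
    by simp
  then show ?thesis unfolding lnh_def[abs_def] E_def by (intro DERIV_sum DERIV_cmult) auto
qed

text \<open>
  The function \<open>\<Phi>\<close> below is nonincreasing.  Its derivative is the sum of the \<open>\<rho> l\<close> times the
  logarithmic derivatives of the \<open>\<delta> l\<close>, minus \<open>t * \<nu> t\<close> and \<open>R / (2 * t)\<close>, and an arithmetic-geometric
  mean inequality compares the first with the other two.
  On the other hand, \<open>\<beta>\<close> is bounded below by \<open>R * ln t\<close>, up to a constant, at a sequence of times tending to infinity,
  because there the norm of \<open>A\<close> is of order at most \<open>1 / t\<close> and powers of \<open>A\<close> match the flag vectors of
  opposite weights.  Comparing the coefficients of \<open>ln t\<close> gives the claim.
\<close>

theorem energy_inequality:
  fixes \<rho> :: "nat \<Rightarrow> int" and w C t0 :: real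
  assumes bij: "bij_betw \<sigma> {l. l < d' \<and> 0 < \<rho> l} {l. l < d' \<and> \<rho> l < 0}"
    and rho: "\<And>l. l < d' \<Longrightarrow> 0 < \<rho> l \<Longrightarrow> \<rho> (\<sigma> l) = - \<rho> l"
    and g_pair: "\<And>l. l < d' \<Longrightarrow> 0 < \<rho> l \<Longrightarrow> g (\<sigma> l) = ((*v) A ^^ nat (\<rho> l)) (g l)"
    and flag_pair: "\<And>l u. l < d' \<Longrightarrow> 0 < \<rho> l \<Longrightarrow> u \<in> vec.span (g ` {..<l}) \<Longrightarrow>
        ((*v) A ^^ nat (\<rho> l)) u \<in> vec.span (g ` {..<\<sigma> l})"
    and growth: "\<And>t. t0 \<le> t \<Longrightarrow> lnh t \<le> w * ln t + C"
    and slope: "\<And>t. t0 \<le> t \<Longrightarrow> 0 \<le> E t \<and> t * E t \<le> C"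
  shows "of_int (\<Sum>l<d'. (\<rho> l)\<^sup>2) \<le> 2 * w"
proof -
  let ?P = "{l. l < d' \<and> 0 < \<rho> l}" and ?N = "{l. l < d' \<and> \<rho> l < 0}"
  define R :: real where "R = of_int (\<Sum>l<d'. (\<rho> l)\<^sup>2)"
  define t1 where "t1 = max t0 (max b 0 + 1)"
  define C1 where "C1 = \<bar>C\<bar> + 1"
  have t1: "b < t" "1 \<le> t" "t0 \<le> t" if "t1 \<le> t" for t using that by (auto simp: t1_def)
  define \<beta> where "\<beta> t = (\<Sum>l<d'. of_int (\<rho> l) * ln (\<delta> l t))" for t
  define z where "z l t = Re (M' t (e l t) (e l t)) / \<delta> l t" for l t
  define \<Phi> where "\<Phi> t = \<beta> t + t * E t - lnh t - R / 2 * ln t" for t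
  have split: "(\<Sum>l<d'. h l) = (\<Sum>l\<in>?P. h l + h (\<sigma> l))" if "\<And>l. l < d' \<Longrightarrow> \<rho> l = 0 \<Longrightarrow> h l = 0" for h :: "nat \<Rightarrow> real"
  proof -
    have "(\<Sum>l<d'. h l) = (\<Sum>l\<in>?P \<union> ?N. h l)"
    proof (intro sum.mono_neutral_right ballI)
      fix i assume "i \<in> {..<d'} - (?P \<union> ?N)"
      then have "i < d'" "\<rho> i = 0" by auto
      then show "h i = 0" by (rule that)
    qed auto
    also have "\<dots> = (\<Sum>l\<in>?P. h l) + (\<Sum>l\<in>?N. h l)" by (intro sum.union_disjoint) auto
    also have "(\<Sum>l\<in>?N. h l) = (\<Sum>l\<in>?P. h (\<sigma> l))" by (rule sum.reindex_bij_betw[OF bij, symmetric])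
    finally show ?thesis by (simp add: sum.distrib)
  qed
  have R_split: "R = (\<Sum>l\<in>?P. 2 * (of_int (\<rho> l))\<^sup>2)"
  proof -
    have "R = (\<Sum>l<d'. (of_int (\<rho> l))\<^sup>2)" by (simp add: R_def)
    also have "\<dots> = (\<Sum>l\<in>?P. 2 * (of_int (\<rho> l))\<^sup>2)" by (subst split) (auto intro!: sum.cong simp: rho)
    finally show ?thesis .
  qed
  have Phi_mono: "\<Phi> t \<le> \<Phi> t1" if "t1 \<le> t" for t
  proof (rule DERIV_nonpos_imp_nonincreasing[OF that])
    fix s assume "t1 \<le> s" "s \<le> t"
    then have s: "b < s" "1 \<le> s" using t1 by auto
    have "((\<lambda>t. ln (\<delta> l t)) has_real_derivative z l s) (at s)" if "l < d'" for l
      using DERIV_chain2[OF DERIV_ln_divide delta_deriv[OF s(1) that]] delta_pos[OF s(1) that]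
      by (simp add: z_def)
    then have "(\<beta> has_real_derivative (\<Sum>l<d'. of_int (\<rho> l) * z l s)) (at s)"
      unfolding \<beta>_def[abs_def] by (intro DERIV_sum DERIV_cmult) auto
    moreover have "((\<lambda>t. t * E t) has_real_derivative (1 * E s + (- \<nu> s) * s)) (at s)"
      by (intro DERIV_mult DERIV_ident E_deriv' s)
    moreover have "((\<lambda>t. R / 2 * ln t) has_real_derivative R / 2 * (1 / s)) (at s)"
      using s by (intro DERIV_cmult DERIV_ln_divide) auto
    ultimately have "(\<Phi> has_real_derivative ((\<Sum>l<d'. of_int (\<rho> l) * z l s) + (1 * E s + (- \<nu> s) * s)
        - E s - R / 2 * (1 / s))) (at s)"
      unfolding \<Phi>_def[abs_def] using lnh_deriv[OF s(1)] by (intro DERIV_diff DERIV_add) auto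
    moreover have "(\<Sum>l<d'. of_int (\<rho> l) * z l s) \<le> s * \<nu> s + R / 2 * (1 / s)"
    proof -
      have "of_int (\<rho> l) * z l s \<le> s / 2 * (z l s)\<^sup>2 + (of_int (\<rho> l))\<^sup>2 / (2 * s)" for l
      proof -
        have "0 \<le> (s * z l s - of_int (\<rho> l))\<^sup>2 / (2 * s)" using s by simp
        also have "\<dots> = s / 2 * (z l s)\<^sup>2 + (of_int (\<rho> l))\<^sup>2 / (2 * s) - of_int (\<rho> l) * z l s"
          using s by (simp add: power2_eq_square field_simps)
        finally show ?thesis by simp
      qed
      then have "(\<Sum>l<d'. of_int (\<rho> l) * z l s) \<le> (\<Sum>l<d'. s / 2 * (z l s)\<^sup>2 + (of_int (\<rho> l))\<^sup>2 / (2 * s))"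
        by (intro sum_mono) auto
      also have "\<dots> = s / 2 * (\<Sum>l<d'. (z l s)\<^sup>2) + R / (2 * s)"
        by (simp add: R_def sum.distrib sum_distrib_left sum_divide_distrib)
      also have "(\<Sum>l<d'. (z l s)\<^sup>2) \<le> 2 * \<nu> s"
        unfolding z_def by (rule delta_log_deriv_square_sum[OF s(1)])
      finally show ?thesis using s by (simp add: mult_left_mono)
    qed
    ultimately show "\<exists>y. (\<Phi> has_real_derivative y) (at s) \<and> y \<le> 0"
      by (intro exI conjI) (assumption, simp add: mult.commute)
  qed
  (* The mean value theorem on [s, 2 * s], with the bound C / t for E, finds a time at which nu is small. *)
  have decay: "\<exists>\<xi>>s. \<nu> \<xi> \<le> 4 * C1 / \<xi>\<^sup>2" if s: "t1 \<le> s" for s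
  proof -
    have s1: "1 \<le> s" using t1[OF s] by auto
    obtain \<xi> where xi: "s < \<xi>" "\<xi> < 2 * s" "E (2 * s) - E s = (2 * s - s) * (- \<nu> \<xi>)"
      using MVT2[of s "2 * s" E "\<lambda>t. - \<nu> t"] E_deriv' t1(1)[OF order_trans[OF s]] s1 by auto
    have "s * \<nu> \<xi> \<le> E s" using xi slope[of "2 * s"] t1(3)[OF s] s1 by simp
    then have "s * (s * \<nu> \<xi>) \<le> s * E s" using s1 by (intro mult_left_mono) auto
    also have "\<dots> \<le> C1" using slope[OF t1(3)[OF s]] by (auto simp: C1_def)
    finally have "s * (s * \<nu> \<xi>) \<le> C1" .
    then have "\<nu> \<xi> \<le> C1 / s\<^sup>2" using s1 by (simp add: field_simps power2_eq_square)
    also have "\<dots> = 4 * C1 / (2 * s)\<^sup>2" by (simp add: power2_eq_square)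
    also have "\<dots> \<le> 4 * C1 / \<xi>\<^sup>2"
      using xi s1 by (intro divide_left_mono power_mono mult_pos_pos) (auto simp: C1_def)
    finally show ?thesis using xi by blast
  qed
  (* The vector of weight - rho is the image of the one of weight rho under the power rho of A,
     and this power shrinks squared lengths by the factor nu ^ rho at least. *)
  have beta_lower: "R * ln \<xi> - R / 2 * ln (4 * C1) \<le> \<beta> \<xi>"
    if xi: "t1 \<le> \<xi>" and nu: "\<nu> \<xi> \<le> 4 * C1 / \<xi>\<^sup>2" for \<xi>
  proof -
    note x = t1[OF xi]
    have "2 * (of_int (\<rho> l))\<^sup>2 * (ln \<xi> - ln (4 * C1) / 2) \<le>
        of_int (\<rho> l) * ln (\<delta> l \<xi>) + of_int (\<rho> (\<sigma> l)) * ln (\<delta> (\<sigma> l) \<xi>)" if "l \<in> ?P" for l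
    proof -
      have l: "l < d'" "0 < \<rho> l" using that by auto
      have sl: "\<sigma> l < d'" using bij that by (auto dest: bij_betwE)
      let ?r = "nat (\<rho> l)" and ?q = "4 * C1 / \<xi>\<^sup>2"
      have q: "0 < ?q" using x by (simp add: C1_def)
      have "\<delta> (\<sigma> l) \<xi> \<le> Re (M \<xi> (((*v) A ^^ ?r) (e l \<xi>)) (((*v) A ^^ ?r) (e l \<xi>)))"
      proof (rule delta_minimal[OF x(1) sl])
        have lin: "((*v) A ^^ r) (u - w) = ((*v) A ^^ r) u - ((*v) A ^^ r) w" for r u w
          by (induction r) (simp_all add: matrix_vector_mult_diff_distrib)
        show "g (\<sigma> l) - ((*v) A ^^ ?r) (e l \<xi>) \<in> vec.span (g ` {..<\<sigma> l})"
          using flag_pair[OF l gram_schmidt_diff[of g l "M \<xi>"]] by (simp add: g_pair[OF l] lin e_def)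
      qed
      also have "\<dots> \<le> \<nu> \<xi> ^ ?r * \<delta> l \<xi>" unfolding \<delta>_def by (rule M_A_power_bound[OF x(1)])
      also have "\<dots> \<le> ?q ^ ?r * \<delta> l \<xi>"
        using delta_pos[OF x(1) l(1)] nu nu_nonneg by (intro mult_right_mono power_mono) auto
      finally have "ln (\<delta> (\<sigma> l) \<xi>) \<le> ln (?q ^ ?r * \<delta> l \<xi>)"
        using delta_pos[OF x(1) sl] delta_pos[OF x(1) l(1)] q by simp
      also have "\<dots> = ?r * ln ?q + ln (\<delta> l \<xi>)"
        using delta_pos[OF x(1) l(1)] q by (subst ln_mult) (auto simp: ln_realpow)
      also have "ln ?q = ln (4 * C1) - 2 * ln \<xi>"
        using x by (subst ln_div) (auto simp: C1_def ln_realpow)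
      finally have "of_int (\<rho> l) * (of_int (\<rho> l) * (2 * ln \<xi> - ln (4 * C1))) \<le> of_int (\<rho> l) * (ln (\<delta> l \<xi>) - ln (\<delta> (\<sigma> l) \<xi>))"
        using l by (intro mult_left_mono) (auto simp: algebra_simps)
      then show ?thesis using l by (simp add: rho power2_eq_square algebra_simps)
    qed
    then have "(\<Sum>l\<in>?P. 2 * (of_int (\<rho> l))\<^sup>2 * (ln \<xi> - ln (4 * C1) / 2)) \<le>
        (\<Sum>l\<in>?P. of_int (\<rho> l) * ln (\<delta> l \<xi>) + of_int (\<rho> (\<sigma> l)) * ln (\<delta> (\<sigma> l) \<xi>))" by (rule sum_mono)
    also have "\<dots> = \<beta> \<xi>" unfolding \<beta>_def by (subst split) auto
    also have "(\<Sum>l\<in>?P. 2 * (of_int (\<rho> l))\<^sup>2 * (ln \<xi> - ln (4 * C1) / 2)) = R * (ln \<xi> - ln (4 * C1) / 2)"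
      unfolding R_split by (simp add: sum_distrib_right)
    finally show ?thesis by (simp add: algebra_simps)
  qed
  define c where "c = \<Phi> t1 + C + R / 2 * ln (4 * C1)"
  have bound: "\<exists>\<xi>>s. (R / 2 - w) * ln \<xi> \<le> c" if s: "t1 \<le> s" for s
  proof -
    obtain \<xi> where xi: "s < \<xi>" "\<nu> \<xi> \<le> 4 * C1 / \<xi>\<^sup>2" using decay[OF s] by blast
    then have x: "t1 \<le> \<xi>" using s by simp
    have "0 \<le> \<xi> * E \<xi>" using slope[OF t1(3)[OF x]] t1(2)[OF x] by simp
    then have "(R / 2 - w) * ln \<xi> \<le> c"
      using Phi_mono[OF x] beta_lower[OF x xi(2)] growth[OF t1(3)[OF x]]
      unfolding c_def \<Phi>_def[of \<xi>] by (simp add: algebra_simps)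
    then show ?thesis using xi by blast
  qed
  have "R / 2 \<le> w"
  proof (rule ccontr)
    assume "\<not> R / 2 \<le> w"
    then have pos: "0 < R / 2 - w" by simp
    define s where "s = max t1 (exp ((c + 1) / (R / 2 - w)))"
    obtain \<xi> where xi: "s < \<xi>" "(R / 2 - w) * ln \<xi> \<le> c" using bound[of s] by (auto simp: s_def)
    have "exp ((c + 1) / (R / 2 - w)) < \<xi>" using xi by (simp add: s_def)
    then have "(c + 1) / (R / 2 - w) < ln \<xi>" by (metis exp_gt_zero exp_less_cancel_iff exp_ln order_less_trans)
    then have "c + 1 < (R / 2 - w) * ln \<xi>" using pos by (simp add: field_simps)
    then show False using xi by simp
  qed
  then show ?thesis by (simp add: R_def)
qed

end

section \<open>Bases adapted to two filtrations\<close>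

text \<open>
  An enumeration in decreasing order of the key; the Hodge flow needs the frame in decreasing order of the
  Hodge degree.
\<close>

lemma finite_weight_enumeration:
  fixes key :: "'a \<Rightarrow> int"
  assumes "finite S"
  shows "\<exists>f. bij_betw f {..<card S} S \<and> (\<forall>i j. i \<le> j \<longrightarrow> j < card S \<longrightarrow> key (f j) \<le> key (f i))"
proof -
  obtain xs where xs: "set xs = S" "distinct xs" using finite_distinct_list[OF assms] by blast
  define ys where "ys = sort_key (\<lambda>v. - key v) xs"
  have ys: "set ys = S" "distinct ys" "sorted (map (\<lambda>v. - key v) ys)" using xs by (auto simp: ys_def)
  then have len: "length ys = card S" by (metis distinct_card)
  have "bij_betw (\<lambda>i. ys ! i) {..<card S} S" using ys len by (intro bij_betw_nth) auto
  moreover have "key (ys ! j) \<le> key (ys ! i)" if "i \<le> j" "j < card S" for i j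
    using sorted_nth_mono[OF ys(3), of i j] that len by simp
  ultimately show ?thesis by blast
qed

text \<open>
  The elements are added in increasing order of the second filtration, so that no combination of
  new vectors falls into a lower step by accident.
\<close>

lemma adapted_extend:
  fixes W :: "int \<Rightarrow> (complex ^ 'n) set"
  assumes W: "\<And>l. vec.subspace (W l)" "mono W" "W l0 = {0}" "W l1 = UNIV"
    and X: "vec.subspace X"
  shows "vec.independent S \<Longrightarrow> S \<subseteq> X \<Longrightarrow> (\<And>l. vec.span (S \<inter> W l) = vec.span S \<inter> W l) \<Longrightarrow>
    \<exists>S'. S \<subseteq> S' \<and> vec.independent S' \<and> vec.span S' = X \<and> (\<forall>l. vec.span (S' \<inter> W l) = X \<inter> W l)"
proof (induction "vec.dim X - vec.dim S" arbitrary: S rule: less_induct)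
  case less
  have sub: "vec.span S \<subseteq> X" using less.prems X by (simp add: vec.span_minimal)
  show ?case
  proof (cases "vec.span S = X")
    case True
    then show ?thesis using less.prems by (intro exI[of _ S]) auto
  next
    case False
    then obtain u where u: "u \<in> X" "u \<notin> vec.span S" using sub by blast
    let ?P = "\<lambda>j. \<not> X \<inter> W (l0 + int j) \<subseteq> vec.span S"
    have "W l1 \<subseteq> W (l0 + int (nat (l1 - l0)))" by (rule monoD[OF W(2)]) auto
    then have "W (l0 + int (nat (l1 - l0))) = UNIV" using W(4) by blast
    then have "?P (nat (l1 - l0))" using u by (simp only: Int_UNIV_right) blast
    define j where "j = (LEAST j. ?P j)"
    have j: "?P j" unfolding j_def by (rule LeastI) fact
    then obtain v where v: "v \<in> X" "v \<in> W (l0 + int j)" "v \<notin> vec.span S" by blast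
    have low: "X \<inter> W l \<subseteq> vec.span S" if "l < l0 + int j" for l
    proof (cases "l0 \<le> l")
      case True
      then have "\<not> ?P (nat (l - l0))" using that unfolding j_def by (intro not_less_Least) auto
      then show ?thesis using True by simp
    next
      case False
      then have "W l \<subseteq> W l0" by (intro monoD[OF W(2)]) auto
      then show ?thesis using W(3) vec.span_zero by auto
    qed
    let ?S = "insert v S"
    have ind: "vec.independent ?S"
      using v(3) less.prems(1) by (simp add: vec.independent_insert)
    have SX: "vec.span ?S \<subseteq> X" by (rule vec.span_minimal[OF _ X]) (use v less.prems(2) in auto)
    have "vec.span (?S \<inter> W l) = vec.span ?S \<inter> W l" for l
    proof
      have monoS: "vec.span (S \<inter> W l) \<subseteq> vec.span (?S \<inter> W l)" by (rule vec.span_mono) auto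
      show "vec.span (?S \<inter> W l) \<subseteq> vec.span ?S \<inter> W l"
        by (intro Int_greatest vec.span_mono vec.span_minimal W) auto
      show "vec.span ?S \<inter> W l \<subseteq> vec.span (?S \<inter> W l)"
      proof
        fix x assume x: "x \<in> vec.span ?S \<inter> W l"
        then obtain c where c: "x - c *s v \<in> vec.span S" by (auto simp: vec.span_insert)
        show "x \<in> vec.span (?S \<inter> W l)"
        proof (cases "c = 0")
          case True
          then have "x \<in> vec.span (S \<inter> W l)" using c x less.prems(3) by simp
          then show ?thesis using monoS by blast
        next
          case False
          have "x \<notin> vec.span S"
          proof
            assume "x \<in> vec.span S"
            then have "c *s v \<in> vec.span S" using c vec.span_diff[of x S "x - c *s v"] by simp
            then have "inverse c *s (c *s v) \<in> vec.span S" by (rule vec.span_scale)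
            then show False using False v(3) by (simp add: vector_smult_assoc)
          qed
          moreover have "x \<in> X" using x SX by blast
          ultimately have "\<not> l < l0 + int j" using low[of l] x by blast
          then have vl: "v \<in> W l" using v(2) monoD[OF W(2), of "l0 + int j" l] by auto
          then have "x - c *s v \<in> W l" using x W(1) by (simp add: vec.subspace_diff vec.subspace_scale)
          then have "x - c *s v \<in> vec.span (S \<inter> W l)" using c less.prems(3) by simp
          then have "x - c *s v \<in> vec.span (?S \<inter> W l)" using monoS by blast
          moreover have "c *s v \<in> vec.span (?S \<inter> W l)" using vl by (simp add: vec.span_scale vec.span_base)
          ultimately show ?thesis using vec.span_add[of "x - c *s v" "?S \<inter> W l" "c *s v"] by simp
        qed
      qed
    qed
    moreover have "vec.dim X - vec.dim ?S < vec.dim X - vec.dim S"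
    proof -
      have "vec.dim ?S = vec.dim S + 1" using v(3) by (simp add: vec.dim_insert)
      moreover have "vec.dim ?S \<le> vec.dim X" using v less.prems(2) by (intro vec.dim_subset) auto
      ultimately show ?thesis by simp
    qed
    moreover have "?S \<subseteq> X" using v less.prems(2) by auto
    ultimately obtain S' where "?S \<subseteq> S'" "vec.independent S'" "vec.span S' = X"
      "\<forall>l. vec.span (S' \<inter> W l) = X \<inter> W l"
      using less.hyps[of ?S] ind by blast
    then show ?thesis by blast
  qed
qed

text \<open>
  The basis is built from the smallest nonzero step of the first filtration upwards, each time
  extending it within the next larger step.
\<close>

lemma bifiltration_adapted_basis:
  fixes W F :: "int \<Rightarrow> (complex ^ 'n) set"
  assumes W: "\<And>l. vec.subspace (W l)" "mono W" "W l0 = {0}" "W l1 = UNIV"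
    and F: "\<And>p. vec.subspace (F p)" "antimono F" "F 0 = UNIV" "F (int n + 1) = {0}"
  shows "\<exists>S. vec.independent S \<and> (\<forall>p l. vec.span (S \<inter> F p \<inter> W l) = F p \<inter> W l)"
proof -
  have "\<exists>S. vec.independent S \<and> vec.span S = F (int n + 1 - int j) \<and>
      (\<forall>p l. int n + 1 - int j \<le> p \<longrightarrow> vec.span (S \<inter> F p \<inter> W l) = F p \<inter> W l)" for j
  proof (induction j)
    case 0
    have "F p = {0}" if "int n + 1 \<le> p" for p
      using antimonoD[OF F(2) that] F(4) F(1)[of p] vec.subspace_0 by blast
    then show ?case using W(1) vec.subspace_0 F(4) by (intro exI[of _ "{}"]) (auto simp: vec.independent_empty)
  next
    case (Suc j)
    let ?q = "int n + 1 - int j"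
    obtain S where S: "vec.independent S" "vec.span S = F ?q"
      "\<And>p l. ?q \<le> p \<Longrightarrow> vec.span (S \<inter> F p \<inter> W l) = F p \<inter> W l" using Suc by blast
    have SF: "S \<subseteq> F ?q" using S(2) vec.span_superset by blast
    have qq: "F ?q \<subseteq> F (?q - 1)" by (rule antimonoD[OF F(2)]) simp
    have "vec.span (S \<inter> W l) = vec.span S \<inter> W l" for l
      using S(3)[of ?q l] SF S(2) by (simp add: Int_absorb2)
    then obtain S' where S': "S \<subseteq> S'" "vec.independent S'" "vec.span S' = F (?q - 1)"
        "\<forall>l. vec.span (S' \<inter> W l) = F (?q - 1) \<inter> W l"
      using adapted_extend[OF W F(1)[of "?q - 1"] S(1)] SF qq by blast
    have new: "v \<notin> F ?q" if "v \<in> S' - S" for v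
    proof -
      have "v \<notin> vec.span (S' - {v})" using S'(2) that by (auto simp: vec.dependent_def)
      moreover have "vec.span S \<subseteq> vec.span (S' - {v})" using S'(1) that by (intro vec.span_mono) auto
      ultimately show ?thesis using S(2) by blast
    qed
    have "vec.span (S' \<inter> F p \<inter> W l) = F p \<inter> W l" if "?q - 1 \<le> p" for p l
    proof (cases "?q \<le> p")
      case True
      then have "S' \<inter> F p = S \<inter> F p" using new S'(1) antimonoD[OF F(2) True] by blast
      then show ?thesis using S(3)[OF True] by simp
    next
      case False
      then have "p = ?q - 1" using that by simp
      moreover have "S' \<subseteq> F (?q - 1)" using S'(3) vec.span_superset by blast
      ultimately show ?thesis using S'(4) by (simp add: Int_absorb2)
    qed
    then show ?case using S' by (intro exI[of _ S']) (auto simp: algebra_simps)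
  qed
  from this[of "n + 1"] obtain S where S: "vec.independent S" "vec.span S = F 0"
      "\<And>p l. 0 \<le> p \<Longrightarrow> vec.span (S \<inter> F p \<inter> W l) = F p \<inter> W l" by auto
  have "vec.span (S \<inter> F p \<inter> W l) = F p \<inter> W l" for p l
  proof (cases "0 \<le> p")
    case True then show ?thesis by (rule S(3))
  next
    case False
    then have "F 0 \<subseteq> F p" by (intro antimonoD[OF F(2)]) auto
    then have "F p = F 0" using F(3) by blast
    then show ?thesis using S(3)[OF order_refl, of l] by (simp only:)
  qed
  then show ?thesis using S(1) by blast
qed

lemma filtration_degree:
  fixes F :: "int \<Rightarrow> 'a :: zero set"
  assumes "antimono F" "F 0 = UNIV" "F (int n + 1) = {0}" "v \<noteq> 0"
  shows "\<exists>a. 0 \<le> a \<and> a \<le> int n \<and> (\<forall>p. v \<in> F p \<longleftrightarrow> p \<le> a)"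
proof -
  let ?I = "{p. 0 \<le> p \<and> p \<le> int n \<and> v \<in> F p}"
  have fin: "finite ?I" by (rule finite_subset[of _ "{0..int n}"]) auto
  have ne: "0 \<in> ?I" using assms by auto
  define a where "a = Max ?I"
  have a: "a \<in> ?I" unfolding a_def using fin ne by (intro Max_in) auto
  have "v \<in> F p \<longleftrightarrow> p \<le> a" for p
  proof
    assume vp: "v \<in> F p"
    have "p \<le> int n"
    proof (rule ccontr)
      assume "\<not> p \<le> int n"
      then have "F p \<subseteq> F (int n + 1)" by (intro antimonoD[OF assms(1)]) auto
      then show False using vp assms by auto
    qed
    then show "p \<le> a" using vp a Max_ge[OF fin, of p] by (cases "0 \<le> p") (auto simp: a_def)
  next
    assume "p \<le> a"
    then have "F a \<subseteq> F p" by (rule antimonoD[OF assms(1)])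
    then show "v \<in> F p" using a by auto
  qed
  then show ?thesis using a by auto
qed

lemma weight_degree:
  fixes W :: "int \<Rightarrow> 'a :: zero set"
  assumes "mono W" "W l0 = {0}" "W l1 = UNIV" "v \<noteq> 0"
  shows "\<exists>r. l0 \<le> r \<and> r \<le> l1 \<and> (\<forall>l. v \<in> W l \<longleftrightarrow> r \<le> l)"
proof -
  let ?I = "{l. l0 \<le> l \<and> l \<le> l1 \<and> v \<in> W l}"
  have out: "v \<notin> W l" if "l \<le> l0" for l using monoD[OF assms(1) that] assms by auto
  have fin: "finite ?I" by (rule finite_subset[of _ "{l0..l1}"]) auto
  have "l0 \<le> l1" using out[of l1] assms(3) by (metis UNIV_I linorder_linear)
  then have ne: "l1 \<in> ?I" using assms by auto
  define a where "a = Min ?I"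
  have a: "a \<in> ?I" unfolding a_def using fin ne by (intro Min_in) auto
  have "v \<in> W l \<longleftrightarrow> a \<le> l" for l
  proof
    assume "v \<in> W l"
    then show "a \<le> l" using a out[of l] Min_le[OF fin, of l] by (cases "l \<le> l1"; cases "l0 \<le> l") (auto simp: a_def)
  next
    assume "a \<le> l"
    then show "v \<in> W l" using a monoD[OF assms(1)] by auto
  qed
  then show ?thesis using a by auto
qed

lemma independent_span_disjoint:
  assumes "vec.independent (S :: (complex ^ 'n) set)" "T \<subseteq> S" "T' \<subseteq> S" "T \<inter> T' = {}"
  shows "vec.span T \<inter> vec.span T' = {0}"
proof -
  have fin: "finite S" using assms(1) by (rule vec.finiteI_independent)
  have f: "finite T" "finite T'"
    using rev_finite_subset[OF fin assms(2)] rev_finite_subset[OF fin assms(3)] by auto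
  have ind: "vec.independent T" "vec.independent T'" "vec.independent (T \<union> T')"
    using assms vec.independent_mono by blast+
  have "vec.dim {x + y |x y. x \<in> vec.span T \<and> y \<in> vec.span T'} + vec.dim (vec.span T \<inter> vec.span T') =
      vec.dim (vec.span T) + vec.dim (vec.span T')"
    by (intro vec.dim_sums_Int vec.subspace_span)
  moreover have "{x + y |x y. x \<in> vec.span T \<and> y \<in> vec.span T'} = vec.span (T \<union> T')"
    by (auto simp: vec.span_Un)
  moreover have "card (T \<union> T') = card T + card T'" using f assms by (intro card_Un_disjoint) auto
  ultimately have "vec.dim (vec.span T \<inter> vec.span T') = 0"
    using ind by (simp add: vec.dim_span vec.dim_eq_card_independent)
  then have "vec.span T \<inter> vec.span T' \<subseteq> {0}" by (simp only: vec.dim_eq_0)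
  then show ?thesis using vec.span_zero[of T] vec.span_zero[of T'] by blast
qed

section \<open>A flag compatible with a nilpotent endomorphism\<close>

text \<open>
  The monodromy weight filtration over the complex numbers, centered at zero: powers of \<open>A\<close> are
  isomorphisms between opposite graded pieces.
\<close>

locale lefschetz_filtration =
  fixes A :: "complex ^ 'n ^ 'n" and W :: "int \<Rightarrow> (complex ^ 'n) set" and l0 l1 :: int
  assumes W_sub: "vec.subspace (W l)"
    and W_mono: "mono W" and W_bot: "W l0 = {0}" and W_top: "W l1 = UNIV"
    and W_A: "u \<in> W l \<Longrightarrow> A *v u \<in> W (l - 2)"
    and W_inj: "u \<in> W (int r) \<Longrightarrow> ((*v) A ^^ r) u \<in> W (- int r - 1) \<Longrightarrow> u \<in> W (int r - 1)"
    and W_surj: "w \<in> W (- int r) \<Longrightarrow> \<exists>u \<in> W (int r). w - ((*v) A ^^ r) u \<in> W (- int r - 1)"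
begin

lemma W_le: "l \<le> l' \<Longrightarrow> u \<in> W l \<Longrightarrow> u \<in> W l'" using monoD[OF W_mono] by blast

lemma Apow_add: "((*v) A ^^ r) (u + w) = ((*v) A ^^ r) u + ((*v) A ^^ r) w"
  by (induction r) (simp_all add: matrix_vector_right_distrib)

lemma Apow_diff: "((*v) A ^^ r) (u - w) = ((*v) A ^^ r) u - ((*v) A ^^ r) w"
  by (induction r) (simp_all add: matrix_vector_mult_diff_distrib)

lemma Apow_scale: "((*v) A ^^ r) (c *s u) = c *s ((*v) A ^^ r) u"
  by (induction r) (simp_all add: vec.scale)

lemma Apow_zero: "((*v) A ^^ r) 0 = 0" by (induction r) simp_all

lemma W_Apow: "u \<in> W l \<Longrightarrow> ((*v) A ^^ r) u \<in> W (l - 2 * int r)"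
proof (induction r)
  case (Suc r)
  then have "A *v ((*v) A ^^ r) u \<in> W (l - 2 * int r - 2)" by (intro W_A) auto
  then show ?case by (simp add: algebra_simps)
qed simp

lemma graded_basis:
  "\<exists>xs. set xs \<subseteq> W r \<and> W r \<subseteq> vec.span (W (r - 1) \<union> set xs) \<and>
     (\<forall>i<length xs. xs ! i \<notin> vec.span (W (r - 1) \<union> set (take i xs)))"
proof -
  obtain B0 where B0: "B0 \<subseteq> W (r - 1)" "vec.independent B0" "W (r - 1) \<subseteq> vec.span B0"
    by (rule vec.basis_exists)
  have "B0 \<subseteq> W r" using B0 W_le[of "r - 1" r] by auto
  then obtain B where B: "B0 \<subseteq> B" "B \<subseteq> W r" "vec.independent B" "W r \<subseteq> vec.span B"
    using vec.maximal_independent_subset_extend B0 by metis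
  have "finite B" using B(3) by (rule vec.finiteI_independent)
  then have "finite (B - B0)" by (rule finite_Diff)
  then obtain xs where xs: "set xs = B - B0" "distinct xs" using finite_distinct_list by blast
  have "xs ! i \<notin> vec.span (W (r - 1) \<union> set (take i xs))" if i: "i < length xs" for i
  proof -
    have x: "xs ! i \<in> B - B0" using nth_mem[OF i] xs(1) by simp
    have "distinct (take i xs @ xs ! i # drop (Suc i) xs)"
      using xs(2) by (simp only: id_take_nth_drop[OF i, symmetric])
    then have "xs ! i \<notin> set (take i xs)" by simp
    then have "B0 \<union> set (take i xs) \<subseteq> B - {xs ! i}"
      using x xs(1) B(1) set_take_subset[of i xs] by auto
    then have "vec.span (B0 \<union> set (take i xs)) \<subseteq> vec.span (B - {xs ! i})" by (rule vec.span_mono)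
    moreover have "W (r - 1) \<union> set (take i xs) \<subseteq> vec.span (B0 \<union> set (take i xs))"
      using B0(3) vec.span_mono[of B0 "B0 \<union> set (take i xs)"] vec.span_superset[of "B0 \<union> set (take i xs)"] by auto
    then have "vec.span (W (r - 1) \<union> set (take i xs)) \<subseteq> vec.span (B0 \<union> set (take i xs))"
      by (simp add: vec.span_minimal)
    ultimately show ?thesis using B(3) x by (auto simp: vec.dependent_def)
  qed
  moreover have "W r \<subseteq> vec.span (W (r - 1) \<union> set xs)"
  proof -
    have "B \<subseteq> W (r - 1) \<union> set xs" using B0(1) xs(1) by auto
    from order_trans[OF B(4) vec.span_mono[OF this]] show ?thesis .
  qed
  moreover have "set xs \<subseteq> W r" using xs(1) B(2) by blast
  ultimately show ?thesis by blast
qed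

text \<open>
  \<open>c r\<close> lists representatives of a basis of the graded piece of weight \<open>r\<close>.  Those of negative weight
  are images of those of positive weight, which yields the pairing of the flag constructed from them.
\<close>

definition "graded_list r = (SOME xs. set xs \<subseteq> W r \<and> W r \<subseteq> vec.span (W (r - 1) \<union> set xs) \<and>
     (\<forall>i<length xs. xs ! i \<notin> vec.span (W (r - 1) \<union> set (take i xs))))"

definition "c r = (if 0 \<le> r then graded_list r else map ((*v) A ^^ nat (- r)) (graded_list (- r)))"

lemma graded_list:
  "set (graded_list r) \<subseteq> W r" "W r \<subseteq> vec.span (W (r - 1) \<union> set (graded_list r))"
  "i < length (graded_list r) \<Longrightarrow> graded_list r ! i \<notin> vec.span (W (r - 1) \<union> set (take i (graded_list r)))"
  using someI_ex[OF graded_basis[of r]] unfolding graded_list_def by blast+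

lemma Apow_span:
  assumes "u \<in> vec.span S" shows "((*v) A ^^ r) u \<in> vec.span (((*v) A ^^ r) ` S)"
  using assms
proof (induction rule: vec.span_induct_alt)
  case base then show ?case by (simp add: Apow_zero vec.span_zero)
next
  case (step c x y) then show ?case
    by (simp add: Apow_add Apow_scale vec.span_add vec.span_scale vec.span_base)
qed

lemma span_sub_union:
  assumes "u \<in> vec.span (W l \<union> S)" shows "\<exists>x\<in>W l. \<exists>y\<in>vec.span S. u = x + y"
  using assms W_sub by (auto simp: vec.span_Un vec.span_eq_iff[THEN iffD2])

lemma c_props:
  "set (c r) \<subseteq> W r" "W r \<subseteq> vec.span (W (r - 1) \<union> set (c r))"
  "i < length (c r) \<Longrightarrow> c r ! i \<notin> vec.span (W (r - 1) \<union> set (take i (c r)))"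
proof -
  have "set (c r) \<subseteq> W r \<and> W r \<subseteq> vec.span (W (r - 1) \<union> set (c r)) \<and>
     (\<forall>i<length (c r). c r ! i \<notin> vec.span (W (r - 1) \<union> set (take i (c r))))"
  proof (cases "0 \<le> r")
    case True then show ?thesis using graded_list[where r = r] by (simp add: c_def)
  next
    case False
    define s where "s = nat (- r)"
    have r: "r = - int s" and s: "0 < s" using False by (auto simp: s_def)
    let ?xs = "graded_list (int s)"
    have c: "c r = map ((*v) A ^^ s) ?xs" using False by (simp add: c_def r)
    note g = graded_list[where r = "int s"]
    have 1: "set (c r) \<subseteq> W r"
      unfolding c using W_Apow[of _ "int s" s] g(1) by (auto simp: r)
    have 2: "w \<in> vec.span (W (r - 1) \<union> set (c r))" if w: "w \<in> W r" for w
    proof -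
      obtain u where u: "u \<in> W (int s)" "w - ((*v) A ^^ s) u \<in> W (- int s - 1)"
        using W_surj[OF w[unfolded r]] by blast
      obtain x y where xy: "x \<in> W (int s - 1)" "y \<in> vec.span (set ?xs)" "u = x + y"
        using span_sub_union g(2) u(1) by blast
      have e: "int s - 1 - 2 * int s = r - 1" by (simp add: r)
      have "((*v) A ^^ s) x \<in> W (r - 1)" using W_Apow[OF xy(1), of s] by (simp only: e)
      moreover have "((*v) A ^^ s) y \<in> vec.span (set (c r))" using Apow_span[OF xy(2), where r = s] by (simp add: c)
      moreover have "w - ((*v) A ^^ s) u \<in> W (r - 1)" using u(2) by (simp add: r)
      moreover have "w = (w - ((*v) A ^^ s) u) + ((*v) A ^^ s) x + ((*v) A ^^ s) y" by (simp add: xy(3) Apow_add)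
      moreover have "W (r - 1) \<subseteq> vec.span (W (r - 1) \<union> set (c r))" "vec.span (set (c r)) \<subseteq> vec.span (W (r - 1) \<union> set (c r))"
        using vec.span_superset[of "W (r - 1) \<union> set (c r)"] by (auto intro: vec.span_mono[THEN subsetD])
      ultimately have "(w - ((*v) A ^^ s) u) + ((*v) A ^^ s) x + ((*v) A ^^ s) y \<in> vec.span (W (r - 1) \<union> set (c r))"
        by (intro vec.span_add) auto
      then show ?thesis by (simp only: \<open>w = (w - ((*v) A ^^ s) u) + ((*v) A ^^ s) x + ((*v) A ^^ s) y\<close>[symmetric])
    qed
    have 3: "c r ! i \<notin> vec.span (W (r - 1) \<union> set (take i (c r)))" if i: "i < length (c r)" for i
    proof
      assume "c r ! i \<in> vec.span (W (r - 1) \<union> set (take i (c r)))"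
      then obtain x y where xy: "x \<in> W (r - 1)" "y \<in> vec.span (((*v) A ^^ s) ` set (take i ?xs))" "c r ! i = x + y"
        using span_sub_union[of "c r ! i" "r - 1" "set (take i (c r))"] by (auto simp: c take_map)
      have "\<exists>z\<in>vec.span T. y = ((*v) A ^^ s) z" if "y \<in> vec.span (((*v) A ^^ s) ` T)" for y T
        using that
      proof (induction rule: vec.span_induct_alt)
        case base then show ?case by (intro bexI[of _ 0]) (auto simp: Apow_zero vec.span_zero)
      next
        case (step k x y)
        then obtain z t where "z \<in> vec.span T" "y = ((*v) A ^^ s) z" "t \<in> T" "x = ((*v) A ^^ s) t" by auto
        then show ?case
          by (intro bexI[of _ "k *s t + z"]) (auto simp: Apow_add Apow_scale vec.span_add vec.span_scale vec.span_base)
      qed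
      then obtain z where z: "z \<in> vec.span (set (take i ?xs))" "y = ((*v) A ^^ s) z" using xy(2) by blast
      have i': "i < length ?xs" using i by (simp add: c)
      have "z \<in> W (int s)" using z(1) vec.span_minimal[OF _ W_sub] g(1) set_take_subset[of i ?xs] by blast
      moreover have "?xs ! i \<in> W (int s)" using g(1) i' by auto
      ultimately have "?xs ! i - z \<in> W (int s)" using W_sub by (simp add: vec.subspace_diff)
      moreover have "((*v) A ^^ s) (?xs ! i - z) = x"
        using xy(3) z(2) i' by (simp add: c Apow_diff)
      ultimately have "?xs ! i - z \<in> W (int s - 1)" using W_inj[of "?xs ! i - z" s] xy(1) by (simp add: r)
      then have "(?xs ! i - z) + z \<in> vec.span (W (int s - 1) \<union> set (take i ?xs))"
        using z(1) by (intro vec.span_add) (auto intro: vec.span_base vec.span_mono[THEN subsetD])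
      then show False using g(3)[OF i'] by simp
    qed
    show ?thesis using 1 2 3 by blast
  qed
  then show "set (c r) \<subseteq> W r" "W r \<subseteq> vec.span (W (r - 1) \<union> set (c r))"
    "i < length (c r) \<Longrightarrow> c r ! i \<notin> vec.span (W (r - 1) \<union> set (take i (c r)))" by blast+
qed

lemma c_length: "length (c (- r)) = length (c r)"
  by (auto simp: c_def)

lemma c_neg: "0 < r \<Longrightarrow> i < length (c r) \<Longrightarrow> c (- r) ! i = ((*v) A ^^ nat r) (c r ! i)"
  by (simp add: c_def)

lemma c_empty: "W r = W (r - 1) \<Longrightarrow> c r = []"
  using c_props(1)[of r] c_props(3)[where i = 0 and r = r]
  by (cases "c r") (auto intro: vec.span_base)

end

context lefschetz_filtration begin

lemma c_outside: "r \<notin> {l0..l1} \<Longrightarrow> c r = []"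
proof (rule c_empty)
  assume r: "r \<notin> {l0..l1}"
  have z: "0 \<in> W l" for l using W_sub vec.subspace_0 by blast
  show "W r = W (r - 1)"
  proof (cases "r < l0")
    case True
    then have "W r \<subseteq> {0}" "W (r - 1) \<subseteq> {0}"
      using monoD[OF W_mono, of r l0] monoD[OF W_mono, of "r - 1" l0] W_bot by auto
    then have "W r = {0}" "W (r - 1) = {0}" using z[of r] z[of "r - 1"] by auto
    then show ?thesis by simp
  next
    case False
    then have "W l1 \<subseteq> W r" "W l1 \<subseteq> W (r - 1)"
      using r monoD[OF W_mono, of l1 r] monoD[OF W_mono, of l1 "r - 1"] by auto
    then have "W r = UNIV" "W (r - 1) = UNIV" using W_top by auto
    then show ?thesis by simp
  qed
qed

text \<open>
  Independence of the representatives modulo the previous step makes the dimension jump by their number.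
\<close>

lemma dim_W_step: "vec.dim (W r) = vec.dim (W (r - 1)) + length (c r)"
proof -
  have "i \<le> length (c r) \<Longrightarrow> vec.dim (W (r - 1) \<union> set (take i (c r))) = vec.dim (W (r - 1)) + i" for i
  proof (induction i)
    case (Suc i)
    then have "W (r - 1) \<union> set (take (Suc i) (c r)) = insert (c r ! i) (W (r - 1) \<union> set (take i (c r)))"
      by (simp add: take_Suc_conv_app_nth)
    then show ?case using Suc c_props(3)[where i = i and r = r] by (simp add: vec.dim_insert)
  qed simp
  from this[of "length (c r)"] have "vec.dim (W (r - 1) \<union> set (c r)) = vec.dim (W (r - 1)) + length (c r)" by simp
  moreover have "vec.span (W (r - 1) \<union> set (c r)) = W r"
  proof
    have "W (r - 1) \<subseteq> W r" by (rule monoD[OF W_mono]) simp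
    then show "vec.span (W (r - 1) \<union> set (c r)) \<subseteq> W r"
      using c_props(1)[of r] by (intro vec.span_minimal W_sub) blast
  qed (rule c_props(2))
  ultimately show ?thesis by (metis vec.dim_span)
qed

text \<open>
  The index set of the representatives of all weights, from which the flag is enumerated.
\<close>

definition "pairs = (SIGMA r:{l0..l1}. {..<length (c r)})"

lemma pairs_iff: "(r, i) \<in> pairs \<longleftrightarrow> i < length (c r)"
  using c_outside[of r] by (cases "r \<in> {l0..l1}") (auto simp: pairs_def)

lemma finite_pairs: "finite pairs" by (simp add: pairs_def)

lemma W_spanned: "W (l0 + int j) \<subseteq> vec.span {c r ! i | r i. (r, i) \<in> pairs \<and> r \<le> l0 + int j}"
proof (induction j)
  case 0 then show ?case using W_bot vec.span_zero by auto
next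
  case (Suc j)
  let ?T = "\<lambda>s. {c r ! i | r i. (r, i) \<in> pairs \<and> r \<le> s}"
  let ?s = "l0 + int (Suc j)"
  have s: "?s - 1 = l0 + int j" by simp
  have "?T (l0 + int j) \<subseteq> ?T ?s" by force
  then have 1: "W (?s - 1) \<subseteq> vec.span (?T ?s)" using Suc vec.span_mono unfolding s by blast
  have "set (c ?s) \<subseteq> ?T ?s" by (force simp: in_set_conv_nth pairs_iff)
  then have "set (c ?s) \<subseteq> vec.span (?T ?s)" using vec.span_superset by blast
  with 1 have "vec.span (W (?s - 1) \<union> set (c ?s)) \<subseteq> vec.span (?T ?s)"
    by (intro vec.span_minimal) auto
  then show ?case using c_props(2)[of ?s] by blast
qed

lemma W_spanned': "W s \<subseteq> vec.span {c r ! i | r i. (r, i) \<in> pairs \<and> r \<le> s}"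
proof (cases "l0 \<le> s")
  case True then show ?thesis using W_spanned[of "nat (s - l0)"] by simp
next
  case False
  then have "W s \<subseteq> W l0" by (intro monoD[OF W_mono]) auto
  then show ?thesis using W_bot vec.span_zero by auto
qed

text \<open>
  The pairing \<open>\<sigma>\<close> matches the part of the flag in each positive weight with its image under the
  corresponding power of \<open>A\<close> in the opposite weight, in the same order.
\<close>

lemma compatible_flag:
  "\<exists>(g :: nat \<Rightarrow> complex ^ 'n) (\<rho> :: nat \<Rightarrow> int) \<sigma> d'.
     vec.span (g ` {..<d'}) = UNIV \<and>
     (\<forall>l<d'. g l \<notin> vec.span (g ` {..<l})) \<and>
     (\<forall>l<d'. A *v g l \<in> vec.span (g ` {..<l})) \<and>
     bij_betw \<sigma> {l. l < d' \<and> 0 < \<rho> l} {l. l < d' \<and> \<rho> l < 0} \<and>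
     (\<forall>l<d'. 0 < \<rho> l \<longrightarrow> \<rho> (\<sigma> l) = - \<rho> l \<and> g (\<sigma> l) = ((*v) A ^^ nat (\<rho> l)) (g l) \<and>
        (\<forall>u \<in> vec.span (g ` {..<l}). ((*v) A ^^ nat (\<rho> l)) u \<in> vec.span (g ` {..<\<sigma> l}))) \<and>
     (\<Sum>l<d'. (\<rho> l)\<^sup>2) = (\<Sum>r\<in>{l0..l1}. r\<^sup>2 * int (length (c r)))"
proof -
  define Lm where "Lm = 1 + (\<Sum>r\<in>{l0..l1}. int (length (c r)))"
  have Lm: "int i < Lm" if "(r, i) \<in> pairs" for r i
  proof -
    have "r \<in> {l0..l1}" "i < length (c r)" using that by (auto simp: pairs_def)
    then have "int (length (c r)) \<le> (\<Sum>r\<in>{l0..l1}. int (length (c r)))"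
      by (intro member_le_sum) auto
    then show ?thesis using \<open>i < length (c r)\<close> by (simp add: Lm_def)
  qed
  define rank where "rank q = fst q * Lm + int (snd q)" for q :: "int \<times> nat"
  have rank: "rank (r', i') < rank (r, i) \<longleftrightarrow> r' < r \<or> r' = r \<and> i' < i"
    if "(r', i') \<in> pairs" "(r, i) \<in> pairs" for r r' i i'
  proof -
    note b = Lm[OF that(1)] Lm[OF that(2)]
    have "rank (x, j) < rank (y, k)" if "x < y" "int j < Lm" for x y j k
    proof -
      have "(x + 1) * Lm \<le> y * Lm" using that by (intro mult_right_mono) auto
      then show ?thesis using that by (simp add: rank_def algebra_simps)
    qed
    from this[of r' r i' i] this[of r r' i i'] b show ?thesis
      by (cases "r' < r"; cases "r < r'") (auto simp: rank_def)
  qed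
  obtain ps where ps: "bij_betw ps {..<card pairs} pairs"
    and ps_mono: "\<And>i j. i \<le> j \<Longrightarrow> j < card pairs \<Longrightarrow> - rank (ps j) \<le> - rank (ps i)"
    using finite_weight_enumeration[OF finite_pairs, of "\<lambda>q. - rank q"] by blast
  define d' where "d' = card pairs"
  have ps_in: "ps l \<in> pairs" if "l < d'" for l using ps that by (auto simp: bij_betw_def d'_def)
  have rank_inj: "p = q" if "p \<in> pairs" "q \<in> pairs" "rank p = rank q" for p q
    using rank[of "fst p" "snd p" "fst q" "snd q"] rank[of "fst q" "snd q" "fst p" "snd p"] that
    by (cases p; cases q) auto
  have ps_less: "j < l \<longleftrightarrow> rank (ps j) < rank (ps l)" if "j < d'" "l < d'" for j l
  proof
    assume "j < l"
    then have "rank (ps j) \<le> rank (ps l)" using ps_mono[of j l] that by (simp add: d'_def)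
    moreover have "ps j \<noteq> ps l" using \<open>j < l\<close> that ps by (auto simp: bij_betw_def inj_on_def d'_def)
    ultimately show "rank (ps j) < rank (ps l)" using rank_inj ps_in that by (metis order_le_less)
  next
    assume "rank (ps j) < rank (ps l)"
    then show "j < l" using ps_mono[of l j] that by (metis d'_def linorder_not_le neg_le_iff_le)
  qed
  define gv where "gv q = c (fst q) ! snd q" for q
  define g where "g l = gv (ps l)" for l
  define \<rho> where "\<rho> l = fst (ps l)" for l
  have earlier: "g ` {..<l} = gv ` {q \<in> pairs. rank q < rank (ps l)}" if l: "l < d'" for l
  proof
    show "g ` {..<l} \<subseteq> gv ` {q \<in> pairs. rank q < rank (ps l)}"
    proof
      fix x assume "x \<in> g ` {..<l}"
      then obtain j where j: "j < l" "x = gv (ps j)" by (auto simp: g_def)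
      then have "ps j \<in> pairs" "rank (ps j) < rank (ps l)"
        using ps_in[of j] ps_less[of j l] l by auto
      then show "x \<in> gv ` {q \<in> pairs. rank q < rank (ps l)}" using j(2) by blast
    qed
    show "gv ` {q \<in> pairs. rank q < rank (ps l)} \<subseteq> g ` {..<l}"
    proof
      fix x assume "x \<in> gv ` {q \<in> pairs. rank q < rank (ps l)}"
      then obtain q where q: "q \<in> pairs" "rank q < rank (ps l)" "x = gv q" by blast
      have "q \<in> ps ` {..<d'}" using ps q(1) by (simp add: bij_betw_def d'_def)
      then obtain j where j: "j < d'" "ps j = q" by auto
      then show "x \<in> g ` {..<l}" using q ps_less[of j l] l by (auto simp: g_def)
    qed
  qed
  have span_low: "W (\<rho> l - 1) \<subseteq> vec.span (g ` {..<l})" if l: "l < d'" for l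
  proof -
    obtain r i where ri: "ps l = (r, i)" by fastforce
    have sub: "{c r' ! i' | r' i'. (r', i') \<in> pairs \<and> r' \<le> r - 1} \<subseteq> gv ` {q \<in> pairs. rank q < rank (ps l)}"
      using rank[of _ _ r i] ps_in[OF l] by (force simp: gv_def ri)
    show ?thesis using order_trans[OF W_spanned' vec.span_mono[OF sub]]
      by (simp only: earlier[OF l]) (simp add: \<rho>_def ri)
  qed
  have g_W: "g l \<in> W (\<rho> l)" if "l < d'" for l
  proof -
    obtain r i where ri: "ps l = (r, i)" by fastforce
    then have "i < length (c r)" using ps_in[OF that] pairs_iff by auto
    then show ?thesis using c_props(1)[of r] by (auto simp: g_def gv_def \<rho>_def ri)
  qed
  have g_indep: "g l \<notin> vec.span (g ` {..<l})" if l: "l < d'" for l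
  proof -
    obtain r i where ri: "ps l = (r, i)" by fastforce
    have i: "i < length (c r)" using ps_in[OF l] pairs_iff ri by auto
    have "g ` {..<l} \<subseteq> W (r - 1) \<union> set (take i (c r))"
    proof
      fix x assume "x \<in> g ` {..<l}"
      then obtain r' i' where q: "(r', i') \<in> pairs" "rank (r', i') < rank (r, i)" "x = c r' ! i'"
        unfolding earlier[OF l] by (auto simp: gv_def ri)
      have i': "i' < length (c r')" using q(1) pairs_iff by simp
      consider "r' < r" | "r' = r" "i' < i" using q(2) rank[OF q(1)] ps_in[OF l] ri by auto
      then show "x \<in> W (r - 1) \<union> set (take i (c r))"
      proof cases
        case 1
        have "x \<in> W r'" using c_props(1)[of r'] i' q(3) by auto
        then show ?thesis using W_le[of r' "r - 1"] 1 by simp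
      next
        case 2
        then show ?thesis using q(3) i by (auto simp: in_set_conv_nth)
      qed
    qed
    then have "vec.span (g ` {..<l}) \<subseteq> vec.span (W (r - 1) \<union> set (take i (c r)))" by (rule vec.span_mono)
    then show ?thesis using c_props(3)[OF i] by (auto simp: g_def gv_def ri)
  qed
  have g_lower: "A *v g l \<in> vec.span (g ` {..<l})" if l: "l < d'" for l
    using W_A[OF g_W[OF l]] W_le[of "\<rho> l - 2" "\<rho> l - 1"] span_low[OF l] by auto
  have g_span: "vec.span (g ` {..<d'}) = UNIV"
  proof -
    have im: "g ` {..<d'} = gv ` pairs" using ps unfolding g_def d'_def bij_betw_def by (auto simp: image_image[symmetric])
    have sub: "{c r ! i | r i. (r, i) \<in> pairs \<and> r \<le> l1} \<subseteq> gv ` pairs" by (force simp: gv_def)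
    show ?thesis using order_trans[OF W_spanned' vec.span_mono[OF sub]] W_top unfolding im by blast
  qed
  define opp where "opp q = (- fst q, snd q)" for q :: "int \<times> nat"
  have opp_in: "opp q \<in> pairs" if "q \<in> pairs" for q
    using that by (cases q) (simp add: opp_def pairs_iff c_length)
  define \<sigma> where "\<sigma> l = inv_into {..<d'} ps (opp (ps l))" for l
  have sig: "\<sigma> l < d' \<and> ps (\<sigma> l) = opp (ps l)" if "l < d'" for l
  proof -
    have "opp (ps l) \<in> ps ` {..<d'}" using ps opp_in[OF ps_in[OF that]] by (simp add: bij_betw_def d'_def)
    then show ?thesis using inv_into_into[of "opp (ps l)" ps "{..<d'}"] f_inv_into_f[of "opp (ps l)" ps "{..<d'}"]
      by (simp add: \<sigma>_def)
  qed
  have ss: "\<sigma> (\<sigma> l) = l" if "l < d'" for l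
  proof -
    have "ps (\<sigma> (\<sigma> l)) = ps l" "\<sigma> (\<sigma> l) < d'" using sig that by (auto simp: opp_def)
    then show ?thesis using ps that by (auto simp: bij_betw_def inj_on_def d'_def)
  qed
  have rs: "\<rho> (\<sigma> l) = - \<rho> l" if "l < d'" for l using sig[OF that] by (simp add: \<rho>_def opp_def)
  have bij: "bij_betw \<sigma> {l. l < d' \<and> 0 < \<rho> l} {l. l < d' \<and> \<rho> l < 0}"
    by (rule bij_betwI[of _ _ _ \<sigma>]) (auto simp: ss rs sig)
  have pair: "\<rho> (\<sigma> l) = - \<rho> l \<and> g (\<sigma> l) = ((*v) A ^^ nat (\<rho> l)) (g l) \<and>
        (\<forall>u \<in> vec.span (g ` {..<l}). ((*v) A ^^ nat (\<rho> l)) u \<in> vec.span (g ` {..<\<sigma> l}))"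
    if l: "l < d'" "0 < \<rho> l" for l
  proof (intro conjI ballI)
    obtain r i where ri: "ps l = (r, i)" by fastforce
    have r: "0 < r" using l by (simp add: \<rho>_def ri)
    have i: "i < length (c r)" using ps_in[OF l(1)] pairs_iff ri by auto
    have sl: "\<sigma> l < d'" "ps (\<sigma> l) = (- r, i)" using sig[OF l(1)] by (auto simp: opp_def ri)
    show "\<rho> (\<sigma> l) = - \<rho> l" by (rule rs[OF l(1)])
    show "g (\<sigma> l) = ((*v) A ^^ nat (\<rho> l)) (g l)"
      using c_neg[OF r i] by (simp add: g_def gv_def \<rho>_def ri sl)
    fix u assume u: "u \<in> vec.span (g ` {..<l})"
    have gen: "((*v) A ^^ nat r) x \<in> vec.span (g ` {..<\<sigma> l})" if "x \<in> g ` {..<l}" for x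
    proof -
      obtain r' i' where q: "(r', i') \<in> pairs" "rank (r', i') < rank (r, i)" "x = c r' ! i'"
        using \<open>x \<in> g ` {..<l}\<close> unfolding earlier[OF l(1)] by (auto simp: gv_def ri)
      have i': "i' < length (c r')" using q(1) pairs_iff by simp
      consider "r' < r" | "r' = r" "i' < i" using q(2) rank[OF q(1)] ps_in[OF l(1)] ri by auto
      then show ?thesis
      proof cases
        case 1
        have "x \<in> W r'" using c_props(1)[of r'] i' q(3) by auto
        then have "((*v) A ^^ nat r) x \<in> W (r' - 2 * int (nat r))" by (rule W_Apow)
        then have "((*v) A ^^ nat r) x \<in> W (\<rho> (\<sigma> l) - 1)"
          by (rule W_le[rotated]) (use 1 r in \<open>simp add: \<rho>_def sl\<close>)
        then show ?thesis using span_low[OF sl(1)] by blast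
      next
        case 2
        have m: "(- r, i') \<in> pairs" "(- r, i) \<in> pairs" using 2 i' i by (auto simp: pairs_iff c_length)
        have "((*v) A ^^ nat r) x = gv (- r, i')" using c_neg[OF r, of i'] 2 i' q(3) by (simp add: gv_def)
        moreover have "rank (- r, i') < rank (ps (\<sigma> l))" using rank[OF m] 2 by (simp add: sl)
        ultimately have "((*v) A ^^ nat r) x \<in> g ` {..<\<sigma> l}" unfolding earlier[OF sl(1)] using m by blast
        then show ?thesis by (rule vec.span_base)
      qed
    qed
    have "((*v) A ^^ nat r) ` (g ` {..<l}) \<subseteq> vec.span (g ` {..<\<sigma> l})" using gen by blast
    then have "vec.span (((*v) A ^^ nat r) ` (g ` {..<l})) \<subseteq> vec.span (g ` {..<\<sigma> l})"
      by (simp add: vec.span_minimal)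
    then show "((*v) A ^^ nat (\<rho> l)) u \<in> vec.span (g ` {..<\<sigma> l})"
      using Apow_span[OF u, where r = "nat r"] by (auto simp: \<rho>_def ri)
  qed
  have "(\<Sum>l<d'. (\<rho> l)\<^sup>2) = (\<Sum>q\<in>pairs. (fst q)\<^sup>2)"
    unfolding \<rho>_def d'_def by (rule sum.reindex_bij_betw[OF ps])
  also have "\<dots> = (\<Sum>r\<in>{l0..l1}. \<Sum>i<length (c r). r\<^sup>2)"
    unfolding pairs_def by (subst sum.Sigma) (auto simp: case_prod_unfold)
  also have "\<dots> = (\<Sum>r\<in>{l0..l1}. r\<^sup>2 * int (length (c r)))" by (simp add: mult.commute)
  finally have "(\<Sum>l<d'. (\<rho> l)\<^sup>2) = (\<Sum>r\<in>{l0..l1}. r\<^sup>2 * int (length (c r)))" .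
  with g_span g_indep g_lower bij pair show ?thesis
    by (intro exI[of _ g] exI[of _ \<rho>] exI[of _ \<sigma>] exI[of _ d']) blast
qed

end

section \<open>Gram determinants\<close>

lemma det_unitriangular:
  fixes A :: "complex ^ 'n ^ 'n" and h :: "'n \<Rightarrow> nat"
  assumes "inj h" and zero: "\<And>x y. h x < h y \<Longrightarrow> A $ x $ y = 0" and diag: "\<And>x. A $ x $ x = 1"
  shows "det A = 1"
proof -
  have "(\<Prod>x\<in>UNIV. A $ x $ p x) = 0" if p: "p permutes UNIV" "p \<noteq> id" for p
  proof -
    have "\<exists>x. h x < h (p x)"
    proof (rule ccontr)
      assume "\<not> ?thesis"
      then have le: "h (p x) \<le> h x" for x by (simp add: not_less)
      have "(\<Sum>x\<in>UNIV. h (p x)) = (\<Sum>x\<in>UNIV. h x)" using p(1) by (rule sum.permute[symmetric, unfolded o_def])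
      then have "h (p x) = h x" for x
        using sum_mono_inv[of "\<lambda>x. h (p x)" UNIV h x] le by auto
      then have "p x = x" for x using assms(1) by (simp add: inj_def)
      then show False using p(2) by (auto simp: fun_eq_iff)
    qed
    then show ?thesis using zero by (intro prod_zero) auto
  qed
  then have "det A = (\<Sum>p\<in>{p. p permutes (UNIV :: 'n set)}. if p = id then 1 else 0 :: complex)"
    unfolding det_def by (intro sum.cong refl) (auto simp: diag)
  also have "\<dots> = 1" by (simp add: permutes_id finite_permutations)
  finally show ?thesis .
qed

text \<open>
  Orthogonalization changes the frame by a unitriangular matrix, so the Gram determinant of the first \<open>m\<close>
  vectors is the product of the squares of the orthogonalized ones.  Because the size of a square matrix
  is a type, the leading minor is padded with an identity block.
\<close>

lemma gram_determinant:
  fixes G :: "complex ^ 'n \<Rightarrow> complex ^ 'n \<Rightarrow> complex" and h :: "'n \<Rightarrow> nat"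
  assumes G: "hermitian_form G" and reg: "regular_along G f d" and sp: "vec.span (f ` {..<d}) = UNIV"
    and h: "bij_betw h UNIV {..<d}" and m: "m \<le> d"
  shows "det (\<chi> x y. if h x < m \<and> h y < m then G (f (h x)) (f (h y)) else if x = y then 1 else 0) =
     (\<Prod>i<m. G (gram_schmidt G f i) (gram_schmidt G f i))"
proof -
  let ?v = "gram_schmidt G f"
  have fr: "orthogonal_frame G ?v d" by (rule orthogonal_frame_gram_schmidt[OF G reg sp])
  have hd: "h x < d" for x using h by (auto simp: bij_betw_def)
  have inj: "inj h" using h by (auto simp: bij_betw_def)
  have nz: "G (?v i) (?v i) \<noteq> 0" if "i < d" for i using reg that by (auto simp: regular_along_def)
  have Gvf0: "G (?v l) (f i) = 0" if "i < l" "l < d" for i l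
    by (rule gram_schmidt_orthogonal_span[OF G reg that(2)]) (use that in \<open>auto intro: vec.span_base\<close>)
  then have Gfv0: "G (f i) (?v l) = 0" if "i < l" "l < d" for i l
    using that hermitian_form_sym_zero[OF G] by blast
  have Gfv1: "G (f i) (?v i) = G (?v i) (?v i)" if "i < d" for i
  proof -
    have "G (?v i) (f i - ?v i) = 0"
      by (rule gram_schmidt_orthogonal_span[OF G reg that gram_schmidt_diff])
    then have "G (f i - ?v i) (?v i) = 0" by (rule hermitian_form_sym_zero[OF G])
    then show ?thesis by (simp add: hermitian_form_diff[OF G])
  qed
  define u where "u x y = (if h x < m \<and> h y < m then G (f (h x)) (?v (h y)) / G (?v (h y)) (?v (h y))
      else if x = y then 1 else 0)" for x y
  define U where "U = (\<chi> x y. u x y)"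
  define U' where "U' = (\<chi> x y. cnj (u x y))"
  define k where "k x = (if h x < m then G (?v (h x)) (?v (h x)) else 1)" for x
  define V where "V = (\<chi> x y. if x = y then k x else (0 :: complex))"
  have u0: "u x y = 0" if "h x < h y" for x y using that Gfv0[OF that hd] by (auto simp: u_def)
  have u1: "u x x = 1" for x using Gfv1[OF hd] nz[OF hd] by (simp add: u_def)
  have detU: "det U = 1" by (rule det_unitriangular[OF inj]) (auto simp: U_def u0 u1)
  have detU': "det (transpose U') = 1"
    unfolding det_transpose by (rule det_unitriangular[OF inj]) (auto simp: U'_def u0 u1)
  have entry: "(\<Sum>z\<in>UNIV. u x z * k z * cnj (u y z)) =
     (if h x < m \<and> h y < m then G (f (h x)) (f (h y)) else if x = y then 1 else 0)" for x y
  proof (cases "h x < m \<and> h y < m")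
    case True
    have "(\<Sum>z\<in>UNIV. u x z * k z * cnj (u y z)) =
       (\<Sum>z\<in>UNIV. G (f (h x)) (?v (h z)) / G (?v (h z)) (?v (h z)) * G (?v (h z)) (f (h y)))"
    proof (rule sum.cong[OF refl])
      fix z
      have c: "cnj (G (f (h y)) (?v (h z))) = G (?v (h z)) (f (h y))"
        by (rule hermitian_formD(3)[OF G, symmetric])
      have cc: "cnj (G (?v (h z)) (?v (h z))) = G (?v (h z)) (?v (h z))"
        by (rule hermitian_formD(3)[OF G, symmetric])
      show "u x z * k z * cnj (u y z) = G (f (h x)) (?v (h z)) / G (?v (h z)) (?v (h z)) * G (?v (h z)) (f (h y))"
      proof (cases "h z < m")
        case h: True
        show ?thesis using True h nz[OF hd[of z]] by (simp add: u_def k_def c cc)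
      next
        case False
        then have "h x < h z" "z \<noteq> x" using True by auto
        then show ?thesis using False Gfv0[OF _ hd] by (simp add: u_def)
      qed
    qed
    also have "\<dots> = (\<Sum>l<d. G (f (h x)) (?v l) / G (?v l) (?v l) * G (?v l) (f (h y)))"
      by (rule sum.reindex_bij_betw[OF h])
    also have "\<dots> = G (f (h x)) (f (h y))" by (rule orthogonal_frame_parseval[OF fr G, symmetric])
    finally show ?thesis using True by simp
  next
    case False
    have "(\<Sum>z\<in>UNIV. u x z * k z * cnj (u y z)) = (\<Sum>z\<in>UNIV. if z = x \<and> x = y then 1 else 0)"
    proof (rule sum.cong[OF refl])
      fix z
      show "u x z * k z * cnj (u y z) = (if z = x \<and> x = y then 1 else 0)"
        using False by (auto simp: u_def k_def)
    qed
    also have "\<dots> = (if x = y then 1 else 0)" by (cases "x = y") auto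
    finally show ?thesis using False by (auto split: if_splits)
  qed
  have "(\<chi> x y. if h x < m \<and> h y < m then G (f (h x)) (f (h y)) else if x = y then 1 else 0) =
     U ** V ** transpose U'"
  proof -
    have UV: "(U ** V) $ x $ z = u x z * k z" for x z
      by (simp add: matrix_matrix_mult_def U_def V_def if_distrib cong: if_cong)
    have "(U ** V ** transpose U') $ x $ y = (\<Sum>z\<in>UNIV. u x z * k z * cnj (u y z))" for x y
      unfolding matrix_matrix_mult_def[of "U ** V"] by (simp add: UV U'_def transpose_def)
    then show ?thesis unfolding vec_eq_iff using entry by simp
  qed
  then have "det (\<chi> x y. if h x < m \<and> h y < m then G (f (h x)) (f (h y)) else if x = y then 1 else 0) = det V"
    by (simp only: det_mul detU detU' mult_1_left mult_1_right)
  also have "det V = (\<Prod>x\<in>UNIV. k x)" by (subst det_diagonal) (auto simp: V_def)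
  also have "\<dots> = (\<Prod>l<d. if l < m then G (?v l) (?v l) else 1)"
    unfolding k_def by (rule prod.reindex_bij_betw[OF h])
  also have "\<dots> = (\<Prod>i<m. G (?v i) (?v i))"
    using m by (intro prod.mono_neutral_cong_right) auto
  finally show ?thesis .
qed

text \<open>
  In the Leibniz formula each permutation contributes the same power of \<open>t\<close>, since every index
  occurs once as a row and once as a column.
\<close>

lemma gram_determinant_bound:
  fixes M :: "nat \<Rightarrow> nat \<Rightarrow> complex" and h :: "'n :: finite \<Rightarrow> nat" and r :: "nat \<Rightarrow> real"
  assumes h: "bij_betw h UNIV {..<d}" and m: "m \<le> d" and C: "1 \<le> C" "0 < t"
    and M: "\<And>i j. i < d \<Longrightarrow> j < d \<Longrightarrow> cmod (M i j) \<le> C * t powr ((r i + r j) / 2)"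
  shows "cmod (det (\<chi> x y :: 'n. if h x < m \<and> h y < m then M (h x) (h y) else if x = y then 1 else 0)) \<le>
     fact (CARD('n)) * (C ^ CARD('n) * t powr (\<Sum>i<m. r i))"
proof -
  let ?g = "\<lambda>x y. if h x < m \<and> h y < m then M (h x) (h y) else if x = y then 1 else 0"
  let ?r = "\<lambda>x. if h x < m then r (h x) else 0"
  have hd: "h x < d" for x using h by (auto simp: bij_betw_def)
  have summand: "cmod (of_int (sign p) * (\<Prod>x\<in>UNIV. ?g x (p x))) \<le> C ^ CARD('n) * t powr (\<Sum>i<m. r i)"
    if p: "p permutes UNIV" for p
  proof -
    have "cmod (?g x y) \<le> C * t powr ((?r x + ?r y) / 2)" for x y
      using M[OF hd[of x] hd[of y]] C by auto
    then have "cmod (\<Prod>x\<in>UNIV. ?g x (p x)) \<le> (\<Prod>x\<in>UNIV. C * t powr ((?r x + ?r (p x)) / 2))"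
      unfolding prod_norm[symmetric] by (intro prod_mono) auto
    also have "\<dots> = C ^ CARD('n) * t powr (\<Sum>x\<in>UNIV. (?r x + ?r (p x)) / 2)"
      using C by (simp add: prod.distrib powr_sum)
    also have "(\<Sum>x\<in>UNIV. (?r x + ?r (p x)) / 2) = ((\<Sum>x\<in>UNIV. ?r x) + (\<Sum>x\<in>UNIV. ?r (p x))) / 2"
      by (simp only: sum.distrib flip: sum_divide_distrib)
    also have "(\<Sum>x\<in>UNIV. ?r (p x)) = (\<Sum>x\<in>UNIV. ?r x)"
      using sum.permute[OF p, of ?r] by (simp add: o_def)
    also have "(\<Sum>x\<in>UNIV. ?r x) = (\<Sum>l<d. if l < m then r l else 0)" by (rule sum.reindex_bij_betw[OF h])
    also have "\<dots> = (\<Sum>i<m. r i)" using m by (intro sum.mono_neutral_cong_right) auto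
    finally have "cmod (\<Prod>x\<in>UNIV. ?g x (p x)) \<le> C ^ CARD('n) * t powr (\<Sum>i<m. r i)" by simp
    moreover have "cmod (of_int (sign p)) = 1" by (simp add: sign_def)
    ultimately show ?thesis by (simp add: norm_mult)
  qed
  have "cmod (det (\<chi> x y :: 'n. ?g x y)) \<le> (\<Sum>p\<in>{p. p permutes (UNIV :: 'n set)}. C ^ CARD('n) * t powr (\<Sum>i<m. r i))"
    unfolding det_def by (intro order_trans[OF norm_sum] sum_mono) (use summand in simp)
  also have "\<dots> = fact (CARD('n)) * (C ^ CARD('n) * t powr (\<Sum>i<m. r i))"
    by (simp add: card_permutations[of "UNIV :: 'n set"])
  finally show ?thesis .
qed

section \<open>Polynomial dependence on a real parameter\<close>

definition polynomial_in :: "(real \<Rightarrow> complex) \<Rightarrow> bool" where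
  "polynomial_in \<phi> \<longleftrightarrow> (\<exists>P. \<forall>t. \<phi> t = poly P (of_real t))"

lemma polynomial_in_const: "polynomial_in (\<lambda>_. c)"
  unfolding polynomial_in_def by (intro exI[of _ "[:c:]"]) simp

lemma polynomial_in_ident: "polynomial_in (\<lambda>t. of_real t)"
  unfolding polynomial_in_def by (intro exI[of _ "[:0, 1:]"]) simp

lemma polynomial_in_add: "polynomial_in \<phi> \<Longrightarrow> polynomial_in \<psi> \<Longrightarrow> polynomial_in (\<lambda>t. \<phi> t + \<psi> t)"
  unfolding polynomial_in_def by (metis poly_add)

lemma polynomial_in_mult: "polynomial_in \<phi> \<Longrightarrow> polynomial_in \<psi> \<Longrightarrow> polynomial_in (\<lambda>t. \<phi> t * \<psi> t)"
  unfolding polynomial_in_def by (metis poly_mult)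

lemma polynomial_in_power: "polynomial_in \<phi> \<Longrightarrow> polynomial_in (\<lambda>t. \<phi> t ^ k)"
  by (induction k) (auto intro: polynomial_in_const polynomial_in_mult)

lemma polynomial_in_sum: "(\<And>i. i \<in> I \<Longrightarrow> polynomial_in (\<phi> i)) \<Longrightarrow> polynomial_in (\<lambda>t. \<Sum>i\<in>I. \<phi> i t)"
  by (induction I rule: infinite_finite_induct) (auto intro: polynomial_in_const polynomial_in_add)

lemma polynomial_in_prod: "(\<And>i. i \<in> I \<Longrightarrow> polynomial_in (\<phi> i)) \<Longrightarrow> polynomial_in (\<lambda>t. \<Prod>i\<in>I. \<phi> i t)"
  by (induction I rule: infinite_finite_induct) (auto intro: polynomial_in_const polynomial_in_mult)

lemma polynomial_in_det:
  fixes M :: "'n :: finite \<Rightarrow> 'n \<Rightarrow> real \<Rightarrow> complex"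
  assumes "\<And>x y. polynomial_in (M x y)"
  shows "polynomial_in (\<lambda>t. det (\<chi> x y. M x y t))"
  unfolding det_def
  by (intro polynomial_in_sum polynomial_in_mult polynomial_in_const) (auto intro!: polynomial_in_prod assms)

lemma polynomial_in_Re:
  assumes "polynomial_in \<phi>" shows "\<exists>p :: real poly. \<forall>t. Re (\<phi> t) = poly p t"
proof -
  obtain P where P: "\<And>t. \<phi> t = poly P (of_real t)" using assms by (auto simp: polynomial_in_def)
  define p where "p = (\<Sum>i\<le>degree P. monom (Re (coeff P i)) i)"
  have "Re (\<phi> t) = poly p t" for t
    unfolding P poly_altdef[of P] by (simp add: p_def poly_sum poly_monom flip: of_real_power)
  then show ?thesis by blast
qed

lemma poly_lead_limit:
  fixes p :: "real poly"
  shows "((\<lambda>x. poly p x / x ^ degree p) \<longlongrightarrow> lead_coeff p) at_top"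
  using poly_divide_tendsto_aux[of p] at_top_le_at_infinity tendsto_mono by blast

text \<open>
  A nonzero polynomial behaves like its leading term, for which \<open>t\<close> times the logarithmic derivative is
  the degree.
\<close>

lemma poly_log_derivative_bound:
  fixes p :: "real poly"
  assumes "p \<noteq> 0"
  shows "\<exists>t0. \<forall>t\<ge>t0. 0 \<le> poly (pderiv p) t / poly p t \<and> t * (poly (pderiv p) t / poly p t) \<le> real (degree p) + 1"
proof (cases "degree p = 0")
  case True
  then have "pderiv p = 0" by (simp add: pderiv_eq_0_iff)
  then show ?thesis by simp
next
  case False
  define q where "q = pderiv p"
  have dq: "degree q = degree p - 1" by (simp add: q_def degree_pderiv)
  have lq: "lead_coeff q = real (degree p) * lead_coeff p"
    using False by (simp add: dq) (simp add: q_def coeff_pderiv)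
  have L1: "((\<lambda>x. (poly q x / x ^ degree q) / (poly p x / x ^ degree p)) \<longlongrightarrow> lead_coeff q / lead_coeff p) at_top"
    using assms by (intro tendsto_divide poly_lead_limit) auto
  have L2: "lead_coeff q / lead_coeff p = real (degree p)" using assms by (simp add: lq)
  have ev: "\<forall>\<^sub>F x in at_top. (poly q x / x ^ degree q) / (poly p x / x ^ degree p) = x * (poly q x / poly p x)"
  proof (rule eventually_mono[OF eventually_gt_at_top[of 0]])
    fix x :: real assume "0 < x"
    moreover have "x ^ degree p = x * x ^ degree q" using False by (simp add: dq flip: power_Suc)
    ultimately show "(poly q x / x ^ degree q) / (poly p x / x ^ degree p) = x * (poly q x / poly p x)"
      by (simp add: field_simps)
  qed
  have lim: "((\<lambda>x. x * (poly q x / poly p x)) \<longlongrightarrow> real (degree p)) at_top"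
    by (rule Lim_transform_eventually[OF L1[unfolded L2] ev])
  have "\<forall>\<^sub>F x in at_top. x * (poly q x / poly p x) < real (degree p) + 1"
    using lim by (rule order_tendstoD) simp
  moreover have "\<forall>\<^sub>F x in at_top. 0 < x * (poly q x / poly p x)"
    using lim by (rule order_tendstoD) (use False in simp)
  moreover have "\<forall>\<^sub>F x in at_top. (0::real) < x" by (rule eventually_gt_at_top)
  ultimately have "\<forall>\<^sub>F x in at_top. 0 \<le> poly q x / poly p x \<and> x * (poly q x / poly p x) \<le> real (degree p) + 1"
  proof eventually_elim
    case (elim x)
    then have "0 < poly q x / poly p x" using zero_less_mult_pos by blast
    then show ?case using elim by (intro conjI less_imp_le)
  qed
  then show ?thesis by (simp add: eventually_at_top_linorder q_def)
qed

section \<open>Strictness of a polarized nilpotent orbit\<close>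

text \<open>
  The series of \<open>e\<^sup>z\<^sup>A\<close> cut off after \<open>k\<close> terms, which is the exponential when the power \<open>k\<close> of \<open>A\<close> is
  zero.
\<close>

definition nilexp :: "complex ^ 'n ^ 'n \<Rightarrow> nat \<Rightarrow> complex \<Rightarrow> complex ^ 'n \<Rightarrow> complex ^ 'n" where
  "nilexp A k z u = (\<Sum>m<k. (z ^ m / fact m) *s ((*v) A ^^ m) u)"

lemma nilexp_add: "nilexp A k z (u + w) = nilexp A k z u + nilexp A k z w"
proof -
  have "((*v) A ^^ m) (u + w) = ((*v) A ^^ m) u + ((*v) A ^^ m) w" for m
    by (induction m) (simp_all add: matrix_vector_right_distrib)
  then show ?thesis by (simp add: nilexp_def vec.scale_right_distrib sum.distrib)
qed

lemma nilexp_scale: "nilexp A k z (c *s u) = c *s nilexp A k z u"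
proof -
  have "((*v) A ^^ m) (c *s u) = c *s ((*v) A ^^ m) u" for m
    by (induction m) (simp_all add: vec.scale)
  then show ?thesis
    by (simp add: nilexp_def vec.scale_sum_right vector_smult_assoc mult.commute)
qed

lemma nilexp_commute: "A *v nilexp A k z u = nilexp A k z (A *v u)"
proof -
  have "((*v) A ^^ m) (A *v u) = A *v ((*v) A ^^ m) u" for m
    by (induction m) simp_all
  then show ?thesis
    by (simp add: nilexp_def vec.sum vec.scale)
qed

lemma nilexp_has_derivative:
  assumes nil: "\<And>u. ((*v) A ^^ k) u = 0"
  shows "((\<lambda>t. nilexp A k (of_real t * c) u) has_vector_derivative c *s (A *v nilexp A k (of_real t * c) u)) (at t)"
proof (cases k)
  case 0 then show ?thesis by (simp add: nilexp_def)
next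
  case (Suc k')
  let ?a = "\<lambda>m. ((*v) A ^^ m) u"
  have D: "((\<lambda>t. ((of_real t * c) ^ m / fact m) *s ?a m) has_vector_derivative
      (of_nat m * c * (of_real t * c) ^ (m - 1) / fact m) *s ?a m) (at t)" for m
  proof -
    have "((\<lambda>z. (z * c) ^ m / fact m) has_field_derivative (of_nat m * (of_real t * c) ^ (m - 1) * (1 * c) / fact m)) (at (complex_of_real t))"
      by (auto intro!: derivative_eq_intros)
    from has_vector_derivative_scale[OF has_vector_derivative_real_field[OF this] has_vector_derivative_const[of "?a m"]]
    show ?thesis by (simp add: mult_ac)
  qed
  have "((\<lambda>t. nilexp A k (of_real t * c) u) has_vector_derivative
      (\<Sum>m<k. (of_nat m * c * (of_real t * c) ^ (m - 1) / fact m) *s ?a m)) (at t)"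
    unfolding nilexp_def by (intro has_vector_derivative_sum D)
  moreover have "(\<Sum>m<k. (of_nat m * c * (of_real t * c) ^ (m - 1) / fact m) *s ?a m) =
      (\<Sum>m<k'. (c * ((of_real t * c) ^ m / fact m)) *s ?a (Suc m))"
    unfolding Suc sum.lessThan_Suc_shift by (simp add: field_simps del: of_nat_Suc)
  moreover have "\<dots> = (\<Sum>m<k. (c * ((of_real t * c) ^ m / fact m)) *s ?a (Suc m))"
    using nil[of u] unfolding Suc by simp
  moreover have "\<dots> = c *s (A *v nilexp A k (of_real t * c) u)"
    by (simp add: nilexp_def vec.sum vec.scale vec.scale_sum_right vector_smult_assoc)
  ultimately show ?thesis by simp
qed

text \<open>
  A nilpotent orbit, seen from the complex vector space only: the weight filtration of \<open>A\<close>, a flag \<open>F\<close>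
  on which \<open>A\<close> acts transversally, and a Hermitian form that polarizes \<open>e\<^sup>i\<^sup>t\<^sup>A F\<close> for \<open>t > b\<close>.
\<close>

locale polarized_nilpotent = lefschetz_filtration A W l0 l1
  for A :: "complex ^ 'n ^ 'n" and W l0 l1 +
  fixes H :: "complex ^ 'n \<Rightarrow> complex ^ 'n \<Rightarrow> complex"
    and F :: "int \<Rightarrow> (complex ^ 'n) set" and n :: nat and b :: real and k :: nat
  assumes H_herm: "hermitian_form H"
    and H_skew: "H (A *v u) w = - H u (A *v w)"
    and A_nil: "((*v) A ^^ k) u = 0"
    and F_sub: "vec.subspace (F p)"
    and F_anti: "antimono F" and F_0: "F 0 = UNIV" and F_top: "F (int n + 1) = {0}"
    and F_A: "u \<in> F p \<Longrightarrow> A *v u \<in> F (p - 1)"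
    and W_orth: "u \<in> W l \<Longrightarrow> w \<in> W l' \<Longrightarrow> l + l' < 0 \<Longrightarrow> H u w = 0"
    and polarized: "b < t \<Longrightarrow> u \<in> F p \<Longrightarrow> u \<noteq> 0 \<Longrightarrow>
        (\<And>w. w \<in> F (p + 1) \<Longrightarrow> H (nilexp A k (of_real t * \<i>) u) (nilexp A k (of_real t * \<i>) w) = 0) \<Longrightarrow>
        0 < (if even p then 1 else -1) * Re (H (nilexp A k (of_real t * \<i>) u) (nilexp A k (of_real t * \<i>) u))"
begin

definition "K t u w = H (nilexp A k (of_real t * \<i>) u) (nilexp A k (of_real t * \<i>) w)"

lemma K_herm: "hermitian_form (K t)"
proof -
  have "K t w u = cnj (K t u w)" for u w unfolding K_def by (rule hermitian_formD(3)[OF H_herm])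
  moreover have "K t (u + v) w = K t u w + K t v w" "K t (c *s u) w = c * K t u w" for u v w c
    by (simp_all add: K_def nilexp_add nilexp_scale hermitian_formD(1,2)[OF H_herm])
  ultimately show ?thesis unfolding hermitian_form_def by blast
qed

lemma K_skew: "K t (A *v u) w = - K t u (A *v w)"
  by (simp add: K_def nilexp_commute[symmetric] H_skew[of "nilexp A k (of_real t * \<i>) u"])

lemma K_deriv: "form_derivative K (\<lambda>u w. 2 * \<i> * K t (A *v u) w) t"
  unfolding form_derivative_def
proof (intro allI)
  fix u w
  let ?e = "\<lambda>u t. nilexp A k (of_real t * \<i>) u"
  have c: "form_derivative (\<lambda>_. H) (\<lambda>_ _. 0) t" by (simp add: form_derivative_def)
  have "((\<lambda>s. H (?e u s) (?e w s)) has_vector_derivative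
      (0 + H (\<i> *s (A *v ?e u t)) (?e w t) + H (?e u t) (\<i> *s (A *v ?e w t)))) (at t)"
    by (rule form_derivative_product_rule[OF H_herm c nilexp_has_derivative[OF A_nil] nilexp_has_derivative[OF A_nil]])
  moreover have "0 + H (\<i> *s (A *v ?e u t)) (?e w t) + H (?e u t) (\<i> *s (A *v ?e w t)) = 2 * \<i> * K t (A *v u) w"
    using H_skew[of "?e u t" "?e w t"]
    by (simp add: hermitian_formD(2)[OF H_herm] hermitian_form_right(2)[OF H_herm] K_def nilexp_commute)
  ultimately show "((\<lambda>t. K t u w) has_vector_derivative 2 * \<i> * K t (A *v u) w) (at t)"
    by (simp add: K_def)
qed

lemma K_expand: "K t u w = (\<Sum>m<k. \<Sum>j<k. ((of_real t * \<i>) ^ m / fact m) *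
    (cnj ((of_real t * \<i>) ^ j / fact j) * H (((*v) A ^^ m) u) (((*v) A ^^ j) w)))"
  unfolding K_def nilexp_def hermitian_form_sum(1)[OF H_herm]
  by (simp add: hermitian_form_sum(2)[OF H_herm] hermitian_formD(2)[OF H_herm]
      hermitian_form_right(2)[OF H_herm] sum_distrib_left mult_ac)

lemma polynomial_in_K: "polynomial_in (\<lambda>t. K t u w)"
  unfolding K_expand complex_cnj_divide complex_cnj_power complex_cnj_mult complex_cnj_complex_of_real divide_inverse
  by (intro polynomial_in_sum polynomial_in_mult polynomial_in_power polynomial_in_const polynomial_in_ident)

text \<open>
  Each application of \<open>A\<close> lowers the weight by two and comes with one factor \<open>t\<close>, and the pairing vanishes
  in negative total weight.  So the power of \<open>t\<close> is at most half the total weight.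
\<close>

lemma K_bound:
  assumes u: "u \<in> W r" and w: "w \<in> W r'" and t: "1 \<le> t"
  shows "cmod (K t u w) \<le> (\<Sum>m<k. \<Sum>j<k. cmod (H (((*v) A ^^ m) u) (((*v) A ^^ j) w))) * t powr ((of_int r + of_int r') / 2)"
proof -
  have "cmod (((of_real t * \<i>) ^ m / fact m) * (cnj ((of_real t * \<i>) ^ j / fact j) * H (((*v) A ^^ m) u) (((*v) A ^^ j) w))) \<le>
     cmod (H (((*v) A ^^ m) u) (((*v) A ^^ j) w)) * t powr ((of_int r + of_int r') / 2)" for m j
  proof (cases "(r - 2 * int m) + (r' - 2 * int j) < 0")
    case True
    then have "H (((*v) A ^^ m) u) (((*v) A ^^ j) w) = 0" by (intro W_orth[OF W_Apow[OF u] W_Apow[OF w]])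
    then show ?thesis by simp
  next
    case False
    then have "2 * int m + 2 * int j \<le> r + r'" by simp
    then have "(of_int (2 * int m + 2 * int j) :: real) \<le> of_int (r + r')" by (simp only: of_int_le_iff)
    then have "2 * (real m + real j) \<le> of_int r + of_int r'" by simp
    then have "t powr (real m + real j) \<le> t powr ((of_int r + of_int r') / 2)" using t by (intro powr_mono) auto
    then have 1: "t ^ m * t ^ j \<le> t powr ((of_int r + of_int r') / 2)" using t by (simp add: powr_add powr_realpow)
    have "cmod ((of_real t * \<i>) ^ m / fact m) \<le> t ^ m" for m
      using t fact_ge_1[of m, where 'a = real] by (simp add: norm_divide norm_power norm_mult divide_le_eq mult_le_cancel_left1)
    then have "cmod ((of_real t * \<i>) ^ m / fact m) * cmod ((of_real t * \<i>) ^ j / fact j) \<le> t ^ m * t ^ j"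
      using t by (intro mult_mono) auto
    then have "cmod ((of_real t * \<i>) ^ m / fact m) * cmod ((of_real t * \<i>) ^ j / fact j) \<le> t powr ((of_int r + of_int r') / 2)"
      using 1 by linarith
    note 2 = mult_right_mono[OF this norm_ge_zero[of "H (((*v) A ^^ m) u) (((*v) A ^^ j) w)"]]
    show ?thesis
      using 2 by (simp only: norm_mult complex_mod_cnj mult.assoc[symmetric] mult.commute[of "cmod (H _ _)"])
  qed
  then show ?thesis unfolding K_expand sum_distrib_right
    by (intro order_trans[OF norm_sum] sum_mono order_trans[OF norm_sum]) auto
qed

text \<open>
  The energy inequality for a frame adapted to both filtrations and the flag compatible with \<open>A\<close>.  Its
  two analytic inputs come from the Gram determinants of the steps of \<open>F\<close>: they are polynomials in \<open>t\<close>,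
  which bounds \<open>E\<close>, and their growth is bounded by the weights of the step, which bounds \<open>lnh\<close>.
\<close>

theorem weight_energy:
  "\<exists>S a r. vec.independent S \<and> finite S \<and>
     (\<forall>v\<in>S. 0 \<le> a v \<and> a v \<le> int n \<and> (\<forall>p. v \<in> F p \<longleftrightarrow> p \<le> a v)) \<and>
     (\<forall>v\<in>S. l0 \<le> r v \<and> r v \<le> l1 \<and> (\<forall>l. v \<in> W l \<longleftrightarrow> r v \<le> l)) \<and>
     (\<forall>p l. vec.span (S \<inter> F p \<inter> W l) = F p \<inter> W l) \<and>
     (\<Sum>l\<in>{l0..l1}. l\<^sup>2 * int (length (c l))) \<le> 2 * (\<Sum>v\<in>S. a v * r v)"
proof -
  obtain S where S: "vec.independent S" "\<And>p l. vec.span (S \<inter> F p \<inter> W l) = F p \<inter> W l"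
    using bifiltration_adapted_basis[OF W_sub W_mono W_bot W_top F_sub F_anti F_0 F_top] by blast
  have fin: "finite S" using S(1) by (rule vec.finiteI_independent)
  have nz: "v \<noteq> 0" if "v \<in> S" for v using S(1) that vec.dependent_zero by blast
  have "\<forall>v\<in>S. \<exists>a. 0 \<le> a \<and> a \<le> int n \<and> (\<forall>p. v \<in> F p \<longleftrightarrow> p \<le> a)"
    using filtration_degree[OF F_anti F_0 F_top] nz by blast
  then obtain a where a: "\<forall>v\<in>S. 0 \<le> a v \<and> a v \<le> int n \<and> (\<forall>p. v \<in> F p \<longleftrightarrow> p \<le> a v)"
    unfolding bchoice_iff by blast
  have "\<forall>v\<in>S. \<exists>r. l0 \<le> r \<and> r \<le> l1 \<and> (\<forall>l. v \<in> W l \<longleftrightarrow> r \<le> l)"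
    using weight_degree[OF W_mono W_bot W_top] nz by blast
  then obtain r where r: "\<forall>v\<in>S. l0 \<le> r v \<and> r v \<le> l1 \<and> (\<forall>l. v \<in> W l \<longleftrightarrow> r v \<le> l)"
    unfolding bchoice_iff by blast
  define d where "d = card S"
  obtain f where f: "bij_betw f {..<d} S" and f_anti: "\<And>i j. i \<le> j \<Longrightarrow> j < d \<Longrightarrow> a (f j) \<le> a (f i)"
    using finite_weight_enumeration[OF fin, of a] unfolding d_def by blast
  have fS: "f i \<in> S" if "i < d" for i using f that by (auto simp: bij_betw_def)
  have f_im: "f ` {..<d} = S" using f by (simp add: bij_betw_def)
  have spanS: "vec.span S = UNIV" using S(2)[of 0 l1] F_0 W_top by simp
  have spanF: "vec.span (S \<inter> F p) = F p" for p using S(2)[of p l1] W_top by simp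
  have dN: "d = CARD('n)"
    using S(1) spanS unfolding d_def by (metis vec.dim_eq_card_independent vec.dim_span vec_dim_card)
  have SF: "S \<inter> F p = f ` {j. j < d \<and> p \<le> a (f j)}" for p
    using a f_im fS by (auto simp: image_iff)
  obtain g :: "nat \<Rightarrow> complex ^ 'n" and \<rho> :: "nat \<Rightarrow> int" and \<sigma> d' where g: "vec.span (g ` {..<d'}) = UNIV"
     "\<forall>l<d'. g l \<notin> vec.span (g ` {..<l})" "\<forall>l<d'. A *v g l \<in> vec.span (g ` {..<l})"
     "bij_betw \<sigma> {l. l < d' \<and> 0 < \<rho> l} {l. l < d' \<and> \<rho> l < (0::int)}"
     "\<forall>l<d'. 0 < \<rho> l \<longrightarrow> \<rho> (\<sigma> l) = - \<rho> l \<and> g (\<sigma> l) = ((*v) A ^^ nat (\<rho> l)) (g l) \<and>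
        (\<forall>u \<in> vec.span (g ` {..<l}). ((*v) A ^^ nat (\<rho> l)) u \<in> vec.span (g ` {..<\<sigma> l}))"
     "(\<Sum>l<d'. (\<rho> l)\<^sup>2) = (\<Sum>r\<in>{l0..l1}. r\<^sup>2 * int (length (c r)))"
    using compatible_flag by blast
  interpret fl: hodge_flow_flag K A f d "\<lambda>i. a (f i)" b g d'
  proof
    show "hermitian_form (K t)" for t by (rule K_herm)
    show "K t (A *v u) w = - K t u (A *v w)" for t u w by (rule K_skew)
    show "form_derivative K (\<lambda>u w. 2 * \<i> * K t (A *v u) w) t" for t by (rule K_deriv)
    show "vec.span (f ` {..<d}) = UNIV" by (simp add: f_im spanS)
    show "a (f j) \<le> a (f i)" if "i \<le> j" "j < d" for i j by (rule f_anti[OF that])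
    show "A *v f i \<in> vec.span (f ` {j. j < d \<and> a (f i) - 1 \<le> a (f j)})" if "i < d" for i
    proof -
      have "f i \<in> F (a (f i))" using a fS[OF that] by auto
      then have "A *v f i \<in> F (a (f i) - 1)" by (rule F_A)
      then show ?thesis using spanF[of "a (f i) - 1"] by (simp add: SF)
    qed
    show "0 < (if even (a (f i)) then 1 else - 1) * Re (K t u u)"
      if t: "b < t" and i: "i < d" and u: "f i - u \<in> vec.span (f ` {..<i})"
        and orth: "\<And>w. w \<in> vec.span (f ` {..<i}) \<Longrightarrow> K t u w = 0" for t i u
      unfolding K_def
    proof (rule polarized[OF t])
      have "f ` {..<i} \<subseteq> F (a (f i))"
        using a fS f_anti i by auto
      then have "f i - u \<in> F (a (f i))" using u vec.span_minimal[OF _ F_sub] by blast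
      moreover have "f i \<in> F (a (f i))" using a fS[OF i] by auto
      ultimately have "f i - (f i - u) \<in> F (a (f i))" using F_sub vec.subspace_diff by blast
      then show "u \<in> F (a (f i))" by simp
      show "u \<noteq> 0"
      proof
        assume "u = 0"
        then have "f i \<in> vec.span (f ` {..<i})" using u by simp
        moreover have "f ` {..<i} \<subseteq> S - {f i}"
          using f fS i by (auto simp: bij_betw_def inj_on_def)
        ultimately have "f i \<in> vec.span (S - {f i})" using vec.span_mono by blast
        then show False using S(1) fS[OF i] by (auto simp: vec.dependent_def)
      qed
      show "H (nilexp A k (of_real t * \<i>) u) (nilexp A k (of_real t * \<i>) w) = 0" if w: "w \<in> F (a (f i) + 1)" for w
      proof -
        have "{j. j < d \<and> a (f i) + 1 \<le> a (f j)} \<subseteq> {..<i}"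
          using f_anti[of i] by (force simp: not_less[symmetric])
        then have "S \<inter> F (a (f i) + 1) \<subseteq> f ` {..<i}" unfolding SF by (intro image_mono)
        from vec.span_mono[OF this] have "w \<in> vec.span (f ` {..<i})" using w unfolding spanF by (rule subsetD)
        from orth[OF this] show ?thesis by (simp only: K_def)
      qed
    qed
    show "vec.span (g ` {..<d'}) = UNIV" by (rule g(1))
    show "g l \<notin> vec.span (g ` {..<l})" if "l < d'" for l using g(2) that by blast
    show "A *v g l \<in> vec.span (g ` {..<l})" if "l < d'" for l using g(3) that by blast
  qed
  (* The frame is sorted by degree, so each step of F is spanned by an initial segment of it. *)
  define mq where "mq q = card {i. i < d \<and> q \<le> a (f i)}" for q :: int
  have mq: "{i. i < d \<and> q \<le> a (f i)} = {..<mq q}" "mq q \<le> d" for q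
  proof -
    have "\<exists>m\<le>d. {i. i < d \<and> q \<le> a (f i)} = {..<m}"
    proof (cases "\<exists>i<d. \<not> q \<le> a (f i)")
      case True
      define m where "m = (LEAST i. i < d \<and> \<not> q \<le> a (f i))"
      have m: "m < d \<and> \<not> q \<le> a (f m)" 
        using LeastI_ex[of "\<lambda>i. i < d \<and> \<not> q \<le> a (f i)"] True unfolding m_def by blast
      have "i < m \<longleftrightarrow> i < d \<and> q \<le> a (f i)" for i
      proof
        assume "i < m"
        then show "i < d \<and> q \<le> a (f i)"
          using not_less_Least[of i "\<lambda>i. i < d \<and> \<not> q \<le> a (f i)"] m unfolding m_def by simp
      next
        assume i: "i < d \<and> q \<le> a (f i)"
        show "i < m"
        proof (rule ccontr)
          assume "\<not> i < m"
          then have "a (f i) \<le> a (f m)" using i by (intro f_anti) auto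
          then show False using i m by simp
        qed
      qed
      then show ?thesis using m by (intro exI[of _ m]) auto
    next
      case False then show ?thesis by (intro exI[of _ d]) auto
    qed
    then obtain m where m: "m \<le> d" "{i. i < d \<and> q \<le> a (f i)} = {..<m}" by blast
    then have "mq q = m" by (simp add: mq_def)
    then show "{i. i < d \<and> q \<le> a (f i)} = {..<mq q}" "mq q \<le> d" using m by auto
  qed
  obtain h :: "'n \<Rightarrow> nat" where h: "bij_betw h UNIV {..<d}"
    using ex_bij_betw_finite_nat[of "UNIV :: 'n set"] dN by (auto simp: atLeast0LessThan)
  have "\<exists>p C. \<forall>t. (b < t \<longrightarrow> (\<Prod>i<m. fl.\<kappa> i t) = poly p t) \<and>
      (b < t \<longrightarrow> 1 \<le> t \<longrightarrow> \<bar>poly p t\<bar> \<le> C * t powr (\<Sum>i<m. of_int (r (f i)))) \<and> (0 < C)" if m: "m \<le> d" for m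
  proof -
    define Dt where "Dt t = det (\<chi> x y. if h x < m \<and> h y < m then K t (f (h x)) (f (h y)) else if x = y then 1 else 0)" for t
    have "polynomial_in Dt" unfolding Dt_def[abs_def]
    proof (rule polynomial_in_det)
      fix x y
      show "polynomial_in (\<lambda>t. if h x < m \<and> h y < m then K t (f (h x)) (f (h y)) else if x = y then 1 else 0)"
      proof (cases "h x < m \<and> h y < m")
        case True then show ?thesis by (simp add: polynomial_in_K)
      next
        case False
        show ?thesis by (simp only: False if_False polynomial_in_const)
      qed
    qed
    then obtain p where p: "\<And>t. Re (Dt t) = poly p t" using polynomial_in_Re by blast
    have Dprod: "Dt t = of_real (\<Prod>i<m. fl.\<kappa> i t)" if "b < t" for t
      unfolding Dt_def gram_determinant[OF K_herm fl.regular[OF that] fl.f_span h m]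
      by (simp add: fl.K_vv[unfolded fl.v_def])
    define C where "C = 1 + (\<Sum>i<d. \<Sum>j<d. \<Sum>m<k. \<Sum>l<k. cmod (H (((*v) A ^^ m) (f i)) (((*v) A ^^ l) (f j))))"
    have C1: "1 \<le> C" unfolding C_def by (simp add: sum_nonneg)
    have KC: "cmod (K t (f i) (f j)) \<le> C * t powr ((of_int (r (f i)) + of_int (r (f j))) / 2)"
      if "i < d" "j < d" "1 \<le> t" for i j t
    proof -
      let ?s = "\<lambda>i j. \<Sum>m<k. \<Sum>l<k. cmod (H (((*v) A ^^ m) (f i)) (((*v) A ^^ l) (f j)))"
      have "?s i j \<le> (\<Sum>j<d. ?s i j)" using that by (intro member_le_sum) (auto intro!: sum_nonneg)
      also have "\<dots> \<le> (\<Sum>i<d. \<Sum>j<d. ?s i j)" using that by (intro member_le_sum[of i _ "\<lambda>i. \<Sum>j<d. ?s i j"]) (auto intro!: sum_nonneg)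
      finally have "?s i j \<le> C" by (simp add: C_def)
      moreover have "cmod (K t (f i) (f j)) \<le> ?s i j * t powr ((of_int (r (f i)) + of_int (r (f j))) / 2)"
        using r fS that by (intro K_bound) auto
      ultimately show ?thesis by (meson order_trans mult_right_mono powr_ge_zero)
    qed
    have "\<bar>poly p t\<bar> \<le> fact (CARD('n)) * C ^ CARD('n) * t powr (\<Sum>i<m. of_int (r (f i)))" if "b < t" "1 \<le> t" for t
    proof -
      have "\<bar>poly p t\<bar> \<le> cmod (Dt t)" unfolding p[symmetric] by (rule abs_Re_le_cmod)
      also have "\<dots> \<le> fact (CARD('n)) * (C ^ CARD('n) * t powr (\<Sum>i<m. of_int (r (f i))))"
        unfolding Dt_def using that KC by (intro gram_determinant_bound[OF h m C1]) auto
      finally show ?thesis by (simp add: mult.assoc)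
    qed
    moreover have "(\<Prod>i<m. fl.\<kappa> i t) = poly p t" if "b < t" for t
      using Dprod[OF that] p[of t] by (metis Re_complex_of_real)
    moreover have "0 < fact (CARD('n)) * C ^ CARD('n)" using C1 by simp
    ultimately show ?thesis by (intro exI[of _ p] exI[of _ "fact (CARD('n)) * C ^ CARD('n)"]) blast
  qed
  then have "\<forall>q. \<exists>p C. \<forall>t. (b < t \<longrightarrow> (\<Prod>i<mq q. fl.\<kappa> i t) = poly p t) \<and>
      (b < t \<longrightarrow> 1 \<le> t \<longrightarrow> \<bar>poly p t\<bar> \<le> C * t powr (\<Sum>i<mq q. of_int (r (f i)))) \<and> (0 < C)"
    using mq(2) by blast
  then obtain P C where P: "\<And>q t. b < t \<Longrightarrow> (\<Prod>i<mq q. fl.\<kappa> i t) = poly (P q) t"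
    "\<And>q t. b < t \<Longrightarrow> 1 \<le> t \<Longrightarrow> \<bar>poly (P q) t\<bar> \<le> C q * t powr (\<Sum>i<mq q. of_int (r (f i)))"
    "\<And>q. 0 < (C q :: real)"
    by metis
  have Pnz: "poly (P q) t \<noteq> 0" if t: "b < t" for q t
  proof -
    have "fl.\<kappa> i t \<noteq> 0" if "i \<in> {..<mq q}" for i
      using fl.kappa_nz[OF t] that mq(2)[of q] by simp
    then have "(\<Prod>i<mq q. fl.\<kappa> i t) \<noteq> 0" by simp
    then show ?thesis unfolding P(1)[OF t] .
  qed
  let ?Q = "{1..int n}"
  (* Summation by layers turns exponents a i into products over the steps of F. *)
  have layer: "(\<Sum>i<d. of_int (a (f i)) * x i) = (\<Sum>q\<in>?Q. \<Sum>i<mq q. x i)" for x :: "nat \<Rightarrow> real"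
  proof -
    have "(\<Sum>q\<in>?Q. \<Sum>i<mq q. x i) = (\<Sum>q\<in>?Q. \<Sum>i<d. if q \<le> a (f i) then x i else 0)"
      unfolding mq(1)[symmetric] by (intro sum.cong refl sum.mono_neutral_cong_left) auto
    also have "\<dots> = (\<Sum>i<d. \<Sum>q\<in>?Q. if q \<le> a (f i) then x i else 0)" by (rule sum.swap)
    also have "\<dots> = (\<Sum>i<d. of_int (a (f i)) * x i)"
    proof (rule sum.cong[OF refl])
      fix i assume "i \<in> {..<d}"
      then have ai: "0 \<le> a (f i)" "a (f i) \<le> int n" using a fS by auto
      have "(\<Sum>q\<in>?Q. if q \<le> a (f i) then x i else 0) = (\<Sum>q\<in>{1..a (f i)}. x i)"
        using ai by (intro sum.mono_neutral_cong_right) auto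
      then show "(\<Sum>q\<in>?Q. if q \<le> a (f i) then x i else 0) = of_int (a (f i)) * x i" using ai by simp
    qed
    finally show ?thesis by simp
  qed
  have lnh: "fl.lnh t = (\<Sum>q\<in>?Q. ln \<bar>poly (P q) t\<bar>)" if "b < t" for t
  proof -
    have "ln \<bar>poly (P q) t\<bar> = (\<Sum>i<mq q. ln \<bar>fl.\<kappa> i t\<bar>)" for q
      unfolding P(1)[OF that, symmetric] abs_prod
      using fl.kappa_nz[OF that] mq(2)[of q] by (intro ln_prod) auto
    then show ?thesis unfolding fl.lnh_def layer by simp
  qed
  define w :: real where "w = (\<Sum>i<d. of_int (a (f i)) * of_int (r (f i)))"
  have growth: "fl.lnh t \<le> w * ln t + (\<Sum>q\<in>?Q. ln (C q))" if "b < t" "1 \<le> t" for t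
  proof -
    have "ln \<bar>poly (P q) t\<bar> \<le> ln (C q) + (\<Sum>i<mq q. of_int (r (f i))) * ln t" for q
    proof -
      have "ln \<bar>poly (P q) t\<bar> \<le> ln (C q * t powr (\<Sum>i<mq q. of_int (r (f i))))"
        using P(2)[OF that, of q] Pnz[OF that(1), of q] P(3)[of q] that by (intro ln_mono) auto
      also have "\<dots> = ln (C q) + (\<Sum>i<mq q. of_int (r (f i))) * ln t"
        using P(3)[of q] that by (subst ln_mult) (auto simp: ln_powr)
      finally show ?thesis .
    qed
    then have "fl.lnh t \<le> (\<Sum>q\<in>?Q. ln (C q) + (\<Sum>i<mq q. of_int (r (f i))) * ln t)"
      unfolding lnh[OF that(1)] by (intro sum_mono)
    also have "\<dots> = (\<Sum>q\<in>?Q. ln (C q)) + (\<Sum>q\<in>?Q. \<Sum>i<mq q. of_int (r (f i))) * ln t"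
      by (simp add: sum.distrib sum_distrib_right)
    finally show ?thesis by (simp add: w_def layer)
  qed
  have E: "fl.E t = (\<Sum>q\<in>?Q. poly (pderiv (P q)) t / poly (P q) t)" if t: "b < t" for t
  proof -
    have ln: "((\<lambda>t. ln \<bar>poly (P q) t\<bar>) has_real_derivative poly (pderiv (P q)) t / poly (P q) t) (at t)" for q
    proof -
      have nz: "poly (P q) t \<noteq> 0" by (rule Pnz[OF t])
      have "((\<lambda>t. ln ((poly (P q) t)\<^sup>2) / 2) has_real_derivative
          (1 / (poly (P q) t)\<^sup>2 * (of_nat 2 * (poly (pderiv (P q)) t * poly (P q) t ^ (2 - Suc 0)))) / 2) (at t)"
        using nz by (intro DERIV_cdivide DERIV_chain2[OF DERIV_ln_divide] DERIV_power poly_DERIV) auto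
      moreover have "ln ((poly (P q) t)\<^sup>2) / 2 = ln \<bar>poly (P q) t\<bar>" for t
      proof (cases "poly (P q) t = 0")
        case False
        have "ln ((poly (P q) t)\<^sup>2) = ln (\<bar>poly (P q) t\<bar> ^ 2)" by (simp only: power2_abs)
        also have "\<dots> = 2 * ln \<bar>poly (P q) t\<bar>" using False by (subst ln_realpow) auto
        finally show ?thesis by simp
      qed simp
      ultimately show ?thesis using nz by (simp add: power2_eq_square field_simps)
    qed
    have "((\<lambda>t. \<Sum>q\<in>?Q. ln \<bar>poly (P q) t\<bar>) has_real_derivative (\<Sum>q\<in>?Q. poly (pderiv (P q)) t / poly (P q) t)) (at t)"
      by (intro DERIV_sum ln)
    then have "(fl.lnh has_real_derivative (\<Sum>q\<in>?Q. poly (pderiv (P q)) t / poly (P q) t)) (at t)"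
      by (rule has_field_derivative_transform_within_open[of _ _ _ "{b<..}"]) (use t lnh in auto)
    then show ?thesis using fl.lnh_deriv[OF t] DERIV_unique by blast
  qed
  have "P q \<noteq> 0" for q using Pnz[of "b + 1" q] by auto
  then have "\<forall>q. \<exists>t0. \<forall>t\<ge>t0. 0 \<le> poly (pderiv (P q)) t / poly (P q) t \<and>
      t * (poly (pderiv (P q)) t / poly (P q) t) \<le> real (degree (P q)) + 1"
    using poly_log_derivative_bound by blast
  then obtain T where T: "\<And>q t. T q \<le> t \<Longrightarrow> 0 \<le> poly (pderiv (P q)) t / poly (P q) t \<and>
      t * (poly (pderiv (P q)) t / poly (P q) t) \<le> real (degree (P q)) + 1" by metis
  define t0 where "t0 = max (\<bar>b\<bar> + 1) (\<Sum>q\<in>?Q. \<bar>T q\<bar>)"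
  have t0: "b < t" "1 \<le> t" "\<And>q. q \<in> ?Q \<Longrightarrow> T q \<le> t" if "t0 \<le> t" for t
  proof -
    show "b < t" "1 \<le> t" using that by (auto simp: t0_def)
    fix q assume q: "q \<in> ?Q"
    have "T q \<le> \<bar>T q\<bar>" by simp
    also have "\<dots> \<le> (\<Sum>q\<in>?Q. \<bar>T q\<bar>)" using q by (intro member_le_sum) auto
    finally show "T q \<le> t" using that by (simp add: t0_def)
  qed
  define C0 where "C0 = \<bar>\<Sum>q\<in>?Q. ln (C q)\<bar> + (\<Sum>q\<in>?Q. real (degree (P q)) + 1)"
  have C0: "(\<Sum>q\<in>?Q. ln (C q)) \<le> C0" "(\<Sum>q\<in>?Q. real (degree (P q)) + 1) \<le> C0"
    unfolding C0_def using sum_nonneg[of ?Q "\<lambda>q. real (degree (P q)) + 1"] by auto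
  have slope: "0 \<le> fl.E t \<and> t * fl.E t \<le> C0" if "t0 \<le> t" for t
  proof
    note t = t0[OF that]
    show "0 \<le> fl.E t" unfolding E[OF t(1)] using T t(3) by (intro sum_nonneg) auto
    have "t * fl.E t = (\<Sum>q\<in>?Q. t * (poly (pderiv (P q)) t / poly (P q) t))"
      unfolding E[OF t(1)] by (rule sum_distrib_left)
    also have "\<dots> \<le> (\<Sum>q\<in>?Q. real (degree (P q)) + 1)" using T t(3) by (intro sum_mono) auto
    finally show "t * fl.E t \<le> C0" using C0 by linarith
  qed
  have "of_int (\<Sum>l<d'. (\<rho> l)\<^sup>2) \<le> 2 * w"
  proof (rule fl.energy_inequality[OF g(4), where C = C0 and ?t0.0 = t0])
    show "fl.lnh t \<le> w * ln t + C0" if "t0 \<le> t" for t using growth[OF t0(1,2)[OF that]] C0 by linarith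
  qed (use g(5) slope in auto)
  moreover have "w = of_int (\<Sum>v\<in>S. a v * r v)"
    unfolding w_def using sum.reindex_bij_betw[OF f, of "\<lambda>v. a v * r v"] by (simp flip: of_int_mult of_int_sum)
  ultimately have "(\<Sum>l<d'. (\<rho> l)\<^sup>2) \<le> 2 * (\<Sum>v\<in>S. a v * r v)" by linarith
  then show ?thesis using S fin a r g(6) by (intro exI[of _ S] exI[of _ a] exI[of _ r]) simp
qed

end

lemma sum_as_layers:
  fixes \<alpha> :: "'a \<Rightarrow> int"
  assumes "finite B" "\<And>v. v \<in> B \<Longrightarrow> 0 \<le> \<alpha> v \<and> \<alpha> v \<le> M"
  shows "(\<Sum>v\<in>B. \<alpha> v) = (\<Sum>p\<in>{1..M}. int (card {v \<in> B. p \<le> \<alpha> v}))"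
proof -
  have "(\<Sum>p\<in>{1..M}. int (card {v \<in> B. p \<le> \<alpha> v})) = (\<Sum>p\<in>{1..M}. \<Sum>v\<in>B. if p \<le> \<alpha> v then 1 else 0)"
    using assms(1) by (intro sum.cong refl) (simp add: sum.If_cases Int_def)
  also have "\<dots> = (\<Sum>v\<in>B. \<Sum>p\<in>{1..M}. if p \<le> \<alpha> v then 1 else 0)" by (rule sum.swap)
  also have "\<dots> = (\<Sum>v\<in>B. \<alpha> v)"
  proof (rule sum.cong[OF refl])
    fix v assume v: "v \<in> B"
    have "(\<Sum>p\<in>{1..M}. if p \<le> \<alpha> v then 1 else 0) = (\<Sum>p\<in>{1..\<alpha> v}. 1 :: int)"
      using assms(2)[OF v] by (intro sum.mono_neutral_cong_right) auto
    then show "(\<Sum>p\<in>{1..M}. if p \<le> \<alpha> v then 1 else 0) = \<alpha> v" using assms(2)[OF v] by simp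
  qed
  finally show ?thesis by simp
qed

lemma sum_over_weights:
  fixes x :: "'a \<Rightarrow> int" and r :: "'a \<Rightarrow> int"
  assumes "finite S" "finite I"
  shows "(\<Sum>l\<in>I. \<Sum>v\<in>{v \<in> S. r v = l}. x v) = (\<Sum>v\<in>{v \<in> S. r v \<in> I}. x v)"
proof -
  have "(\<Sum>l\<in>I. \<Sum>v\<in>{v \<in> S. r v = l}. x v) = (\<Sum>l\<in>I. \<Sum>v\<in>{v \<in> {v \<in> S. r v \<in> I}. r v = l}. x v)"
    by (intro sum.cong refl) auto
  also have "\<dots> = (\<Sum>v\<in>{v \<in> S. r v \<in> I}. x v)" using assms by (intro sum.group) auto
  finally show ?thesis .
qed

context polarized_nilpotent begin

text \<open>
  Injectivity of the powers of \<open>A\<close> on graded pieces bounds the number of basis vectors of weight \<open>s\<close> and degree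
  at least \<open>p\<close> by the number of those of weight \<open>- s\<close> and degree at least \<open>p - s\<close>.  Summed
  over \<open>p\<close> and weighted by \<open>s\<close>, these inequalities add up to the opposite of the inequality of
  \<open>weight_energy\<close>.  So all of them are equalities, and an injection between spaces of the same dimension is onto.
\<close>

theorem strictness:
  assumes x: "x \<in> F (p - int s)" "x \<in> W (- int s)"
  shows "\<exists>u. u \<in> F p \<and> u \<in> W (int s) \<and> x - ((*v) A ^^ s) u \<in> W (- int s - 1)"
proof -
  obtain S a r where S: "vec.independent S" "finite S"
     and a: "\<forall>v\<in>S. 0 \<le> a v \<and> a v \<le> int n \<and> (\<forall>p. v \<in> F p \<longleftrightarrow> p \<le> a v)"
     and r: "\<forall>v\<in>S. l0 \<le> r v \<and> r v \<le> l1 \<and> (\<forall>l. v \<in> W l \<longleftrightarrow> r v \<le> l)"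
     and sp: "\<And>p l. vec.span (S \<inter> F p \<inter> W l) = F p \<inter> W l"
     and energy: "(\<Sum>l\<in>{l0..l1}. l\<^sup>2 * int (length (c l))) \<le> 2 * (\<Sum>v\<in>S. a v * r v)"
    using weight_energy by blast
  define T where "T l p = {v \<in> S. r v = l \<and> p \<le> a v}" for l p
  have finT: "finite (T l p)" for l p using S(2) by (simp add: T_def)
  have TS: "T l p \<subseteq> S" for l p by (auto simp: T_def)
  have spW: "vec.span (S \<inter> W l) = W l" for l using sp[of 0 l] F_0 by simp
  have dimFW: "vec.dim (F p \<inter> W l) = card (S \<inter> F p \<inter> W l)" for p l
    using vec.dim_eq_card_independent[OF vec.independent_mono[OF S(1), of "S \<inter> F p \<inter> W l"]] sp[of p l]
    by (metis inf.assoc inf_le1 vec.dim_span)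
  have zeroT: "u = 0" if u: "u \<in> vec.span (T (int s) p)" "((*v) A ^^ s) u \<in> W (- int s - 1)" for u s p
  proof -
    have "T (int s) p \<subseteq> W (int s)" using r by (auto simp: T_def)
    then have "u \<in> W (int s)" using u(1) vec.span_minimal[OF _ W_sub] by blast
    then have "u \<in> W (int s - 1)" using u(2) by (rule W_inj)
    then have "u \<in> vec.span (S \<inter> W (int s - 1))" by (simp add: spW)
    moreover have "T (int s) p \<inter> (S \<inter> W (int s - 1)) = {}" using r by (auto simp: T_def)
    ultimately show "u = 0"
      using independent_span_disjoint[OF S(1) TS[of "int s" p] Int_lower1[of S "W (int s - 1)"]] u(1) by blast
  qed
  have lin: "Vector_Spaces.linear (*s) (*s) ((*v) A ^^ s)" for s
    by (rule vec_linearI) (simp_all add: Apow_add Apow_scale)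
  have main: "card (T (int s) p) \<le> card (T (- int s) (p - int s)) \<and>
     (card (T (int s) p) = card (T (- int s) (p - int s)) \<longrightarrow>
       (\<forall>x \<in> F (p - int s) \<inter> W (- int s). \<exists>u\<in>vec.span (T (int s) p). x - ((*v) A ^^ s) u \<in> W (- int s - 1)))"
    for s p
  proof -
    let ?f = "((*v) A ^^ s)" and ?T = "T (int s) p"
    let ?Y = "S \<inter> F (p - int s) \<inter> W (- int s - 1)" and ?Z = "F (p - int s) \<inter> W (- int s)"
    have inj: "inj_on ?f (vec.span ?T)"
    proof (rule inj_onI)
      fix u w assume uw: "u \<in> vec.span ?T" "w \<in> vec.span ?T" "?f u = ?f w"
      then have "?f (u - w) = 0" by (simp add: Apow_diff)
      then have "?f (u - w) \<in> W (- int s - 1)" using vec.subspace_0[OF W_sub] by simp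
      then show "u = w" using zeroT[of "u - w" s p] uw by (simp add: vec.span_diff)
    qed
    have indf: "vec.independent (?f ` ?T)"
      using vec.linear_independent_injective_image[OF lin[of s] vec.independent_mono[OF S(1) TS] inj] .
    have cardf: "card (?f ` ?T) = card ?T"
      using inj_on_subset[OF inj vec.span_superset] by (rule card_image)
    have spanf: "\<exists>u\<in>vec.span ?T. y = ?f u" if "y \<in> vec.span (?f ` ?T)" for y
      using that vec.linear_span_image[OF lin[of s], of ?T] by auto
    have disj: "vec.span (?f ` ?T) \<inter> vec.span ?Y \<subseteq> {0}"
    proof
      fix y assume y: "y \<in> vec.span (?f ` ?T) \<inter> vec.span ?Y"
      then obtain u where u: "u \<in> vec.span ?T" "y = ?f u" using spanf by blast
      have "y \<in> W (- int s - 1)" using y sp by blast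
      then show "y \<in> {0}" using zeroT[OF u(1)] u(2) Apow_zero by simp
    qed
    have sums: "{x + y |x y. x \<in> vec.span (?f ` ?T) \<and> y \<in> vec.span ?Y} = vec.span (?f ` ?T \<union> ?Y)"
      by (auto simp: vec.span_Un)
    have indY: "vec.independent ?Y" by (rule vec.independent_mono[OF S(1)]) auto
    have "vec.dim (vec.span (?f ` ?T \<union> ?Y)) + vec.dim (vec.span (?f ` ?T) \<inter> vec.span ?Y) =
        vec.dim (vec.span (?f ` ?T)) + vec.dim (vec.span ?Y)"
      unfolding sums[symmetric] by (intro vec.dim_sums_Int vec.subspace_span)
    moreover have "vec.dim (vec.span (?f ` ?T) \<inter> vec.span ?Y) = 0" using disj by (simp only: vec.dim_eq_0)
    ultimately have dimU: "vec.dim (vec.span (?f ` ?T \<union> ?Y)) = card ?T + card ?Y"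
      using vec.dim_eq_card_independent[OF indf] vec.dim_eq_card_independent[OF indY] cardf
      by (simp add: vec.dim_span)
    have subT: "?f ` ?T \<subseteq> ?Z"
    proof
      fix y assume "y \<in> ?f ` ?T"
      then obtain v where v: "v \<in> ?T" "y = ?f v" by blast
      have "v \<in> F p" "v \<in> W (int s)" using v(1) a r by (auto simp: T_def)
      have "((*v) A ^^ j) v \<in> F (p - int j)" for j
      proof (induction j)
        case 0 then show ?case using \<open>v \<in> F p\<close> by simp
      next
        case (Suc j)
        from F_A[OF this] show ?case by (simp add: algebra_simps)
      qed
      then show "y \<in> ?Z" using W_Apow[OF \<open>v \<in> W (int s)\<close>, of s] v(2) by simp
    qed
    have "?Y \<subseteq> ?Z" using W_le[of "- int s - 1" "- int s"] by auto
    with subT have sub: "vec.span (?f ` ?T \<union> ?Y) \<subseteq> ?Z"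
      by (intro vec.span_minimal vec.subspace_inter F_sub W_sub) auto
    have Z: "S \<inter> F (p - int s) \<inter> W (- int s) = ?Y \<union> T (- int s) (p - int s)"
      using a r by (auto simp: T_def)
    have cardZ: "vec.dim ?Z = card ?Y + card (T (- int s) (p - int s))"
      unfolding dimFW Z using S(2) finT r by (intro card_Un_disjoint) (auto simp: T_def)
    have le: "card ?T + card ?Y \<le> card ?Y + card (T (- int s) (p - int s))"
      using vec.dim_subset[OF sub] dimU cardZ by simp
    moreover have "\<exists>u\<in>vec.span ?T. x - ?f u \<in> W (- int s - 1)"
      if eq: "card ?T = card (T (- int s) (p - int s))" and x: "x \<in> ?Z" for x
    proof -
      have "vec.span (?f ` ?T \<union> ?Y) = ?Z"
        using dimU cardZ eq sub
        by (intro vec.subspace_dim_equal vec.subspace_span vec.subspace_inter F_sub W_sub) auto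
      then have "x \<in> vec.span (?f ` ?T \<union> ?Y)" using x by simp
      then obtain y z where yz: "y \<in> vec.span (?f ` ?T)" "z \<in> vec.span ?Y" "x = y + z"
        unfolding sums[symmetric] by blast
      obtain u where u: "u \<in> vec.span ?T" "y = ?f u" using spanf[OF yz(1)] by blast
      have "z \<in> W (- int s - 1)" using yz(2) sp by blast
      then show ?thesis using u yz(3) by (intro bexI[of _ u]) auto
    qed
    ultimately show ?thesis by auto
  qed
  have card_weight: "card {v \<in> S. r v = l} = length (c l)" for l
  proof -
    have "S \<inter> W l = (S \<inter> W (l - 1)) \<union> {v \<in> S. r v = l}" using r by auto
    then have "card (S \<inter> W l) = card (S \<inter> W (l - 1)) + card {v \<in> S. r v = l}"
      using S(2) r by (auto intro!: card_Un_disjoint)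
    moreover have "vec.dim (W l) = card (S \<inter> W l)" for l using dimFW[of 0 l] F_0 by simp
    ultimately show ?thesis using dim_W_step[of l] by simp
  qed
  define L where "L = max \<bar>l0\<bar> \<bar>l1\<bar>"
  have rL: "- L \<le> r v \<and> r v \<le> L" if "v \<in> S" for v
  proof -
    have "l0 \<le> r v \<and> r v \<le> l1" using r that by blast
    then show ?thesis unfolding L_def by linarith
  qed
  (* Dl l sums over all p the differences between the two numbers of basis vectors. *)
  define Dl where "Dl l = (\<Sum>v\<in>{v \<in> S. r v = - l}. a v + l) - (\<Sum>v\<in>{v \<in> S. r v = l}. a v)" for l
  have Dl: "Dl l = (\<Sum>p\<in>{1..int n + l}. int (card (T (- l) (p - l))) - int (card (T l p)))" if "0 < l" for l
  proof -
    have "(\<Sum>v\<in>{v \<in> S. r v = l}. a v) = (\<Sum>p\<in>{1..int n + l}. int (card {v \<in> {v \<in> S. r v = l}. p \<le> a v}))"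
      using S(2) a that by (intro sum_as_layers) force+
    moreover have "(\<Sum>v\<in>{v \<in> S. r v = - l}. a v + l) = (\<Sum>p\<in>{1..int n + l}. int (card {v \<in> {v \<in> S. r v = - l}. p \<le> a v + l}))"
      using S(2) a that by (intro sum_as_layers) force+
    moreover have "{v \<in> {v \<in> S. r v = l}. p \<le> a v} = T l p" "{v \<in> {v \<in> S. r v = - l}. p \<le> a v + l} = T (- l) (p - l)" for p
      by (auto simp: T_def)
    ultimately show ?thesis by (simp add: Dl_def sum_subtractf)
  qed
  have nonneg: "0 \<le> int (card (T (- l) (p - l))) - int (card (T l p))" if "0 < l" for l p
    using main[of "nat l" p] that by simp
  have Dl0: "0 \<le> Dl l" if "0 < l" for l unfolding Dl[OF that] using nonneg[OF that] by (intro sum_nonneg) auto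
  have "(\<Sum>l\<in>{1..L}. l * Dl l) \<le> 0"
  proof -
    have "(\<Sum>l\<in>{1..L}. l * Dl l) =
       (\<Sum>l\<in>{1..L}. \<Sum>v\<in>{v \<in> S. r v = - l}. - r v * (a v - r v)) - (\<Sum>l\<in>{1..L}. \<Sum>v\<in>{v \<in> S. r v = l}. r v * a v)"
      unfolding sum_subtractf[symmetric] Dl_def right_diff_distrib sum_distrib_left
      by (intro sum.cong arg_cong2[where f = "(-)"] refl) (auto simp: algebra_simps)
    also have "(\<Sum>l\<in>{1..L}. \<Sum>v\<in>{v \<in> S. r v = - l}. - r v * (a v - r v)) =
       (\<Sum>l\<in>{1..L}. \<Sum>v\<in>{v \<in> S. - r v = l}. - r v * (a v - r v))"
      by (intro sum.cong refl) auto
    also have "\<dots> = (\<Sum>v\<in>{v \<in> S. - r v \<in> {1..L}}. - r v * (a v - r v))"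
      by (rule sum_over_weights[OF S(2)]) simp
    also have "{v \<in> S. - r v \<in> {1..L}} = {v \<in> S. r v < 0}" using rL by force
    also have "(\<Sum>l\<in>{1..L}. \<Sum>v\<in>{v \<in> S. r v = l}. r v * a v) = (\<Sum>v\<in>{v \<in> S. 0 < r v}. r v * a v)"
      unfolding sum_over_weights[OF S(2) finite_atLeastAtMost_int] using rL by (intro sum.cong) force+
    also have "(\<Sum>v\<in>{v \<in> S. r v < 0}. - r v * (a v - r v)) - (\<Sum>v\<in>{v \<in> S. 0 < r v}. r v * a v) =
        (\<Sum>v\<in>{v \<in> S. r v < 0}. (r v)\<^sup>2) - (\<Sum>v\<in>S. a v * r v)"
    proof -
      have "(\<Sum>v\<in>S. a v * r v) = (\<Sum>v\<in>{v \<in> S. r v < 0} \<union> {v \<in> S. 0 < r v}. a v * r v)"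
        using S(2) by (intro sum.mono_neutral_right) (auto simp: neq_iff)
      also have "\<dots> = (\<Sum>v\<in>{v \<in> S. r v < 0}. a v * r v) + (\<Sum>v\<in>{v \<in> S. 0 < r v}. a v * r v)"
        using S(2) by (intro sum.union_disjoint) auto
      finally have "(\<Sum>v\<in>S. a v * r v) = (\<Sum>v\<in>{v \<in> S. r v < 0}. a v * r v) + (\<Sum>v\<in>{v \<in> S. 0 < r v}. r v * a v)"
        by (simp add: mult.commute)
      moreover have "(\<Sum>v\<in>{v \<in> S. r v < 0}. - r v * (a v - r v)) =
          (\<Sum>v\<in>{v \<in> S. r v < 0}. (r v)\<^sup>2) - (\<Sum>v\<in>{v \<in> S. r v < 0}. a v * r v)"
        unfolding sum_subtractf[symmetric] by (intro sum.cong refl) (simp add: power2_eq_square algebra_simps)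
      ultimately show ?thesis by simp
    qed
    also have "\<dots> \<le> 0"
    proof -
      have sq: "(\<Sum>v\<in>{v \<in> S. r v \<in> I}. (r v)\<^sup>2) = (\<Sum>l\<in>I. l\<^sup>2 * int (length (c l)))" if "finite I" for I
      proof -
        have "(\<Sum>v\<in>{v \<in> S. r v \<in> I}. (r v)\<^sup>2) = (\<Sum>l\<in>I. \<Sum>v\<in>{v \<in> S. r v = l}. (r v)\<^sup>2)"
          by (rule sum_over_weights[OF S(2) that, symmetric])
        also have "\<dots> = (\<Sum>l\<in>I. \<Sum>v\<in>{v \<in> S. r v = l}. l\<^sup>2)" by (intro sum.cong refl) auto
        also have "\<dots> = (\<Sum>l\<in>I. l\<^sup>2 * int (length (c l)))"
          by (simp add: card_weight mult.commute)
        finally show ?thesis .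
      qed
      have neg: "{v \<in> S. r v < 0} = {v \<in> S. r v \<in> {- L..-1}}" using rL by force
      have pos: "{v \<in> S. 0 < r v} = {v \<in> S. r v \<in> {1..L}}" using rL by force
      have "(\<Sum>v\<in>{v \<in> S. r v < 0}. (r v)\<^sup>2) = (\<Sum>l\<in>{- L..-1}. l\<^sup>2 * int (length (c l)))"
        unfolding neg by (rule sq) simp
      also have "\<dots> = (\<Sum>l\<in>{1..L}. l\<^sup>2 * int (length (c l)))"
        by (rule sum.reindex_bij_witness[of _ uminus uminus]) (auto simp: c_length)
      also have "\<dots> = (\<Sum>v\<in>{v \<in> S. 0 < r v}. (r v)\<^sup>2)" unfolding pos by (rule sq[symmetric]) simp
      finally have half: "(\<Sum>v\<in>{v \<in> S. r v < 0}. (r v)\<^sup>2) = (\<Sum>v\<in>{v \<in> S. 0 < r v}. (r v)\<^sup>2)" .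
      have "(\<Sum>l\<in>{l0..l1}. l\<^sup>2 * int (length (c l))) = (\<Sum>v\<in>{v \<in> S. r v \<in> {l0..l1}}. (r v)\<^sup>2)"
        by (rule sq[symmetric]) simp
      also have "{v \<in> S. r v \<in> {l0..l1}} = S" using r by auto
      also have "(\<Sum>v\<in>S. (r v)\<^sup>2) = (\<Sum>v\<in>{v \<in> S. r v < 0} \<union> {v \<in> S. 0 < r v}. (r v)\<^sup>2)"
        using S(2) by (intro sum.mono_neutral_right) (auto simp: neq_iff)
      also have "\<dots> = (\<Sum>v\<in>{v \<in> S. r v < 0}. (r v)\<^sup>2) + (\<Sum>v\<in>{v \<in> S. 0 < r v}. (r v)\<^sup>2)"
        using S(2) by (intro sum.union_disjoint) auto
      finally show ?thesis using energy half by linarith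
    qed
    finally show ?thesis .
  qed
  moreover have "0 \<le> l * Dl l" if "l \<in> {1..L}" for l using Dl0[of l] that by simp
  ultimately have "l * Dl l = 0" if "l \<in> {1..L}" for l
    using that sum_nonneg_eq_0_iff[of "{1..L}" "\<lambda>l. l * Dl l"] sum_nonneg[of "{1..L}" "\<lambda>l. l * Dl l"] by force
  then have DlL: "Dl l = 0" if "l \<in> {1..L}" for l using that by force
  have D0: "Dl l = 0" if "0 < l" for l
  proof (cases "l \<le> L")
    case True then show ?thesis using DlL that by simp
  next
    case False
    then have "{v \<in> S. r v = - l} = {}" "{v \<in> S. r v = l} = {}" using rL by force+
    then show ?thesis by (simp only: Dl_def sum.empty)
  qed
  consider "s = 0" | "p \<le> 0" | "int n + int s < p" | "0 < s" "p \<in> {1..int n + int s}" by force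
  then show ?thesis
  proof cases
    case 1
    then show ?thesis using x W_sub[of "-1"] vec.subspace_0 by (intro exI[of _ x]) auto
  next
    case 2
    then have "F 0 \<subseteq> F p" by (rule antimonoD[OF F_anti])
    then have "F p = UNIV" using F_0 by blast
    then show ?thesis using W_surj[OF x(2)] by auto
  next
    case 3
    then have "F (p - int s) \<subseteq> F (int n + 1)" by (intro antimonoD[OF F_anti]) auto
    then have "x = 0" using x(1) F_top by auto
    then show ?thesis using F_sub[of p] W_sub vec.subspace_0 by (intro exI[of _ 0]) (auto simp: Apow_zero)
  next
    case 4
    have "int (card (T (- int s) (p - int s))) - int (card (T (int s) p)) = 0"
    proof -
      have pos: "0 < int s" using 4(1) by simp
      from D0[OF pos] show ?thesis
        unfolding Dl[OF pos] sum_nonneg_eq_0_iff[OF finite_atLeastAtMost_int nonneg[OF pos]] using 4(2) by blast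
    qed
    then obtain u where u: "u \<in> vec.span (T (int s) p)" "x - ((*v) A ^^ s) u \<in> W (- int s - 1)"
      using main[of s p] x by auto
    have "T (int s) p \<subseteq> F p \<inter> W (int s)" using a r by (auto simp: T_def)
    then have "u \<in> F p \<inter> W (int s)"
      using u(1) vec.span_minimal[of "T (int s) p" "F p \<inter> W (int s)"] F_sub W_sub vec.subspace_inter by blast
    then show ?thesis using u by blast
  qed
qed

text \<open>Strictness on the graded pieces gives strictness on the filtration steps themselves.\<close>

theorem exact_lift:
  assumes "x \<in> F (p - int j)" "x \<in> W (l - 2 * int j)" "l \<le> int j"
  shows "\<exists>u. u \<in> F p \<and> u \<in> W l \<and> ((*v) A ^^ j) u = x"
  using assms
proof (induction "nat (l - 2 * int j - l0)" arbitrary: x l)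
  case 0
  then have "W (l - 2 * int j) \<subseteq> W l0" by (intro monoD[OF W_mono]) auto
  then have "x = 0" using 0 W_bot by auto
  then show ?case using F_sub W_sub vec.subspace_0 by (intro exI[of _ 0]) (auto simp: Apow_zero)
next
  case (Suc m)
  define s where "s = nat (2 * int j - l)"
  have s: "int s = 2 * int j - l" "j \<le> s" using Suc.prems(3) by (auto simp: s_def)
  have Apow_F: "((*v) A ^^ i) u \<in> F (q - int i)" if "u \<in> F q" for u q i
    using that
  proof (induction i)
    case (Suc i)
    then have "A *v ((*v) A ^^ i) u \<in> F (q - int i - 1)" by (intro F_A) auto
    then show ?case by (simp add: algebra_simps)
  qed simp
  have "x \<in> F ((p - int j + int s) - int s)" "x \<in> W (- int s)" using Suc.prems s by auto
  from strictness[OF this] obtain u' where u': "u' \<in> F (p - int j + int s)" "u' \<in> W (int s)"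
    "x - ((*v) A ^^ s) u' \<in> W (- int s - 1)" by blast
  define u1 where "u1 = ((*v) A ^^ (s - j)) u'"
  have u1F: "u1 \<in> F p" using Apow_F[OF u'(1), of "s - j"] s by (simp add: u1_def of_nat_diff)
  have e: "int s - 2 * int (s - j) = l" using s by (simp add: of_nat_diff)
  have u1W: "u1 \<in> W l" using W_Apow[OF u'(2), of "s - j"] by (simp only: u1_def e)
  have Au1: "((*v) A ^^ j) u1 = ((*v) A ^^ s) u'"
    using s(2) by (simp add: u1_def flip: funpow_add[THEN fun_cong, unfolded o_def])
  let ?x = "x - ((*v) A ^^ j) u1"
  have "?x \<in> F (p - int j)" using Suc.prems(1) Apow_F[OF u1F] F_sub vec.subspace_diff by blast
  moreover have e2: "(l - 1) - 2 * int j = - int s - 1" using s by simp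
  have "?x \<in> W ((l - 1) - 2 * int j)" unfolding e2 Au1 by (rule u'(3))
  moreover have "m = nat ((l - 1) - 2 * int j - l0)" using Suc.hyps(2) by simp
  ultimately obtain u2 where u2: "u2 \<in> F p" "u2 \<in> W (l - 1)" "((*v) A ^^ j) u2 = ?x"
    using Suc.hyps(1)[of "l - 1" ?x] Suc.prems(3) by auto
  have "u1 + u2 \<in> F p" using u1F u2 F_sub vec.subspace_add by blast
  moreover have "u1 + u2 \<in> W l" using u1W u2(2) W_le[of "l - 1" l] by (intro vec.subspace_add[OF W_sub]) auto
  moreover have "((*v) A ^^ j) (u1 + u2) = x" by (simp add: Apow_add u2)
  ultimately show ?case by blast
qed

end

section \<open>Complexification of real vectors, forms and matrices\<close>

definition of_real_vec :: "real ^ 'n \<Rightarrow> complex ^ 'n" where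
  "of_real_vec x = (\<chi> i. of_real (x $ i))"

lemma re_vec_simps [simp]:
  "re_vec (v + w) = re_vec v + re_vec w" "re_vec (v - w) = re_vec v - re_vec w"
  "re_vec (- v) = - re_vec v" "re_vec 0 = 0"
  "re_vec (c *s v) = Re c *\<^sub>R re_vec v - Im c *\<^sub>R im_vec v"
  "re_vec (cnj_vec v) = re_vec v" "re_vec (of_real_vec x) = x"
  by (simp_all add: re_vec_def im_vec_def cnj_vec_def of_real_vec_def vec_eq_iff)

lemma im_vec_simps [simp]:
  "im_vec (v + w) = im_vec v + im_vec w" "im_vec (v - w) = im_vec v - im_vec w"
  "im_vec (- v) = - im_vec v" "im_vec 0 = 0"
  "im_vec (c *s v) = Re c *\<^sub>R im_vec v + Im c *\<^sub>R re_vec v"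
  "im_vec (cnj_vec v) = - im_vec v" "im_vec (of_real_vec x) = 0"
  by (simp_all add: re_vec_def im_vec_def cnj_vec_def of_real_vec_def vec_eq_iff)

lemma complex_vec_eqI: "re_vec v = re_vec w \<Longrightarrow> im_vec v = im_vec w \<Longrightarrow> v = w"
  by (simp add: re_vec_def im_vec_def vec_eq_iff complex_eq_iff)

lemma cnj_vec_simps [simp]:
  "cnj_vec (v + w) = cnj_vec v + cnj_vec w" "cnj_vec (v - w) = cnj_vec v - cnj_vec w"
  "cnj_vec (- v) = - cnj_vec v" "cnj_vec 0 = 0" "cnj_vec (c *s v) = cnj c *s cnj_vec v"
  "cnj_vec (cnj_vec v) = v" "cnj_vec (of_real_vec x) = of_real_vec x"
  by (simp_all add: cnj_vec_def of_real_vec_def vec_eq_iff)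

lemma cnj_vec_image_iff: "v \<in> cnj_vec ` S \<longleftrightarrow> cnj_vec v \<in> S"
  by (metis (no_types, opaque_lifting) cnj_vec_simps(6) image_iff)

lemma subspace_complexify: "subspace U \<Longrightarrow> vec.subspace (complexify U)"
  unfolding vec.subspace_def complexify_def
  by (auto simp: subspace_0 subspace_add subspace_diff subspace_scale)

lemma complexify_UNIV [simp]: "complexify UNIV = UNIV" by (simp add: complexify_def)

lemma cnj_vec_complexify: "v \<in> complexify U \<Longrightarrow> subspace U \<Longrightarrow> cnj_vec v \<in> complexify U"
  by (simp add: complexify_def subspace_neg)

lemma subspace_cnj_vec_image: "vec.subspace S \<Longrightarrow> vec.subspace (cnj_vec ` S)"
proof -
  assume S: "vec.subspace S"
  have "(v \<in> cnj_vec ` S) = (cnj_vec v \<in> S)" for v by (rule cnj_vec_image_iff)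
  then show ?thesis
    using S unfolding vec.subspace_def by auto
qed

lemma complexify_form_add:
  assumes "bilinear Q"
  shows "complexify_form Q (u + v) w = complexify_form Q u w + complexify_form Q v w"
    "complexify_form Q w (u + v) = complexify_form Q w u + complexify_form Q w v"
  by (simp_all add: complexify_form_def complex_eq_iff bilinear_ladd[OF assms] bilinear_radd[OF assms])

lemma complexify_form_scale:
  assumes "bilinear Q"
  shows "complexify_form Q (c *s u) w = c * complexify_form Q u w"
    "complexify_form Q u (c *s w) = c * complexify_form Q u w"
  by (simp_all add: complexify_form_def complex_eq_iff bilinear_ladd[OF assms] bilinear_radd[OF assms]
      bilinear_lsub[OF assms] bilinear_rsub[OF assms] bilinear_lmul[OF assms] bilinear_rmul[OF assms] algebra_simps)

lemma complexify_form_zero: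
  assumes "bilinear Q"
  shows "complexify_form Q 0 w = 0" "complexify_form Q w 0 = 0"
  using complexify_form_scale(1)[OF assms, where c = 0 and u = 0 and w = w]
    complexify_form_scale(2)[OF assms, where c = 0 and u = w and w = 0] by auto

lemma complexify_form_minus:
  assumes "bilinear Q"
  shows "complexify_form Q (- u) w = - complexify_form Q u w" "complexify_form Q w (- u) = - complexify_form Q w u"
  using complexify_form_scale(1)[OF assms, where c = "-1" and u = u and w = w]
    complexify_form_scale(2)[OF assms, where c = "-1" and u = w and w = u]
  by (auto simp: vector_sneg_minus1[symmetric])

lemma complexify_form_diff:
  assumes "bilinear Q"
  shows "complexify_form Q (u - v) w = complexify_form Q u w - complexify_form Q v w"
    "complexify_form Q w (u - v) = complexify_form Q w u - complexify_form Q w v"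
  using complexify_form_add(1)[OF assms, where u = u and v = "- v" and w = w]
    complexify_form_add(2)[OF assms, where u = u and v = "- v" and w = w]
  by (auto simp: complexify_form_minus[OF assms])

lemmas complexify_form_simps =
  complexify_form_add complexify_form_scale complexify_form_zero complexify_form_minus complexify_form_diff

lemma complexify_form_cnj:
  assumes "bilinear Q"
  shows "complexify_form Q (cnj_vec u) (cnj_vec w) = cnj (complexify_form Q u w)"
  by (simp add: complexify_form_def complex_eq_iff bilinear_lneg[OF assms] bilinear_rneg[OF assms])

lemma complexify_form_of_real: 
  assumes "bilinear Q"
  shows "complexify_form Q (of_real_vec x) (of_real_vec y) = of_real (Q x y)"
  by (simp add: complexify_form_def complex_eq_iff bilinear_lzero[OF assms] bilinear_rzero[OF assms])

lemma complexify_form_sym: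
  assumes "\<forall>v\<in>U. \<forall>w\<in>U. Q v w = (-1) ^ n * Q w v" "u \<in> complexify U" "w \<in> complexify U"
  shows "complexify_form Q u w = (-1) ^ n * complexify_form Q w u"
proof -
  have e: "Q x y = (-1) ^ n * Q y x" if "x \<in> U" "y \<in> U" for x y using assms(1) that by blast
  have "even n \<or> odd n" by blast
  then show ?thesis
    using assms(2,3) e[of "re_vec u" "re_vec w"] e[of "im_vec u" "im_vec w"] e[of "re_vec u" "im_vec w"] e[of "im_vec u" "re_vec w"]
    by (auto simp: complexify_form_def complexify_def complex_eq_iff algebra_simps)
qed

lemma complexify_form_nondegenerate:
  assumes Q: "bilinear Q" and U: "subspace U" and nd: "\<forall>v\<in>U. (\<forall>w\<in>U. Q v w = 0) \<longrightarrow> v = 0"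
    and v: "v \<in> complexify U" and z: "\<And>w. w \<in> complexify U \<Longrightarrow> complexify_form Q v w = 0"
  shows "v = 0"
proof (rule complex_vec_eqI)
  have "Q (re_vec v) w = 0 \<and> Q (im_vec v) w = 0" if "w \<in> U" for w
  proof -
    have "of_real_vec w \<in> complexify U" using that U by (simp add: complexify_def subspace_0)
    from z[OF this] show ?thesis
      by (simp add: complexify_form_def complex_eq_iff bilinear_lzero[OF Q] bilinear_rzero[OF Q])
  qed
  then show "re_vec v = re_vec 0" "im_vec v = im_vec 0" using nd v by (auto simp: complexify_def)
qed

lemma complexify_matrix_vector:
  "re_vec (complexify_matrix A *v v) = A *v re_vec v" "im_vec (complexify_matrix A *v v) = A *v im_vec v"
  by (simp_all add: re_vec_def im_vec_def complexify_matrix_def matrix_vector_mult_def vec_eq_iff)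

lemma complexify_matrix_cnj: "complexify_matrix A *v cnj_vec v = cnj_vec (complexify_matrix A *v v)"
  by (simp add: complexify_matrix_def cnj_vec_def matrix_vector_mult_def vec_eq_iff)

lemma complexify_matrix_mult: "complexify_matrix (A ** B) = complexify_matrix A ** complexify_matrix B"
  by (simp add: complexify_matrix_def matrix_matrix_mult_def vec_eq_iff)

lemma complexify_form_isometry:
  assumes "\<forall>v w. Q (g *v v) (g *v w) = Q v w"
  shows "complexify_form Q (complexify_matrix g *v v) (complexify_matrix g *v w) = complexify_form Q v w"
  using assms by (simp add: complexify_form_def complexify_matrix_vector)

section \<open>The isometry groups\<close>

lemma continuous_on_matrix_mult:
  fixes f g :: "'a::topological_space \<Rightarrow> ('b::real_normed_algebra_1) ^ 'n ^ 'n"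
  assumes "continuous_on T f" "continuous_on T g"
  shows "continuous_on T (\<lambda>x. f x ** g x)"
  unfolding matrix_matrix_mult_def using assms
  by (intro continuous_on_vec_lambda continuous_on_sum continuous_on_mult continuous_on_component) auto

lemma identity_component_mult:
  fixes S :: "(('a::real_normed_algebra_1) ^ 'n ^ 'n) set"
  assumes one: "mat 1 \<in> S" and mult: "\<And>g h. g \<in> S \<Longrightarrow> h \<in> S \<Longrightarrow> g ** h \<in> S"
    and g: "g \<in> connected_component_set S (mat 1)" and h: "h \<in> connected_component_set S (mat 1)"
  shows "g ** h \<in> connected_component_set S (mat 1)"
proof -
  let ?C = "connected_component_set S (mat 1)"
  have C: "connected ?C" "?C \<subseteq> S" by (rule connected_connected_component, rule connected_component_subset)
  have "mat 1 \<in> ?C" using one by (simp add: connected_component_refl)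
  have "connected ((\<lambda>x. g ** x) ` ?C)"
    by (intro connected_continuous_image continuous_on_matrix_mult continuous_on_const continuous_on_id C)
  moreover have "(\<lambda>x. g ** x) ` ?C \<subseteq> S" using mult g C(2) by blast
  moreover have "g \<in> (\<lambda>x. g ** x) ` ?C" using \<open>mat 1 \<in> ?C\<close> by (metis image_eqI matrix_mul_rid)
  ultimately have "(\<lambda>x. g ** x) ` ?C \<subseteq> connected_component_set S g" by (intro connected_component_maximal)
  also have "\<dots> = ?C" using g by (metis connected_component_eq mem_Collect_eq)
  finally show ?thesis using h by blast
qed

lemma identity_component_path:
  fixes S :: "(('a::real_normed_algebra_1) ^ 'n ^ 'n) set"
  assumes "connected T" "continuous_on T \<gamma>" "\<gamma> ` T \<subseteq> S" "t0 \<in> T" "\<gamma> t0 = mat 1" "t \<in> T"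
  shows "\<gamma> t \<in> connected_component_set S (mat 1)"
proof -
  have "\<gamma> ` T \<subseteq> connected_component_set S (mat 1)"
    using assms by (intro connected_component_maximal connected_continuous_image) (auto intro: image_eqI[of _ _ t0])
  then show ?thesis using assms by blast
qed

definition real_isometries :: "(real ^ 'n \<Rightarrow> real ^ 'n \<Rightarrow> real) \<Rightarrow> (real ^ 'n ^ 'n) set" where
  "real_isometries Q = {g. \<forall>v w. Q (g *v v) (g *v w) = Q v w}"

definition complex_isometries :: "(real ^ 'n \<Rightarrow> real ^ 'n \<Rightarrow> real) \<Rightarrow> (complex ^ 'n ^ 'n) set" where
  "complex_isometries Q = {g. \<forall>v w. complexify_form Q (g *v v) (g *v w) = complexify_form Q v w}"

lemma real_group_isometry: "g \<in> real_group Q \<Longrightarrow> g \<in> real_isometries Q"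
  using connected_component_subset[of "real_isometries Q" "mat 1"] unfolding real_group_def real_isometries_def by blast

lemma complex_group_isometry: "g \<in> complex_group Q \<Longrightarrow> g \<in> complex_isometries Q"
  using connected_component_subset[of "complex_isometries Q" "mat 1"] unfolding complex_group_def complex_isometries_def by blast

lemma real_group_mult: "g \<in> real_group Q \<Longrightarrow> h \<in> real_group Q \<Longrightarrow> g ** h \<in> real_group Q"
  unfolding real_group_def
  by (rule identity_component_mult) (auto simp: matrix_vector_mul_assoc[symmetric])

lemma complex_group_mult: "g \<in> complex_group Q \<Longrightarrow> h \<in> complex_group Q \<Longrightarrow> g ** h \<in> complex_group Q"
  unfolding complex_group_def
  by (rule identity_component_mult) (auto simp: matrix_vector_mul_assoc[symmetric])

lemma real_group_path:
  assumes "connected T" "continuous_on T \<gamma>" "\<gamma> ` T \<subseteq> real_isometries Q" "t0 \<in> T" "\<gamma> t0 = mat 1" "t \<in> T"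
  shows "\<gamma> t \<in> real_group Q"
  using identity_component_path[OF assms] unfolding real_group_def real_isometries_def .

lemma complex_group_path:
  assumes "connected T" "continuous_on T \<gamma>" "\<gamma> ` T \<subseteq> complex_isometries Q" "t0 \<in> T" "\<gamma> t0 = mat 1" "t \<in> T"
  shows "\<gamma> t \<in> complex_group Q"
  using identity_component_path[OF assms] unfolding complex_group_def complex_isometries_def .

lemma act_mult: "act (g ** h) F = act g (act h F)"
  by (auto simp: act_def fun_eq_iff image_image matrix_vector_mul_assoc)

lemma act_1: "act (mat 1) F = F"
  by (auto simp: act_def fun_eq_iff)

section \<open>Polarized Hodge structures and isotropic flags\<close>

text \<open>
  The annihilator of a step is the complementary step.  A vector splits into a part in that
  step and a conjugate part; the conjugate part is orthogonal to everything and hence zero.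
\<close>

lemma polarized_hodge_structure_perp:
  assumes F: "polarized_hodge_structure n U Q F" and v: "v \<in> complexify U"
    and perp: "\<And>w. w \<in> F p \<Longrightarrow> complexify_form Q v w = 0"
  shows "v \<in> F (int n + 1 - p)"
proof -
  let ?q = "int n + 1 - p"
  have nd: "\<forall>v\<in>U. (\<forall>w\<in>U. Q v w = 0) \<longrightarrow> v = 0"
    using F unfolding polarized_hodge_structure_def by blast
  have Q: "bilinear Q" and U: "subspace U" and sub: "vec.subspace (F p)" for p
    using F unfolding polarized_hodge_structure_def hodge_structure_def by blast+
  have sums: "{x + y |x y. x \<in> F p \<and> y \<in> cnj_vec ` F (int n - p + 1)} = complexify U" for p
    using F unfolding polarized_hodge_structure_def hodge_structure_def by blast+
  have iso: "complexify_form Q x y = 0" if "x \<in> F p" "y \<in> F (int n - p + 1)" for x y p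
    using F that by (auto simp: polarized_hodge_structure_def)
  have "v \<in> {x + y |x y. x \<in> F ?q \<and> y \<in> cnj_vec ` F (int n - ?q + 1)}" using v sums[of ?q] by simp
  then obtain \<alpha> \<beta> where ab: "\<alpha> \<in> F ?q" "\<beta> \<in> F (int n - ?q + 1)" "v = \<alpha> + cnj_vec \<beta>" by blast
  have pp: "int n - ?q + 1 = p" by simp
  have 1: "complexify_form Q (cnj_vec \<beta>) w = 0" if "w \<in> F p" for w
    using perp[OF that] iso[OF ab(1), of w] that by (simp add: ab(3) complexify_form_simps[OF Q])
  have 2: "complexify_form Q (cnj_vec \<beta>) w = 0" if "w \<in> cnj_vec ` F (int n - p + 1)" for w
  proof -
    obtain x where x: "x \<in> F (int n - p + 1)" "w = cnj_vec x" using \<open>w \<in> _\<close> by blast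
    then show ?thesis using iso[of \<beta> p x] ab(2) unfolding pp by (simp add: complexify_form_cnj[OF Q])
  qed
  have 3: "complexify_form Q (cnj_vec \<beta>) w = 0" if w: "w \<in> complexify U" for w
  proof -
    obtain x y where "x \<in> F p" "y \<in> cnj_vec ` F (int n - p + 1)" "w = x + y"
      using w unfolding sums[of p, symmetric] by blast
    then show ?thesis using 1 2 by (simp add: complexify_form_simps[OF Q])
  qed
  have "cnj_vec \<beta> \<in> complexify U"
  proof -
    have "0 + cnj_vec \<beta> \<in> {x + y |x y. x \<in> F ?q \<and> y \<in> cnj_vec ` F (int n - ?q + 1)}"
      using ab(2) sub[of ?q] vec.subspace_0 by blast
    then show ?thesis unfolding sums by simp
  qed
  then have "cnj_vec \<beta> = 0" using 3 by (rule complexify_form_nondegenerate[OF Q U nd])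
  then show ?thesis using ab by simp
qed

text \<open>
  The factor makes the form Hermitian for both parities of \<open>n\<close>, and with it the polarization has sign
  \<open>(-1)\<^sup>p\<close> on the Hodge space of degree \<open>p\<close>.
\<close>

definition hermitian_extension :: "nat \<Rightarrow> (real ^ 'n \<Rightarrow> real ^ 'n \<Rightarrow> real) \<Rightarrow> complex ^ 'n \<Rightarrow> complex ^ 'n \<Rightarrow> complex" where
  "hermitian_extension n Q u w = (- \<i>) ^ n * complexify_form Q u (cnj_vec w)"

lemma hermitian_extension_hermitian:
  assumes Q: "bilinear Q" and sym: "\<forall>v w. Q v w = (-1) ^ n * Q w v"
  shows "hermitian_form (hermitian_extension n Q)"
proof -
  have "hermitian_extension n Q w u = cnj (hermitian_extension n Q u w)" for u w
  proof -
    have "cnj (hermitian_extension n Q u w) = \<i> ^ n * cnj (complexify_form Q u (cnj_vec w))"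
      by (simp add: hermitian_extension_def)
    also have "cnj (complexify_form Q u (cnj_vec w)) = complexify_form Q (cnj_vec u) w"
      using complexify_form_cnj[OF Q, of u "cnj_vec w"] by simp
    also have "\<dots> = (-1) ^ n * complexify_form Q w (cnj_vec u)"
      by (rule complexify_form_sym[of UNIV]) (use sym in blast, simp_all)
    also have "\<i> ^ n * ((-1) ^ n * complexify_form Q w (cnj_vec u)) = (- \<i>) ^ n * complexify_form Q w (cnj_vec u)"
      by (simp add: power_mult_distrib[symmetric] mult.assoc[symmetric])
    finally show ?thesis by (simp add: hermitian_extension_def)
  qed
  moreover have "hermitian_extension n Q (u + v) w = hermitian_extension n Q u w + hermitian_extension n Q v w"
    "hermitian_extension n Q (c *s u) w = c * hermitian_extension n Q u w" for u v w c
    by (simp_all add: hermitian_extension_def complexify_form_simps[OF Q] algebra_simps)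
  ultimately show ?thesis unfolding hermitian_form_def by blast
qed

lemma weil_sign: "\<i> powi (p - (int n - p)) = (if even p then 1 else -1) * (- \<i>) ^ n"
proof -
  have "\<i> powi (p - (int n - p)) = \<i> powi (2 * p) * \<i> powi (- int n)"
    by (simp add: power_int_add[symmetric])
  also have "\<i> powi (2 * p) = (\<i> powi 2) powi p" by (simp add: power_int_mult)
  also have "\<i> powi 2 = -1" by (simp add: power_int_def)
  also have "(-1 :: complex) powi p = (if even p then 1 else -1)"
    by (cases p rule: int_cases2) (auto simp: power_int_minus)
  finally show ?thesis by (simp add: power_int_minus flip: power_inverse)
qed

lemma hodge_space_sign:
  assumes F: "polarized_hodge_structure n U Q F" and v: "v \<in> hodge_space n F p" "v \<in> complexify U" "v \<noteq> 0"
  shows "0 < (if even p then 1 else -1) * Re (hermitian_extension n Q v v)"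
proof -
  have Q: "bilinear Q" using F unfolding polarized_hodge_structure_def by blast+
  obtain C where C: "weil_operator n F C"
    "\<And>v. v \<in> complexify U \<Longrightarrow> v \<noteq> 0 \<Longrightarrow> Re (complexify_form Q (C v) (cnj_vec v)) > 0"
    using F unfolding polarized_hodge_structure_def by blast+
  have "C v = (\<i> powi (p - (int n - p))) *s v" using C(1) v(1) by (simp add: weil_operator_def)
  then have "0 < Re ((\<i> powi (p - (int n - p))) * complexify_form Q v (cnj_vec v))"
    using C(2)[OF v(2,3)] by (simp add: complexify_form_simps[OF Q])
  then show ?thesis unfolding weil_sign hermitian_extension_def by (cases "even p") (simp_all add: mult.assoc)
qed

text \<open>
  Points of the compact dual have these properties, in which no reality condition is left.
\<close>

definition isotropic_flag :: "nat \<Rightarrow> (real ^ 'n \<Rightarrow> real ^ 'n \<Rightarrow> real) \<Rightarrow> 'n filtration \<Rightarrow> bool" where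
  "isotropic_flag n Q L \<longleftrightarrow>
     (\<forall>p. vec.subspace (L p)) \<and> antimono L \<and> L 0 = UNIV \<and> L (int n + 1) = {0} \<and>
     (\<forall>p v. v \<in> L (int n + 1 - p) \<longleftrightarrow> (\<forall>w\<in>L p. complexify_form Q v w = 0))"

lemma isotropic_flag_hodge_structure:
  assumes F: "polarized_hodge_structure n UNIV Q F"
  shows "isotropic_flag n Q F"
proof -
  have hs: "hodge_structure n UNIV F" using F unfolding polarized_hodge_structure_def by blast
  have F': "\<And>p. vec.subspace (F p)" "antimono F" "F 0 = UNIV"
    "\<And>p. F p \<inter> cnj_vec ` F (int n - p + 1) = {0}"
    using hs unfolding hodge_structure_def complexify_UNIV by blast+
  have iso: "complexify_form Q v w = 0" if "v \<in> F p" "w \<in> F (int n - p + 1)" for p v w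
    using F that unfolding polarized_hodge_structure_def by blast
  have "cnj_vec ` F 0 = UNIV" unfolding F'(3) using cnj_vec_image_iff[of _ UNIV] by blast
  then have "F (int n + 1) = {0}" using F'(4)[of "int n + 1"] by simp
  moreover have "v \<in> F (int n + 1 - p) \<longleftrightarrow> (\<forall>w\<in>F p. complexify_form Q v w = 0)" for p v
  proof
    assume v: "v \<in> F (int n + 1 - p)"
    have pp: "int n - (int n + 1 - p) + 1 = p" by simp
    show "\<forall>w\<in>F p. complexify_form Q v w = 0" using iso[OF v] unfolding pp by blast
  next
    assume "\<forall>w\<in>F p. complexify_form Q v w = 0"
    then show "v \<in> F (int n + 1 - p)" by (intro polarized_hodge_structure_perp[OF F]) auto
  qed
  ultimately show ?thesis using F' unfolding isotropic_flag_def by blast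
qed

lemma complex_isometry_inverse:
  assumes Q: "bilinear Q" and nd: "\<forall>v. (\<forall>w. Q v w = 0) \<longrightarrow> v = 0" and g: "g \<in> complex_isometries Q"
  shows "\<exists>g'. g ** g' = mat 1 \<and> g' ** g = mat 1 \<and> g' \<in> complex_isometries Q"
proof -
  have "inj ((*v) g)"
  proof (rule injI)
    fix x y assume "g *v x = g *v y"
    then have z: "g *v (x - y) = 0" by (simp add: matrix_vector_mult_diff_distrib)
    have "complexify_form Q (x - y) w = 0" for w
      using g z by (metis (mono_tags, lifting) complex_isometries_def complexify_form_zero(1)[OF Q] mem_Collect_eq)
    then have "x - y = 0" using nd by (intro complexify_form_nondegenerate[OF Q subspace_UNIV]) auto
    then show "x = y" by simp
  qed
  then obtain g' where g': "g' ** g = mat 1" using matrix_left_invertible_injective by blast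
  then have gg: "g ** g' = mat 1" using matrix_left_right_inverse by blast
  have "complexify_form Q (g' *v v) (g' *v w) = complexify_form Q v w" for v w
  proof -
    have "complexify_form Q (g *v (g' *v v)) (g *v (g' *v w)) = complexify_form Q (g' *v v) (g' *v w)"
      using g by (simp add: complex_isometries_def)
    then show ?thesis by (simp add: matrix_vector_mul_assoc gg)
  qed
  then show ?thesis using g' gg by (auto simp: complex_isometries_def)
qed

lemma isotropic_flag_act:
  assumes Q: "bilinear Q" and nd: "\<forall>v. (\<forall>w. Q v w = 0) \<longrightarrow> v = 0"
    and g: "g \<in> complex_isometries Q" and L: "isotropic_flag n Q L"
  shows "isotropic_flag n Q (act g L)"
proof -
  obtain g' where g': "g ** g' = mat 1" "g' ** g = mat 1" "g' \<in> complex_isometries Q"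
    using complex_isometry_inverse[OF Q nd g] by blast
  have mem: "v \<in> act g L p \<longleftrightarrow> g' *v v \<in> L p" for v p
  proof
    assume "v \<in> act g L p"
    then obtain u where "u \<in> L p" "v = g *v u" by (auto simp: act_def)
    then show "g' *v v \<in> L p" by (simp add: matrix_vector_mul_assoc g')
  next
    assume "g' *v v \<in> L p"
    then have "g *v (g' *v v) \<in> act g L p" by (auto simp: act_def)
    then show "v \<in> act g L p" by (simp add: matrix_vector_mul_assoc g')
  qed
  have L': "\<And>p. vec.subspace (L p)" "antimono L" "L 0 = UNIV" "L (int n + 1) = {0}"
     "\<And>p v. v \<in> L (int n + 1 - p) \<longleftrightarrow> (\<forall>w\<in>L p. complexify_form Q v w = 0)"
    using L by (auto simp: isotropic_flag_def)
  have "vec.subspace (act g L p)" for p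
    using L'(1)[of p] unfolding vec.subspace_def Ball_def mem
    by (simp add: matrix_vector_right_distrib vec.scale)
  moreover have "antimono (act g L)"
    using L'(2) by (auto simp: antimono_def act_def)
  moreover have "act g L 0 = UNIV" using mem L'(3) by auto
  moreover have "act g L (int n + 1) = {0}" using L'(4) by (simp add: act_def)
  moreover have "v \<in> act g L (int n + 1 - p) \<longleftrightarrow> (\<forall>w\<in>act g L p. complexify_form Q v w = 0)" for p v
  proof -
    have "complexify_form Q v (g *v w) = complexify_form Q (g' *v v) w" for w
    proof -
      have "complexify_form Q v (g *v w) = complexify_form Q (g *v (g' *v v)) (g *v w)"
        by (simp add: matrix_vector_mul_assoc g')
      also have "\<dots> = complexify_form Q (g' *v v) w" using g by (simp add: complex_isometries_def)
      finally show ?thesis .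
    qed
    then show ?thesis unfolding mem L'(5) by (auto simp: act_def)
  qed
  ultimately show ?thesis unfolding isotropic_flag_def by blast
qed

text \<open>
  A vector of step \<open>p\<close> orthogonal to step \<open>p + 1\<close> is in the Hodge space of degree \<open>p\<close>, because its
  conjugate annihilates step \<open>p + 1\<close>.
\<close>

lemma period_point_sign:
  assumes F: "polarized_hodge_structure n UNIV Q F\<^sub>0" and g: "g \<in> real_isometries Q"
    and T: "T = act (complexify_matrix g) F\<^sub>0"
    and v: "v \<in> T p" "v \<noteq> 0" and orth: "\<And>w. w \<in> T (p + 1) \<Longrightarrow> hermitian_extension n Q v w = 0"
  shows "0 < (if even p then 1 else -1) * Re (hermitian_extension n Q v v)"
proof -
  have Q: "bilinear Q" and nd: "\<forall>v. (\<forall>w. Q v w = 0) \<longrightarrow> v = 0"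
    using F unfolding polarized_hodge_structure_def by blast+
  let ?g = "complexify_matrix g"
  have gi: "?g \<in> complex_isometries Q"
    using g complexify_form_isometry[of Q g] by (simp add: real_isometries_def complex_isometries_def)
  have L: "isotropic_flag n Q T" unfolding T by (rule isotropic_flag_act[OF Q nd gi isotropic_flag_hodge_structure[OF F]])
  have "complexify_form Q (cnj_vec v) w = 0" if "w \<in> T (p + 1)" for w
  proof -
    have "complexify_form Q v (cnj_vec w) = 0" using orth[OF that] by (simp add: hermitian_extension_def)
    then show ?thesis using complexify_form_cnj[OF Q, of v "cnj_vec w"] by simp
  qed
  then have "cnj_vec v \<in> T (int n + 1 - (p + 1))" using L unfolding isotropic_flag_def by blast
  then obtain v1 where v1: "v1 \<in> F\<^sub>0 (int n - p)" "cnj_vec v = ?g *v v1" by (auto simp: T act_def)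
  obtain v0 where v0: "v0 \<in> F\<^sub>0 p" "v = ?g *v v0" using v(1) by (auto simp: T act_def)
  have "?g *v cnj_vec v0 = ?g *v v1" using v0 v1 by (simp add: complexify_matrix_cnj)
  then have "cnj_vec v0 = v1"
    using complex_isometry_inverse[OF Q nd gi] by (metis matrix_vector_mul_assoc matrix_vector_mul_lid)
  then have "v0 \<in> hodge_space n F\<^sub>0 p" using v0 v1 by (simp add: hodge_space_def cnj_vec_image_iff)
  moreover have "v0 \<noteq> 0" using v0 v by auto
  ultimately have "0 < (if even p then 1 else -1) * Re (hermitian_extension n Q v0 v0)"
    by (intro hodge_space_sign[OF F]) auto
  moreover have "hermitian_extension n Q v v = hermitian_extension n Q v0 v0"
    using gi by (simp add: hermitian_extension_def v0 complexify_matrix_cnj[symmetric] complex_isometries_def)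
  ultimately show ?thesis by simp
qed

section \<open>The exponential of a nilpotent matrix\<close>

lemma matrix_pow_vector: "matrix_pow A j *v u = ((*v) A ^^ j) u"
  by (induction j) (simp_all add: matrix_pow_def matrix_vector_mul_assoc[symmetric])

lemma mat_mult_vector: "(mat c ** A) *v u = c *s ((A :: complex ^ 'n ^ 'n) *v u)"
proof -
  have "mat c *v x = c *s x" for x :: "complex ^ 'n"
  proof (rule iffD2[OF vec_eq_iff, OF allI])
    fix i
    have "(mat c *v x) $ i = (\<Sum>j\<in>UNIV. if i = j then c * x $ j else 0)"
      unfolding matrix_vector_mult_def mat_def vec_lambda_beta by (intro sum.cong refl) simp
    then show "(mat c *v x) $ i = (c *s x) $ i" by simp
  qed
  then show ?thesis by (simp flip: matrix_vector_mul_assoc)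
qed

lemma matrix_eqI_vector: "(\<And>u. A *v u = B *v (u :: complex ^ 'n)) \<Longrightarrow> A = B"
  by (metis matrix_eq)

lemma matrix_pow_scaled: "matrix_pow (mat z ** A) j = mat (z ^ j) ** matrix_pow (A :: complex ^ 'n ^ 'n) j"
proof (rule matrix_eqI_vector)
  fix u
  have "((*v) (mat z ** A) ^^ j) u = z ^ j *s ((*v) A ^^ j) u"
    by (induction j) (simp_all add: mat_mult_vector vec.scale vector_smult_assoc)
  then show "matrix_pow (mat z ** A) j *v u = (mat (z ^ j) ** matrix_pow A j) *v u"
    by (simp add: matrix_pow_vector mat_mult_vector)
qed

lemma matrix_exp_vector:
  fixes A :: "complex ^ 'n ^ 'n"
  assumes "matrix_pow A k = 0"
  shows "matrix_exp (mat z ** A) *v u = nilexp A k z u"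
proof -
  have zero: "matrix_pow A j = 0" if "k \<le> j" for j
  proof (rule matrix_eqI_vector)
    fix u
    have z: "((*v) A ^^ i) 0 = 0" for i by (induction i) simp_all
    have "((*v) A ^^ j) u = ((*v) A ^^ (j - k)) (((*v) A ^^ k) u)"
      using that by (simp flip: funpow_add[THEN fun_cong, unfolded o_def])
    also have "((*v) A ^^ k) u = 0" using assms by (simp flip: matrix_pow_vector)
    finally show "matrix_pow A j *v u = 0 *v u" by (simp add: matrix_pow_vector z)
  qed
  have "matrix_exp (mat z ** A) = (\<Sum>j<k. mat (1 / fact j) ** matrix_pow (mat z ** A) j)"
    unfolding matrix_exp_def by (rule suminf_finite) (auto simp: matrix_pow_scaled zero)
  moreover have "(\<Sum>j\<in>J. B j) *v u = (\<Sum>j\<in>J. B j *v u)" for J :: "nat set" and B :: "nat \<Rightarrow> complex ^ 'n ^ 'n"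
    by (induction J rule: infinite_finite_induct) (simp_all add: matrix_vector_mult_add_rdistrib)
  ultimately show ?thesis
    by (simp add: nilexp_def mat_mult_vector matrix_pow_scaled matrix_pow_vector vector_smult_assoc)
qed

text \<open>
  The derivative in \<open>t\<close> of the composition is zero, which avoids multiplying out the two truncated series.
\<close>

lemma nilexp_inverse:
  assumes nil: "\<And>u. ((*v) A ^^ k) u = 0" and k: "0 < k"
  shows "nilexp A k (of_real t * c) (nilexp A k (- of_real t * c) u) = u"
proof -
  define \<psi> where "\<psi> t = nilexp A k (of_real t * c) (nilexp A k (of_real t * (- c)) u)" for t
  have lin: "((*v) A ^^ m) (a *s x) = a *s ((*v) A ^^ m) x" "((*v) A ^^ m) (x + y) = ((*v) A ^^ m) x + ((*v) A ^^ m) y" for m a x y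
    by (induction m) (simp_all add: vec.scale matrix_vector_right_distrib)
  have "(\<psi> has_vector_derivative 0) (at t)" for t
  proof -
    let ?w = "\<lambda>t. nilexp A k (of_real t * (- c)) u"
    have Dw: "(?w has_vector_derivative (- c) *s (A *v ?w t)) (at t)"
      by (rule nilexp_has_derivative[OF nil])
    have Da: "((\<lambda>t. (of_real t * c) ^ m / fact m) has_vector_derivative
        of_nat m * (of_real t * c) ^ (m - 1) * c / fact m) (at t)" for m
    proof -
      have "((\<lambda>z. (z * c) ^ m / fact m) has_field_derivative (of_nat m * (of_real t * c) ^ (m - 1) * c / fact m)) (at (complex_of_real t))"
        by (auto intro!: derivative_eq_intros)
      then show ?thesis by (rule has_vector_derivative_real_field)
    qed
    have DAw: "((\<lambda>t. ((*v) A ^^ m) (?w t)) has_vector_derivative ((*v) A ^^ m) ((- c) *s (A *v ?w t))) (at t)" for m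
    proof (induction m)
      case 0 show ?case using Dw by (simp only: funpow.simps id_apply)
    next
      case (Suc m)
      from has_vector_derivative_matrix_vector[OF this] show ?case by (simp only: funpow.simps o_apply)
    qed
    have D: "(\<psi> has_vector_derivative (\<Sum>m<k. ((of_real t * c) ^ m / fact m) *s ((*v) A ^^ m) ((- c) *s (A *v ?w t)) +
        (of_nat m * (of_real t * c) ^ (m - 1) * c / fact m) *s ((*v) A ^^ m) (?w t))) (at t)"
      unfolding \<psi>_def nilexp_def[of A k "of_real _ * c"]
      by (intro has_vector_derivative_sum has_vector_derivative_scale Da DAw)
    have D2: "((\<lambda>s. nilexp A k (of_real s * c) (?w t)) has_vector_derivative
        (\<Sum>m<k. ((of_real t * c) ^ m / fact m) *s 0 + (of_nat m * (of_real t * c) ^ (m - 1) * c / fact m) *s ((*v) A ^^ m) (?w t))) (at t)"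
      unfolding nilexp_def[of A k "of_real _ * c"]
      by (intro has_vector_derivative_sum has_vector_derivative_scale Da has_vector_derivative_const)
    have e2: "(\<Sum>m<k. (of_nat m * (of_real t * c) ^ (m - 1) * c / fact m) *s ((*v) A ^^ m) (?w t)) =
        c *s (A *v nilexp A k (of_real t * c) (?w t))"
      using vector_derivative_unique_at[OF D2 nilexp_has_derivative[OF nil]] by simp
    have "(\<Sum>m<k. ((of_real t * c) ^ m / fact m) *s ((*v) A ^^ m) ((- c) *s (A *v ?w t))) =
        nilexp A k (of_real t * c) ((- c) *s (A *v ?w t))" by (simp add: nilexp_def)
    also have "\<dots> = - (c *s (A *v nilexp A k (of_real t * c) (?w t)))"
      unfolding nilexp_scale by (simp add: nilexp_commute)
    finally have "(\<Sum>m<k. ((of_real t * c) ^ m / fact m) *s ((*v) A ^^ m) ((- c) *s (A *v ?w t)) +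
        (of_nat m * (of_real t * c) ^ (m - 1) * c / fact m) *s ((*v) A ^^ m) (?w t)) = 0"
      unfolding sum.distrib e2 by simp
    then show ?thesis using D by simp
  qed
  then have "\<psi> t = \<psi> 0"
    using has_vector_derivative_zero_constant[of UNIV \<psi>] by (metis UNIV_I convex_UNIV)
  moreover have "nilexp A k 0 x = x" for x
  proof -
    have "(\<Sum>m<k. ((0::complex) ^ m / fact m) *s ((*v) A ^^ m) x) = (\<Sum>m<k. if m = 0 then x else 0)"
      by (intro sum.cong) auto
    then show ?thesis using k by (simp add: nilexp_def)
  qed
  ultimately show ?thesis by (simp add: \<psi>_def)
qed

section \<open>Limits in the compact dual\<close>

lemma bounded_bilinear_complexify_form:
  assumes "bilinear Q" shows "bounded_bilinear (complexify_form Q)"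
proof -
  have s: "r *\<^sub>R u = of_real r *s (u :: complex ^ 'a)" for r u by (simp add: vec_eq_iff scaleR_conv_of_real[where 'a = complex])
  have "bilinear (complexify_form Q)"
    by (auto simp: bilinear_def linear_iff complexify_form_add[OF assms] s complexify_form_scale[OF assms] scaleR_conv_of_real)
  then show ?thesis by (simp add: bilinear_conv_bounded_bilinear)
qed

lemma complex_subspace_closed: "vec.subspace (S :: (complex ^ 'n) set) \<Longrightarrow> closed S"
proof -
  assume S: "vec.subspace S"
  have "r *\<^sub>R u = of_real r *s u" for r and u :: "complex ^ 'n" by (simp add: vec_eq_iff scaleR_conv_of_real[where 'a = complex])
  then have "subspace S" using S by (simp add: vec.subspace_def subspace_def)
  then show "closed S" by (rule closed_subspace)
qed

text \<open>
  Having a vector of a compact set in step \<open>p\<close> is a closed condition on the group element, by projection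
  along that compact set.  A small ball around a vector outside \<open>L p\<close> gives an open neighbourhood of \<open>L\<close> whose
  points have no vector of that ball in step \<open>p\<close>.
\<close>

lemma limit_vector_in_limit_flag:
  assumes Q: "bilinear Q" and nd: "\<forall>v. (\<forall>w. Q v w = 0) \<longrightarrow> v = 0"
    and F0: "isotropic_flag n Q F\<^sub>0"
    and lim: "limitin (compact_dual Q F\<^sub>0) T L (filtercomap Im at_top)"
    and w: "\<forall>\<^sub>F y in at_top. w y \<in> T (of_real y * \<i>) p" and w0: "(w \<longlongrightarrow> w0) at_top"
  shows "w0 \<in> L p"
proof (rule ccontr)
  assume nin: "w0 \<notin> L p"
  let ?G = "complex_group Q"
  have LX: "L \<in> complex_orbit Q F\<^sub>0" using lim by (simp add: limitin_def topspace_compact_dual)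
  then obtain g0 where g0: "g0 \<in> ?G" "L = act g0 F\<^sub>0" by (auto simp: complex_orbit_def)
  have flag: "isotropic_flag n Q (act g F\<^sub>0)" if "g \<in> ?G" for g
    by (rule isotropic_flag_act[OF Q nd complex_group_isometry[OF that] F0])
  have "closed (L p)" using flag[OF g0(1)] g0(2) by (intro complex_subspace_closed) (simp add: isotropic_flag_def)
  then have "open (- L p)" by (rule open_Compl)
  then obtain \<epsilon> where eps: "0 < \<epsilon>" "cball w0 \<epsilon> \<subseteq> - L p" using nin open_contains_cball by (metis ComplI)
  define C where "C = {g. \<exists>x\<in>cball w0 \<epsilon>. \<forall>u\<in>F\<^sub>0 (int n + 1 - p). complexify_form Q x (g *v u) = 0}"
  have mem: "(\<exists>x\<in>cball w0 \<epsilon>. x \<in> act g F\<^sub>0 p) \<longleftrightarrow> g \<in> C" if "g \<in> ?G" for g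
  proof -
    have "x \<in> act g F\<^sub>0 p \<longleftrightarrow> (\<forall>u\<in>F\<^sub>0 (int n + 1 - p). complexify_form Q x (g *v u) = 0)" for x
    proof -
      have pp: "int n + 1 - (int n + 1 - p) = p" by simp
      have "x \<in> act g F\<^sub>0 (int n + 1 - (int n + 1 - p)) \<longleftrightarrow> (\<forall>w\<in>act g F\<^sub>0 (int n + 1 - p). complexify_form Q x w = 0)"
        using flag[OF that] unfolding isotropic_flag_def by blast
      then show ?thesis unfolding pp by (simp add: act_def)
    qed
    then show ?thesis by (simp add: C_def)
  qed
  have "closed C"
  proof -
    define Z where "Z = {z \<in> cball w0 \<epsilon> \<times> UNIV. \<forall>u\<in>F\<^sub>0 (int n + 1 - p). complexify_form Q (fst z) (snd z *v u) = 0}"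
    have "continuous_on UNIV (\<lambda>z :: (complex ^ 'a) \<times> (complex ^ 'a ^ 'a). complexify_form Q (fst z) (snd z *v u))" for u
    proof -
      have "continuous_on UNIV (\<lambda>z :: (complex ^ 'a) \<times> (complex ^ 'a ^ 'a). snd z *v u)"
        unfolding matrix_vector_mult_def
        by (intro continuous_on_vec_lambda continuous_on_sum continuous_on_mult continuous_on_component continuous_on_snd continuous_on_id continuous_on_const)
      then show ?thesis
        by (intro bounded_bilinear.continuous_on[OF bounded_bilinear_complexify_form[OF Q]] continuous_on_fst continuous_on_id)
    qed
    then have "closed {z :: (complex ^ 'a) \<times> (complex ^ 'a ^ 'a). complexify_form Q (fst z) (snd z *v u) = 0}" for u
      by (intro closed_Collect_eq continuous_on_const) auto
    then have "closed (\<Inter>u\<in>F\<^sub>0 (int n + 1 - p). {z :: (complex ^ 'a) \<times> (complex ^ 'a ^ 'a). complexify_form Q (fst z) (snd z *v u) = 0})"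
      by blast
    moreover have "Z = (cball w0 \<epsilon> \<times> UNIV) \<inter> (\<Inter>u\<in>F\<^sub>0 (int n + 1 - p). {z. complexify_form Q (fst z) (snd z *v u) = 0})"
      by (auto simp: Z_def)
    ultimately have "closedin (top_of_set (cball w0 \<epsilon> \<times> UNIV)) Z" by (auto simp: closedin_closed)
    then have "closedin (top_of_set UNIV) {g. \<exists>x. x \<in> cball w0 \<epsilon> \<and> (x, g) \<in> Z}"
      by (intro closedin_compact_projection compact_cball)
    moreover have "{g. \<exists>x. x \<in> cball w0 \<epsilon> \<and> (x, g) \<in> Z} = C" by (auto simp: Z_def C_def)
    ultimately show ?thesis by simp
  qed
  define U where "U = {S \<in> complex_orbit Q F\<^sub>0. \<not> (\<exists>x\<in>cball w0 \<epsilon>. x \<in> S p)}"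
  have "openin (compact_dual Q F\<^sub>0) U"
    unfolding openin_compact_dual
  proof
    have "{g \<in> ?G. act g F\<^sub>0 \<in> U} = ?G \<inter> - C" using mem by (auto simp: U_def complex_orbit_def)
    then show "openin (top_of_set ?G) {g \<in> ?G. act g F\<^sub>0 \<in> U}"
      using \<open>closed C\<close> by (auto simp: openin_open)
  qed (auto simp: U_def)
  moreover have "L \<in> U" using eps LX by (auto simp: U_def)
  ultimately have "\<forall>\<^sub>F z in filtercomap Im at_top. T z \<in> U" using lim by (simp add: limitin_def)
  then have "\<exists>R. (\<forall>\<^sub>F y in at_top. R y) \<and> (\<forall>z. R (Im z) \<longrightarrow> T z \<in> U)" by (simp add: eventually_filtercomap)
  then have ev1: "\<forall>\<^sub>F y in at_top. T (of_real y * \<i>) \<in> U" by (auto elim: eventually_mono)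
  have ev2: "\<forall>\<^sub>F y in at_top. w y \<in> cball w0 \<epsilon>"
    using tendstoD[OF w0 eps(1)] by (rule eventually_mono) (simp add: dist_commute less_imp_le)
  have "\<forall>\<^sub>F y :: real in at_top. False"
    by (rule eventually_mono[OF eventually_conj[OF ev1 eventually_conj[OF ev2 w]]]) (auto simp: U_def)
  then show False by (simp add: eventually_False trivial_limit_at_top_linorder)
qed

section \<open>Degenerating a flag along a real torus\<close>

lemma matrix_add_scale_vector:
  fixes A B :: "complex ^ 'n ^ 'n"
  shows "(A + B) *v v = A *v v + B *v v" "(t *\<^sub>R A) *v v = of_real t *s (A *v v)"
  by (simp_all add: matrix_vector_mult_def vec_eq_iff sum.distrib algebra_simps sum_distrib_left scaleR_conv_of_real[where 'a = complex])

lemma matrix_add_scale_vector_real: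
  fixes A B :: "real ^ 'n ^ 'n"
  shows "(A + B) *v v = A *v v + B *v v" "(t *\<^sub>R A) *v v = t *\<^sub>R (A *v v)"
  by (simp_all add: matrix_vector_mult_def vec_eq_iff sum.distrib algebra_simps sum_distrib_left)

locale isotropic_pair =
  fixes Q :: "real ^ 'n \<Rightarrow> real ^ 'n \<Rightarrow> real" and n :: nat and x y :: "real ^ 'n"
  assumes Q: "bilinear Q" and sym: "Q v w = (-1) ^ n * Q w v"
    and Qxy: "Q x y = 1" and Qxx: "Q x x = 0" and Qyy: "Q y y = 0"
begin

abbreviation "B \<equiv> complexify_form Q"
abbreviation "X \<equiv> of_real_vec x"
abbreviation "Y \<equiv> of_real_vec y"
abbreviation "s \<equiv> ((-1) ^ n :: complex)"

lemmas B_simps = complexify_form_simps[OF Q]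

lemma B_sym: "B v w = s * B w v"
  by (rule complexify_form_sym[of UNIV]) (use sym in blast, simp_all)

lemma ss: "s * s = 1" by (simp flip: power_add mult_2)

lemma BXY: "B X Y = 1" "B X X = 0" "B Y Y = 0" "B Y X = s"
  using B_sym[of Y X] by (simp_all add: complexify_form_of_real[OF Q] Qxy Qxx Qyy)

text \<open>
  The isometry that scales \<open>x\<close> by \<open>t\<close> and \<open>y\<close> by \<open>1 / t\<close>, and fixes the vectors orthogonal to both.
\<close>

definition "torus t = mat 1 + (t - 1) *\<^sub>R matrix (\<lambda>v. Q v y *\<^sub>R x) + (1 / t - 1) *\<^sub>R matrix (\<lambda>v. Q x v *\<^sub>R y)"

lemma torus_real: "torus t *v v = v + ((t - 1) * Q v y) *\<^sub>R x + ((1 / t - 1) * Q x v) *\<^sub>R y"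
proof -
  have "linear (\<lambda>v. Q v y *\<^sub>R x)" "linear (\<lambda>v. Q x v *\<^sub>R y)"
    by (simp_all add: linear_iff bilinear_ladd[OF Q] bilinear_radd[OF Q] bilinear_lmul[OF Q] bilinear_rmul[OF Q] scaleR_add_left)
  then show ?thesis by (simp add: torus_def matrix_add_scale_vector_real matrix_works linear_matrix_vector_mul_eq)
qed

lemma torus_vector:
  "complexify_matrix (torus t) *v v = v + (of_real (t - 1) * B v Y) *s X + (of_real (1 / t - 1) * B X v) *s Y"
  by (rule complex_vec_eqI)
     (simp_all add: complexify_matrix_vector torus_real complexify_form_def bilinear_lzero[OF Q] bilinear_rzero[OF Q])

lemma torus_isometry: "0 < t \<Longrightarrow> torus t \<in> real_isometries Q"
proof -
  assume t: "0 < t"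
  have "Q (torus t *v v) (torus t *v w) = Q v w" for v w
  proof -
    have e: "Q y x = (-1) ^ n" "Q y w = (-1) ^ n * Q w y" "Q v x = (-1) ^ n * Q x v" "((-1) ^ n * (-1) ^ n :: real) = 1"
      using sym[of y x] sym[of y w] sym[of v x] Qxy by (simp_all flip: power_add mult_2)
    have expand: "Q (v + a *\<^sub>R x + b *\<^sub>R y) (w + c *\<^sub>R x + d *\<^sub>R y) =
        Q v w + c * Q v x + d * Q v y + a * Q x w + a * d + b * Q y w + b * c * Q y x" for a b c d
      by (simp add: bilinear_ladd[OF Q] bilinear_radd[OF Q] bilinear_lmul[OF Q] bilinear_rmul[OF Q] Qxx Qyy Qxy algebra_simps)
    define p r where "p = t - 1" and "r = 1 / t - 1"
    have z: "p + r + p * r = 0" using t by (simp add: p_def r_def field_simps)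
    have "Q (torus t *v v) (torus t *v w) = Q v w + (p + r + p * r) * (Q v y * Q x w + (-1) ^ n * Q w y * Q x v)"
      unfolding torus_real p_def[symmetric] r_def[symmetric] expand e(1-3) by (simp add: algebra_simps)
    also have "\<dots> = Q v w" by (simp add: z)
    finally show ?thesis .
  qed
  then show ?thesis by (simp add: real_isometries_def)
qed

lemma torus_in_group:
  assumes "0 < t" shows "torus t \<in> real_group Q"
proof (rule real_group_path[of "{0<..}" torus Q 1])
  show "continuous_on {0<..} torus"
    unfolding torus_def by (intro continuous_intros) auto
  show "torus 1 = mat 1" by (simp add: torus_def)
qed (use assms torus_isometry in auto)

text \<open>
  An Eichler transvection: for \<open>e\<close> orthogonal to \<open>x\<close> and \<open>y\<close> and \<open>\<tau> = 1\<close> it fixes \<open>y\<close> and maps \<open>x\<close> to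
  \<open>x + e + k y\<close>.  The parameter \<open>\<tau>\<close> joins it to the identity within the isometries.
\<close>

definition "transvection e k \<tau> = mat 1 + \<tau> *\<^sub>R matrix (\<lambda>v. B v Y *s e - B e v *s Y)
     + \<tau>\<^sup>2 *\<^sub>R matrix (\<lambda>v. (k * B v Y) *s Y)"

lemma transvection_vector:
  "transvection e k \<tau> *v v = v + of_real \<tau> *s (B v Y *s e - B e v *s Y) + of_real (\<tau>\<^sup>2) *s ((k * B v Y) *s Y)"
proof -
  have "Vector_Spaces.linear (*s) (*s) (\<lambda>v. B v Y *s e - B e v *s Y)" "Vector_Spaces.linear (*s) (*s) (\<lambda>v. (k * B v Y) *s Y)"
    by (rule vec_linearI; simp add: B_simps vec_eq_iff algebra_simps)+
  then show ?thesis by (simp add: transvection_def matrix_add_scale_vector matrix_works)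
qed

lemma transvection_isometry:
  assumes e: "B X e = 0" "B e Y = 0" "B e e + k * (1 + s) = 0"
  shows "transvection e k \<tau> \<in> complex_isometries Q"
proof -
  have "B (transvection e k \<tau> *v v) (transvection e k \<tau> *v w) = B v w" for v w
  proof -
    have r: "B v e = s * B e v" "B Y w = s * B w Y" "B Y e = 0" using B_sym[of v e] B_sym[of Y w] B_sym[of Y e] e by auto
    have "B (transvection e k \<tau> *v v) (transvection e k \<tau> *v w) = B v w +
        of_real (\<tau>\<^sup>2) * B v Y * B w Y * (B e e + k * (1 + s))"
      unfolding transvection_vector by (simp add: B_simps BXY r e(2) power2_eq_square algebra_simps)
    then show ?thesis by (simp add: e(3))
  qed
  then show ?thesis by (simp add: complex_isometries_def)
qed

lemma transvection_in_group:
  assumes "B X e = 0" "B e Y = 0" "B e e + k * (1 + s) = 0"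
  shows "transvection e k \<tau> \<in> complex_group Q"
proof (rule complex_group_path[of UNIV "transvection e k" Q 0])
  show "continuous_on UNIV (transvection e k)"
    unfolding transvection_def by (intro continuous_intros)
  show "transvection e k 0 = mat 1" by (simp add: transvection_def)
qed (use transvection_isometry[OF assms] in auto)

text \<open>
  Conjugation with the torus contracts the transvections as \<open>t\<close> grows.
\<close>

lemma torus_transvection:
  assumes e: "B X e = 0" "B e Y = 0" and t: "0 < t"
  shows "complexify_matrix (torus t) *v (transvection e k 1 *v v) =
     transvection e k (1 / t) *v (complexify_matrix (torus t) *v v)"
proof -
  have r: "B e X = 0" using B_sym[of e X] e by simp
  have t': "complex_of_real t \<noteq> 0" using t by simp
  show ?thesis
    unfolding torus_vector transvection_vector
    using t' by (simp add: B_simps BXY e r vec_eq_iff power2_eq_square field_simps)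
qed

lemma transvection_inverse:
  assumes e: "B X e = 0" "B e Y = 0"
  shows "transvection e k 1 *v (transvection (- e) (- k - B e e) 1 *v v) = v"
proof -
  have r: "B Y e = 0" using B_sym[of Y e] e by simp
  show ?thesis
    unfolding transvection_vector by (simp add: B_simps BXY e r vec_eq_iff algebra_simps)
qed

end

text \<open>
  An invariant of real orbits, whose jump excludes the degeneration in the next theorem.
\<close>

definition real_part_dim :: "int \<Rightarrow> 'n::finite filtration \<Rightarrow> nat" where
  "real_part_dim a L = vec.dim {v \<in> L a. cnj_vec v \<in> L a}"

lemma real_part_dim_orbit:
  assumes Q: "bilinear Q" and nd: "\<forall>v. (\<forall>w. Q v w = 0) \<longrightarrow> v = 0" and g: "g \<in> real_group Q"
  shows "real_part_dim a (act (complexify_matrix g) L) = real_part_dim a L"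
proof -
  let ?g = "complexify_matrix g"
  have gi: "?g \<in> complex_isometries Q"
    using real_group_isometry[OF g] complexify_form_isometry[of Q g]
    by (simp add: real_isometries_def complex_isometries_def)
  obtain g' where g': "g' ** ?g = mat 1" using complex_isometry_inverse[OF Q nd gi] by blast
  have inj: "inj ((*v) ?g)" by (metis g' injI matrix_vector_mul_assoc matrix_vector_mul_lid)
  have "{v \<in> act ?g L a. cnj_vec v \<in> act ?g L a} = (*v) ?g ` {v \<in> L a. cnj_vec v \<in> L a}"
  proof (intro set_eqI iffI)
    fix v assume "v \<in> {v \<in> act ?g L a. cnj_vec v \<in> act ?g L a}"
    then obtain u w where u: "u \<in> L a" "v = ?g *v u" "w \<in> L a" "cnj_vec v = ?g *v w" by (auto simp: act_def)
    then have "?g *v cnj_vec u = ?g *v w" by (simp add: complexify_matrix_cnj)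
    then have "cnj_vec u = w" using inj by (simp add: inj_def)
    then show "v \<in> (*v) ?g ` {v \<in> L a. cnj_vec v \<in> L a}" using u by auto
  next
    fix v assume "v \<in> (*v) ?g ` {v \<in> L a. cnj_vec v \<in> L a}"
    then show "v \<in> {v \<in> act ?g L a. cnj_vec v \<in> act ?g L a}"
      by (auto simp: act_def complexify_matrix_cnj[symmetric])
  qed
  then show ?thesis
    unfolding real_part_dim_def
    by (simp only: vec.dim_image_eq[OF matrix_vector_mul_linear_gen[of ?g] inj_on_subset[OF inj subset_UNIV]])
qed

text \<open>
  Assume \<open>y\<close> is not in \<open>L c\<close>.  In the last step of \<open>L\<close> that is not orthogonal to \<open>y\<close> there is an isotropic vector
  \<open>l\<close> pairing to one with \<open>y\<close>, and a transvection \<open>w\<close> moves it to the real vector \<open>x\<close>.  The flag \<open>L' = w L\<close>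
  is stable under the torus, so the torus translates of \<open>L\<close> are transvections of \<open>L'\<close> that tend to \<open>L'\<close>.  Hence
  \<open>L'\<close> is in the closed orbit.  With \<open>a = n + 1 - c\<close>, real vectors of \<open>L a\<close> are orthogonal to \<open>y\<close> by
  hypothesis, and up to multiples of \<open>y\<close> they survive in \<open>L' a\<close>, which contains \<open>x\<close> in addition.
\<close>

theorem closed_orbit_isotropic_vector:
  assumes Q: "bilinear Q" and sym: "\<forall>v w. Q v w = (-1) ^ n * Q w v" and nd: "\<forall>v. (\<forall>w. Q v w = 0) \<longrightarrow> v = 0"
    and F0: "isotropic_flag n Q F\<^sub>0" and closed: "closed_real_orbit Q F\<^sub>0 \<O>" and LO: "L \<in> \<O>"
    and y: "Q y y = 0" and yL: "of_real_vec y = \<alpha> + cnj_vec \<beta>" "\<alpha> \<in> L c" "\<beta> \<in> L c"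
  shows "of_real_vec y \<in> L c"
proof (rule ccontr)
  let ?B = "complexify_form Q" and ?Y = "of_real_vec y"
  assume nin: "?Y \<notin> L c"
  obtain E where E: "\<O> = real_orbit Q E" "E \<in> topspace (compact_dual Q F\<^sub>0)"
    "closedin (compact_dual Q F\<^sub>0) \<O>" using closed by (auto simp: closed_real_orbit_def)
  have "L \<in> topspace (compact_dual Q F\<^sub>0)" using LO closedin_subset[OF E(3)] by blast
  then obtain g0 where g0: "g0 \<in> complex_group Q" "L = act g0 F\<^sub>0"
    by (auto simp: topspace_compact_dual complex_orbit_def)
  have Lf: "isotropic_flag n Q L" unfolding g0(2) by (rule isotropic_flag_act[OF Q nd complex_group_isometry[OF g0(1)] F0])
  then have Lsub: "vec.subspace (L p)" and Lanti: "antimono L" and Ltop: "L (int n + 1) = {0}"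
    and Lperp: "v \<in> L (int n + 1 - p) \<longleftrightarrow> (\<forall>w\<in>L p. ?B v w = 0)" for p v
    unfolding isotropic_flag_def by blast+
  have Lle: "q \<le> p \<Longrightarrow> v \<in> L p \<Longrightarrow> v \<in> L q" for p q v using antimonoD[OF Lanti] by blast
  obtain x where x: "Q x y = 1" "Q x x = 0"
  proof -
    have "y \<noteq> 0"
    proof
      assume "y = 0"
      then have "?Y = 0" by (intro complex_vec_eqI) simp_all
      then show False using nin vec.subspace_0[OF Lsub] by simp
    qed
    then obtain w where "Q y w \<noteq> 0" using nd by blast
    then have w: "Q w y \<noteq> 0" using sym by (metis mult_zero_right)
    define x0 where "x0 = (1 / Q w y) *\<^sub>R w"
    have x0: "Q x0 y = 1" using w by (simp add: x0_def bilinear_lmul[OF Q])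
    define x where "x = x0 - (Q x0 x0 / 2) *\<^sub>R y"
    have "Q x y = 1" by (simp add: x_def x0 y bilinear_lsub[OF Q] bilinear_lmul[OF Q])
    moreover have "Q x x = 0"
    proof -
      have yx: "Q y x0 = (-1) ^ n" using sym[rule_format, of y x0] x0 by simp
      have z: "Q x0 x0 = 0" if "odd n"
        using sym[rule_format, of x0 x0] unfolding neg_one_odd_power[OF that] by linarith
      have "Q x x = Q x0 x0 - Q x0 x0 / 2 * (1 + (-1) ^ n)"
        by (simp add: x_def y x0 yx bilinear_lsub[OF Q] bilinear_rsub[OF Q] bilinear_lmul[OF Q] bilinear_rmul[OF Q] field_simps)
      then show ?thesis using z by (cases "even n") auto
    qed
    ultimately show thesis by (rule that)
  qed
  interpret isotropic_pair Q n x y by unfold_locales (use Q sym x y in blast)+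
  define a where "a = int n + 1 - c"
  define hits where "hits p \<longleftrightarrow> (\<exists>v\<in>L p. B v Y \<noteq> 0)" for p
  have Y_in: "Y \<in> L (int n + 1 - p) \<longleftrightarrow> \<not> hits p" for p
  proof -
    have "B Y v = 0 \<longleftrightarrow> B v Y = 0" for v using B_sym[of v Y] ss by auto
    then show ?thesis unfolding Lperp hits_def by blast
  qed
  have ac: "int n + 1 - a = c" by (simp add: a_def)
  have hits_a: "hits a" using Y_in[of a] nin unfolding ac by blast
  have hits_anti: "hits q" if "hits p" "q \<le> p" for p q using that Lle unfolding hits_def by blast
  have no_hit: "\<not> hits p" if "int n < p" for p
  proof
    assume "hits p"
    then have "hits (int n + 1)" using hits_anti[of p "int n + 1"] that by simp
    then show False using Ltop by (auto simp: hits_def B_simps)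
  qed
  (* The vector l is taken from the last step that does not annihilate y; this is what makes L' graded. *)
  define a0 where "a0 = Max {p. a \<le> p \<and> p \<le> int n \<and> hits p}"
  have fin: "finite {p. a \<le> p \<and> p \<le> int n \<and> hits p}" by (rule finite_subset[of _ "{a..int n}"]) auto
  have "a \<in> {p. a \<le> p \<and> p \<le> int n \<and> hits p}" using hits_a no_hit[of a] by force
  then have a0in: "a0 \<in> {p. a \<le> p \<and> p \<le> int n \<and> hits p}" unfolding a0_def using fin by (intro Max_in) auto
  have hits_iff: "hits p \<longleftrightarrow> p \<le> a0" for p
  proof
    assume p: "hits p"
    show "p \<le> a0"
    proof (cases "a \<le> p")
      case True
      then show ?thesis unfolding a0_def using fin p no_hit[of p] by (intro Max_ge) force+
    next
      case False then show ?thesis using a0in by simp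
    qed
  next
    assume "p \<le> a0" then show "hits p" using a0in hits_anti by blast
  qed
  have Y_iff: "Y \<in> L p \<longleftrightarrow> p \<le> int n - a0" for p
  proof -
    have "Y \<in> L (int n + 1 - (int n + 1 - p)) \<longleftrightarrow> \<not> int n + 1 - p \<le> a0" unfolding Y_in hits_iff ..
    then show ?thesis by (simp add: not_le) linarith
  qed
  obtain l where l: "l \<in> L a0" "B l Y = 1" "B l l = 0"
  proof -
    obtain v where v: "v \<in> L a0" "B v Y \<noteq> 0" using a0in by (auto simp: hits_def)
    define u where "u = (1 / B v Y) *s v"
    have u: "u \<in> L a0" "B u Y = 1" using v Lsub by (auto simp: u_def vec.subspace_scale B_simps)
    show thesis
    proof (cases "int n + 1 \<le> 2 * a0")
      case True
      have "u \<in> L (int n + 1 - a0)" using True u(1) Lle[of "int n + 1 - a0" a0] by auto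
      then have "B u u = 0" using u(1) unfolding Lperp by blast
      then show ?thesis using u that by blast
    next
      case False
      then have YL: "Y \<in> L a0" using Y_iff by auto
      have Yu: "B Y u = s" using B_sym[of Y u] u by simp
      have "B u u = s * B u u" by (rule B_sym)
      then have odd: "odd n \<Longrightarrow> B u u = 0" by simp
      let ?u = "u - (B u u / 2) *s Y"
      have "B ?u ?u = B u u - B u u / 2 * (1 + s)"
        by (simp add: B_simps u Yu BXY field_simps)
      then have "B ?u ?u = 0" using odd by (cases "even n") auto
      moreover have "B ?u Y = 1" by (simp add: B_simps u BXY)
      moreover have "?u \<in> L a0" using u YL Lsub by (simp add: vec.subspace_diff vec.subspace_scale)
      ultimately show ?thesis using that by blast
    qed
  qed
  define k where "k = B X l"
  define e where "e = l - X - k *s Y"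
  have e: "B X e = 0" "B e Y = 0" by (simp_all add: e_def B_simps BXY l k_def)
  have eX: "B e X = 0" "B Y e = 0" using B_sym[of e X] B_sym[of Y e] e by auto
  have ell: "l = X + e + k *s Y" by (simp add: e_def)
  have ke: "B e e + k * (1 + s) = 0"
    using l(3) unfolding ell by (simp add: B_simps BXY e eX algebra_simps)
  define k' where "k' = - k - B e e"
  have ke': "B (- e) (- e) + k' * (1 + s) = 0"
  proof (cases "even n")
    case True
    then have "B e e = - 2 * k" using ke by (simp add: add_eq_0_iff2 mult.commute)
    then show ?thesis using True by (simp add: k'_def B_simps)
  next
    case False then show ?thesis using ke by (simp add: B_simps)
  qed
  have e': "B X (- e) = 0" "B (- e) Y = 0" using e by (simp_all add: B_simps)
  define w where "w = transvection (- e) k' 1"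
  define u where "u = transvection e k"
  have uw: "u 1 *v (w *v v) = v" for v unfolding u_def w_def k'_def by (rule transvection_inverse[OF e])
  have uw1: "u 1 ** w = mat 1" using uw by (intro matrix_eqI_vector) (simp add: matrix_vector_mul_assoc[symmetric])
  have wu1: "w ** u 1 = mat 1" using uw1 matrix_left_right_inverse by blast
  have w_vec: "w *v v = v - B v Y *s e + (B e v + k' * B v Y) *s Y" for v
    unfolding w_def transvection_vector by (simp add: B_simps vec_eq_iff algebra_simps)
  have wl: "w *v l = X"
  proof -
    have "u 1 *v X = l" unfolding u_def transvection_vector by (simp add: BXY eX ell vec_eq_iff algebra_simps)
    then have "w *v l = (w ** u 1) *v X" by (simp add: matrix_vector_mul_assoc[symmetric])
    then show ?thesis by (simp add: wu1)
  qed
  have wY: "w *v Y = Y" by (simp add: w_vec BXY e)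
  define L' where "L' = act w L"
  have L'sub: "vec.subspace (L' p)" for p
    unfolding L'_def act_def using vec.linear_subspace_image[OF matrix_vector_mul_linear_gen Lsub] by blast
  have L'in: "v \<in> L p \<Longrightarrow> w *v v \<in> L' p" for v p by (auto simp: L'_def act_def)
  have X_in: "X \<in> L' p" if "p \<le> a0" for p using L'in[OF Lle[OF that l(1)]] by (simp add: wl)
  have graded0: "B X (w *v v) *s Y \<in> L' p" if v: "v \<in> L p" "B v Y = 0" for v p
  proof (cases "Y \<in> L p")
    case True
    then have "Y \<in> L' p" using L'in wY by metis
    then show ?thesis using L'sub by (simp add: vec.subspace_scale)
  next
    case False
    then have "int n + 1 - p \<le> a0" using Y_iff by auto
    then have "l \<in> L (int n + 1 - p)" using l(1) Lle by blast
    then have "B l v = 0" using v(1) Lperp by blast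
    moreover have "B Y v = 0" using v(2) B_sym[of Y v] by simp
    ultimately have "B X v + B e v = 0" unfolding ell by (simp add: B_simps)
    then have "B X (w *v v) = 0" by (simp add: w_vec v(2) B_simps BXY)
    then show ?thesis using vec.subspace_0[OF L'sub] by simp
  qed
  have graded: "B v' Y *s X \<in> L' p \<and> B X v' *s Y \<in> L' p" if v': "v' \<in> L' p" for v' p
  proof -
    obtain v where v: "v \<in> L p" "v' = w *v v" using v' by (auto simp: L'_def act_def)
    have vY: "B v' Y = B v Y" by (simp add: v w_vec B_simps BXY e)
    show ?thesis
    proof (cases "p \<le> a0")
      case True
      have lp: "l \<in> L p" by (rule Lle[OF True l(1)])
      let ?v = "v - B v Y *s l"
      have "?v \<in> L p" using v lp Lsub by (simp add: vec.subspace_diff vec.subspace_scale)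
      moreover have "B ?v Y = 0" by (simp add: B_simps l)
      ultimately have "B X (w *v ?v) *s Y \<in> L' p" by (rule graded0)
      moreover have "B X (w *v ?v) = B X v'"
        by (simp add: v matrix_vector_mult_diff_distrib vec.scale wl B_simps BXY)
      ultimately show ?thesis using X_in[OF True] L'sub by (simp add: vec.subspace_scale)
    next
      case False
      then have "B v Y = 0" using v(1) hits_iff unfolding hits_def by blast
      then show ?thesis using graded0[OF v(1)] vY v(2) vec.subspace_0[OF L'sub] by simp
    qed
  qed
  have torus_L': "complexify_matrix (torus t) *v v \<in> L' p" if "v \<in> L' p" for v p t
  proof -
    have X: "of_real (t - 1) *s (B v Y *s X) \<in> L' p"
      by (rule vec.subspace_scale[OF L'sub conjunct1[OF graded[OF that]]])
    have Y: "of_real (1 / t - 1) *s (B X v *s Y) \<in> L' p"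
      by (rule vec.subspace_scale[OF L'sub conjunct2[OF graded[OF that]]])
    show ?thesis
      using vec.subspace_add[OF L'sub vec.subspace_add[OF L'sub that X] Y]
      unfolding torus_vector vector_smult_assoc .
  qed
  have torus_fix: "act (complexify_matrix (torus t)) L' = L'" if t: "0 < t" for t
  proof (rule ext)
    fix p
    have inv: "complexify_matrix (torus t) *v (complexify_matrix (torus (1 / t)) *v v) = v" for v
      unfolding torus_vector using t by (simp add: B_simps BXY vec_eq_iff field_simps)
    show "act (complexify_matrix (torus t)) L' p = L' p"
    proof
      show "act (complexify_matrix (torus t)) L' p \<subseteq> L' p" using torus_L' by (auto simp: act_def)
      show "L' p \<subseteq> act (complexify_matrix (torus t)) L' p"
      proof
        fix v assume "v \<in> L' p"
        then have "complexify_matrix (torus t) *v (complexify_matrix (torus (1 / t)) *v v) \<in> act (complexify_matrix (torus t)) L' p"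
          unfolding act_def by (intro imageI torus_L')
        then show "v \<in> act (complexify_matrix (torus t)) L' p" by (simp only: inv)
      qed
    qed
  qed
  have L_L': "L = act (u 1) L'" unfolding L'_def by (simp add: act_mult[symmetric] uw1 act_1)
  have orbit_closed: "act (complexify_matrix g) M \<in> \<O>" if M: "M \<in> \<O>" "g \<in> real_group Q" for g M
  proof -
    obtain h where h: "h \<in> real_group Q" "M = act (complexify_matrix h) E" using M(1) unfolding E(1) real_orbit_def by blast
    then have "act (complexify_matrix g) M = act (complexify_matrix (g ** h)) E"
      by (simp add: complexify_matrix_mult act_mult)
    then show ?thesis using E(1) real_group_mult[OF M(2) h(1)] by (auto simp: real_orbit_def)
  qed
  define P where "P = {g \<in> complex_group Q. act g F\<^sub>0 \<in> \<O>}"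
  have path_in: "u (1 / t) ** (w ** g0) \<in> P" if t: "0 < t" for t
  proof -
    have "act (complexify_matrix (torus t)) L = act (complexify_matrix (torus t) ** u 1) L'"
      by (subst L_L') (simp add: act_mult)
    also have "complexify_matrix (torus t) ** u 1 = u (1 / t) ** complexify_matrix (torus t)"
      unfolding u_def by (rule matrix_eqI_vector) (simp add: matrix_vector_mul_assoc[symmetric] torus_transvection[OF e t])
    also have "act (u (1 / t) ** complexify_matrix (torus t)) L' = act (u (1 / t)) L'"
      by (simp add: act_mult torus_fix[OF t])
    also have "\<dots> = act (u (1 / t) ** (w ** g0)) F\<^sub>0" by (simp add: act_mult L'_def g0(2))
    finally have "act (u (1 / t) ** (w ** g0)) F\<^sub>0 \<in> \<O>"
      using orbit_closed[OF LO torus_in_group[OF t]] by simp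
    moreover have "u (1 / t) ** (w ** g0) \<in> complex_group Q"
      unfolding u_def w_def by (intro complex_group_mult transvection_in_group e e' ke ke' g0(1))
    ultimately show ?thesis by (simp add: P_def)
  qed
  have "closedin (top_of_set (complex_group Q)) P"
  proof -
    have X: "topspace (compact_dual Q F\<^sub>0) = complex_orbit Q F\<^sub>0" by (rule topspace_compact_dual)
    have "openin (compact_dual Q F\<^sub>0) (complex_orbit Q F\<^sub>0 - \<O>)" using E(3) X by (simp add: closedin_def)
    then have "openin (top_of_set (complex_group Q)) {g \<in> complex_group Q. act g F\<^sub>0 \<in> complex_orbit Q F\<^sub>0 - \<O>}"
      by (simp add: openin_compact_dual)
    moreover have "{g \<in> complex_group Q. act g F\<^sub>0 \<in> complex_orbit Q F\<^sub>0 - \<O>} = complex_group Q - P"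
      by (auto simp: P_def complex_orbit_def)
    ultimately show ?thesis by (simp add: closedin_def P_def)
  qed
  then obtain T where T: "closed T" "P = complex_group Q \<inter> T" by (auto simp: closedin_closed)
  have lim: "(\<lambda>i. u (1 / real (Suc i)) ** (w ** g0)) \<longlonglongrightarrow> u 0 ** (w ** g0)"
  proof -
    have "continuous_on UNIV u" unfolding u_def transvection_def by (intro continuous_intros)
    then have "continuous_on UNIV (\<lambda>\<tau>. u \<tau> ** (w ** g0))" by (intro continuous_on_matrix_mult continuous_on_const)
    then have "isCont (\<lambda>\<tau>. u \<tau> ** (w ** g0)) 0" by (simp add: continuous_on_eq_continuous_at)
    moreover have "(\<lambda>i. 1 / real (Suc i)) \<longlonglongrightarrow> 0" using LIMSEQ_inverse_real_of_nat by (simp add: inverse_eq_divide)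
    ultimately show ?thesis by (rule isCont_tendsto_compose)
  qed
  have "u (1 / real (Suc i)) ** (w ** g0) \<in> T" for i using path_in[of "real (Suc i)"] T(2) by auto
  then have "u 0 ** (w ** g0) \<in> T" by (rule closed_sequentially[OF T(1) _ lim])
  moreover have "u 0 = mat 1" by (simp add: u_def transvection_def)
  ultimately have "w ** g0 \<in> T" by simp
  moreover have "w ** g0 \<in> complex_group Q"
    unfolding w_def by (intro complex_group_mult transvection_in_group e' ke' g0(1))
  ultimately have "w ** g0 \<in> P" using T(2) by blast
  then have "L' \<in> \<O>" by (simp add: P_def L'_def g0(2) act_mult)
  then have dims: "real_part_dim a L' = real_part_dim a L"
    using LO E(1) real_part_dim_orbit[OF Q nd] by (auto simp: real_orbit_def)
  define R where "R = {v \<in> L a. cnj_vec v \<in> L a}"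
  define R' where "R' = {v \<in> L' a. cnj_vec v \<in> L' a}"
  have aa0: "a \<le> a0" using a0in by simp
  have subR': "vec.subspace R'"
    unfolding R'_def using L'sub[of a] by (auto simp: vec.subspace_def)
  have subR: "vec.subspace R"
    unfolding R_def using Lsub[of a] by (auto simp: vec.subspace_def)
  have XR': "X \<in> R'" using X_in[OF aa0] by (simp add: R'_def)
  have RY: "B v Y = 0" if "v \<in> R" for v
  proof -
    have c: "int n + 1 - a = c" by (simp add: a_def)
    have 1: "B \<alpha> v = 0" if "v \<in> L a" for v using yL(2) that Lperp[of _ a] unfolding c by blast
    have 2: "B \<beta> v = 0" if "v \<in> L a" for v using yL(3) that Lperp[of _ a] unfolding c by blast
    have "B (cnj_vec \<beta>) v = 0"
      using 2[of "cnj_vec v"] \<open>v \<in> R\<close> complexify_form_cnj[OF Q, of \<beta> "cnj_vec v"] by (simp add: R_def)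
    then have "B Y v = 0" using 1[of v] \<open>v \<in> R\<close> by (simp add: yL(1) B_simps R_def)
    then show ?thesis using B_sym[of v Y] by simp
  qed
  have low: "v - B X v *s Y \<in> L' a" if v: "v \<in> L a" "B v Y = 0" for v
  proof -
    have "w *v v - B X (w *v v) *s Y \<in> L' a" using L'in[OF v(1)] graded0[OF v] L'sub by (simp add: vec.subspace_diff)
    moreover have "w *v v - B X (w *v v) *s Y = v - B X v *s Y"
      by (simp add: w_vec v(2) B_simps BXY vec_eq_iff algebra_simps)
    ultimately show ?thesis by simp
  qed
  have lowR: "v - B X v *s Y \<in> R'" if "v \<in> R" for v
  proof -
    have v: "v \<in> L a" "cnj_vec v \<in> L a" "B v Y = 0" using that RY by (auto simp: R_def)
    have c: "B (cnj_vec v) Y = cnj (B v Y)" "B X (cnj_vec v) = cnj (B X v)"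
      using complexify_form_cnj[OF Q, of v Y] complexify_form_cnj[OF Q, of X v] by simp_all
    have "cnj_vec v - B X (cnj_vec v) *s Y \<in> L' a" by (rule low[OF v(2)]) (simp add: c v(3))
    then have "cnj_vec (v - B X v *s Y) \<in> L' a" by (simp add: c)
    then show ?thesis using low[OF v(1,3)] by (simp add: R'_def)
  qed
  have "\<exists>R1. vec.subspace R1 \<and> R1 \<subseteq> R' \<and> vec.dim R1 = vec.dim R \<and> X \<notin> R1"
  proof (cases "Y \<in> L a")
    case True
    have YR': "Y \<in> R'" using L'in[OF True] by (simp add: wY R'_def)
    have "v \<in> R'" if "v \<in> R" for v
    proof -
      have "(v - B X v *s Y) + B X v *s Y \<in> R'"
        using lowR[OF that] YR' subR' by (simp only: vec.subspace_add vec.subspace_scale)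
      then show ?thesis by simp
    qed
    moreover have "X \<notin> R" using RY[of X] BXY by auto
    ultimately show ?thesis using subR by (intro exI[of _ R]) auto
  next
    case False
    let ?\<tau> = "\<lambda>v. v - B X v *s Y"
    have lin: "Vector_Spaces.linear (*s) (*s) ?\<tau>"
      by (rule vec_linearI) (simp_all add: B_simps vec_eq_iff algebra_simps)
    have inj: "inj_on ?\<tau> R"
    proof (rule inj_onI)
      fix v v' assume v: "v \<in> R" "v' \<in> R" "?\<tau> v = ?\<tau> v'"
      then have d: "v - v' = B X (v - v') *s Y" by (simp add: B_simps vec_eq_iff algebra_simps)
      have "v - v' \<in> R" using v subR by (simp add: vec.subspace_diff)
      then have "B X (v - v') *s Y \<in> L a" using d by (simp add: R_def)
      then have "B X (v - v') = 0"
      proof (rule contrapos_pp)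
        assume nz: "B X (v - v') \<noteq> 0"
        show "B X (v - v') *s Y \<notin> L a"
        proof
          assume "B X (v - v') *s Y \<in> L a"
          then have "(1 / B X (v - v')) *s (B X (v - v') *s Y) \<in> L a" using Lsub vec.subspace_scale by blast
          then show False using nz False by (simp add: vector_smult_assoc)
        qed
      qed
      then show "v = v'" using d by simp
    qed
    have "vec.dim (?\<tau> ` R) = vec.dim R"
      by (rule vec.dim_image_eq[OF lin]) (simp only: vec.span_eq_iff[THEN iffD2, OF subR] inj)
    moreover have "?\<tau> ` R \<subseteq> R'" using lowR by blast
    moreover have "X \<notin> ?\<tau> ` R"
    proof
      assume "X \<in> ?\<tau> ` R"
      then obtain v where "v \<in> R" "X = v - B X v *s Y" by blast
      then have "B X Y = 0" using RY[of v] by (metis BXY(3) B_simps(3) complexify_form_diff(1)[OF Q] diff_zero mult_zero_right)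
      then show False using BXY by simp
    qed
    moreover have "vec.subspace (?\<tau> ` R)" by (rule vec.linear_subspace_image[OF lin subR])
    ultimately show ?thesis by blast
  qed
  then obtain R1 where R1: "vec.subspace R1" "R1 \<subseteq> R'" "vec.dim R1 = vec.dim R" "X \<notin> R1" by blast
  have "R1 = R'"
    using R1 dims by (intro vec.subspace_dim_equal[OF R1(1) subR' R1(2)]) (simp add: real_part_dim_def R_def R'_def)
  then show False using R1(4) XR' by simp
qed

section \<open>Flat holomorphic families\<close>

lemma holomorphic_map_subset:
  assumes f: "holomorphic_map A S f" and S': "S' \<subseteq> S"
  shows "holomorphic_map A S' f"
  unfolding holomorphic_map_def
proof clarify
  fix T \<phi> assume "(T, \<phi>) \<in> A"
  then have "complex_differentiable_on (f \<circ> inv_into T \<phi>) (\<phi> ` (S \<inter> T))"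
    using f unfolding holomorphic_map_def by fast
  then show "complex_differentiable_on (f \<circ> inv_into T \<phi>) (\<phi> ` (S' \<inter> T))"
    unfolding complex_differentiable_on_def using S' by blast
qed

lemma has_derivative_vec_scale:
  fixes c :: "'a::real_normed_vector \<Rightarrow> complex" and f :: "'a \<Rightarrow> complex ^ 'm"
  assumes "(c has_derivative c') (at x)" "(f has_derivative f') (at x)"
  shows "((\<lambda>x. c x *s f x) has_derivative (\<lambda>v. c x *s f' v + c' v *s f x)) (at x)"
  by (rule bounded_bilinear.FDERIV[OF bounded_bilinear_scale assms])

lemma has_derivative_vec_component:
  fixes f :: "'a::real_normed_vector \<Rightarrow> complex ^ 'm"
  assumes "(f has_derivative f') (at x)"
  shows "((\<lambda>x. f x $ i) has_derivative (\<lambda>v. f' v $ i)) (at x)"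
  by (rule bounded_linear.has_derivative[OF bounded_linear_vec_nth assms])

lemma span_image_lessThan:
  fixes f :: "nat \<Rightarrow> complex ^ 'm"
  shows "vec.span (f ` {..<r}) \<subseteq> {(\<Sum>l<r. u l *s f l) | u. True}"
proof (rule vec.span_minimal)
  show "f ` {..<r} \<subseteq> {(\<Sum>l<r. u l *s f l) | u. True}"
  proof
    fix x assume "x \<in> f ` {..<r}"
    then obtain j where j: "j < r" "x = f j" by auto
    have "(\<Sum>l<r. (if l = j then 1 else 0) *s f l) = (\<Sum>l<r. if l = j then f j else 0)"
      by (intro sum.cong) auto
    then have x: "x = (\<Sum>l<r. (if l = j then 1 else 0) *s f l)" using j by simp
    show "x \<in> {(\<Sum>l<r. u l *s f l) | u. True}"
      by (intro CollectI exI[of _ "\<lambda>l. if l = j then 1 else 0"] conjI TrueI x)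
  qed
  show "vec.subspace {(\<Sum>l<r. u l *s f l) | u. True}"
  proof (rule vec.subspaceI)
    show "0 \<in> {(\<Sum>l<r. u l *s f l) | u. True}"
      by (intro CollectI exI[of _ "\<lambda>l. 0"] conjI TrueI) simp
  next
    fix x y assume "x \<in> {(\<Sum>l<r. u l *s f l) | u. True}" "y \<in> {(\<Sum>l<r. u l *s f l) | u. True}"
    then obtain u w where "x = (\<Sum>l<r. u l *s f l)" "y = (\<Sum>l<r. w l *s f l)" by auto
    then have e: "x + y = (\<Sum>l<r. (u l + w l) *s f l)" by (simp add: sum.distrib vec.scale_left_distrib)
    show "x + y \<in> {(\<Sum>l<r. u l *s f l) | u. True}"
      by (intro CollectI exI[of _ "\<lambda>l. u l + w l"] conjI TrueI e)
  next
    fix c x assume "x \<in> {(\<Sum>l<r. u l *s f l) | u. True}"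
    then obtain u where "x = (\<Sum>l<r. u l *s f l)" by auto
    then have e: "c *s x = (\<Sum>l<r. (c * u l) *s f l)" by (simp add: vec.scale_sum_right vector_smult_assoc)
    show "c *s x \<in> {(\<Sum>l<r. u l *s f l) | u. True}"
      by (intro CollectI exI[of _ "\<lambda>l. c * u l"] conjI TrueI e)
  qed
qed

lemma chart_properties:
  assumes "complex_atlas A" "(T, \<phi>) \<in> A"
  shows "open T" "open (\<phi> ` T)" "continuous_on T \<phi>" "continuous_on (\<phi> ` T) (inv_into T \<phi>)"
    "\<And>t. t \<in> T \<Longrightarrow> inv_into T \<phi> (\<phi> t) = t"
proof -
  have h: "open T" "open (\<phi> ` T)" "homeomorphism T (\<phi> ` T) \<phi> (inv_into T \<phi>)"
    using assms unfolding complex_atlas_def by fast+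
  then show "open T" "open (\<phi> ` T)" "continuous_on T \<phi>" "continuous_on (\<phi> ` T) (inv_into T \<phi>)"
    "\<And>t. t \<in> T \<Longrightarrow> inv_into T \<phi> (\<phi> t) = t"
    by (auto simp: homeomorphism_def)
qed

lemma holomorphic_map_combination:
  assumes A: "complex_atlas A"
    and f: "holomorphic_map A S f" and g: "holomorphic_map A S g" and nz: "\<And>s. s \<in> S \<Longrightarrow> g s $ c \<noteq> 0"
  shows "holomorphic_map A S (\<lambda>s. f s - (f s $ c / g s $ c) *s g s)"
    "holomorphic_map A S (\<lambda>s. (1 / g s $ c) *s g s)"
proof -
  have main: "complex_differentiable_on ((\<lambda>s. f s - (f s $ c / g s $ c) *s g s) \<circ> inv_into T \<phi>) (\<phi> ` (S \<inter> T)) \<and>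
     complex_differentiable_on ((\<lambda>s. (1 / g s $ c) *s g s) \<circ> inv_into T \<phi>) (\<phi> ` (S \<inter> T))"
    if TA: "(T, \<phi>) \<in> A" for T \<phi>
    unfolding complex_differentiable_on_def
  proof (intro conjI ballI)
    fix x assume x: "x \<in> \<phi> ` (S \<inter> T)"
    let ?f = "f \<circ> inv_into T \<phi>" and ?g = "g \<circ> inv_into T \<phi>"
    have "complex_differentiable_on ?f (\<phi> ` (S \<inter> T))" "complex_differentiable_on ?g (\<phi> ` (S \<inter> T))"
      using f g TA unfolding holomorphic_map_def by fast+
    then obtain f' g' where f': "(?f has_derivative f') (at x)" "\<And>k v. f' (k *s v) = k *s f' v"
      and g': "(?g has_derivative g') (at x)" "\<And>k v. g' (k *s v) = k *s g' v"
      using x unfolding complex_differentiable_on_def by blast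
    have gx: "?g x $ c \<noteq> 0" using x nz chart_properties(5)[OF A TA] by auto
    note fc = has_derivative_vec_component[OF f'(1), of c] and gc = has_derivative_vec_component[OF g'(1), of c]
    define q where "q v = - (?f x $ c) * (inverse (?g x $ c) * (g' v $ c) * inverse (?g x $ c)) + (f' v $ c) / (?g x $ c)" for v
    have "((\<lambda>x. ?f x $ c / ?g x $ c) has_derivative q) (at x)"
      unfolding q_def using has_derivative_divide[OF fc gc gx] .
    from has_derivative_diff[OF f'(1) has_derivative_vec_scale[OF this g'(1)]]
    have "((\<lambda>x. ?f x - (?f x $ c / ?g x $ c) *s ?g x) has_derivative
        (\<lambda>v. f' v - ((?f x $ c / ?g x $ c) *s g' v + q v *s ?g x))) (at x)" .
    moreover have "q (k *s v) = k * q v" for k v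
      by (simp add: q_def f'(2) g'(2) algebra_simps)
    ultimately show "\<exists>h'. (((\<lambda>s. f s - (f s $ c / g s $ c) *s g s) \<circ> inv_into T \<phi>) has_derivative h') (at x) \<and> (\<forall>k v. h' (k *s v) = k *s h' v)"
      by (intro exI[of _ "\<lambda>v. f' v - ((?f x $ c / ?g x $ c) *s g' v + q v *s ?g x)"])
         (simp add: o_def f'(2) g'(2) vec_eq_iff algebra_simps)
    define q1 where "q1 v = - 1 * (inverse (?g x $ c) * (g' v $ c) * inverse (?g x $ c)) + 0 / (?g x $ c)" for v
    have "((\<lambda>x. 1 / ?g x $ c) has_derivative q1) (at x)"
      unfolding q1_def using has_derivative_divide[OF has_derivative_const gc gx] .
    from has_derivative_vec_scale[OF this g'(1)]
    have "((\<lambda>x. (1 / ?g x $ c) *s ?g x) has_derivative (\<lambda>v. (1 / ?g x $ c) *s g' v + q1 v *s ?g x)) (at x)" .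
    moreover have "q1 (k *s v) = k * q1 v" for k v
      by (simp add: q1_def g'(2) algebra_simps)
    ultimately show "\<exists>h'. (((\<lambda>s. (1 / g s $ c) *s g s) \<circ> inv_into T \<phi>) has_derivative h') (at x) \<and> (\<forall>k v. h' (k *s v) = k *s h' v)"
      by (intro exI[of _ "\<lambda>v. (1 / ?g x $ c) *s g' v + q1 v *s ?g x"])
         (simp add: o_def g'(2) vec_eq_iff algebra_simps)
  qed
  then show "holomorphic_map A S (\<lambda>s. f s - (f s $ c / g s $ c) *s g s)"
    "holomorphic_map A S (\<lambda>s. (1 / g s $ c) *s g s)"
    unfolding holomorphic_map_def by blast+
qed

lemma holomorphic_map_continuous:
  assumes A: "complex_atlas A" "(T, \<phi>) \<in> A" and f: "holomorphic_map A S f" and S: "S \<subseteq> T"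
  shows "continuous_on S f"
proof -
  note ch = chart_properties[OF A]
  have "complex_differentiable_on (f \<circ> inv_into T \<phi>) (\<phi> ` (S \<inter> T))"
    using f A(2) unfolding holomorphic_map_def by fast
  then have "isCont (f \<circ> inv_into T \<phi>) x" if "x \<in> \<phi> ` S" for x
    using that S has_derivative_continuous unfolding complex_differentiable_on_def
    by (metis Int_absorb2)
  then have "continuous_on (\<phi> ` S) (f \<circ> inv_into T \<phi>)" using continuous_at_imp_continuous_on by blast
  then have "continuous_on S ((f \<circ> inv_into T \<phi>) \<circ> \<phi>)"
    by (rule continuous_on_compose[OF continuous_on_subset[OF ch(3) S]])
  moreover have "((f \<circ> inv_into T \<phi>) \<circ> \<phi>) t = f t" if "t \<in> S" for t using ch(5) that S by auto
  ultimately show ?thesis by (simp cong: continuous_on_cong)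
qed

text \<open>
  Gaussian elimination: near a given point, some coordinate of the next frame vector does not
  vanish, and dividing by it keeps the frame holomorphic.
\<close>

lemma normalized_holomorphic_frame:
  fixes A :: "('s::{t2_space, second_countable_topology}, 'd::finite) chart set" and e :: "nat \<Rightarrow> 's \<Rightarrow> complex ^ 'm::finite"
  assumes A: "complex_atlas A" "(T, \<phi>) \<in> A" and S: "open S" "s \<in> S" "S \<subseteq> T"
    and e: "\<And>i. i < r \<Longrightarrow> holomorphic_map A S (e i)"
    and sp: "\<And>t. t \<in> S \<Longrightarrow> vec.span ((\<lambda>i. e i t) ` {..<r}) = E t"
    and dim: "vec.dim (E s) = r"
  shows "\<exists>S' e' (c :: nat \<Rightarrow> 'm). open S' \<and> s \<in> S' \<and> S' \<subseteq> S \<and> (\<forall>i<r. holomorphic_map A S' (e' i)) \<and>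
     (\<forall>t\<in>S'. vec.span ((\<lambda>i. e' i t) ` {..<r}) = E t) \<and>
     (\<forall>t\<in>S'. \<forall>i<r. \<forall>j<r. e' i t $ c j = (if i = j then 1 else (0 :: complex)))"
proof -
  have "k \<le> r \<Longrightarrow> \<exists>S' e' (c :: nat \<Rightarrow> 'm). open S' \<and> s \<in> S' \<and> S' \<subseteq> S \<and> (\<forall>i<r. holomorphic_map A S' (e' i)) \<and>
     (\<forall>t\<in>S'. vec.span ((\<lambda>i. e' i t) ` {..<r}) = E t) \<and>
     (\<forall>t\<in>S'. \<forall>i<r. \<forall>j<k. e' i t $ c j = (if i = j then 1 else (0 :: complex)))" for k
  proof (induction k)
    case 0 then show ?case using S e sp by (intro exI[of _ S] exI[of _ e]) auto
  next
    case (Suc k)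
    have "k \<le> r" using Suc.prems by simp
    from Suc.IH[OF this] obtain S' e' and c :: "nat \<Rightarrow> 'm" where S': "open S'" "s \<in> S'" "S' \<subseteq> S"
      and a: "\<forall>i<r. holomorphic_map A S' (e' i)" "\<forall>t\<in>S'. vec.span ((\<lambda>i. e' i t) ` {..<r}) = E t"
        "\<forall>t\<in>S'. \<forall>i<r. \<forall>j<k. e' i t $ c j = (if i = j then 1 else (0 :: complex))"
      by (elim exE conjE) (rule that; assumption)
    have e': "holomorphic_map A S' (e' i)" if "i < r" for i using a(1) that by blast
    have sp': "vec.span ((\<lambda>i. e' i t) ` {..<r}) = E t" if "t \<in> S'" for t using a(2) that by blast
    have c: "e' i t $ c j = (if i = j then 1 else 0)" if "t \<in> S'" "i < r" "j < k" for t i j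
      using a(3) that by blast
    have k: "k < r" using Suc.prems by simp
    have "e' k s \<noteq> 0"
    proof
      assume z: "e' k s = 0"
      have "(\<lambda>i. e' i s) ` {..<r} \<subseteq> insert 0 ((\<lambda>i. e' i s) ` ({..<r} - {k}))" using z by auto
      then have "E s \<subseteq> vec.span ((\<lambda>i. e' i s) ` ({..<r} - {k}))"
        unfolding sp'[OF S'(2), symmetric] using vec.span_mono by (metis vec.span_insert_0)
      then have "vec.dim (E s) \<le> card ((\<lambda>i. e' i s) ` ({..<r} - {k}))" by (intro vec.dim_le_card) auto
      also have "\<dots> \<le> card ({..<r} - {k})" by (intro card_image_le) auto
      finally show False using dim k by simp
    qed
    then obtain a where a: "e' k s $ a \<noteq> 0" by (auto simp: vec_eq_iff)
    define S2 where "S2 = {t \<in> S'. e' k t $ a \<noteq> 0}"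
    have "continuous_on S' (\<lambda>t. e' k t $ a)"
      by (intro continuous_on_component holomorphic_map_continuous[OF A e'[OF k]]) (use S' S in auto)
    then have "open (S' \<inter> (\<lambda>t. e' k t $ a) -` (- {0}))"
      using S'(1) by (intro continuous_open_preimage) auto
    moreover have "S' \<inter> (\<lambda>t. e' k t $ a) -` (- {0}) = S2" by (auto simp: S2_def)
    ultimately have S2: "open S2" "s \<in> S2" "S2 \<subseteq> S'" using a S' by (auto simp: S2_def)
    define e2 where "e2 i = (if i = k then (\<lambda>t. (1 / e' k t $ a) *s e' k t)
        else (\<lambda>t. e' i t - (e' i t $ a / e' k t $ a) *s e' k t))" for i
    have hol: "holomorphic_map A S2 (e2 i)" if "i < r" for i
      using holomorphic_map_combination[OF A(1) holomorphic_map_subset[OF e'[OF that] S2(3)]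
          holomorphic_map_subset[OF e'[OF k] S2(3)], of a]
      by (auto simp: e2_def S2_def)
    have sp2: "vec.span ((\<lambda>i. e2 i t) ` {..<r}) = E t" if t: "t \<in> S2" for t
    proof -
      have nz: "e' k t $ a \<noteq> 0" "t \<in> S'" using t by (auto simp: S2_def)
      let ?V = "vec.span ((\<lambda>i. e2 i t) ` {..<r})" and ?V' = "vec.span ((\<lambda>i. e' i t) ` {..<r})"
      have b': "e' i t \<in> ?V'" if "i < r" for i using that by (intro vec.span_base) auto
      have b2: "e2 i t \<in> ?V" if "i < r" for i using that by (intro vec.span_base) auto
      have "e2 i t \<in> ?V'" if "i < r" for i
        using b'[OF that] b'[OF k] by (auto simp: e2_def intro!: vec.span_diff vec.span_scale)
      then have "?V \<subseteq> ?V'" by (intro vec.span_minimal) auto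
      moreover have k2: "e' k t \<in> ?V"
      proof -
        have "e' k t = e' k t $ a *s e2 k t" using nz by (simp add: e2_def vector_smult_assoc)
        then show ?thesis using b2[OF k] vec.span_scale by metis
      qed
      have "e' i t \<in> ?V" if "i < r" for i
      proof (cases "i = k")
        case False
        then have "e' i t = e2 i t + (e' i t $ a / e' k t $ a) *s e' k t" by (simp add: e2_def)
        then show ?thesis using b2[OF that] k2 vec.span_add vec.span_scale by metis
      qed (use k2 in simp)
      then have "?V' \<subseteq> ?V" by (intro vec.span_minimal) auto
      ultimately show ?thesis using sp'[OF nz(2)] by blast
    qed
    have "e2 i t $ (c(k := a)) j = (if i = j then 1 else 0)" if "t \<in> S2" "i < r" "j < Suc k" for t i j
    proof -
      have t: "t \<in> S'" "e' k t $ a \<noteq> 0" using that(1) by (auto simp: S2_def)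
      show ?thesis
      proof (cases "j = k")
        case True then show ?thesis using t by (auto simp: e2_def)
      next
        case False
        then have "j < k" using that by simp
        then show ?thesis using c[OF t(1) that(2)] c[OF t(1) k] False by (auto simp: e2_def)
      qed
    qed
    then show ?case using S2 S' hol sp2 by (intro exI[of _ S2] exI[of _ e2] exI[of _ "c(k := a)"]) auto
  qed
  from this[of r] show ?thesis by simp
qed

text \<open>
  The derivative of a normalized frame vector is in the family by assumption, and its normalized
  coordinates are zero because those of the vector are constant.  A vector of the family with zero normalized
  coordinates is zero, so the frame is locally constant.
\<close>

theorem flat_holomorphic_family_constant:
  fixes E :: "'s :: {t2_space, second_countable_topology} \<Rightarrow> (complex ^ 'm) set" and A :: "('s, 'd::finite) chart set"
  assumes A: "complex_atlas A" and conn: "connected (UNIV :: 's set)" and E: "holomorphic_family A E"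
    and flat: "\<And>S f T \<phi> s f' v. open S \<Longrightarrow> holomorphic_map A S f \<Longrightarrow> (\<forall>s\<in>S. f s \<in> E s) \<Longrightarrow> (T, \<phi>) \<in> A \<Longrightarrow>
       s \<in> S \<inter> T \<Longrightarrow> ((f \<circ> inv_into T \<phi>) has_derivative f') (at (\<phi> s)) \<Longrightarrow> f' v \<in> E s"
  shows "E s = E t"
proof (rule connected_local_const[OF conn UNIV_I UNIV_I], intro ballI)
  fix s :: 's
  have "\<exists>S (r::nat) e. open S \<and> s \<in> S \<and> (\<forall>i<r. holomorphic_map A S (e i)) \<and>
        (\<forall>t\<in>S. inj_on (\<lambda>i. e i t) {..<r} \<and> vec.independent ((\<lambda>i. e i t) ` {..<r}) \<and>
               vec.span ((\<lambda>i. e i t) ` {..<r}) = E t)"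
    using E unfolding holomorphic_family_def by (rule spec)
  then obtain S1 and r :: nat and e where S1: "open S1" "s \<in> S1" and h1: "\<forall>i<r. holomorphic_map A S1 (e i)"
      "\<forall>t\<in>S1. inj_on (\<lambda>i. e i t) {..<r} \<and> vec.independent ((\<lambda>i. e i t) ` {..<r}) \<and>
               vec.span ((\<lambda>i. e i t) ` {..<r}) = E t"
    by (elim exE conjE) (rule that; assumption)
  have hol1: "holomorphic_map A S1 (e i)" if "i < r" for i using h1(1) that by blast
  have e1: "inj_on (\<lambda>i. e i t) {..<r} \<and> vec.independent ((\<lambda>i. e i t) ` {..<r}) \<and>
       vec.span ((\<lambda>i. e i t) ` {..<r}) = E t" if "t \<in> S1" for t using h1(2) that by blast
  have "s \<in> (\<Union>(T, \<phi>)\<in>A. T)" unfolding conjunct1[OF A[unfolded complex_atlas_def]] by (rule UNIV_I)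
  then obtain T \<phi> where T: "(T, \<phi>) \<in> A" "s \<in> T" by blast
  note ch = chart_properties[OF A T(1)]
  have dim: "vec.dim (E s) = r"
    using e1[OF S1(2)] by (metis card_image card_lessThan vec.dim_eq_card_independent vec.dim_span)
  have "\<exists>S' e' (c :: nat \<Rightarrow> 'm). open S' \<and> s \<in> S' \<and> S' \<subseteq> S1 \<inter> T \<and> (\<forall>i<r. holomorphic_map A S' (e' i)) \<and>
     (\<forall>t\<in>S'. vec.span ((\<lambda>i. e' i t) ` {..<r}) = E t) \<and>
     (\<forall>t\<in>S'. \<forall>i<r. \<forall>j<r. e' i t $ c j = (if i = j then 1 else (0 :: complex)))"
    by (rule normalized_holomorphic_frame[OF A T(1), of "S1 \<inter> T" s r e])
       (use S1 T ch(1) hol1 e1 dim in \<open>auto intro: holomorphic_map_subset\<close>)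
  then obtain S' e' and c :: "nat \<Rightarrow> 'm" where S0: "open S'" "s \<in> S'" "S' \<subseteq> S1 \<inter> T"
      and a: "\<forall>i<r. holomorphic_map A S' (e' i)" "\<forall>t\<in>S'. vec.span ((\<lambda>i. e' i t) ` {..<r}) = E t"
        "\<forall>t\<in>S'. \<forall>i<r. \<forall>j<r. e' i t $ c j = (if i = j then 1 else (0 :: complex))"
      by (elim exE conjE) (rule that; assumption)
  have S': "open S'" "s \<in> S'" "S' \<subseteq> T" using S0 by auto
  have e': "holomorphic_map A S' (e' i)" if "i < r" for i using a(1) that by blast
  have sp': "vec.span ((\<lambda>i. e' i t) ` {..<r}) = E t" if "t \<in> S'" for t using a(2) that by blast
  have c: "e' i t $ c j = (if i = j then 1 else 0)" if "t \<in> S'" "i < r" "j < r" for t i j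
    using a(3) that by blast
  let ?inv = "inv_into T \<phi>"
  have opS: "open (\<phi> ` S')"
  proof -
    have "openin (top_of_set (\<phi> ` T)) (\<phi> ` T \<inter> ?inv -` S')"
      using ch(4) S'(1) by (rule continuous_openin_preimage_gen)
    moreover have "\<phi> ` T \<inter> ?inv -` S' = \<phi> ` S'" using ch(5) S'(3) by force
    ultimately show ?thesis using ch(2) openin_open_eq by metis
  qed
  have zero: "((e' i \<circ> ?inv) has_derivative (\<lambda>_. 0)) (at x)" if i: "i < r" and x: "x \<in> \<phi> ` S'" for i x
  proof -
    obtain t where t: "t \<in> S'" "x = \<phi> t" using x by blast
    have "complex_differentiable_on (e' i \<circ> ?inv) (\<phi> ` (S' \<inter> T))"
      using e'[OF i] T(1) unfolding holomorphic_map_def by fast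
    then obtain f' where f': "((e' i \<circ> ?inv) has_derivative f') (at x)"
      using x S'(3) unfolding complex_differentiable_on_def by (metis Int_absorb2)
    have "f' v = 0" for v
    proof -
      have "\<forall>t\<in>S'. e' i t \<in> E t" using sp' i by (metis imageI lessThan_iff vec.span_base)
      then have "f' v \<in> E t"
        using flat[OF S'(1) e'[OF i] _ T(1), of t f' v] t S'(3) f' by auto
      then have "f' v \<in> vec.span ((\<lambda>i. e' i t) ` {..<r})" by (simp add: sp'[OF t(1)])
      then obtain u where u: "f' v = (\<Sum>l<r. u l *s e' l t)"
        using span_image_lessThan[of "\<lambda>i. e' i t" r] by blast
      have "f' v $ c j = 0" if "j < r" for j
      proof -
        have "((\<lambda>x. (e' i \<circ> ?inv) x $ c j) has_derivative (\<lambda>v. f' v $ c j)) (at x)"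
          by (rule has_derivative_vec_component[OF f'])
        moreover have "((\<lambda>x. (e' i \<circ> ?inv) x $ c j) has_derivative (\<lambda>_. 0)) (at x)"
        proof (rule has_derivative_transform_within_open[OF has_derivative_const opS x])
          fix z assume "z \<in> \<phi> ` S'"
          then show "(if i = j then 1 else 0) = (e' i \<circ> ?inv) z $ c j"
            using c[OF _ i that] ch(5) S'(3) by auto
        qed
        ultimately show ?thesis using has_derivative_unique by (metis (no_types, lifting))
      qed
      moreover have "f' v $ c j = u j" if "j < r" for j
      proof -
        have "f' v $ c j = (\<Sum>l<r. u l * (e' l t $ c j))" unfolding u by simp
        also have "\<dots> = (\<Sum>l<r. if l = j then u l else 0)"
          by (intro sum.cong refl) (use c[OF t(1) _ that] in simp)
        finally have "f' v $ c j = (\<Sum>l<r. if l = j then u l else 0)" .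
        then show ?thesis using that by simp
      qed
      ultimately show "f' v = 0" unfolding u by simp
    qed
    then show ?thesis using f' by (metis (no_types, lifting) ext)
  qed
  obtain \<epsilon> where eps: "0 < \<epsilon>" "ball (\<phi> s) \<epsilon> \<subseteq> \<phi> ` S'"
    using opS S'(2) open_contains_ball by blast
  define V where "V = T \<inter> \<phi> -` ball (\<phi> s) \<epsilon>"
  have V: "open V" "s \<in> V" using ch(1,3) T(2) eps by (auto simp: V_def intro: continuous_open_preimage)
  have "E s = E t" if t: "t \<in> V" for t
  proof -
    have pt: "\<phi> t \<in> ball (\<phi> s) \<epsilon>" "t \<in> T" using t by (auto simp: V_def)
    then obtain t' where "t' \<in> S'" "\<phi> t = \<phi> t'" using eps(2) by blast
    then have tS: "t \<in> S'" using ch(5) pt S'(3) by (metis subsetD)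
    have "e' i t = e' i s" if i: "i < r" for i
    proof -
      have "(e' i \<circ> ?inv) (\<phi> t) = (e' i \<circ> ?inv) (\<phi> s)"
      proof (rule has_derivative_zero_unique[of "ball (\<phi> s) \<epsilon>"])
        show "((e' i \<circ> ?inv) has_derivative (\<lambda>h. 0)) (at x within ball (\<phi> s) \<epsilon>)" if "x \<in> ball (\<phi> s) \<epsilon>" for x
          using zero[OF i] eps(2) that has_derivative_at_withinI by blast
      qed (use pt eps in auto)
      then show ?thesis using ch(5) pt T(2) by simp
    qed
    then have "(\<lambda>i. e' i t) ` {..<r} = (\<lambda>i. e' i s) ` {..<r}" by auto
    then show ?thesis using sp'[OF tS] sp'[OF S'(2)] by simp
  qed
  then show "\<forall>\<^sub>F t in at s within UNIV. E s = E t"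
    using V unfolding eventually_at_topological by blast
qed

section \<open>Self-duality of the weight filtration\<close>

lemma skew_pow:
  fixes H :: "'a::semiring_1 ^ 'n \<Rightarrow> 'a ^ 'n \<Rightarrow> 'b::comm_ring_1"
  assumes "\<And>u w. H (A *v u) w = - H u (A *v w)"
  shows "H (((*v) A ^^ m) u) w = (-1) ^ m * H u (((*v) A ^^ m) w)"
proof (induction m arbitrary: w)
  case (Suc m)
  have "H (((*v) A ^^ Suc m) u) w = - H (((*v) A ^^ m) u) (A *v w)" by (simp add: assms)
  also have "\<dots> = - ((-1) ^ m * H u (((*v) A ^^ m) (A *v w)))" by (simp only: Suc.IH)
  finally show ?case by (simp add: funpow_swap1)
qed simp

context lefschetz_filtration begin

lemma exact_surjective:
  assumes "w \<in> W l" "l \<le> - int r"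
  shows "\<exists>u. u \<in> W (l + 2 * int r) \<and> ((*v) A ^^ r) u = w"
  using assms
proof (induction "nat (l - l0)" arbitrary: w l)
  case 0
  then have "w = 0" using W_le[of l l0 w] W_bot by auto
  then show ?case using vec.subspace_0[OF W_sub] by (intro exI[of _ 0]) (simp add: Apow_zero)
next
  case (Suc m)
  define s where "s = nat (- l)"
  have s: "l = - int s" "r \<le> s" using Suc.prems(2) by (auto simp: s_def)
  obtain u' where u': "u' \<in> W (int s)" "w - ((*v) A ^^ s) u' \<in> W (- int s - 1)"
    using W_surj[of w s] Suc.prems(1) s(1) by blast
  have "\<exists>u. u \<in> W (l - 1 + 2 * int r) \<and> ((*v) A ^^ r) u = w - ((*v) A ^^ s) u'"
    by (rule Suc.hyps(1)) (use Suc.hyps(2) Suc.prems(2) u'(2) s in auto)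
  then obtain u2 where u2: "u2 \<in> W (l - 1 + 2 * int r)" "((*v) A ^^ r) u2 = w - ((*v) A ^^ s) u'" by blast
  have "int s - 2 * int (s - r) = l + 2 * int r" using s by (simp add: of_nat_diff)
  then have "((*v) A ^^ (s - r)) u' \<in> W (l + 2 * int r)" using W_Apow[OF u'(1), of "s - r"] by simp
  moreover have "u2 \<in> W (l + 2 * int r)" using u2(1) by (rule W_le[rotated]) simp
  ultimately have "((*v) A ^^ (s - r)) u' + u2 \<in> W (l + 2 * int r)" by (rule vec.subspace_add[OF W_sub])
  moreover have "((*v) A ^^ r) (((*v) A ^^ (s - r)) u') = ((*v) A ^^ s) u'"
    using s(2) by (simp flip: funpow_add[THEN fun_cong, unfolded o_def])
  ultimately show ?case using u2(2) by (intro exI[of _ "((*v) A ^^ (s - r)) u' + u2"]) (simp add: Apow_add)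
qed

text \<open>
  A vector of weight at most \<open>- s - 1\<close> is the image under the power \<open>s + 1\<close> of \<open>A\<close> of a vector of weight at most
  \<open>s + 1\<close>.  Moving the power to the other side raises \<open>s\<close> by one, and for large \<open>s\<close> the space is zero.
\<close>

lemma weight_orthogonal:
  assumes H: "hermitian_form H" and skew: "\<And>u w. H (A *v u) w = - H u (A *v w)"
    and u: "u \<in> W l" and w: "w \<in> W l'" and neg: "l + l' < 0"
  shows "H u w = 0"
proof -
  have pos: "H u w = 0" if "u \<in> W (int s)" "w \<in> W (- int s - 1)" for s u w
    using that
  proof (induction "nat (- l0 - int s)" arbitrary: s u w)
    case 0
    then have "w = 0" using W_le[of "- int s - 1" l0 w] W_bot by auto
    then show ?case using hermitian_form_zero[OF H] by simp
  next
    case (Suc m)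
    obtain x where x: "x \<in> W (- int s - 1 + 2 * int (Suc s))" "((*v) A ^^ Suc s) x = w"
      using exact_surjective[OF Suc.prems(2), of "Suc s"] by auto
    have e: "- int s - 1 + 2 * int (Suc s) = int (Suc s)" "int s - 2 * int (Suc s) = - int (Suc s) - 1" by simp_all
    have "H x (((*v) A ^^ Suc s) u) = 0"
    proof (rule Suc.hyps(1))
      show "m = nat (- l0 - int (Suc s))" using Suc.hyps(2) by simp
      show "x \<in> W (int (Suc s))" using x(1) unfolding e .
      show "((*v) A ^^ Suc s) u \<in> W (- int (Suc s) - 1)" using W_Apow[OF Suc.prems(1), of "Suc s"] unfolding e .
    qed
    then have "H w u = 0" unfolding x(2)[symmetric] skew_pow[of H A, OF skew] by simp
    then show ?case using hermitian_formD(3)[OF H, of w u] by simp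
  qed
  have w': "w \<in> W (- l - 1)" using neg by (intro W_le[OF _ w]) simp
  show ?thesis
  proof (cases "0 \<le> l")
    case True
    then show ?thesis using pos[of u "nat l" w] u w' by simp
  next
    case False
    then have "H w u = 0" using pos[of w "nat (- l - 1)" u] u w' by simp
    then show ?thesis using hermitian_formD(3)[OF H, of w u] by simp
  qed
qed

end

section \<open>Variations without consecutive Hodge numbers\<close>

lemma holomorphic_family_dim:
  fixes E :: "'s :: {t2_space, second_countable_topology} \<Rightarrow> (complex ^ 'm::finite) set"
    and A :: "('s, 'd::finite) chart set"
  assumes conn: "connected (UNIV :: 's set)" and E: "holomorphic_family A E"
  shows "vec.dim (E s) = vec.dim (E t)"
proof (rule connected_local_const[OF conn UNIV_I UNIV_I], intro ballI)
  fix s :: 's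
  have "\<exists>S (r::nat) e. open S \<and> s \<in> S \<and> (\<forall>i<r. holomorphic_map A S (e i)) \<and>
        (\<forall>t\<in>S. inj_on (\<lambda>i. e i t) {..<r} \<and> vec.independent ((\<lambda>i. e i t) ` {..<r}) \<and>
               vec.span ((\<lambda>i. e i t) ` {..<r}) = E t)"
    using E unfolding holomorphic_family_def by (rule spec)
  then obtain S and r :: nat and e where S: "open S" "s \<in> S" and e: "\<forall>t\<in>S. inj_on (\<lambda>i. e i t) {..<r} \<and>
      vec.independent ((\<lambda>i. e i t) ` {..<r}) \<and> vec.span ((\<lambda>i. e i t) ` {..<r}) = E t"
    by (elim exE conjE) (rule that; assumption)
  have "vec.dim (E t) = r" if t: "t \<in> S" for t
  proof -
    note et = bspec[OF e t]
    have "vec.dim (E t) = vec.dim (vec.span ((\<lambda>i. e i t) ` {..<r}))" using et by simp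
    also have "\<dots> = card ((\<lambda>i. e i t) ` {..<r})"
      unfolding vec.dim_span by (rule vec.dim_eq_card_independent) (use et in blast)
    finally show ?thesis using et by (simp add: card_image)
  qed
  then show "\<forall>\<^sub>F t in at s within UNIV. vec.dim (E s) = vec.dim (E t)"
    using S unfolding eventually_at_topological by auto
qed

text \<open>
  Constant dimensions carry the coincidence of \<open>F\<^sup>p\<close> with a neighbouring step from one point to all of
  them.  In either case transversality makes \<open>F\<^sup>p\<close> flat.
\<close>

lemma polarized_VHS_constant:
  fixes \<Phi> :: "'s :: {t2_space, second_countable_topology} \<Rightarrow> 'm::finite filtration"
    and A :: "('s, 'd::finite) chart set"
  assumes A: "complex_atlas A" and conn: "connected (UNIV :: 's set)" and VHS: "polarized_VHS A w U q \<Phi>"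
    and gap: "\<And>p. \<Phi> s\<^sub>0 p = \<Phi> s\<^sub>0 (p - 1) \<or> \<Phi> s\<^sub>0 p = \<Phi> s\<^sub>0 (p + 1)"
  shows "\<Phi> s = \<Phi> t"
proof
  fix p
  have hs: "hodge_structure w U (\<Phi> s)" for s
    using VHS unfolding polarized_VHS_def polarized_hodge_structure_def by blast
  have sub: "vec.subspace (\<Phi> s p)" and anti: "p \<le> p' \<Longrightarrow> \<Phi> s p' \<subseteq> \<Phi> s p" for s p p'
    using hs[of s] unfolding hodge_structure_def antimono_def by blast+
  have hol: "holomorphic_family A (\<lambda>s. \<Phi> s p)" for p using VHS unfolding polarized_VHS_def by blast
  have grif: "griffiths_transversal A \<Phi>" using VHS unfolding polarized_VHS_def by blast
  have same: "\<Phi> s p' = \<Phi> s p" if "\<Phi> s\<^sub>0 p' = \<Phi> s\<^sub>0 p" "p \<le> p'" for s p p'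
  proof -
    have "vec.dim (\<Phi> s p') = vec.dim (\<Phi> s p)"
      using holomorphic_family_dim[OF conn hol[of p], of s s\<^sub>0] holomorphic_family_dim[OF conn hol[of p'], of s s\<^sub>0]
      by (simp add: that(1))
    then show ?thesis by (intro vec.subspace_dim_equal sub anti that(2)) simp
  qed
  have "\<exists>p'. (\<forall>s. \<Phi> s p' = \<Phi> s p) \<and> (\<forall>s. \<Phi> s (p' - 1) = \<Phi> s p)"
  proof (cases "\<Phi> s\<^sub>0 p = \<Phi> s\<^sub>0 (p - 1)")
    case True
    have "\<Phi> s p = \<Phi> s (p - 1)" for s by (rule same[OF True]) simp
    from this[symmetric] show ?thesis by (intro exI[of _ p] conjI allI refl)
  next
    case False
    then have "\<Phi> s\<^sub>0 (p + 1) = \<Phi> s\<^sub>0 p" using gap[of p] by (auto simp only:)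
    then have "\<Phi> s (p + 1) = \<Phi> s p" for s by (rule same) simp
    then show ?thesis by (intro exI[of _ "p + 1"]) simp
  qed
  then obtain p' where p': "\<And>s. \<Phi> s p' = \<Phi> s p" "\<And>s. \<Phi> s (p' - 1) = \<Phi> s p" by blast
  show "\<Phi> s p = \<Phi> t p"
  proof (rule flat_holomorphic_family_constant[OF A conn hol])
    fix S f T \<phi> s f' v
    assume h: "open S" "holomorphic_map A S f" "\<forall>s\<in>S. f s \<in> \<Phi> s p" "(T, \<phi>) \<in> A" "s \<in> S \<inter> T"
      "((f \<circ> inv_into T \<phi>) has_derivative f') (at (\<phi> s))"
    have h3: "\<forall>s\<in>S. f s \<in> \<Phi> s p'" using h(3) by (simp add: p')
    have "\<forall>(T, \<phi>)\<in>A. \<forall>s \<in> S \<inter> T. \<forall>f'. ((f \<circ> inv_into T \<phi>) has_derivative f') (at (\<phi> s)) \<longrightarrow> (\<forall>v. f' v \<in> \<Phi> s (p' - 1))"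
      using grif h(1,2) h3 unfolding griffiths_transversal_def by blast
    from bspec[OF this h(4)] have "f' v \<in> \<Phi> s (p' - 1)" using h(5,6) by simp
    then show "f' v \<in> \<Phi> s p" by (simp only: p')
  qed
qed

section \<open>The primitive parts of a limit sent to the closed orbit\<close>

lemma complexify_map_simps [simp]:
  "re_vec (complexify_map f v) = f (re_vec v)" "im_vec (complexify_map f v) = f (im_vec v)"
  by (simp_all add: complexify_map_def re_vec_def im_vec_def vec_eq_iff)

lemma complexify_singleton_0: "complexify {0} = {0}"
  using complex_vec_eqI[of _ 0] by (auto simp: complexify_def)

lemma matrix_pow_complexify:
  "re_vec (((*v) (complexify_matrix N) ^^ m) v) = ((*v) N ^^ m) (re_vec v)"
  "im_vec (((*v) (complexify_matrix N) ^^ m) v) = ((*v) N ^^ m) (im_vec v)"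
  by (induction m) (simp_all add: complexify_matrix_vector)

lemma power_ratio_tendsto_0:
  assumes "m < k"
  shows "((\<lambda>y. a * ((of_real y * \<i>) ^ m / (of_real y * \<i>) ^ k)) \<longlongrightarrow> 0) at_top"
proof -
  have "((\<lambda>y. (of_real y * \<i>) ^ m / (of_real y * \<i>) ^ k) \<longlongrightarrow> 0) at_top"
  proof (rule Lim_null_comparison)
    show "\<forall>\<^sub>F y in at_top. norm ((of_real y * \<i>) ^ m / (of_real y * \<i>) ^ k) \<le> inverse y"
      using eventually_ge_at_top[of 1]
    proof eventually_elim
      fix y :: real assume y: "1 \<le> y"
      have "norm ((of_real y * \<i>) ^ m / (of_real y * \<i>) ^ k) = y ^ m / y ^ k"
        using y by (simp add: norm_divide norm_power norm_mult)
      also have "\<dots> \<le> inverse y"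
        using power_increasing[of "Suc m" k y] assms y by (simp add: field_simps)
      finally show "norm ((of_real y * \<i>) ^ m / (of_real y * \<i>) ^ k) \<le> inverse y" .
    qed
    show "(inverse \<longlongrightarrow> 0) (at_top :: real filter)" by (rule tendsto_inverse_0_at_top[OF filterlim_ident])
  qed
  from tendsto_mult_right_zero[OF this] show ?thesis .
qed

text \<open>
  A nilpotent orbit with limit \<open>L\<close> in the closed orbit.  The numbers \<open>b\<close>, \<open>j\<close>, \<open>l0\<close>, \<open>l1\<close> are witnesses of the
  existential statements in the definitions, and \<open>l0\<close>, \<open>l1\<close> are shifted by \<open>n\<close> to center the weights at zero.
\<close>

locale closed_orbit_limit =
  fixes Q :: "real ^ 'n \<Rightarrow> real ^ 'n \<Rightarrow> real" and n :: nat and F\<^sub>0 F L :: "'n filtration"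
    and \<O> :: "'n filtration set" and N :: "real ^ 'n ^ 'n" and W :: "int \<Rightarrow> (real ^ 'n) set"
    and b :: real and j :: nat and l0 l1 :: int
  assumes base: "polarized_hodge_structure n UNIV Q F\<^sub>0"
    and closed: "closed_real_orbit Q F\<^sub>0 \<O>" and L_orbit: "L \<in> \<O>"
    and limit: "limitin (compact_dual Q F\<^sub>0) (exp_translate N F) L (filtercomap Im at_top)"
    and F_dual: "F \<in> topspace (compact_dual Q F\<^sub>0)" and N_lie: "N \<in> real_lie_algebra Q"
    and N_nil: "matrix_pow N j = 0" "0 < j"
    and orbit: "b < Im z \<Longrightarrow> exp_translate N F z \<in> real_orbit Q F\<^sub>0"
    and F_N: "v \<in> F p \<Longrightarrow> complexify_matrix N *v v \<in> F (p - 1)"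
    and W: "monodromy_weight_filtration N (int n) W" and W_l0: "W (int n + l0) = {0}" and W_l1: "W (int n + l1) = UNIV"
begin

abbreviation "B \<equiv> complexify_form Q"
abbreviation "Nc \<equiv> complexify_matrix N"
abbreviation "Wc \<equiv> (\<lambda>l. complexify (W (int n + l)))"

lemma Q: "bilinear Q" and Q_sym: "\<forall>v w. Q v w = (-1) ^ n * Q w v"
  and Q_nd: "\<forall>v. (\<forall>w. Q v w = 0) \<longrightarrow> v = 0"
  using base unfolding polarized_hodge_structure_def by blast+

lemmas B_simps = complexify_form_simps[OF Q]

lemma base_flag: "isotropic_flag n Q F\<^sub>0" by (rule isotropic_flag_hodge_structure[OF base])

lemma dual_flag: "E \<in> topspace (compact_dual Q F\<^sub>0) \<Longrightarrow> isotropic_flag n Q E"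
  unfolding topspace_compact_dual complex_orbit_def
  using isotropic_flag_act[OF Q Q_nd complex_group_isometry base_flag] by blast

lemma F_flag: "isotropic_flag n Q F" by (rule dual_flag[OF F_dual])

lemma L_flag: "isotropic_flag n Q L"
  using limit dual_flag by (simp add: limitin_def)

lemma N_skew: "Q (N *v v) w = - Q v (N *v w)"
  using N_lie by (simp add: real_lie_algebra_def add_eq_0_iff)

lemma B_skew: "B (Nc *v u) w = - B u (Nc *v w)"
  by (simp add: complexify_form_def complexify_matrix_vector N_skew complex_eq_iff)

lemma Nc_nil: "((*v) Nc ^^ j) u = 0"
proof (rule complex_vec_eqI)
  have "((*v) N ^^ j) x = 0" for x using N_nil(1) matrix_pow_vector[of N j x] by simp
  then show "re_vec (((*v) Nc ^^ j) u) = re_vec 0" "im_vec (((*v) Nc ^^ j) u) = im_vec 0"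
    by (simp_all add: matrix_pow_complexify)
qed

lemma matrix_pow_Nc: "matrix_pow Nc j = 0"
  by (rule matrix_eqI_vector) (simp add: matrix_pow_vector Nc_nil)

lemma exp_translate_eq: "exp_translate N F z p = nilexp Nc j z ` F p"
  by (simp add: exp_translate_def act_def matrix_exp_vector[OF matrix_pow_Nc])

lemma W_props:
  "subspace (W l)" "mono W" "v \<in> W l \<Longrightarrow> N *v v \<in> W (l - 2)"
  "v \<in> W (int n + int r) \<Longrightarrow> ((*v) N ^^ r) v \<in> W (int n + (- int r - 1)) \<Longrightarrow> v \<in> W (int n + (int r - 1))"
  "v \<in> W (int n + (- int r)) \<Longrightarrow> \<exists>u\<in>W (int n + int r). v - ((*v) N ^^ r) u \<in> W (int n + (- int r - 1))"
proof -
  have e: "int n + (- int r - 1) = int n - int r - 1" "int n + (int r - 1) = int n + int r - 1"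
    "int n + (- int r) = int n - int r" for r by simp_all
  show "subspace (W l)" "mono W" "v \<in> W l \<Longrightarrow> N *v v \<in> W (l - 2)"
    "v \<in> W (int n + int r) \<Longrightarrow> ((*v) N ^^ r) v \<in> W (int n + (- int r - 1)) \<Longrightarrow> v \<in> W (int n + (int r - 1))"
    "v \<in> W (int n + (- int r)) \<Longrightarrow> \<exists>u\<in>W (int n + int r). v - ((*v) N ^^ r) u \<in> W (int n + (- int r - 1))"
    unfolding e using W unfolding monodromy_weight_filtration_def matrix_pow_vector by blast+
qed

sublocale weight: lefschetz_filtration Nc Wc l0 l1
proof
  show "vec.subspace (Wc l)" for l by (rule subspace_complexify[OF W_props(1)])
  show "mono Wc"
  proof (rule monoI)
    fix l l' :: int assume "l \<le> l'"
    then have "W (int n + l) \<subseteq> W (int n + l')" by (intro monoD[OF W_props(2)]) simp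
    then show "Wc l \<subseteq> Wc l'" by (auto simp: complexify_def)
  qed
  show "Wc l0 = {0}" by (simp add: W_l0 complexify_singleton_0)
  show "Wc l1 = UNIV" by (simp add: W_l1)
  show "Nc *v u \<in> Wc (l - 2)" if "u \<in> Wc l" for u l
    using that W_props(3)[of _ "int n + l"] by (simp add: complexify_def complexify_matrix_vector add_diff_eq)
  show "u \<in> Wc (int r - 1)" if "u \<in> Wc (int r)" "((*v) Nc ^^ r) u \<in> Wc (- int r - 1)" for u r
    using that W_props(4)[of _ r] unfolding complexify_def mem_Collect_eq matrix_pow_complexify by blast
  show "\<exists>u\<in>Wc (int r). w - ((*v) Nc ^^ r) u \<in> Wc (- int r - 1)" if "w \<in> Wc (- int r)" for w r
  proof -
    have w: "re_vec w \<in> W (int n + (- int r))" "im_vec w \<in> W (int n + (- int r))"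
      using that unfolding complexify_def by blast+
    obtain x where x: "x \<in> W (int n + int r)" "re_vec w - ((*v) N ^^ r) x \<in> W (int n + (- int r - 1))"
      using W_props(5)[OF w(1)] by blast
    obtain y where y: "y \<in> W (int n + int r)" "im_vec w - ((*v) N ^^ r) y \<in> W (int n + (- int r - 1))"
      using W_props(5)[OF w(2)] by blast
    let ?u = "of_real_vec x + \<i> *s of_real_vec y"
    have u: "re_vec ?u = x" "im_vec ?u = y" by simp_all
    show ?thesis
    proof (rule bexI[of _ ?u])
      show "w - ((*v) Nc ^^ r) ?u \<in> Wc (- int r - 1)"
        unfolding complexify_def mem_Collect_eq re_vec_simps(2) im_vec_simps(2) matrix_pow_complexify u using x y by blast
      show "?u \<in> Wc (int r)" unfolding complexify_def mem_Collect_eq u using x y by blast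
    qed
  qed
qed

abbreviation "H \<equiv> hermitian_extension n Q"

lemma H_herm: "hermitian_form H" by (rule hermitian_extension_hermitian[OF Q Q_sym])

lemma H_skew: "H (Nc *v u) w = - H u (Nc *v w)"
  by (simp add: hermitian_extension_def B_skew complexify_matrix_cnj)

lemma nilexp_inj: "nilexp Nc j (of_real t * \<i>) u = 0 \<Longrightarrow> u = 0"
  using nilexp_inverse[where A = Nc and k = j and t = t and c = "- \<i>" and u = u, OF Nc_nil N_nil(2)] nilexp_scale[of Nc j _ 0 0] by simp

sublocale polarized: polarized_nilpotent Nc Wc l0 l1 H F n b j
proof
  show "hermitian_form H" by (rule H_herm)
  show "H (Nc *v u) w = - H u (Nc *v w)" for u w by (rule H_skew)
  show "((*v) Nc ^^ j) u = 0" for u by (rule Nc_nil)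
  show "vec.subspace (F p)" for p using F_flag by (simp add: isotropic_flag_def)
  show "antimono F" using F_flag by (simp add: isotropic_flag_def)
  show "F 0 = UNIV" using F_flag by (simp add: isotropic_flag_def)
  show "F (int n + 1) = {0}" using F_flag by (simp add: isotropic_flag_def)
  show "u \<in> F p \<Longrightarrow> Nc *v u \<in> F (p - 1)" for u p by (rule F_N)
  show "H u w = 0" if "u \<in> Wc l" "w \<in> Wc l'" "l + l' < 0" for u w l l'
    by (rule weight.weight_orthogonal[OF H_herm H_skew that])
  fix t u p
  assume t: "b < t" and u: "u \<in> F p" "u \<noteq> 0"
    and orth: "\<And>w. w \<in> F (p + 1) \<Longrightarrow> H (nilexp Nc j (of_real t * \<i>) u) (nilexp Nc j (of_real t * \<i>) w) = 0"
  let ?T = "exp_translate N F (of_real t * \<i>)"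
  have "?T \<in> real_orbit Q F\<^sub>0" using t by (intro orbit) simp
  then obtain g where g: "g \<in> real_group Q" "?T = act (complexify_matrix g) F\<^sub>0" by (auto simp: real_orbit_def)
  show "0 < (if even p then 1 else -1) * Re (H (nilexp Nc j (of_real t * \<i>) u) (nilexp Nc j (of_real t * \<i>) u))"
  proof (rule period_point_sign[OF base real_group_isometry[OF g(1)] g(2)])
    show "nilexp Nc j (of_real t * \<i>) u \<in> ?T p" using u by (simp add: exp_translate_eq)
    show "nilexp Nc j (of_real t * \<i>) u \<noteq> 0" using nilexp_inj u(2) by blast
    show "H (nilexp Nc j (of_real t * \<i>) u) w = 0" if "w \<in> ?T (p + 1)" for w
      using that orth by (auto simp: exp_translate_eq)
  qed
qed

lemma Apow_F: "v \<in> F p \<Longrightarrow> ((*v) Nc ^^ m) v \<in> F (p - int m)"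
proof (induction m)
  case (Suc m)
  then have "Nc *v (((*v) Nc ^^ m) v) \<in> F (p - int m - 1)" by (intro F_N) simp
  then show ?case by (simp add: algebra_simps)
qed simp

lemma Apow_eq_0: "((*v) Nc ^^ Suc k) v = 0 \<Longrightarrow> k < m \<Longrightarrow> ((*v) Nc ^^ m) v = 0"
proof -
  assume v: "((*v) Nc ^^ Suc k) v = 0" and m: "k < m"
  have "((*v) Nc ^^ m) v = ((*v) Nc ^^ (m - Suc k)) (((*v) Nc ^^ Suc k) v)"
    using m by (simp del: funpow.simps flip: funpow_add[THEN fun_cong, unfolded o_def])
  then show ?thesis by (simp only: v weight.Apow_zero)
qed

lemma L_sub: "vec.subspace (L p)" using L_flag by (simp add: isotropic_flag_def)

text \<open>
  Divided by \<open>z\<^sup>k / k!\<close>, the vector \<open>e\<^sup>z\<^sup>N v\<close> tends to its leading term.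
\<close>

lemma leading_term_in_limit:
  assumes v: "v \<in> F p" and k: "((*v) Nc ^^ Suc k) v = 0"
  shows "((*v) Nc ^^ k) v \<in> L p"
proof (cases "k < j")
  case False
  then have "((*v) Nc ^^ k) v = 0"
    using Nc_nil[of "((*v) Nc ^^ (k - j)) v"] by (simp flip: funpow_add[THEN fun_cong, unfolded o_def])
  then show ?thesis using vec.subspace_0[OF L_sub] by simp
next
  case True
  define w where "w y = (fact k / (of_real y * \<i>) ^ k) *s nilexp Nc j (of_real y * \<i>) v" for y :: real
  have "w y \<in> exp_translate N F (of_real y * \<i>) p" for y
  proof -
    have "w y = nilexp Nc j (of_real y * \<i>) ((fact k / (of_real y * \<i>) ^ k) *s v)" by (simp add: w_def nilexp_scale)
    then show ?thesis using v polarized.F_sub[of p] by (simp add: exp_translate_eq vec.subspace_scale)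
  qed
  moreover have "(w \<longlongrightarrow> (\<Sum>m<j. (if m = k then ((*v) Nc ^^ k) v else 0))) at_top"
  proof -
    have w_eq: "w = (\<lambda>y. \<Sum>m<j. ((fact k / fact m) * ((of_real y * \<i>) ^ m / (of_real y * \<i>) ^ k)) *s ((*v) Nc ^^ m) v)"
      by (rule ext) (simp add: w_def nilexp_def vec.scale_sum_right vector_smult_assoc field_simps)
    have "((\<lambda>y. ((fact k / fact m) * ((of_real y * \<i>) ^ m / (of_real y * \<i>) ^ k)) *s ((*v) Nc ^^ m) v)
        \<longlongrightarrow> (if m = k then ((*v) Nc ^^ k) v else 0)) at_top" for m
    proof -
      consider "m < k" | "m = k" | "k < m" by linarith
      then show ?thesis
      proof cases
        case 1
        from bounded_bilinear.tendsto[OF bounded_bilinear_scale power_ratio_tendsto_0[OF 1, of "fact k / fact m"]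
            tendsto_const[of "((*v) Nc ^^ m) v"]]
        show ?thesis using 1 by simp
      next
        case 2
        have "\<forall>\<^sub>F y in at_top. ((*v) Nc ^^ k) v = ((fact k / fact m) * ((of_real y * \<i>) ^ m / (of_real y * \<i>) ^ k)) *s ((*v) Nc ^^ m) v"
          using eventually_gt_at_top[of "0::real"] by eventually_elim (simp add: 2)
        then show ?thesis using 2 by (simp add: tendsto_eventually eventually_mono)
      next
        case 3
        then show ?thesis using Apow_eq_0[OF k 3] by simp
      qed
    qed
    then show ?thesis unfolding w_eq by (intro tendsto_sum)
  qed
  moreover have "(\<Sum>m<j. (if m = k then ((*v) Nc ^^ k) v else 0)) = ((*v) Nc ^^ k) v" using True by simp
  ultimately show ?thesis
    using limit_vector_in_limit_flag[OF Q Q_nd base_flag limit, of w p "((*v) Nc ^^ k) v"] by simp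
qed

text \<open>
  The constant vector \<open>v\<close> is \<open>e\<^sup>z\<^sup>N\<close> applied to \<open>e\<^sup>-\<^sup>z\<^sup>N v\<close>, which is in step \<open>p - k\<close> of \<open>F\<close>.
\<close>

lemma shifted_in_limit:
  assumes v: "v \<in> F p" and k: "((*v) Nc ^^ Suc k) v = 0"
  shows "v \<in> L (p - int k)"
proof (rule limit_vector_in_limit_flag[OF Q Q_nd base_flag limit always_eventually tendsto_const], rule allI)
  fix y :: real
  have mem: "((*v) Nc ^^ m) v \<in> F (p - int k)" for m
  proof (cases "m \<le> k")
    case True
    then have "F (p - int m) \<subseteq> F (p - int k)" by (intro antimonoD[OF polarized.F_anti]) simp
    then show ?thesis using Apow_F[OF v] by blast
  next
    case False
    then show ?thesis using Apow_eq_0[OF k, of m] vec.subspace_0[OF polarized.F_sub] by simp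
  qed
  have "nilexp Nc j (- of_real y * \<i>) v \<in> F (p - int k)"
    unfolding nilexp_def by (intro vec.subspace_sum vec.subspace_scale polarized.F_sub mem)
  then have "nilexp Nc j (of_real y * \<i>) (nilexp Nc j (- of_real y * \<i>) v) \<in> exp_translate N F (of_real y * \<i>) (p - int k)"
    unfolding exp_translate_eq by (rule imageI)
  then show "v \<in> exp_translate N F (of_real y * \<i>) (p - int k)"
    by (simp only: nilexp_inverse[OF Nc_nil N_nil(2)])
qed

end

locale closed_orbit_primitive = closed_orbit_limit Q n F\<^sub>0 F L \<O> N W b j l0 l1
  for Q :: "real ^ 'n \<Rightarrow> real ^ 'n \<Rightarrow> real" and n F\<^sub>0 F L \<O> N W b j l0 l1 +
  fixes k :: nat and U :: "(real ^ 'm) set" and \<pi> :: "real ^ 'n \<Rightarrow> real ^ 'm" and \<epsilon> :: real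
    and q :: "real ^ 'm \<Rightarrow> real ^ 'm \<Rightarrow> real"
  assumes quotient: "primitive_quotient N n W k U \<pi>" and \<epsilon>: "\<epsilon> \<in> {1, -1}"
    and form: "primitive_form Q N n W k \<pi> \<epsilon> q"
    and induced: "polarized_hodge_structure (n + k) U q (induced_filtration N n W k \<pi> F)"
begin

abbreviation "P \<equiv> primitive_lifts N n W k"
abbreviation "G \<equiv> induced_filtration N n W k \<pi> F"
abbreviation "\<pi>c \<equiv> complexify_map \<pi>"

lemma pi_linear: "linear \<pi>" using quotient by (simp add: primitive_quotient_def)

lemma pic_simps: "\<pi>c (u - v) = \<pi>c u - \<pi>c v" "\<pi>c (cnj_vec v) = cnj_vec (\<pi>c v)"
  by (rule complex_vec_eqI; simp add: linear_diff[OF pi_linear] linear_neg[OF pi_linear])+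

lemma P_iff: "v \<in> P \<longleftrightarrow> v \<in> W (int n + int k) \<and> ((*v) N ^^ Suc k) v \<in> W (int n + (- int k - 3))"
proof -
  have e: "int n + (- int k - 3) = int n - int k - 3" by simp
  show ?thesis unfolding e by (simp add: primitive_lifts_def matrix_pow_vector del: funpow.simps)
qed

lemma P_complexify_iff: "v \<in> complexify P \<longleftrightarrow> v \<in> Wc (int k) \<and> ((*v) Nc ^^ Suc k) v \<in> Wc (- int k - 3)"
  unfolding complexify_def mem_Collect_eq P_iff matrix_pow_complexify by blast

lemma P_subspace: "vec.subspace (complexify P)"
  unfolding vec.subspace_def P_complexify_iff Ball_def weight.Apow_add weight.Apow_scale weight.Apow_zero
  using weight.W_sub[of "int k"] weight.W_sub[of "- int k - 3"] unfolding vec.subspace_def by blast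

lemma P_cnj: "v \<in> complexify P \<Longrightarrow> cnj_vec v \<in> complexify P"
proof -
  assume v: "v \<in> complexify P"
  have "((*v) Nc ^^ m) (cnj_vec v) = cnj_vec (((*v) Nc ^^ m) v)" for m
    by (induction m) (simp_all add: complexify_matrix_cnj)
  then show ?thesis using v cnj_vec_complexify[OF _ W_props(1)] unfolding P_complexify_iff by metis
qed

lemma form_complexified:
  assumes "v \<in> complexify P" "w \<in> complexify P"
  shows "complexify_form q (\<pi>c v) (\<pi>c w) = of_real \<epsilon> * B v (((*v) Nc ^^ k) w)"
proof -
  have "q (\<pi> x) (\<pi> y) = \<epsilon> * Q x (((*v) N ^^ k) y)" if "x \<in> P" "y \<in> P" for x y
    using form that by (simp add: primitive_form_def matrix_pow_vector)
  then show ?thesis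
    using assms by (simp add: complexify_form_def matrix_pow_complexify complexify_def[of P] complex_eq_iff right_diff_distrib distrib_left)
qed

text \<open>
  By strictness, the image of a lift under the power \<open>k + 1\<close> of \<open>N\<close>, which has weight at most \<open>- k - 3\<close>, is also the
  image of a vector of \<open>F p\<close> of weight at most \<open>k - 1\<close>.  Subtracting it does not change the class.
\<close>

lemma exact_primitive_lift:
  assumes "\<gamma> \<in> G p"
  shows "\<exists>v. v \<in> F p \<and> v \<in> complexify P \<and> ((*v) Nc ^^ Suc k) v = 0 \<and> \<pi>c v = \<gamma>"
proof -
  obtain \<alpha> where \<alpha>: "\<alpha> \<in> F p" "\<alpha> \<in> complexify P" "\<gamma> = \<pi>c \<alpha>" using assms by (auto simp: induced_filtration_def)
  let ?x = "((*v) Nc ^^ Suc k) \<alpha>"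
  have e: "(int k - 1) - 2 * int (Suc k) = - int k - 3" by simp
  have "\<exists>u. u \<in> F p \<and> u \<in> Wc (int k - 1) \<and> ((*v) Nc ^^ Suc k) u = ?x"
  proof (rule polarized.exact_lift)
    show "?x \<in> F (p - int (Suc k))" by (rule Apow_F[OF \<alpha>(1)])
    show "?x \<in> Wc ((int k - 1) - 2 * int (Suc k))" unfolding e using \<alpha>(2) unfolding P_complexify_iff by blast
  qed simp
  then obtain u where u: "u \<in> F p" "u \<in> Wc (int k - 1)" "((*v) Nc ^^ Suc k) u = ?x" by blast
  have "u \<in> Wc (int k)" using u(2) by (rule weight.W_le[rotated]) simp
  then have uP: "u \<in> complexify P" using u(3) \<alpha>(2) unfolding P_complexify_iff by metis
  have "\<pi> x = 0" if "x \<in> P" "x \<in> W (int n + (int k - 1))" for x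
    using quotient that by (simp add: primitive_quotient_def add_diff_eq)
  then have "\<pi>c u = 0" using u(2) uP by (intro complex_vec_eqI) (simp_all add: complexify_def)
  then have "\<pi>c (\<alpha> - u) = \<gamma>" by (simp add: pic_simps \<alpha>(3))
  moreover have "((*v) Nc ^^ Suc k) (\<alpha> - u) = 0" by (simp only: weight.Apow_diff u(3) diff_self)
  moreover have "\<alpha> - u \<in> F p" by (rule vec.subspace_diff[OF polarized.F_sub \<alpha>(1) u(1)])
  moreover have "\<alpha> - u \<in> complexify P" by (rule vec.subspace_diff[OF P_subspace \<alpha>(2) uP])
  ultimately show ?thesis by blast
qed

text \<open>
  The closed orbit enters here.  For \<open>k \<ge> 1\<close> the vector \<open>y\<close> below is isotropic since the power \<open>2 k\<close> of \<open>N\<close> kills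
  the lift, for odd \<open>n\<close> because the form is alternating, and in the remaining case by hypothesis.
\<close>

lemma isotropic_conjugate:
  assumes \<gamma>: "\<gamma> \<in> G c" and iso: "1 \<le> k \<or> odd n \<or> q (re_vec \<gamma>) (re_vec \<gamma>) = 0"
  shows "cnj_vec \<gamma> \<in> G c"
proof -
  obtain v where v: "v \<in> F c" "v \<in> complexify P" "((*v) Nc ^^ Suc k) v = 0" "\<pi>c v = \<gamma>"
    using exact_primitive_lift[OF \<gamma>] by blast
  let ?\<eta> = "((*v) Nc ^^ k) v" and ?x = "re_vec v"
  define y where "y = ((*v) N ^^ k) (?x + ?x)"
  have y_twice: "y = ((*v) N ^^ k) ?x + ((*v) N ^^ k) ?x"
  proof -
    have "((*v) N ^^ m) (x + x') = ((*v) N ^^ m) x + ((*v) N ^^ m) x'" for m x x'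
      by (induction m) (simp_all add: matrix_vector_right_distrib)
    then show ?thesis by (simp only: y_def)
  qed
  have y_eq: "of_real_vec y = ?\<eta> + cnj_vec ?\<eta>"
    by (rule complex_vec_eqI) (simp_all only: y_twice re_vec_simps im_vec_simps matrix_pow_complexify add.right_inverse)
  have x_nil: "((*v) N ^^ Suc k) ?x = 0"
    using v(3) matrix_pow_complexify(1)[where N = N and m = "Suc k" and v = v] by (simp del: funpow.simps)
  have pos: "Q (((*v) N ^^ k) ?x) (((*v) N ^^ k) ?x) = 0" if k: "1 \<le> k"
  proof -
    obtain i where i: "k = Suc i" using k by (cases k) auto
    have pow0: "((*v) N ^^ m) (((*v) N ^^ Suc k) ?x) = 0" for m unfolding x_nil by (induction m) simp_all
    have "((*v) N ^^ k) (((*v) N ^^ k) ?x) = ((*v) N ^^ i) (((*v) N ^^ Suc k) ?x)"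
      unfolding funpow_add[THEN fun_cong, unfolded o_def, symmetric] by (simp only: i add_Suc add_Suc_right)
    then have z: "((*v) N ^^ k) (((*v) N ^^ k) ?x) = 0" by (simp only: pow0)
    show ?thesis unfolding skew_pow[of Q N, OF N_skew] by (simp only: z bilinear_rzero[OF Q] mult_zero_right)
  qed
  have "Q (((*v) N ^^ k) ?x) (((*v) N ^^ k) ?x) = 0"
  proof (cases "1 \<le> k")
    case True
    then show ?thesis by (rule pos)
  next
    case False
    then have k: "k = 0" by simp
    show ?thesis
    proof (cases "odd n")
      case True
      have "Q ?x ?x = 0"
        using Q_sym[rule_format, of ?x ?x] unfolding neg_one_odd_power[OF True] by linarith
      then show ?thesis by (simp add: k)
    next
      case even: False
      have "?x \<in> P" using v(2) by (simp add: complexify_def)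
      then have "q (\<pi> ?x) (\<pi> ?x) = \<epsilon> * Q ?x (((*v) N ^^ k) ?x)"
        using form by (simp add: primitive_form_def matrix_pow_vector)
      moreover have "\<pi> ?x = re_vec \<gamma>" using v(4) complexify_map_simps(1)[of \<pi> v] by simp
      ultimately show ?thesis using iso even \<epsilon> k by auto
    qed
  qed
  then have "Q y y = 0" by (simp only: y_twice bilinear_ladd[OF Q] bilinear_radd[OF Q] add_0)
  moreover have \<eta>L: "?\<eta> \<in> L c" by (rule leading_term_in_limit[OF v(1,3)])
  ultimately have "of_real_vec y \<in> L c"
    using closed_orbit_isotropic_vector[OF Q Q_sym Q_nd base_flag closed L_orbit _ y_eq] by blast
  then have cL: "cnj_vec ?\<eta> \<in> L c" using vec.subspace_diff[OF L_sub _ \<eta>L] unfolding y_eq by fastforce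
  have cP: "cnj_vec v \<in> complexify P" by (rule P_cnj[OF v(2)])
  have pow_cnj: "((*v) Nc ^^ m) (cnj_vec v) = cnj_vec (((*v) Nc ^^ m) v)" for m
    by (induction m) (simp_all add: complexify_matrix_cnj)
  have "complexify_form q (cnj_vec \<gamma>) \<delta> = 0" if \<delta>: "\<delta> \<in> G (int (n + k) + 1 - c)" for \<delta>
  proof -
    obtain d where d: "d \<in> F (int (n + k) + 1 - c)" "d \<in> complexify P" "((*v) Nc ^^ Suc k) d = 0" "\<pi>c d = \<delta>"
      using exact_primitive_lift[OF \<delta>] by blast
    have "d \<in> L (int (n + k) + 1 - c - int k)" by (rule shifted_in_limit[OF d(1,3)])
    then have dL: "d \<in> L (int n + 1 - c)" by (simp add: algebra_simps)
    have "B d (cnj_vec ?\<eta>) = 0" using L_flag dL cL unfolding isotropic_flag_def by blast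
    moreover have "B (cnj_vec ?\<eta>) d = (-1) ^ n * B d (cnj_vec ?\<eta>)"
      by (rule complexify_form_sym[of UNIV]) (use Q_sym in blast, simp_all)
    ultimately have "B (((*v) Nc ^^ k) (cnj_vec v)) d = 0" by (simp add: pow_cnj)
    then have "B (cnj_vec v) (((*v) Nc ^^ k) d) = 0" unfolding skew_pow[of B Nc, OF B_skew] by simp
    then show ?thesis using form_complexified[OF cP d(2)] by (simp add: pic_simps v(4) d(4))
  qed
  moreover have "cnj_vec \<gamma> \<in> complexify U"
  proof -
    have U: "\<pi> x \<in> U" if "x \<in> P" for x using quotient that by (auto simp: primitive_quotient_def)
    have "cnj_vec \<gamma> = \<pi>c (cnj_vec v)" by (simp add: pic_simps v(4))
    then show ?thesis using cP U by (simp add: complexify_def)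
  qed
  ultimately have "cnj_vec \<gamma> \<in> G (int (n + k) + 1 - (int (n + k) + 1 - c))"
    using polarized_hodge_structure_perp[OF induced, of "cnj_vec \<gamma>" "int (n + k) + 1 - c"] by blast
  then show ?thesis by simp
qed

end

context closed_orbit_primitive begin

lemma G_props:
  "vec.subspace (G p)" "p \<le> p' \<Longrightarrow> G p' \<subseteq> G p" "G p \<subseteq> complexify U"
  "v \<in> complexify U \<Longrightarrow> \<exists>x y. x \<in> G p \<and> cnj_vec y \<in> G (int (n + k) - p + 1) \<and> v = x + y"
  "v \<in> G p \<Longrightarrow> cnj_vec v \<in> G (int (n + k) - p + 1) \<Longrightarrow> v = 0"
proof -
  have hs: "hodge_structure (n + k) U G" using induced unfolding polarized_hodge_structure_def by blast
  have sub: "vec.subspace (G p)" for p using hs unfolding hodge_structure_def by blast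
  have sums: "{a + b | a b. a \<in> G p \<and> b \<in> cnj_vec ` G (int (n + k) - p + 1)} = complexify U" for p
    using hs unfolding hodge_structure_def by blast
  show "vec.subspace (G p)" by (rule sub)
  show "p \<le> p' \<Longrightarrow> G p' \<subseteq> G p" using hs unfolding hodge_structure_def antimono_def by blast
  have "x + 0 \<in> complexify U" if "x \<in> G p" for x
    using that sums[of p] vec.subspace_0[OF subspace_cnj_vec_image[OF sub]] by blast
  then show "G p \<subseteq> complexify U" by auto
  show "\<exists>x y. x \<in> G p \<and> cnj_vec y \<in> G (int (n + k) - p + 1) \<and> v = x + y" if "v \<in> complexify U"
    using that unfolding sums[of p, symmetric] by (fastforce simp: cnj_vec_image_iff)
  show "v = 0" if "v \<in> G p" "cnj_vec v \<in> G (int (n + k) - p + 1)"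
    using hs that unfolding hodge_structure_def cnj_vec_image_iff[symmetric] by blast
qed

lemma hodge_vector:
  assumes "G p \<noteq> G (p + 1)"
  shows "\<exists>e. e \<noteq> 0 \<and> e \<in> G p \<and> cnj_vec e \<in> G (int (n + k) - p)"
proof -
  obtain v where v: "v \<in> G p" "v \<notin> G (p + 1)" using assms G_props(2)[of p "p + 1"] by auto
  then obtain x y where xy: "x \<in> G (p + 1)" "cnj_vec y \<in> G (int (n + k) - (p + 1) + 1)" "v = x + y"
    using G_props(4)[of v "p + 1"] G_props(3) by blast
  have "x \<in> G p" using xy(1) G_props(2)[of p "p + 1"] by auto
  then have "v - x \<in> G p" by (rule vec.subspace_diff[OF G_props(1) v(1)])
  moreover have "cnj_vec y \<in> G (int (n + k) - p)"
  proof -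
    have "int (n + k) - (p + 1) + 1 = int (n + k) - p" by simp
    with xy(2) show ?thesis by (simp only:)
  qed
  ultimately show ?thesis using xy(1,3) v(2) by (intro exI[of _ y]) auto
qed

text \<open>
  Complementary steps that are stable under conjugation are nested and intersect in zero, so one of them is zero and
  the other one is everything.
\<close>

lemma conjugation_stable_gap:
  assumes stable: "\<And>c \<gamma>. \<gamma> \<in> G c \<Longrightarrow> cnj_vec \<gamma> \<in> G c"
  shows "G p = G (p - 1) \<or> G p = G (p + 1)"
proof -
  have zero: "G c \<subseteq> {0}" if "int (n + k) - c + 1 \<le> c" for c
    using G_props(5) stable G_props(2)[OF that] by blast
  have zero': "G c = {0}" if "G c \<subseteq> {0}" for c using that vec.subspace_0[OF G_props(1)] by blast
  show ?thesis
  proof (cases "int (n + k) - p + 1 \<le> p")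
    case True
    then show ?thesis using zero'[OF zero[of p]] zero'[OF zero[of "p + 1"]] by simp
  next
    case False
    have "complexify U \<subseteq> G p"
    proof
      fix v assume "v \<in> complexify U"
      then obtain x y where xy: "x \<in> G p" "cnj_vec y \<in> G (int (n + k) - p + 1)" "v = x + y" using G_props(4) by blast
      have "cnj_vec y = 0" using zero[of "int (n + k) - p + 1"] xy(2) False by auto
      then have "y = 0" using cnj_vec_simps(6)[of y] by simp
      then show "v \<in> G p" using xy by simp
    qed
    then show ?thesis using G_props(2)[of "p - 1" p] G_props(3)[of "p - 1"] by auto
  qed
qed

text \<open>
  Let \<open>e\<close> and \<open>f\<close> be nonzero of Hodge degrees \<open>p\<close> and \<open>p - 1\<close>.  The form has opposite signs on them, so
  some \<open>\<gamma> = e + y f\<close> has isotropic real part.  Then the conjugate of \<open>\<gamma>\<close> is in step \<open>p - 1\<close>, which pairs to zero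
  with \<open>e\<close> since \<open>p\<close> is in the upper half; but this pairing is the nonzero norm of \<open>e\<close>.
\<close>

lemma even_weight_no_upper_jump:
  assumes k: "k = 0" and n: "even n" and p: "int n + 2 \<le> 2 * p"
    and jump: "G p \<noteq> G (p + 1)" "G (p - 1) \<noteq> G p"
  shows False
proof -
  let ?q = "complexify_form q"
  have q: "bilinear q" using induced unfolding polarized_hodge_structure_def by blast
  note q_simps = complexify_form_simps[OF q]
  have q_sym: "?q u v = ?q v u" if "u \<in> complexify U" "v \<in> complexify U" for u v
  proof -
    have "\<forall>v\<in>U. \<forall>w\<in>U. q v w = (- 1) ^ (n + k) * q w v" using induced unfolding polarized_hodge_structure_def by blast
    from complexify_form_sym[OF this that] show ?thesis using n k by simp
  qed
  have iso: "?q u v = 0" if "u \<in> G c" "v \<in> G d" "int n + 1 \<le> c + d" for u v c d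
  proof -
    have "v \<in> G (int (n + k) - c + 1)" using that(2) G_props(2)[of "int (n + k) - c + 1" d] that(3) k by auto
    then show ?thesis using induced that(1) unfolding polarized_hodge_structure_def by blast
  qed
  obtain e where e: "e \<noteq> 0" "e \<in> G p" "cnj_vec e \<in> G (int n - p)" using hodge_vector[OF jump(1)] k by auto
  obtain f0 where f0: "f0 \<noteq> 0" "f0 \<in> G (p - 1)" "cnj_vec f0 \<in> G (int n - (p - 1))"
    using hodge_vector[of "p - 1"] jump(2) k by auto
  define \<sigma> :: real where "\<sigma> = (-1) ^ (n div 2)"
  have \<sigma>: "(- \<i>) ^ n = of_real \<sigma>"
  proof -
    have "(- \<i>) ^ n = ((- \<i>)\<^sup>2) ^ (n div 2)" using n by (simp flip: power_mult)
    then show ?thesis by (simp add: \<sigma>_def)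
  qed
  have sign: "0 < (if even c then 1 else -1) * (\<sigma> * Re (?q v (cnj_vec v)))"
    if v: "v \<noteq> 0" "v \<in> G c" "cnj_vec v \<in> G (int n - c)" for v c
  proof -
    have "0 < (if even c then 1 else -1) * Re (hermitian_extension (n + k) q v v)"
      using v G_props(3) k by (intro hodge_space_sign[OF induced]) (auto simp: hodge_space_def cnj_vec_image_iff)
    then show ?thesis using k by (simp add: hermitian_extension_def \<sigma>)
  qed
  (* In the middle degree f need not be isotropic.  Multiplication by i changes the sign of q f f,
     so f can be chosen with this number of the same sign as the norm of f. *)
  have "\<exists>f. f \<noteq> 0 \<and> f \<in> G (p - 1) \<and> cnj_vec f \<in> G (int n - (p - 1)) \<and> 0 \<le> Re (?q f f) * Re (?q f (cnj_vec f))"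
  proof (cases "0 \<le> Re (?q f0 f0) * Re (?q f0 (cnj_vec f0))")
    case True then show ?thesis using f0 by blast
  next
    case False
    have "?q (\<i> *s f0) (\<i> *s f0) = - ?q f0 f0" "?q (\<i> *s f0) (cnj_vec (\<i> *s f0)) = ?q f0 (cnj_vec f0)"
      by (simp_all add: q_simps)
    then have "0 \<le> Re (?q (\<i> *s f0) (\<i> *s f0)) * Re (?q (\<i> *s f0) (cnj_vec (\<i> *s f0)))" using False by simp
    moreover have "\<i> *s f0 \<noteq> 0" using f0(1) by simp
    moreover have "\<i> *s f0 \<in> G (p - 1)" by (rule vec.subspace_scale[OF G_props(1) f0(2)])
    moreover have "cnj_vec (\<i> *s f0) \<in> G (int n - (p - 1))"
      using vec.subspace_scale[OF G_props(1) f0(3), of "- \<i>"] by simp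
    ultimately show ?thesis by blast
  qed
  then obtain f where f: "f \<noteq> 0" "f \<in> G (p - 1)" "cnj_vec f \<in> G (int n - (p - 1))"
    and ff: "0 \<le> Re (?q f f) * Re (?q f (cnj_vec f))" by blast
  let ?E = "Re (?q e (cnj_vec e))" and ?F = "Re (?q f (cnj_vec f))" and ?M = "Re (?q f f)"
  have EF: "?E * ?F < 0"
  proof -
    have "0 < ((if even p then 1 else -1) * (\<sigma> * ?E)) * ((if even (p - 1) then 1 else -1) * (\<sigma> * ?F))"
      by (rule mult_pos_pos[OF sign[OF e] sign[OF f]])
    also have "\<dots> = - (\<sigma> * \<sigma>) * (?E * ?F)" by auto
    also have "\<sigma> * \<sigma> = 1" by (simp add: \<sigma>_def flip: power_add)
    finally show ?thesis by simp
  qed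
  have neg: "?E * (?M + ?F) < 0"
  proof -
    have F0: "?F \<noteq> 0" using EF by auto
    have "?E * (?M + ?F) * ?F\<^sup>2 = (?E * ?F) * (?M * ?F + ?F\<^sup>2)" by (simp add: power2_eq_square algebra_simps)
    also have "\<dots> < 0" by (rule mult_neg_pos[OF EF add_nonneg_pos[OF ff]]) (use F0 in simp)
    finally show ?thesis using F0 by (simp add: mult_less_0_iff)
  qed
  define y where "y = sqrt (- ?E / (?M + ?F))"
  have y2: "?E + y\<^sup>2 * (?M + ?F) = 0"
  proof -
    have "0 \<le> - ?E / (?M + ?F)" using neg by (auto simp: mult_less_0_iff zero_le_divide_iff divide_le_0_iff)
    then have "y\<^sup>2 = - ?E / (?M + ?F)" by (simp add: y_def)
    moreover have "?M + ?F \<noteq> 0" using neg by auto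
    ultimately show ?thesis by simp
  qed
  define \<gamma> where "\<gamma> = e + of_real y *s f"
  have eG: "e \<in> G (p - 1)" using e(2) G_props(2)[of "p - 1" p] by auto
  have \<gamma>G: "\<gamma> \<in> G (p - 1)"
    unfolding \<gamma>_def by (intro vec.subspace_add vec.subspace_scale G_props(1) eG f(2))
  have z: "?q e e = 0" "?q e f = 0" "?q e (cnj_vec f) = 0"
    using iso[OF e(2) e(2)] iso[OF e(2) f(2)] iso[OF e(2) f(3)] p by auto
  have mem: "e \<in> complexify U" "f \<in> complexify U" using e f G_props(3) by auto
  have z2: "?q f e = 0" using q_sym[OF mem] z(2) by simp
  have "cnj_vec f \<in> complexify U" using f(3) G_props(3) by auto
  then have z3: "?q (cnj_vec f) e = 0" using q_sym[OF mem(1)] z(3) by simp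
  then have z4: "?q f (cnj_vec e) = 0" using complexify_form_cnj[OF q, of "cnj_vec f" e] by simp
  have "?q \<gamma> \<gamma> = of_real (y\<^sup>2) * ?q f f" by (simp add: \<gamma>_def q_simps z z2 power2_eq_square)
  moreover have "?q \<gamma> (cnj_vec \<gamma>) = ?q e (cnj_vec e) + of_real (y\<^sup>2) * ?q f (cnj_vec f)"
    by (simp add: \<gamma>_def q_simps z z4 power2_eq_square)
  ultimately have "Re (?q \<gamma> \<gamma>) + Re (?q \<gamma> (cnj_vec \<gamma>)) = ?E + y\<^sup>2 * (?M + ?F)"
    by (simp add: distrib_left)
  also have "Re (?q \<gamma> \<gamma>) + Re (?q \<gamma> (cnj_vec \<gamma>)) = 2 * q (re_vec \<gamma>) (re_vec \<gamma>)"
    by (simp add: complexify_form_def bilinear_rneg[OF q])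
  finally have "q (re_vec \<gamma>) (re_vec \<gamma>) = 0" using y2 by simp
  then have "cnj_vec \<gamma> \<in> G (p - 1)" using isotropic_conjugate[OF \<gamma>G] by blast
  then have "?q (cnj_vec \<gamma>) e = 0" using iso[OF _ e(2)] p by auto
  then have "?q (cnj_vec e) e = 0" by (simp add: \<gamma>_def q_simps z3)
  then have "?q e (cnj_vec e) = 0" using complexify_form_cnj[OF q, of "cnj_vec e" e] by simp
  then show False using EF by simp
qed

text \<open>
  Conjugation maps a pair of adjacent jumps in the lower half to one in the upper half, and in even weight
  no pair is its own mirror image.
\<close>

lemma even_weight_gap:
  assumes k: "k = 0" and n: "even n"
  shows "G p = G (p - 1) \<or> G p = G (p + 1)"
proof (rule ccontr)
  assume "\<not> ?thesis"
  then have jump: "G p \<noteq> G (p + 1)" "G (p - 1) \<noteq> G p" by auto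
  have dual: "G (int n - c) \<noteq> G (int n - c + 1)" if c: "G c \<noteq> G (c + 1)" for c
  proof -
    obtain e where e: "e \<noteq> 0" "e \<in> G c" "cnj_vec e \<in> G (int n - c)" using hodge_vector[OF c] k by auto
    then have "cnj_vec e \<notin> G (int n - c + 1)" using G_props(5)[of e c] k by auto
    then show ?thesis using e(3) by blast
  qed
  show False
  proof (cases "int n + 2 \<le> 2 * p")
    case True
    then show False using even_weight_no_upper_jump[OF k n] jump by blast
  next
    case False
    moreover have "2 * p \<noteq> int n + 1" using n by (metis even_of_nat dvd_triv_left even_plus_one_iff)
    ultimately have p': "int n + 2 \<le> 2 * (int n - p + 1)" by presburger
    have d1: "G (int n - p + 1) \<noteq> G (int n - p + 1 + 1)" using dual[of "p - 1"] jump(2) by (simp add: algebra_simps)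
    have d2: "G (int n - p + 1 - 1) \<noteq> G (int n - p + 1)" using dual[of p] jump(1) by simp
    show False by (rule even_weight_no_upper_jump[OF k n p' d1 d2])
  qed
qed

theorem no_consecutive_hodge_numbers: "G p = G (p - 1) \<or> G p = G (p + 1)"
proof (cases "1 \<le> k \<or> odd n")
  case True
  then show ?thesis by (intro conjugation_stable_gap isotropic_conjugate) auto
next
  case False
  then show ?thesis by (intro even_weight_gap) auto
qed

end

theorem corollary1p14:
  fixes Q :: "real ^ 'n \<Rightarrow> real ^ 'n \<Rightarrow> real"
    and n k :: nat
    and h :: "int \<Rightarrow> nat"
    and F\<^sub>0 F :: "'n filtration"
    and D \<O> :: "'n filtration set"
    and N :: "real ^ 'n ^ 'n"
    and W :: "int \<Rightarrow> (real ^ 'n) set"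
    and U :: "(real ^ 'm) set"
    and \<pi> :: "real ^ 'n \<Rightarrow> real ^ 'm"
    and \<epsilon> :: real
    and q :: "real ^ 'm \<Rightarrow> real ^ 'm \<Rightarrow> real"
    and A :: "('s::{t2_space, second_countable_topology}, 'd::finite) chart set"
    and \<Phi> :: "'s \<Rightarrow> 'm filtration"
  assumes "period_domain n Q h F\<^sub>0 D"
    and "semisimple_lie_algebra (real_lie_algebra Q)"
    and "\<forall>E\<in>D. bracket_generating_at n Q E"
    and "nilpotent_orbit Q F\<^sub>0 D F N"
    and "monodromy_weight_filtration N (int n) W"
    and "closed_real_orbit Q F\<^sub>0 \<O>"
    and "sent_to_orbit Q F\<^sub>0 F N \<O>"
    and "primitive_quotient N n W k U \<pi>"
    and "\<epsilon> \<in> {1, -1}"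
    and "primitive_form Q N n W k \<pi> \<epsilon> q"
    and "complex_atlas A"
    and "connected (UNIV :: 's set)"
    and "simply_connected (UNIV :: 's set)"
    and "polarized_VHS A (n + k) U q \<Phi>"
    and "\<exists>s\<^sub>0. \<Phi> s\<^sub>0 = induced_filtration N n W k \<pi> F"
  shows "\<forall>s t. \<Phi> s = \<Phi> t"
proof -
  have base: "polarized_hodge_structure n UNIV Q F\<^sub>0" and D: "D = real_orbit Q F\<^sub>0"
    using assms(1) by (auto simp only: period_domain_def polarized_hodge_structures_with_numbers_def mem_Collect_eq)
  obtain L where L: "L \<in> \<O>" "limitin (compact_dual Q F\<^sub>0) (exp_translate N F) L (filtercomap Im at_top)"
    using assms(7) unfolding sent_to_orbit_def by blast
  have F: "F \<in> topspace (compact_dual Q F\<^sub>0)" "N \<in> real_lie_algebra Q"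
    and F_N: "\<And>p v. v \<in> F p \<Longrightarrow> complexify_matrix N *v v \<in> F (p - 1)"
    using assms(4) unfolding nilpotent_orbit_def by blast+
  obtain m where "matrix_pow N m = 0" using assms(4) unfolding nilpotent_orbit_def by blast
  then have nil: "matrix_pow N (Suc m) = 0" by (simp add: matrix_pow_def)
  obtain b where b: "\<And>z. b < Im z \<Longrightarrow> exp_translate N F z \<in> real_orbit Q F\<^sub>0"
    using assms(4) unfolding nilpotent_orbit_def D by blast
  obtain l l' where "W l = {0}" "W l' = UNIV" using assms(5) unfolding monodromy_weight_filtration_def by blast
  then have l: "W (int n + (l - int n)) = {0}" "W (int n + (l' - int n)) = UNIV" by simp_all
  obtain s\<^sub>0 where s0: "\<Phi> s\<^sub>0 = induced_filtration N n W k \<pi> F" using assms(15) by blast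
  have induced: "polarized_hodge_structure (n + k) U q (induced_filtration N n W k \<pi> F)"
    unfolding s0[symmetric] using assms(14) unfolding polarized_VHS_def by blast
  interpret closed_orbit_primitive Q n F\<^sub>0 F L \<O> N W b "Suc m" "l - int n" "l' - int n" k U \<pi> \<epsilon> q
    by unfold_locales (fact base assms(6) L F nil zero_less_Suc b F_N assms(5) l assms(8-10) induced)+
  have "\<Phi> s\<^sub>0 p = \<Phi> s\<^sub>0 (p - 1) \<or> \<Phi> s\<^sub>0 p = \<Phi> s\<^sub>0 (p + 1)" for p
    unfolding s0 by (rule no_consecutive_hodge_numbers)
  then show ?thesis using polarized_VHS_constant[OF assms(11,12,14)] by blast
qed

end
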